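(* Let $\Lambda$ be a Koszul self-injective algebra. If $\Lambda$ is an $n$-translation algebra, then its trivial extension $\tilde\Lambda=\Lambda\ltimes D_*\Lambda$ is an $(n+1)$-translation algebra.
   Context: Let $k$ be a field. Algebras are graded algebras $\Lambda=\Lambda_0+\Lambda_1+\cdots$ with $\Lambda_0=\bigoplus_{i\in Q_0}k e_i$, generated by $\Lambda_1$ over $\Lambda_0$, locally finite and connected; they are written $\Lambda=k(Q)=kQ/(\rho)$ for a connected locally finite bound quiver $Q=(Q_0,Q_1,\rho)$ whose relations $\rho$ are homogeneous (linear combinations of paths of the same length, at least $2$), graded by path length. Paths are composed right to left, so $e_j\Lambda e_i$ is spanned by paths from $i$ to $j$. A path (or a linear combination of paths) is called bound if its image in $k(Q)$ is nonzero. **$n$-translation quiver.** Let $n\ge 0$ be an integer. $Q$ is an $n$-translation quiver if there are subsets $\mathcal P,\mathcal I\subset Q_0$ and a bijection $\tau:Q_0\setminus\mathcal P\to Q_0\setminus\mathcal I$ (the $n$-translation) such that: (1) for each $i\in Q_0\setminus\mathcal P$ there is a bound path of length $n+1$ from $\tau i$ to $i$, and any maximal bound path is of length $n+1$ from $\tau i$ to $i$ for some $i\in Q_0\setminus\mathcal P$; (2) any two bound paths of length $n+1$ from $\tau i$ to $i$ are linearly dependent (in $k(Q)$), for any $i\in Q_0\setminus\mathcal P$; (3) for $i\in Q_0\setminus\mathcal P$, $j\in Q_0$ and any bound element $u$ which is a linear combination of paths of the same length $t\le n+1$ from $j$ to $i$, there is a path $q$ of length $n+1-t$ from $\tau i$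 to $j$ such that $uq$ is a bound element; (4) for $i\in Q_0\setminus\mathcal I$, $j\in Q_0$ and any bound element $u$ which is a linear combination of paths of the same length $t\le n+1$ from $i$ to $j$, there is a path $p$ of length $n+1-t$ from $j$ to $\tau^{-1}i$ such that $pu$ is a bound element. A bound quiver all of whose bound paths have length $\le n$ also counts as an $n$-translation quiver, with $\mathcal P=\mathcal I=Q_0$ (a null $n$-translation quiver). **$(p,q)$-Koszul.** For $p,q\in\mathbb N\cup\{\infty\}$, $\Lambda$ is $(p,q)$-Koszul if $\Lambda_t=0$ for $t>p$ and for each $i\in Q_0$ there is a graded complex $0\to P^q(i)\to\cdots\to P^1(i)\to P^0(i)\to0$ of projective left $\Lambda$-modules with $P^t(i)$ generated by its component of degree $t$, whose only non-zero homologies are $S(i)=\Lambda_0e_i$ in degree $0$ and possibly one other in degree $p+q$, which in that case is $\Lambda_p\otimes_{\Lambda_0} P^q_q(i)$ (with the convention that components of degree $\infty$ are $0$; for $q=\infty$ the complex may be infinite to the left). A $(p,q)$-Koszul algebra is Koszul if $p$ or $q$ is $\infty$. **$n$-translation algebra.** $\Lambda$ is an $n$-pretranslation algebra if its bound quiver is an $n$-translation quiver, and an $n$-translation algebra if moreover there is $l\in\mathbb N\cup\{\infty\}$ such that $\Lambda$ is $(n+1,l)$-Koszul. **Trivial extension.** $D_*\Lambda=\bigoplus_{t}\bigoplus_{i,j}\mathrm{Hom}_k(e_j\Lambda_te_i,k)$ is the local dual, a $\Lambda$-bimodule. $\tilde\Lambda=\Lambda\ltimes D_*\Lambda$ is $\Lambda\oplus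 D_*\Lambda$ with $(a,x)(b,y)=(ab,ay+xb)$. Its grading is the one for which $\Lambda_t$ has degree $t$ and the linear forms dual to bound paths of length $n+1$ have degree $1$ (so $D_*(\Lambda_t)$ has degree $n+2-t$).
   Formalization: If Λ has no bound path of length n+1 (null case), the degree n+2−t for D_*(Λ_t) makes the claim false (Λ=k, n=0 gives k[x]/x² with x in degree 2); there the forms on the top nonzero component of Λ get degree 1 instead. Otherwise the grading is as stated. *)

theory Defs
  imports
    "HOL-Library.Poly_Mapping"
    "HOL-Library.Extended_Nat"
    "HOL-Library.Function_Algebras"
    "HOL-Library.Product_Plus"
begin

section \<open>Bound quivers\<close>

text \<open>
  A path is a pair of its starting vertex and its list of arrows. Paths are composed right to left,
  so in \<open>(i, [a\<^sub>m, \<dots>, a\<^sub>1])\<close> the arrow \<open>a\<^sub>1\<close> starts at \<open>i\<close>; the trivial path at \<open>i\<close> is \<open>(i, [])\<close>.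
\<close>

type_synonym ('v, 'e) qpath = "'v \<times> 'e list"

record (overloaded) ('v, 'e, 'k) bound_quiver =
  verts :: "'v set"
  arrows :: "'e set"
  src :: "'e \<Rightarrow> 'v"
  tgt :: "'e \<Rightarrow> 'v"
  rels :: "(('v, 'e) qpath \<Rightarrow>\<^sub>0 'k::zero) set"

abbreviation plen :: "('v, 'e) qpath \<Rightarrow> nat"
  where "plen w \<equiv> length (snd w)"

definition pend :: "('v, 'e, 'k::field) bound_quiver \<Rightarrow> ('v, 'e) qpath \<Rightarrow> 'v"
  where "pend Q w = (case snd w of [] \<Rightarrow> fst w | a # _ \<Rightarrow> tgt Q a)"

fun is_path_list :: "('v, 'e, 'k::field) bound_quiver \<Rightarrow> 'v \<Rightarrow> 'e list \<Rightarrow> bool" where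
  "is_path_list Q i [] \<longleftrightarrow> i \<in> verts Q"
| "is_path_list Q i (a # as) \<longleftrightarrow>
     a \<in> arrows Q \<and> is_path_list Q i as \<and> src Q a = pend Q (i, as)"

definition paths :: "('v, 'e, 'k::field) bound_quiver \<Rightarrow> ('v, 'e) qpath set"
  where "paths Q = {w. is_path_list Q (fst w) (snd w)}"

definition paths_between ::
    "('v, 'e, 'k::field) bound_quiver \<Rightarrow> nat \<Rightarrow> 'v \<Rightarrow> 'v \<Rightarrow> ('v, 'e) qpath set"
  where "paths_between Q t i j = {w \<in> paths Q. plen w = t \<and> fst w = i \<and> pend Q w = j}"

definition path_algebra :: "('v, 'e, 'k::field) bound_quiver \<Rightarrow> (('v, 'e) qpath \<Rightarrow>\<^sub>0 'k) set"
  where "path_algebra Q = {x. Poly_Mapping.keys x \<subseteq> paths Q}"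

definition path_mult :: "('v, 'e, 'k::field) bound_quiver \<Rightarrow>
    (('v, 'e) qpath \<Rightarrow>\<^sub>0 'k) \<Rightarrow> (('v, 'e) qpath \<Rightarrow>\<^sub>0 'k) \<Rightarrow> (('v, 'e) qpath \<Rightarrow>\<^sub>0 'k)"
  where "path_mult Q x y =
    (\<Sum>w\<in>Poly_Mapping.keys x. \<Sum>v\<in>Poly_Mapping.keys y.
       if fst w = pend Q v
       then Poly_Mapping.single (fst v, snd w @ snd v)
              (Poly_Mapping.lookup x w * Poly_Mapping.lookup y v)
       else 0)"

abbreviation path_elem :: "('v, 'e) qpath \<Rightarrow> (('v, 'e) qpath \<Rightarrow>\<^sub>0 'k::field)"
  where "path_elem w \<equiv> Poly_Mapping.single w 1"

text \<open>
  The two-sided ideal generated by the relations; closure under scalars is included in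
  the closure under multiplication, because \<open>kQ\<close> has local units.
\<close>

inductive_set rel_ideal :: "('v, 'e, 'k::field) bound_quiver \<Rightarrow> (('v, 'e) qpath \<Rightarrow>\<^sub>0 'k) set"
  for Q where
  zero: "0 \<in> rel_ideal Q"
| rel: "r \<in> rels Q \<Longrightarrow> r \<in> rel_ideal Q"
| add: "x \<in> rel_ideal Q \<Longrightarrow> y \<in> rel_ideal Q \<Longrightarrow> x + y \<in> rel_ideal Q"
| left: "x \<in> rel_ideal Q \<Longrightarrow> z \<in> path_algebra Q \<Longrightarrow> path_mult Q z x \<in> rel_ideal Q"
| right: "x \<in> rel_ideal Q \<Longrightarrow> z \<in> path_algebra Q \<Longrightarrow> path_mult Q x z \<in> rel_ideal Q"

definition connected_quiver :: "('v, 'e, 'k::field) bound_quiver \<Rightarrow> bool"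
  where "connected_quiver Q \<longleftrightarrow> verts Q \<noteq> {} \<and>
    (let R = {(src Q a, tgt Q a) | a. a \<in> arrows Q}
     in \<forall>i\<in>verts Q. \<forall>j\<in>verts Q. (i, j) \<in> (R \<union> R\<inverse>)\<^sup>*)"

definition bound_quiver :: "('v, 'e, 'k::field) bound_quiver \<Rightarrow> bool"
  where "bound_quiver Q \<longleftrightarrow>
    (\<forall>a\<in>arrows Q. src Q a \<in> verts Q \<and> tgt Q a \<in> verts Q) \<and>
    connected_quiver Q \<and>
    (\<forall>i\<in>verts Q. finite {a \<in> arrows Q. src Q a = i} \<and> finite {a \<in> arrows Q. tgt Q a = i}) \<and>
    (\<forall>r\<in>rels Q. r \<in> path_algebra Q \<and> (\<exists>m\<ge>2. \<forall>w\<in>Poly_Mapping.keys r. plen w = m))"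

definition bound_path :: "('v, 'e, 'k::field) bound_quiver \<Rightarrow> ('v, 'e) qpath \<Rightarrow> bool"
  where "bound_path Q w \<longleftrightarrow> w \<in> paths Q \<and> path_elem w \<notin> rel_ideal Q"

definition maximal_bound_path :: "('v, 'e, 'k::field) bound_quiver \<Rightarrow> ('v, 'e) qpath \<Rightarrow> bool"
  where "maximal_bound_path Q w \<longleftrightarrow> bound_path Q w \<and>
    (\<forall>u\<in>paths Q. \<forall>v\<in>paths Q. fst u = pend Q w \<and> pend Q v = fst w \<and>
       bound_path Q (fst v, snd u @ snd w @ snd v) \<longrightarrow> plen u = 0 \<and> plen v = 0)"

text \<open>Bound elements that are linear combinations of paths of length \<open>t\<close> from \<open>i\<close> to \<open>j\<close>.\<close>

definition bound_elems ::
    "('v, 'e, 'k::field) bound_quiver \<Rightarrow> nat \<Rightarrow> 'v \<Rightarrow> 'v \<Rightarrow> (('v, 'e) qpath \<Rightarrow>\<^sub>0 'k) set"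
  where "bound_elems Q t i j =
    {u. Poly_Mapping.keys u \<subseteq> paths_between Q t i j \<and> u \<notin> rel_ideal Q}"

definition n_translation :: "nat \<Rightarrow> ('v, 'e, 'k::field) bound_quiver \<Rightarrow>
    'v set \<Rightarrow> 'v set \<Rightarrow> ('v \<Rightarrow> 'v) \<Rightarrow> bool"
  where "n_translation n Q P I \<tau> \<longleftrightarrow>
    P \<subseteq> verts Q \<and> I \<subseteq> verts Q \<and> bij_betw \<tau> (verts Q - P) (verts Q - I) \<and>
    (\<forall>i\<in>verts Q - P. \<exists>w\<in>paths_between Q (n + 1) (\<tau> i) i. bound_path Q w) \<and>
    (\<forall>w. maximal_bound_path Q w \<longrightarrow> (\<exists>i\<in>verts Q - P. w \<in> paths_between Q (n + 1) (\<tau> i) i)) \<and>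
    (\<forall>i\<in>verts Q - P. \<forall>w\<in>paths_between Q (n + 1) (\<tau> i) i. \<forall>v\<in>paths_between Q (n + 1) (\<tau> i) i.
       bound_path Q w \<and> bound_path Q v \<longrightarrow>
       (\<exists>a b. (a, b) \<noteq> (0, 0) \<and>
          Poly_Mapping.single w a + Poly_Mapping.single v b \<in> rel_ideal Q)) \<and>
    (\<forall>i\<in>verts Q - P. \<forall>j\<in>verts Q. \<forall>t\<le>n + 1. \<forall>u\<in>bound_elems Q t j i.
       \<exists>w\<in>paths_between Q (n + 1 - t) (\<tau> i) j. path_mult Q u (path_elem w) \<notin> rel_ideal Q) \<and>
    (\<forall>i\<in>verts Q - I. \<forall>j\<in>verts Q. \<forall>t\<le>n + 1. \<forall>u\<in>bound_elems Q t i j.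
       \<exists>w\<in>paths_between Q (n + 1 - t) j (the_inv_into (verts Q - P) \<tau> i).
         path_mult Q (path_elem w) u \<notin> rel_ideal Q)"

text \<open>The second disjunct is the case of a null \<open>n\<close>-translation quiver.\<close>

definition n_translation_quiver :: "nat \<Rightarrow> ('v, 'e, 'k::field) bound_quiver \<Rightarrow> bool"
  where "n_translation_quiver n Q \<longleftrightarrow>
    (\<exists>P I \<tau>. n_translation n Q P I \<tau>) \<or> (\<forall>w. bound_path Q w \<longrightarrow> plen w \<le> n)"


section \<open>Graded algebras\<close>

text \<open>
  As the vertex set may be infinite, the algebras need not have a unit, but only the local units
  \<open>e\<^sub>i\<close>. Addition is that of the ambient type; the other operations matter on the carrier only.
\<close>

record ('k, 'v, 'a) galgebra =
  vertices :: "'v set"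
  idem :: "'v \<Rightarrow> 'a"
  carrier :: "'a set"
  comp :: "nat \<Rightarrow> 'a set"
  mult :: "'a \<Rightarrow> 'a \<Rightarrow> 'a"
  scale :: "'k \<Rightarrow> 'a \<Rightarrow> 'a"

text \<open>
  \<open>A = kQ/(\<rho>)\<close> as graded algebras: \<open>A\<close> is the image of \<open>kQ\<close>, graded by path length, under a
  homomorphism \<open>\<pi>\<close> with kernel \<open>(\<rho>)\<close>. All the laws of a graded algebra carry over to \<open>A\<close>.
\<close>

definition quiver_algebra ::
    "('v, 'e, 'k::field) bound_quiver \<Rightarrow> ('k, 'v, 'a::ab_group_add) galgebra \<Rightarrow> bool"
  where "quiver_algebra Q A \<longleftrightarrow> verts Q = vertices A \<and>
    (\<exists>\<pi>. (\<forall>x\<in>path_algebra Q. \<forall>y\<in>path_algebra Q.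
            \<pi> (x + y) = \<pi> x + \<pi> y \<and> \<pi> (path_mult Q x y) = mult A (\<pi> x) (\<pi> y)) \<and>
         (\<forall>c. \<forall>x\<in>path_algebra Q. \<pi> (Poly_Mapping.map ((*) c) x) = scale A c (\<pi> x)) \<and>
         (\<forall>i\<in>verts Q. \<pi> (path_elem (i, [])) = idem A i) \<and>
         carrier A = \<pi> ` path_algebra Q \<and>
         (\<forall>t. comp A t =
            \<pi> ` {x \<in> path_algebra Q. \<forall>w\<in>Poly_Mapping.keys x. plen w = t}) \<and>
         (\<forall>x\<in>path_algebra Q. \<pi> x = 0 \<longleftrightarrow> x \<in> rel_ideal Q))"

definition peirce :: "('k, 'v, 'a) galgebra \<Rightarrow> 'v \<Rightarrow> nat \<Rightarrow> 'v \<Rightarrow> 'a set"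
  where "peirce A j t i = {mult A (mult A (idem A j) x) (idem A i) | x. x \<in> comp A t}"

definition opposite :: "('k, 'v, 'a) galgebra \<Rightarrow> ('k, 'v, 'a) galgebra"
  where "opposite A = A\<lparr>mult := \<lambda>x y. mult A y x\<rparr>"


section \<open>Modules\<close>

record ('a, 'm) lmodule =
  mcarrier :: "'m set"
  act :: "'a \<Rightarrow> 'm \<Rightarrow> 'm"

definition add_subgroup :: "'m::ab_group_add set \<Rightarrow> bool"
  where "add_subgroup S \<longleftrightarrow> 0 \<in> S \<and> (\<forall>x\<in>S. \<forall>y\<in>S. x - y \<in> S)"

text \<open>
  Left modules \<open>M\<close> with \<open>M = AM\<close>. The scalar multiplication need not be mentioned: it is
  \<open>c m = (\<Sum>i. (c e\<^sub>i) m)\<close>, and all additive maps that respect the action respect it.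
\<close>

definition left_module ::
    "('k, 'v, 'a::ab_group_add) galgebra \<Rightarrow> ('a, 'm::ab_group_add) lmodule \<Rightarrow> bool"
  where "left_module A M \<longleftrightarrow> add_subgroup (mcarrier M) \<and>
    (\<forall>a\<in>carrier A. \<forall>x\<in>mcarrier M. act M a x \<in> mcarrier M) \<and>
    (\<forall>a\<in>carrier A. \<forall>b\<in>carrier A. \<forall>x\<in>mcarrier M.
       act M (a + b) x = act M a x + act M b x \<and> act M (mult A a b) x = act M a (act M b x)) \<and>
    (\<forall>a\<in>carrier A. \<forall>x\<in>mcarrier M. \<forall>y\<in>mcarrier M. act M a (x + y) = act M a x + act M a y) \<and>
    (\<forall>x\<in>mcarrier M. \<exists>J. finite J \<and> J \<subseteq> vertices A \<and> x = (\<Sum>i\<in>J. act M (idem A i) x))"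

definition module_hom :: "('k, 'v, 'a::ab_group_add) galgebra \<Rightarrow>
    ('a, 'm::ab_group_add) lmodule \<Rightarrow> ('a, 'l::ab_group_add) lmodule \<Rightarrow> ('m \<Rightarrow> 'l) \<Rightarrow> bool"
  where "module_hom A M N f \<longleftrightarrow> f ` mcarrier M \<subseteq> mcarrier N \<and>
    (\<forall>x\<in>mcarrier M. \<forall>y\<in>mcarrier M. f (x + y) = f x + f y) \<and>
    (\<forall>a\<in>carrier A. \<forall>x\<in>mcarrier M. f (act M a x) = act N a (f x))"

text \<open>
  The test modules in the next two definitions are those on the type of the given module.
  For projectivity this is no restriction if that type has room for a direct sum of modules \<open>Ae\<^sub>j\<close>
  mapping onto \<open>P\<close>; for injectivity (Baer's criterion) if it has room for the left ideals of \<open>A\<close>.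
\<close>

definition projective_module ::
    "('k, 'v, 'a::ab_group_add) galgebra \<Rightarrow> ('a, 'm::ab_group_add) lmodule \<Rightarrow> bool"
  where "projective_module A P \<longleftrightarrow> left_module A P \<and>
    (\<forall>(M :: ('a, 'm) lmodule) (N :: ('a, 'm) lmodule) g f.
       left_module A M \<and> left_module A N \<and> module_hom A M N g \<and> g ` mcarrier M = mcarrier N \<and>
       module_hom A P N f \<longrightarrow>
       (\<exists>h. module_hom A P M h \<and> (\<forall>x\<in>mcarrier P. g (h x) = f x)))"

definition injective_module ::
    "('k, 'v, 'a::ab_group_add) galgebra \<Rightarrow> ('a, 'm::ab_group_add) lmodule \<Rightarrow> bool"
  where "injective_module A E \<longleftrightarrow> left_module A E \<and>
    (\<forall>(M :: ('a, 'm) lmodule) (N :: ('a, 'm) lmodule) g f.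
       left_module A M \<and> left_module A N \<and> module_hom A M N g \<and> inj_on g (mcarrier M) \<and>
       module_hom A M E f \<longrightarrow>
       (\<exists>h. module_hom A N E h \<and> (\<forall>x\<in>mcarrier M. h (g x) = f x)))"

definition regular_module :: "('k, 'v, 'a) galgebra \<Rightarrow> ('a, 'a) lmodule"
  where "regular_module A = \<lparr>mcarrier = carrier A, act = mult A\<rparr>"

definition self_injective :: "('k, 'v, 'a::ab_group_add) galgebra \<Rightarrow> bool"
  where "self_injective A \<longleftrightarrow> injective_module A (regular_module A) \<and>
    injective_module (opposite A) (regular_module (opposite A))"

definition graded_module :: "('k, 'v, 'a::ab_group_add) galgebra \<Rightarrow>
    ('a, 'm::ab_group_add) lmodule \<Rightarrow> (nat \<Rightarrow> 'm set) \<Rightarrow> bool"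
  where "graded_module A M G \<longleftrightarrow> left_module A M \<and>
    (\<forall>s. add_subgroup (G s) \<and> G s \<subseteq> mcarrier M) \<and>
    (\<forall>x\<in>mcarrier M. \<exists>!c. (\<forall>s. c s \<in> G s) \<and> finite {s. c s \<noteq> 0} \<and> x = (\<Sum>s | c s \<noteq> 0. c s)) \<and>
    (\<forall>r s. \<forall>a\<in>comp A r. \<forall>x\<in>G s. act M a x \<in> G (r + s))"

definition generated_by ::
    "('k, 'v, 'a::ab_group_add) galgebra \<Rightarrow> ('a, 'm::ab_group_add) lmodule \<Rightarrow> 'm set \<Rightarrow> bool"
  where "generated_by A M S \<longleftrightarrow> (\<forall>N. S \<subseteq> N \<and> N \<subseteq> mcarrier M \<and>
    left_module A (M\<lparr>mcarrier := N\<rparr>) \<longrightarrow> N = mcarrier M)"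


section \<open>(p,q)-Koszul algebras\<close>

definition cycles :: "(nat \<Rightarrow> ('a, 'm::ab_group_add) lmodule) \<Rightarrow> (nat \<Rightarrow> 'm \<Rightarrow> 'm) \<Rightarrow> nat \<Rightarrow> 'm set"
  where "cycles P d t = (case t of 0 \<Rightarrow> mcarrier (P 0) | Suc r \<Rightarrow> {x \<in> mcarrier (P t). d r x = 0})"

definition boundaries :: "(nat \<Rightarrow> ('a, 'm) lmodule) \<Rightarrow> (nat \<Rightarrow> 'm \<Rightarrow> 'm) \<Rightarrow> nat \<Rightarrow> 'm set"
  where "boundaries P d t = d t ` mcarrier (P (Suc t))"

text \<open>
  A complex of graded modules \<open>\<dots> \<rightarrow> P 2 \<rightarrow> P 1 \<rightarrow> P 0 \<rightarrow> 0\<close> with differentials \<open>d t : P (t + 1) \<rightarrow> P t\<close>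
  and \<open>P t = 0\<close> for \<open>t > q\<close>, where \<open>P t\<close> is projective and generated in degree \<open>t\<close>.
\<close>

definition linear_complex :: "enat \<Rightarrow> ('k, 'v, 'a::ab_group_add) galgebra \<Rightarrow>
    (nat \<Rightarrow> ('a, 'm::ab_group_add) lmodule) \<Rightarrow> (nat \<Rightarrow> nat \<Rightarrow> 'm set) \<Rightarrow> (nat \<Rightarrow> 'm \<Rightarrow> 'm) \<Rightarrow> bool"
  where "linear_complex q A P G d \<longleftrightarrow>
    (\<forall>t. projective_module A (P t) \<and> graded_module A (P t) (G t) \<and> generated_by A (P t) (G t t)) \<and>
    (\<forall>t. enat t > q \<longrightarrow> mcarrier (P t) = {0}) \<and>
    (\<forall>t. module_hom A (P (Suc t)) (P t) (d t) \<and> (\<forall>s. d t ` G (Suc t) s \<subseteq> G t s)) \<and>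
    (\<forall>t. \<forall>x\<in>mcarrier (P (Suc (Suc t))). d t (d (Suc t) x) = 0)"

text \<open>
  The modules \<open>P t\<close> are realised inside \<open>nat \<Rightarrow> 'a\<close>. Since they are finitely generated here (the
  algebra is locally finite, and \<open>P (t + 1)\<close> is minimal over the kernel), there is enough room.
  The third clause gives an isomorphism from the homology at \<open>P 0\<close> in degree \<open>0\<close> to
  \<open>S(i) = A\<^sub>0 e\<^sub>i\<close>, the second says that there is no other homology, except possibly at \<open>P q\<close> in
  degree \<open>p + q\<close>. The last one says that the latter is zero or consists of all of the degree
  \<open>p + q\<close> part of \<open>P q\<close>, which is \<open>A\<^sub>p \<otimes> P\<^sup>q\<^sub>q\<close>, spanned by the products \<open>a x\<close>, because \<open>P q\<close> is
  projective and generated in degree \<open>q\<close>.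
\<close>

definition pq_koszul :: "enat \<Rightarrow> enat \<Rightarrow> ('k::field, 'v, 'a::ab_group_add) galgebra \<Rightarrow> bool"
  where "pq_koszul p q A \<longleftrightarrow> (\<forall>t. enat t > p \<longrightarrow> comp A t = {0}) \<and>
    (\<forall>i\<in>vertices A.
      \<exists>(P :: nat \<Rightarrow> ('a, nat \<Rightarrow> 'a) lmodule) G d. linear_complex q A P G d \<and>
        (\<forall>t s. (t, s) \<noteq> (0, 0) \<and> \<not> (enat t = q \<and> enat s = p + q) \<longrightarrow>
           cycles P d t \<inter> G t s \<subseteq> boundaries P d t) \<and>
        (\<exists>\<phi>. \<phi> ` (cycles P d 0 \<inter> G 0 0) = {mult A a (idem A i) | a. a \<in> comp A 0} \<and>
           (\<forall>x\<in>cycles P d 0 \<inter> G 0 0. \<forall>y\<in>cycles P d 0 \<inter> G 0 0. \<phi> (x + y) = \<phi> x + \<phi> y) \<and>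
           (\<forall>a\<in>comp A 0. \<forall>x\<in>cycles P d 0 \<inter> G 0 0. \<phi> (act (P 0) a x) = mult A a (\<phi> x)) \<and>
           (\<forall>x\<in>cycles P d 0 \<inter> G 0 0. \<phi> x = 0 \<longleftrightarrow> x \<in> boundaries P d 0)) \<and>
        (\<forall>r t. p = enat r \<and> q = enat t \<longrightarrow>
           cycles P d t \<inter> G t (r + t) \<subseteq> boundaries P d t \<or>
           (\<forall>a\<in>comp A r. \<forall>x\<in>G t t. act (P t) a x \<in> cycles P d t)))"

definition koszul :: "('k::field, 'v, 'a::ab_group_add) galgebra \<Rightarrow> bool"
  where "koszul A \<longleftrightarrow> (\<exists>p q. (p = \<infinity> \<or> q = \<infinity>) \<and> pq_koszul p q A)"

text \<open>
  Taking the arrows of \<open>Q\<close> from the type of the algebra is no restriction: the arrows of a bound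
  quiver are mapped injectively to \<open>kQ/(\<rho>)\<close>, as the relations have length at least two.
\<close>

definition n_pretranslation_algebra :: "nat \<Rightarrow> ('k::field, 'v, 'a::ab_group_add) galgebra \<Rightarrow> bool"
  where "n_pretranslation_algebra n A \<longleftrightarrow>
    (\<exists>Q :: ('v, 'a, 'k) bound_quiver. bound_quiver Q \<and> quiver_algebra Q A \<and> n_translation_quiver n Q)"

definition n_translation_algebra :: "nat \<Rightarrow> ('k::field, 'v, 'a::ab_group_add) galgebra \<Rightarrow> bool"
  where "n_translation_algebra n A \<longleftrightarrow>
    n_pretranslation_algebra n A \<and> (\<exists>l. pq_koszul (enat (n + 1)) l A)"


section \<open>The trivial extension\<close>

text \<open>
  An element of the local dual is a linear form on \<open>A\<close> that is non-zero on finitely many \<open>e\<^sub>j A\<^sub>t e\<^sub>i\<close>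
  only; outside the carrier it is zero, so that equality of forms is equality of functions.
\<close>

definition local_dual :: "('k::field, 'v, 'a::ab_group_add) galgebra \<Rightarrow> ('a \<Rightarrow> 'k) set"
  where "local_dual A = {f.
    (\<forall>x\<in>carrier A. \<forall>y\<in>carrier A. f (x + y) = f x + f y) \<and>
    (\<forall>c. \<forall>x\<in>carrier A. f (scale A c x) = c * f x) \<and>
    (\<forall>x. x \<notin> carrier A \<longrightarrow> f x = 0) \<and>
    finite {(t, i, j). i \<in> vertices A \<and> j \<in> vertices A \<and> (\<exists>x\<in>peirce A j t i. f x \<noteq> 0)}}"

definition dual_comp :: "('k::field, 'v, 'a::ab_group_add) galgebra \<Rightarrow> nat \<Rightarrow> ('a \<Rightarrow> 'k) set"
  where "dual_comp A t = {f \<in> local_dual A. \<forall>s. s \<noteq> t \<longrightarrow> (\<forall>x\<in>comp A s. f x = 0)}"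

definition dual_left :: "('k::field, 'v, 'a) galgebra \<Rightarrow> 'a \<Rightarrow> ('a \<Rightarrow> 'k) \<Rightarrow> ('a \<Rightarrow> 'k)"
  where "dual_left A a f = (\<lambda>x. if x \<in> carrier A then f (mult A x a) else 0)"

definition dual_right :: "('k::field, 'v, 'a) galgebra \<Rightarrow> ('a \<Rightarrow> 'k) \<Rightarrow> 'a \<Rightarrow> ('a \<Rightarrow> 'k)"
  where "dual_right A f a = (\<lambda>x. if x \<in> carrier A then f (mult A a x) else 0)"

text \<open>
  \<open>D\<^sub>*(A\<^sub>t)\<close> is put in degree \<open>dual_shift n A - t\<close>. The forms dual to bound paths of length \<open>n + 1\<close> have
  degree \<open>1\<close>, so the shift is \<open>n + 2\<close>. There are no such forms if the quiver is null; then it is the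
  forms on the last non-zero component of \<open>A\<close> that get degree \<open>1\<close>, as is needed for the trivial
  extension of a self-injective algebra to be generated in degree \<open>1\<close>.
\<close>

definition dual_shift :: "nat \<Rightarrow> ('k, 'v, 'a::ab_group_add) galgebra \<Rightarrow> nat"
  where "dual_shift n A =
    (if comp A (n + 1) \<noteq> {0} then n + 2 else Max {t. comp A t \<noteq> {0}} + 1)"

definition trivial_extension ::
    "nat \<Rightarrow> ('k::field, 'v, 'a::ab_group_add) galgebra \<Rightarrow> ('k, 'v, 'a \<times> ('a \<Rightarrow> 'k)) galgebra"
  where "trivial_extension n A = \<lparr>
    vertices = vertices A,
    idem = (\<lambda>i. (idem A i, 0)),
    carrier = carrier A \<times> local_dual A,
    comp = (\<lambda>s. comp A s \<times>
              (if s \<le> dual_shift n A then dual_comp A (dual_shift n A - s) else {0})),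
    mult = (\<lambda>(a, x) (b, y). (mult A a b, dual_left A a y + dual_right A x b)),
    scale = (\<lambda>c (a, x). (scale A c a, \<lambda>z. c * x z))\<rparr>"

end

theory Submission imports Defs begin

text \<open>
  Since \<open>\<Lambda>\<close> is connected, self-injective and graded, every \<open>\<Lambda> e\<^sub>i\<close> has a simple socle, all these socles
  lie in the same degree \<open>m\<close>, and \<open>\<Lambda>\<close> carries a nondegenerate form \<open>\<theta>\<close> that vanishes outside
  degree \<open>m\<close>. It satisfies \<open>\<theta>(b x) = \<theta>(x \<sigma>(b))\<close> for the Nakayama automorphism \<open>\<sigma>\<close>, so
  \<open>D\<^sub>*\<Lambda> = \<Lambda> x\<close> with \<open>x b = \<sigma>(b) x\<close>: the trivial extension is a twisted polynomial algebra
  modulo \<open>x\<^sup>2\<close>. It has a symmetric nondegenerate form concentrated in a single degree, which gives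
  the conditions on maximal bound paths for the identity as translation. Its simple modules
  have linear resolutions: if \<open>P\<close> is a linear resolution over \<open>\<Lambda>\<close>, take the total complex of
  the columns \<open>\<Lambda>\<^sup>~ \<otimes> P\<close>, twisted by the powers of \<open>\<sigma>\<^sup>-\<^sup>1\<close> and connected by the multiplication by \<open>x\<close>.
\<close>

section \<open>Additive subgroups and gradings\<close>

text \<open>Simple socles come from injectivity applied to maps between simple left ideals. That
  they share one degree comes from completing an element of degree 1 to socle elements twice, which
  compares the socle degrees at its two ends, and from connectedness. The columns of the resolution
  come from x^2 = 0: the quotient of the trivial extension by x has a periodic resolution whose
  differential is multiplication by x, with one more twist at each step, and combining it with
  \<open>P\<close> resolves S(i). Two obstacles shape the rest. There is no unit, so x itself is not
  an element; it appears as the limit of its products with finite sums of idempotents. And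
  projectivity is tested against modules on one fixed type, whereas the resolution over the trivial
  extension lives on another. Hence the terms of \<open>P\<close> are shown to be finitely
  generated, which makes lifting independent of the type, and the total complex is finally encoded
  into the type that the definition prescribes. The identity translation belongs to socle degree n +
  1; a smaller socle degree leads to a null translation quiver.\<close>

lemma add_subgroup_zero: "add_subgroup S \<Longrightarrow> 0 \<in> S"
  by (simp add: add_subgroup_def)

lemma add_subgroup_diff: "add_subgroup S \<Longrightarrow> x \<in> S \<Longrightarrow> y \<in> S \<Longrightarrow> x - y \<in> S"
  by (simp add: add_subgroup_def)

lemma add_subgroup_minus: "add_subgroup S \<Longrightarrow> x \<in> S \<Longrightarrow> - x \<in> S"
  using add_subgroup_diff[of S 0 x] add_subgroup_zero[of S] by simp

lemma add_subgroup_add: "add_subgroup S \<Longrightarrow> x \<in> S \<Longrightarrow> y \<in> S \<Longrightarrow> x + y \<in> S"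
  using add_subgroup_diff[of S x "- y"] add_subgroup_minus[of S y] by simp

lemma add_subgroup_sum: "add_subgroup S \<Longrightarrow> (\<And>i. i \<in> I \<Longrightarrow> f i \<in> S) \<Longrightarrow> sum f I \<in> S"
  by (induction I rule: infinite_finite_induct) (auto intro: add_subgroup_add add_subgroup_zero)

lemma additive_on_zero:
  fixes f :: "'m::ab_group_add \<Rightarrow> 'l::ab_group_add"
  assumes "add_subgroup S" and "\<And>x y. x \<in> S \<Longrightarrow> y \<in> S \<Longrightarrow> f (x + y) = f x + f y"
  shows "f 0 = 0"
  using assms(2)[of 0 0] add_subgroup_zero[OF assms(1)] by simp

lemma additive_on_sum:
  fixes f :: "'m::ab_group_add \<Rightarrow> 'l::ab_group_add"
  assumes S: "add_subgroup S" and f: "\<And>x y. x \<in> S \<Longrightarrow> y \<in> S \<Longrightarrow> f (x + y) = f x + f y"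
    and g: "\<And>i. i \<in> I \<Longrightarrow> g i \<in> S"
  shows "f (\<Sum>i\<in>I. g i) = (\<Sum>i\<in>I. f (g i))"
  using g
proof (induction I rule: infinite_finite_induct)
  case (insert i I)
  then have "sum g I \<in> S" by (intro add_subgroup_sum[OF S]) auto
  with insert show ?case by (simp add: f)
qed (simp_all add: additive_on_zero[of S f, OF S f])

lemma additive_on_minus:
  fixes f :: "'m::ab_group_add \<Rightarrow> 'l::ab_group_add"
  assumes S: "add_subgroup S" and f: "\<And>x y. x \<in> S \<Longrightarrow> y \<in> S \<Longrightarrow> f (x + y) = f x + f y"
    and x: "x \<in> S"
  shows "f (- x) = - f x"
  using f[OF x add_subgroup_minus[OF S x]] additive_on_zero[of S f, OF S f]
  by (simp add: eq_neg_iff_add_eq_0 add.commute)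

lemma additive_on_diff:
  fixes f :: "'m::ab_group_add \<Rightarrow> 'l::ab_group_add"
  assumes S: "add_subgroup S" and f: "\<And>x y. x \<in> S \<Longrightarrow> y \<in> S \<Longrightarrow> f (x + y) = f x + f y"
    and x: "x \<in> S" and y: "y \<in> S"
  shows "f (x - y) = f x - f y"
  using f[OF x add_subgroup_minus[OF S y]] additive_on_minus[of S f, OF S f y] by simp

text \<open>Scalars and negation are left out so that the same span serves algebras and modules,
  whose records treat scalars differently. Where a subgroup is needed, the generating set is closed
  under negation.\<close>

inductive_set add_span :: "'m::ab_group_add set \<Rightarrow> 'm set" for X where
  zero: "0 \<in> add_span X"
| step: "x \<in> X \<Longrightarrow> y \<in> add_span X \<Longrightarrow> x + y \<in> add_span X"

lemma add_span_base: "x \<in> X \<Longrightarrow> x \<in> add_span X"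
  using add_span.step[OF _ add_span.zero] by fastforce

lemma add_span_add: "x \<in> add_span X \<Longrightarrow> y \<in> add_span X \<Longrightarrow> x + y \<in> add_span X"
  by (induction rule: add_span.induct) (auto simp: add.assoc intro: add_span.step)

lemma add_span_minus:
  assumes "\<And>x. x \<in> X \<Longrightarrow> - x \<in> X" and "x \<in> add_span X"
  shows "- x \<in> add_span X"
  using assms(2)
proof induction
  case (step x y)
  then have "- x + - y \<in> add_span X" using assms(1) by (intro add_span.step)
  then show ?case by simp
qed (simp add: add_span.zero)

lemma add_span_subgroup:
  "(\<And>x. x \<in> X \<Longrightarrow> - x \<in> X) \<Longrightarrow> add_subgroup (add_span X)"
  unfolding add_subgroup_def
  by (metis add_span.zero add_span_add add_span_minus diff_conv_add_uminus)

lemma add_span_sum: "(\<And>i. i \<in> I \<Longrightarrow> f i \<in> add_span X) \<Longrightarrow> sum f I \<in> add_span X"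
  by (induction I rule: infinite_finite_induct) (auto intro: add_span_add add_span.zero)

lemma add_span_least: "X \<subseteq> S \<Longrightarrow> add_subgroup S \<Longrightarrow> add_span X \<subseteq> S"
proof
  fix x assume S: "X \<subseteq> S" "add_subgroup S" "x \<in> add_span X"
  from S(3) show "x \<in> S"
    by induction (use S in \<open>auto intro: add_subgroup_add add_subgroup_zero\<close>)
qed

text \<open>Finite initial sums replace sums over supports, and independence is stated as the
  vanishing of all terms of a zero sum. \<open>grading_iff\<close> relates this to the unique
  decompositions in \<open>graded_module\<close>.\<close>

definition grading :: "'m::ab_group_add set \<Rightarrow> (nat \<Rightarrow> 'm set) \<Rightarrow> bool"
  where "grading C G \<longleftrightarrow> add_subgroup C \<and> (\<forall>s. add_subgroup (G s) \<and> G s \<subseteq> C) \<and>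
    (\<forall>x\<in>C. \<exists>c N. (\<forall>s. c s \<in> G s) \<and> x = (\<Sum>s<N. c s)) \<and>
    (\<forall>c N. (\<forall>s. c s \<in> G s) \<and> (\<Sum>s<(N::nat). c s) = 0 \<longrightarrow> (\<forall>s<N. c s = 0))"

text \<open>Asking for the identity at all large bounds forces the family to vanish eventually, and
  this makes the choice unique for elements of a graded group.\<close>

definition component :: "(nat \<Rightarrow> 'm::ab_group_add set) \<Rightarrow> 'm \<Rightarrow> nat \<Rightarrow> 'm"
  where "component G x = (SOME c. (\<forall>s. c s \<in> G s) \<and> (\<exists>N. \<forall>M\<ge>N. x = (\<Sum>s<M. c s)))"

lemma sum_lessThan_stable:
  fixes c :: "nat \<Rightarrow> 'm::comm_monoid_add"
  assumes "\<And>s. s \<ge> N \<Longrightarrow> c s = 0" and "M \<ge> N"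
  shows "(\<Sum>s<M. c s) = (\<Sum>s<N. c s)"
  by (rule sum.mono_neutral_right) (use assms in auto)

context
  fixes C :: "'m::ab_group_add set" and G
  assumes gr: "grading C G"
begin

lemma grading_carrier: "add_subgroup C"
  and grading_comp: "add_subgroup (G s)"
  and grading_subset: "x \<in> G s \<Longrightarrow> x \<in> C"
  using gr by (auto simp: grading_def)

lemma grading_unique:
  assumes "\<And>s. c s \<in> G s" "\<And>M. M \<ge> N \<Longrightarrow> x = (\<Sum>s<M. c s)"
    and "\<And>s. c' s \<in> G s" "\<And>M. M \<ge> N' \<Longrightarrow> x = (\<Sum>s<M. c' s)"
  shows "c = c'"
proof
  fix s
  define M where "M = Suc (max s (max N N'))"
  have "(\<Sum>s<M. c s - c' s) = 0"
    using assms(2)[of M] assms(4)[of M] by (simp add: sum_subtractf M_def)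
  moreover have "\<forall>s. c s - c' s \<in> G s"
    using assms(1,3) grading_comp add_subgroup_diff by blast
  ultimately have "\<forall>s<M. c s - c' s = 0"
    using gr[unfolded grading_def, THEN conjunct2, THEN conjunct2, THEN conjunct2, THEN spec,
        THEN spec, of "\<lambda>s. c s - c' s" M] by blast
  then show "c s = c' s" by (auto simp: M_def)
qed

lemma component_ex:
  assumes "x \<in> C"
  shows "\<exists>c. (\<forall>s. c s \<in> G s) \<and> (\<exists>N. \<forall>M\<ge>N. x = (\<Sum>s<M. c s))"
proof -
  obtain c N where c: "\<forall>s. c s \<in> G s" "x = (\<Sum>s<N. c s)"
    using gr assms unfolding grading_def by blast
  let ?c = "\<lambda>s. if s < N then c s else 0"
  have "x = (\<Sum>s<M. ?c s)" if "M \<ge> N" for M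
    using sum_lessThan_stable[of N ?c M] that c by simp
  moreover have "\<forall>s. ?c s \<in> G s"
    using c grading_comp add_subgroup_zero by auto
  ultimately have "(\<forall>s. ?c s \<in> G s) \<and> (\<exists>N. \<forall>M\<ge>N. x = (\<Sum>s<M. ?c s))" by blast
  then show ?thesis by (rule exI[of _ ?c])
qed

lemma component_in: "x \<in> C \<Longrightarrow> component G x s \<in> G s"
  and component_sum_ex: "x \<in> C \<Longrightarrow> \<exists>N. \<forall>M\<ge>N. x = (\<Sum>s<M. component G x s)"
  using someI_ex[OF component_ex[of x]] unfolding component_def[symmetric] by blast+

lemma component_eqI:
  assumes "\<And>s. c s \<in> G s" "\<And>M. M \<ge> N \<Longrightarrow> x = (\<Sum>s<M. c s)"
  shows "component G x = c"
proof -
  have "x \<in> C" unfolding assms(2)[OF order_refl]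
    using assms(1) grading_subset by (intro add_subgroup_sum[OF grading_carrier]) auto
  then obtain N' where "\<forall>M\<ge>N'. x = (\<Sum>s<M. component G x s)"
    using component_sum_ex by blast
  then show ?thesis
    using grading_unique[of "component G x" N' x c N] assms component_in[OF \<open>x \<in> C\<close>] by blast
qed

lemma component_zero_ex: "x \<in> C \<Longrightarrow> \<exists>N. (\<forall>s\<ge>N. component G x s = 0) \<and> x = (\<Sum>s<N. component G x s)"
proof -
  assume x: "x \<in> C"
  obtain c N where c: "\<forall>s. c s \<in> G s" "x = (\<Sum>s<N. c s)"
    using gr x unfolding grading_def by blast
  let ?c = "\<lambda>s. if s < N then c s else 0"
  have "component G x = ?c"
  proof (rule component_eqI[of ?c N])
    show "?c s \<in> G s" for s using c grading_comp add_subgroup_zero by auto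
    show "x = (\<Sum>s<M. ?c s)" if "M \<ge> N" for M
      using sum_lessThan_stable[of N ?c M] that c by simp
  qed
  then show ?thesis using c by (intro exI[of _ N]) auto
qed

lemma component_add:
  assumes "x \<in> C" "y \<in> C"
  shows "component G (x + y) s = component G x s + component G y s"
proof -
  obtain N where N: "\<forall>M\<ge>N. x = (\<Sum>s<M. component G x s)" using component_sum_ex assms by blast
  obtain N' where N': "\<forall>M\<ge>N'. y = (\<Sum>s<M. component G y s)" using component_sum_ex assms by blast
  have "component G (x + y) = (\<lambda>s. component G x s + component G y s)"
  proof (rule component_eqI[of _ "max N N'"])
    show "component G x s + component G y s \<in> G s" for s
      using assms component_in grading_comp add_subgroup_add by blast
    show "x + y = (\<Sum>s<M. component G x s + component G y s)" if "M \<ge> max N N'" for M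
      using N[rule_format, of M] N'[rule_format, of M] that by (simp add: sum.distrib)
  qed
  then show ?thesis by simp
qed

lemma component_hom:
  assumes "x \<in> G t"
  shows "component G x s = (if s = t then x else 0)"
proof -
  have "component G x = (\<lambda>s. if s = t then x else 0)"
  proof (rule component_eqI[of _ "Suc t"])
    show "(if s = t then x else 0) \<in> G s" for s
      using assms grading_comp add_subgroup_zero by auto
    show "x = (\<Sum>s<M. if s = t then x else 0)" if "M \<ge> Suc t" for M
      using that by (simp add: sum.delta)
  qed
  then show ?thesis by simp
qed

lemma component_zero: "component G 0 s = 0"
  using component_hom[of 0 s] grading_comp add_subgroup_zero by auto

lemma component_sum:
  assumes "\<And>k. k \<in> K \<Longrightarrow> y k \<in> C"
  shows "component G (\<Sum>k\<in>K. y k) s = (\<Sum>k\<in>K. component G (y k) s)"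
  using additive_on_sum[of C "\<lambda>x. component G x s" K y] component_add grading_carrier assms by auto

lemma component_diff:
  "x \<in> C \<Longrightarrow> y \<in> C \<Longrightarrow> component G (x - y) s = component G x s - component G y s"
  using additive_on_diff[of C "\<lambda>x. component G x s" x y] component_add grading_carrier by auto

lemma component_sum_hom:
  assumes "finite K" "\<And>k. k \<in> K \<Longrightarrow> y k \<in> G (d k)"
  shows "component G (\<Sum>k\<in>K. y k) s = (\<Sum>k\<in>{k\<in>K. d k = s}. y k)"
proof -
  have "component G (\<Sum>k\<in>K. y k) s = (\<Sum>k\<in>K. component G (y k) s)"
    using assms grading_subset by (intro component_sum) blast
  also have "\<dots> = (\<Sum>k\<in>K. if d k = s then y k else 0)"
    by (intro sum.cong refl) (auto simp: component_hom[OF assms(2)])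
  also have "\<dots> = (\<Sum>k\<in>{k\<in>K. d k = s}. y k)"
    using assms(1) by (simp add: sum.inter_filter)
  finally show ?thesis .
qed

lemma component_all_zero: "x \<in> C \<Longrightarrow> (\<And>s. component G x s = 0) \<Longrightarrow> x = 0"
  using component_zero_ex[of x] by auto

lemma add_component_induct:
  assumes "x \<in> C" "P 0" "\<And>x y. x \<in> C \<Longrightarrow> y \<in> C \<Longrightarrow> P x \<Longrightarrow> P y \<Longrightarrow> P (x + y)"
    "\<And>x s. x \<in> G s \<Longrightarrow> P x"
  shows "P x"
proof -
  obtain c N where c: "\<forall>s. c s \<in> G s" "x = (\<Sum>s<N. c s)"
    using gr assms(1) unfolding grading_def by blast
  have "P (\<Sum>s<n. c s) \<and> (\<Sum>s<n. c s) \<in> C" for n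
  proof (induction n)
    case 0 then show ?case using assms add_subgroup_zero[OF grading_carrier] by simp
  next
    case (Suc n)
    have "c n \<in> C" using c grading_subset by blast
    moreover have "P (c n)" using assms(4) c by blast
    ultimately show ?case using Suc assms(3) add_subgroup_add[OF grading_carrier] by auto
  qed
  then show ?thesis using c by simp
qed

end

lemma sum_support_lessThan:
  fixes c :: "nat \<Rightarrow> 'm::comm_monoid_add"
  assumes "finite {s. c s \<noteq> 0}"
  shows "\<exists>N. \<forall>M\<ge>N. c M = 0 \<and> (\<Sum>s<M. c s) = (\<Sum>s | c s \<noteq> 0. c s)"
proof -
  obtain N where N: "\<forall>s\<in>{s. c s \<noteq> 0}. s < N"
    using finite_nat_set_iff_bounded[of "{s. c s \<noteq> 0}"] assms by auto
  have "(\<Sum>s<M. c s) = (\<Sum>s | c s \<noteq> 0. c s)" if "M \<ge> N" for M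
    by (rule sum.mono_neutral_right) (use N that in force)+
  moreover have "c M = 0" if "M \<ge> N" for M using N that by force
  ultimately show ?thesis by blast
qed

lemma grading_iff:
  "grading C G \<longleftrightarrow> add_subgroup C \<and> (\<forall>s. add_subgroup (G s) \<and> G s \<subseteq> C) \<and>
    (\<forall>x\<in>C. \<exists>!c. (\<forall>s. c s \<in> G s) \<and> finite {s. c s \<noteq> 0} \<and> x = (\<Sum>s | c s \<noteq> 0. c s))"
  (is "?L \<longleftrightarrow> ?R")
proof
  assume L: ?L
  have "\<exists>!c. (\<forall>s. c s \<in> G s) \<and> finite {s. c s \<noteq> 0} \<and> x = (\<Sum>s | c s \<noteq> 0. c s)" if x: "x \<in> C" for x
  proof (rule ex1I[of _ "component G x"])
    obtain N where N: "\<forall>s\<ge>N. component G x s = 0" using component_zero_ex[OF L x] by blast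
    then have "{s. component G x s \<noteq> 0} \<subseteq> {..<N}" by (intro subsetI, unfold mem_Collect_eq lessThan_iff) (rule ccontr, simp)
    then have fin: "finite {s. component G x s \<noteq> 0}" by (rule finite_subset) simp
    then obtain M where M: "\<forall>m\<ge>M. (\<Sum>s<m. component G x s) = (\<Sum>s | component G x s \<noteq> 0. component G x s)"
      using sum_support_lessThan by blast
    obtain K where K: "\<forall>m\<ge>K. x = (\<Sum>s<m. component G x s)" using component_sum_ex[OF L x] by blast
    have "x = (\<Sum>s | component G x s \<noteq> 0. component G x s)"
      using K[rule_format, of "max K M"] M[rule_format, of "max K M"] by simp
    then show "(\<forall>s. component G x s \<in> G s) \<and> finite {s. component G x s \<noteq> 0} \<and>
        x = (\<Sum>s | component G x s \<noteq> 0. component G x s)"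
      using fin component_in[OF L x] by blast
    fix c assume c: "(\<forall>s. c s \<in> G s) \<and> finite {s. c s \<noteq> 0} \<and> x = (\<Sum>s | c s \<noteq> 0. c s)"
    then obtain N where N: "\<forall>M\<ge>N. (\<Sum>s<M. c s) = x" using sum_support_lessThan[of c] by auto
    have "component G x = c"
      by (rule component_eqI[OF L, of c N x]) (use N c in auto)
    then show "c = component G x" by (rule sym)
  qed
  moreover have "add_subgroup C \<and> (\<forall>s. add_subgroup (G s) \<and> G s \<subseteq> C)"
    using L unfolding grading_def by (elim conjE) (intro conjI)
  ultimately show ?R by (intro conjI ballI) simp_all
next
  assume R: ?R
  have 1: "\<exists>c N. (\<forall>s. c s \<in> G s) \<and> x = (\<Sum>s<N. c s)" if "x \<in> C" for x
  proof -
    obtain c where c: "\<forall>s. c s \<in> G s" "finite {s. c s \<noteq> 0}" "x = (\<Sum>s | c s \<noteq> 0. c s)"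
      using ex1_implies_ex[OF R[THEN conjunct2, THEN conjunct2, THEN bspec, OF \<open>x \<in> C\<close>]]
      by (elim exE conjE)
    obtain N where "\<forall>M\<ge>N. (\<Sum>s<M. c s) = x" using sum_support_lessThan[OF c(2)] c(3) by auto
    then have "x = (\<Sum>s<N. c s)" by simp
    with c(1) show ?thesis by blast
  qed
  have 2: "\<forall>s<N. c s = 0" if c: "\<forall>s. c s \<in> G s" "(\<Sum>s<(N::nat). c s) = 0" for c N
  proof -
    \<comment> \<open>Truncation gives a family of finite support with the same sum. The zero family
      also decomposes 0, so uniqueness makes the truncated family vanish.\<close>
    let ?c = "\<lambda>s. if s < N then c s else 0"
    have sub: "{s. ?c s \<noteq> 0} \<subseteq> {..<N}" by auto
    then have fin: "finite {s. ?c s \<noteq> 0}" by (rule finite_subset) simp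
    have "(\<Sum>s | ?c s \<noteq> 0. ?c s) = (\<Sum>s<N. ?c s)"
      by (rule sum.mono_neutral_left) auto
    then have c1: "(\<forall>s. ?c s \<in> G s) \<and> finite {s. ?c s \<noteq> 0} \<and> 0 = (\<Sum>s | ?c s \<noteq> 0. ?c s)"
      using fin c R by (auto simp: add_subgroup_zero)
    have c2: "(\<forall>s. (\<lambda>s. 0) s \<in> G s) \<and> finite {s. (\<lambda>s. 0::'a) s \<noteq> 0} \<and> 0 = (\<Sum>s | (\<lambda>s. 0::'a) s \<noteq> 0. (\<lambda>s. 0) s)"
      using R by (auto simp: add_subgroup_zero)
    have "0 \<in> C" using R add_subgroup_zero by auto
    note uniq = R[THEN conjunct2, THEN conjunct2, THEN bspec, OF this]
    have "?c = (\<lambda>s. 0)"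
    proof (rule ex1E[OF uniq])
      fix d assume d: "\<forall>c. (\<forall>s. c s \<in> G s) \<and> finite {s. c s \<noteq> 0} \<and> 0 = (\<Sum>s | c s \<noteq> 0. c s) \<longrightarrow> c = d"
      show ?thesis using d[THEN spec, THEN mp, OF c1] d[THEN spec, THEN mp, OF c2] by simp
    qed
    then show ?thesis by (auto simp: fun_eq_iff split: if_splits)
  qed
  have 3: "add_subgroup C" "\<forall>s. add_subgroup (G s) \<and> G s \<subseteq> C"
    using R by (rule conjunct1, rule conjunct1[OF conjunct2])
  show ?L unfolding grading_def
    by (intro conjI 3 ballI allI impI) (rule 1, assumption, elim conjE, rule 2[rule_format], erule spec, assumption+)
qed

lemma graded_module_iff:
  "graded_module A M G \<longleftrightarrow> left_module A M \<and> grading (mcarrier M) G \<and>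
    (\<forall>r s. \<forall>a\<in>comp A r. \<forall>x\<in>G s. act M a x \<in> G (r + s))"
proof -
  have "left_module A M \<Longrightarrow> add_subgroup (mcarrier M)" by (simp add: left_module_def)
  then show ?thesis unfolding graded_module_def grading_iff
    by (cases "left_module A M") (simp_all only: simp_thms conj_assoc)
qed

section \<open>Graded algebras with local units\<close>

text \<open>These axioms mention no quiver, because they must be checked for the trivial extension
  before a presentation of it is known. \<open>unit_ex\<close> replaces the unit by finite sums of
  idempotents, \<open>comp0_right\<close> and \<open>comp0_left\<close> say that degree 0 is spanned
  by the idempotents, and \<open>gen_left\<close> and \<open>gen_right\<close> that degree 1
  generates.\<close>

locale graded_algebra =
  fixes A :: "('k::field, 'v, 'a::ab_group_add) galgebra"
  assumes grading: "grading (carrier A) (comp A)"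
    and mult_closed: "\<And>a b. a \<in> carrier A \<Longrightarrow> b \<in> carrier A \<Longrightarrow> mult A a b \<in> carrier A"
    and mult_add_left: "\<And>a b c. a \<in> carrier A \<Longrightarrow> b \<in> carrier A \<Longrightarrow> c \<in> carrier A \<Longrightarrow>
      mult A (a + b) c = mult A a c + mult A b c"
    and mult_add_right: "\<And>a b c. a \<in> carrier A \<Longrightarrow> b \<in> carrier A \<Longrightarrow> c \<in> carrier A \<Longrightarrow>
      mult A a (b + c) = mult A a b + mult A a c"
    and mult_assoc: "\<And>a b c. a \<in> carrier A \<Longrightarrow> b \<in> carrier A \<Longrightarrow> c \<in> carrier A \<Longrightarrow>
      mult A (mult A a b) c = mult A a (mult A b c)"
    and scale_closed: "\<And>r a. a \<in> carrier A \<Longrightarrow> scale A r a \<in> carrier A"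
    and scale_add_right: "\<And>r a b. a \<in> carrier A \<Longrightarrow> b \<in> carrier A \<Longrightarrow>
      scale A r (a + b) = scale A r a + scale A r b"
    and scale_add_left: "\<And>r s a. a \<in> carrier A \<Longrightarrow> scale A (r + s) a = scale A r a + scale A s a"
    and scale_scale: "\<And>r s a. a \<in> carrier A \<Longrightarrow> scale A r (scale A s a) = scale A (r * s) a"
    and scale_one: "\<And>a. a \<in> carrier A \<Longrightarrow> scale A 1 a = a"
    and scale_mult_left: "\<And>r a b. a \<in> carrier A \<Longrightarrow> b \<in> carrier A \<Longrightarrow>
      mult A (scale A r a) b = scale A r (mult A a b)"
    and scale_mult_right: "\<And>r a b. a \<in> carrier A \<Longrightarrow> b \<in> carrier A \<Longrightarrow>
      mult A a (scale A r b) = scale A r (mult A a b)"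
    and scale_comp: "\<And>r a t. a \<in> comp A t \<Longrightarrow> scale A r a \<in> comp A t"
    and mult_comp: "\<And>a b s t. a \<in> comp A s \<Longrightarrow> b \<in> comp A t \<Longrightarrow> mult A a b \<in> comp A (s + t)"
    and idem_comp: "\<And>i. i \<in> vertices A \<Longrightarrow> idem A i \<in> comp A 0"
    and idem_mult: "\<And>i j. i \<in> vertices A \<Longrightarrow> j \<in> vertices A \<Longrightarrow>
      mult A (idem A i) (idem A j) = (if i = j then idem A i else 0)"
    and idem_nonzero: "\<And>i. i \<in> vertices A \<Longrightarrow> idem A i \<noteq> 0"
    and unit_ex: "\<And>a. a \<in> carrier A \<Longrightarrow> \<exists>J. finite J \<and> J \<subseteq> vertices A \<and>
      mult A (\<Sum>j\<in>J. idem A j) a = a \<and> mult A a (\<Sum>j\<in>J. idem A j) = a"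
    and comp0_right: "\<And>a i. a \<in> comp A 0 \<Longrightarrow> i \<in> vertices A \<Longrightarrow> \<exists>r. mult A a (idem A i) = scale A r (idem A i)"
    and comp0_left: "\<And>a i. a \<in> comp A 0 \<Longrightarrow> i \<in> vertices A \<Longrightarrow> \<exists>r. mult A (idem A i) a = scale A r (idem A i)"
    and gen_left: "\<And>t. comp A (Suc t) \<subseteq> add_span {mult A b c | b c. b \<in> comp A 1 \<and> c \<in> comp A t}"
    and gen_right: "\<And>t. comp A (Suc t) \<subseteq> add_span {mult A c b | b c. b \<in> comp A 1 \<and> c \<in> comp A t}"
begin

abbreviation mul (infixl "\<cdot>" 70) where "a \<cdot> b \<equiv> mult A a b"
abbreviation smul (infixr "*s" 75) where "r *s a \<equiv> scale A r a"
abbreviation ee where "ee \<equiv> idem A"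
abbreviation CC where "CC \<equiv> carrier A"
abbreviation VV where "VV \<equiv> vertices A"
abbreviation hc where "hc \<equiv> component (comp A)"

definition uu :: "'v set \<Rightarrow> 'a" where "uu J = (\<Sum>j\<in>J. ee j)"
text \<open>Describing the Peirce pieces by fixed-point equations instead of products makes
  membership directly usable in rewriting; \<open>peirce_eq\<close> shows that this agrees with
  \<open>peirce\<close> at vertices.\<close>

definition pc :: "'v \<Rightarrow> nat \<Rightarrow> 'v \<Rightarrow> 'a set"
  where "pc j t i = {a \<in> comp A t. ee j \<cdot> a = a \<and> a \<cdot> ee i = a}"

lemmas CC_group = grading_carrier[OF grading] and comp_group = grading_comp[OF grading]
  and comp_CC = grading_subset[OF grading]

lemma CC_simps[simp]:
  "0 \<in> CC" "a \<in> CC \<Longrightarrow> b \<in> CC \<Longrightarrow> a + b \<in> CC" "a \<in> CC \<Longrightarrow> b \<in> CC \<Longrightarrow> a - b \<in> CC"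
  "a \<in> CC \<Longrightarrow> - a \<in> CC" "a \<in> CC \<Longrightarrow> b \<in> CC \<Longrightarrow> a \<cdot> b \<in> CC" "a \<in> CC \<Longrightarrow> r *s a \<in> CC"
  "i \<in> VV \<Longrightarrow> ee i \<in> CC"
  by (simp_all add: add_subgroup_zero[OF CC_group] add_subgroup_add[OF CC_group]
    add_subgroup_diff[OF CC_group] add_subgroup_minus[OF CC_group]
    mult_closed scale_closed comp_CC[OF idem_comp])

lemma comp_simps[simp]:
  "0 \<in> comp A t" "a \<in> comp A t \<Longrightarrow> b \<in> comp A t \<Longrightarrow> a + b \<in> comp A t"
  "a \<in> comp A t \<Longrightarrow> b \<in> comp A t \<Longrightarrow> a - b \<in> comp A t"
  "a \<in> comp A t \<Longrightarrow> - a \<in> comp A t" "a \<in> comp A t \<Longrightarrow> r *s a \<in> comp A t"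
  by (simp_all add: add_subgroup_zero[OF comp_group] add_subgroup_add[OF comp_group]
    add_subgroup_diff[OF comp_group] add_subgroup_minus[OF comp_group] scale_comp)

lemma CC_sum: "(\<And>i. i \<in> I \<Longrightarrow> f i \<in> CC) \<Longrightarrow> sum f I \<in> CC"
  by (rule add_subgroup_sum[OF CC_group])

lemma comp_sum: "(\<And>i. i \<in> I \<Longrightarrow> f i \<in> comp A t) \<Longrightarrow> sum f I \<in> comp A t"
  by (rule add_subgroup_sum[OF comp_group])

lemma mult_zero[simp]: "a \<in> CC \<Longrightarrow> a \<cdot> 0 = 0" "a \<in> CC \<Longrightarrow> 0 \<cdot> a = 0"
  using mult_add_right[of a 0 0] mult_add_left[of 0 0 a] by simp_all

lemma mult_minus_right: "a \<in> CC \<Longrightarrow> b \<in> CC \<Longrightarrow> a \<cdot> (- b) = - (a \<cdot> b)"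
  and mult_minus_left: "a \<in> CC \<Longrightarrow> b \<in> CC \<Longrightarrow> (- a) \<cdot> b = - (a \<cdot> b)"
  using additive_on_minus[OF CC_group, of "\<lambda>x. a \<cdot> x" b] additive_on_minus[OF CC_group, of "\<lambda>x. x \<cdot> b" a]
    mult_add_right mult_add_left by simp_all

lemma mult_diff_right: "a \<in> CC \<Longrightarrow> b \<in> CC \<Longrightarrow> c \<in> CC \<Longrightarrow> a \<cdot> (b - c) = a \<cdot> b - a \<cdot> c"
  and mult_diff_left: "a \<in> CC \<Longrightarrow> b \<in> CC \<Longrightarrow> c \<in> CC \<Longrightarrow> (a - b) \<cdot> c = a \<cdot> c - b \<cdot> c"
  using mult_add_right[of a b "- c"] mult_add_left[of a "- b" c]
  by (simp_all add: mult_minus_right mult_minus_left)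

lemma mult_sum_right: "a \<in> CC \<Longrightarrow> (\<And>i. i \<in> I \<Longrightarrow> f i \<in> CC) \<Longrightarrow> a \<cdot> sum f I = (\<Sum>i\<in>I. a \<cdot> f i)"
  and mult_sum_left: "a \<in> CC \<Longrightarrow> (\<And>i. i \<in> I \<Longrightarrow> f i \<in> CC) \<Longrightarrow> sum f I \<cdot> a = (\<Sum>i\<in>I. f i \<cdot> a)"
  using additive_on_sum[OF CC_group, of "\<lambda>x. a \<cdot> x" I f] additive_on_sum[OF CC_group, of "\<lambda>x. x \<cdot> a" I f]
    mult_add_right mult_add_left by simp_all

lemma scale_zero[simp]: "r *s 0 = 0" "a \<in> CC \<Longrightarrow> 0 *s a = 0"
  using scale_add_right[of 0 0 r] scale_add_left[of a 0 0] by simp_all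

lemma scale_sum: "(\<And>i. i \<in> I \<Longrightarrow> f i \<in> CC) \<Longrightarrow> r *s sum f I = (\<Sum>i\<in>I. r *s f i)"
  using additive_on_sum[OF CC_group, of "\<lambda>x. r *s x" I f] scale_add_right by simp

lemma scale_minus: "a \<in> CC \<Longrightarrow> (- r) *s a = - (r *s a)"
  using scale_add_left[of a "- r" r] by (simp add: eq_neg_iff_add_eq_0)

lemma scale_diff_left: "a \<in> CC \<Longrightarrow> (r - s) *s a = r *s a - s *s a"
  using scale_add_left[of a r "- s"] by (simp add: scale_minus)

lemma scale_eq_0: "a \<in> CC \<Longrightarrow> r *s a = 0 \<longleftrightarrow> r = 0 \<or> a = 0"
proof
  assume a: "a \<in> CC" "r *s a = 0"
  show "r = 0 \<or> a = 0"
  proof (rule disjCI)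
    assume "a \<noteq> 0"
    show "r = 0"
    proof (rule ccontr)
      assume "r \<noteq> 0"
      then have "a = inverse r *s (r *s a)" using a(1) by (simp add: scale_scale scale_one)
      then show False using a \<open>a \<noteq> 0\<close> by simp
    qed
  qed
qed auto

lemma scale_cancel: "a \<in> CC \<Longrightarrow> a \<noteq> 0 \<Longrightarrow> r *s a = s *s a \<longleftrightarrow> r = s"
  using scale_eq_0[of a "r - s"] by (auto simp: scale_diff_left)

lemma ee_idem[simp]: "i \<in> VV \<Longrightarrow> ee i \<cdot> ee i = ee i" by (simp add: idem_mult)

lemma ee_mult_assoc[simp]:
  "i \<in> VV \<Longrightarrow> a \<in> CC \<Longrightarrow> ee i \<cdot> (ee i \<cdot> a) = ee i \<cdot> a"
  "i \<in> VV \<Longrightarrow> a \<in> CC \<Longrightarrow> (a \<cdot> ee i) \<cdot> ee i = a \<cdot> ee i"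
  using mult_assoc[of "ee i" "ee i" a] mult_assoc[of a "ee i" "ee i"] by simp_all

lemma uu_comp: "J \<subseteq> VV \<Longrightarrow> uu J \<in> comp A 0"
  unfolding uu_def by (intro comp_sum idem_comp) auto

lemma uu_CC[simp]: "J \<subseteq> VV \<Longrightarrow> uu J \<in> CC"
  using uu_comp comp_CC by blast

lemma uu_ee: "finite J \<Longrightarrow> J \<subseteq> VV \<Longrightarrow> i \<in> VV \<Longrightarrow> uu J \<cdot> ee i = (if i \<in> J then ee i else 0)"
  and ee_uu: "finite J \<Longrightarrow> J \<subseteq> VV \<Longrightarrow> i \<in> VV \<Longrightarrow> ee i \<cdot> uu J = (if i \<in> J then ee i else 0)"
  unfolding uu_def by (subst mult_sum_left mult_sum_right; auto simp: idem_mult subset_iff sum.delta cong: sum.cong)+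

lemma uu_uu: "finite J \<Longrightarrow> J \<subseteq> VV \<Longrightarrow> finite K \<Longrightarrow> K \<subseteq> VV \<Longrightarrow> uu J \<cdot> uu K = uu (J \<inter> K)"
proof -
  assume JK: "finite J" "J \<subseteq> VV" "finite K" "K \<subseteq> VV"
  have "uu J \<cdot> uu K = (\<Sum>k\<in>K. uu J \<cdot> ee k)"
    unfolding uu_def[of K] using JK by (subst mult_sum_right) (auto simp: subset_iff)
  also have "\<dots> = (\<Sum>k\<in>K. if k \<in> J then ee k else 0)"
    using JK by (intro sum.cong refl) (auto simp: uu_ee)
  also have "\<dots> = uu (J \<inter> K)"
    unfolding uu_def using JK by (subst sum.inter_restrict[symmetric]) (auto simp: Int_commute)
  finally show ?thesis .
qed

text \<open>The product of \<open>uu K\<close> and \<open>uu J\<close> is \<open>uu J\<close> when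
  \<open>J\<close> lies in \<open>K\<close>, so local units may be enlarged; this is how finitely
  many elements get a common one.\<close>

lemma unit_mono:
  assumes "finite J" "J \<subseteq> VV" "finite K" "K \<subseteq> VV" "J \<subseteq> K" "a \<in> CC"
  shows "uu J \<cdot> a = a \<Longrightarrow> uu K \<cdot> a = a" "a \<cdot> uu J = a \<Longrightarrow> a \<cdot> uu K = a"
proof -
  have "K \<inter> J = J" "J \<inter> K = J" using assms by auto
  then show "uu J \<cdot> a = a \<Longrightarrow> uu K \<cdot> a = a" "a \<cdot> uu J = a \<Longrightarrow> a \<cdot> uu K = a"
    using assms mult_assoc[of "uu K" "uu J" a] mult_assoc[of a "uu J" "uu K"] by (auto simp: uu_uu)
qed

lemma common_unit:
  assumes "finite S" "S \<subseteq> CC"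
  obtains J where "finite J" "J \<subseteq> VV" "\<And>a. a \<in> S \<Longrightarrow> uu J \<cdot> a = a" "\<And>a. a \<in> S \<Longrightarrow> a \<cdot> uu J = a"
proof -
  have "\<forall>a\<in>S. \<exists>J. finite J \<and> J \<subseteq> VV \<and> uu J \<cdot> a = a \<and> a \<cdot> uu J = a"
    using unit_ex assms unfolding uu_def by blast
  then obtain j where j: "\<forall>a\<in>S. finite (j a) \<and> j a \<subseteq> VV \<and> uu (j a) \<cdot> a = a \<and> a \<cdot> uu (j a) = a"
    by metis
  show ?thesis
  proof (rule that[of "\<Union>a\<in>S. j a"])
    show "finite (\<Union>a\<in>S. j a)" "(\<Union>a\<in>S. j a) \<subseteq> VV" using j assms by auto
    then show "uu (\<Union>a\<in>S. j a) \<cdot> a = a" "a \<cdot> uu (\<Union>a\<in>S. j a) = a" if "a \<in> S" for a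
      using unit_mono[of "j a" "\<Union>a\<in>S. j a" a] j assms that by blast+
  qed
qed

lemma common_unit_ex:
  "finite S \<Longrightarrow> S \<subseteq> CC \<Longrightarrow> \<exists>J. finite J \<and> J \<subseteq> VV \<and> (\<forall>a\<in>S. uu J \<cdot> a = a \<and> a \<cdot> uu J = a)"
  by (rule common_unit) auto

lemma unit_obtain:
  assumes "a \<in> CC"
  obtains J where "finite J" "J \<subseteq> VV" "uu J \<cdot> a = a" "a \<cdot> uu J = a"
  using unit_ex[OF assms] unfolding uu_def by blast

lemma unit_support:
  assumes "a \<in> CC" "i \<in> VV" "finite J" "J \<subseteq> VV" "i \<notin> J"
  shows "uu J \<cdot> a = a \<Longrightarrow> ee i \<cdot> a = 0" "a \<cdot> uu J = a \<Longrightarrow> a \<cdot> ee i = 0"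
  using assms mult_assoc[of "ee i" "uu J" a] mult_assoc[of a "uu J" "ee i"] by (auto simp: uu_ee ee_uu)

lemma unit_sum: "finite J \<Longrightarrow> J \<subseteq> VV \<Longrightarrow> a \<in> CC \<Longrightarrow> uu J \<cdot> a = (\<Sum>j\<in>J. ee j \<cdot> a)"
  "finite J \<Longrightarrow> J \<subseteq> VV \<Longrightarrow> a \<in> CC \<Longrightarrow> a \<cdot> uu J = (\<Sum>j\<in>J. a \<cdot> ee j)"
  unfolding uu_def by (auto intro!: mult_sum_left mult_sum_right)

lemma nonzero_peirce_ex:
  assumes "a \<in> CC" "a \<noteq> 0"
  shows "\<exists>j\<in>VV. ee j \<cdot> a \<noteq> 0" "\<exists>j\<in>VV. a \<cdot> ee j \<noteq> 0"
proof -
  obtain J where J: "finite J" "J \<subseteq> VV" "uu J \<cdot> a = a" "a \<cdot> uu J = a"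
    using common_unit[of "{a}"] assms by auto
  then have "(\<Sum>j\<in>J. ee j \<cdot> a) \<noteq> 0" "(\<Sum>j\<in>J. a \<cdot> ee j) \<noteq> 0"
    using assms unit_sum[of J a] by auto
  then show "\<exists>j\<in>VV. ee j \<cdot> a \<noteq> 0" "\<exists>j\<in>VV. a \<cdot> ee j \<noteq> 0"
    using J sum.not_neutral_contains_not_neutral by blast+
qed

lemma hc_comp: "a \<in> CC \<Longrightarrow> hc a t \<in> comp A t" by (rule component_in[OF grading])
lemma hc_CC[simp]: "a \<in> CC \<Longrightarrow> hc a t \<in> CC" using hc_comp comp_CC by blast
lemma hc_sum_ex: "a \<in> CC \<Longrightarrow> \<exists>N. (\<forall>s\<ge>N. hc a s = 0) \<and> a = (\<Sum>s<N. hc a s)"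
  by (rule component_zero_ex[OF grading])
lemma hc_hom: "a \<in> comp A t \<Longrightarrow> hc a s = (if s = t then a else 0)" by (rule component_hom[OF grading])
lemma hc_add: "a \<in> CC \<Longrightarrow> b \<in> CC \<Longrightarrow> hc (a + b) t = hc a t + hc b t" by (rule component_add[OF grading])

lemma mult_comp0_left: "a \<in> comp A 0 \<Longrightarrow> b \<in> comp A t \<Longrightarrow> a \<cdot> b \<in> comp A t"
  and mult_comp0_right: "a \<in> comp A t \<Longrightarrow> b \<in> comp A 0 \<Longrightarrow> a \<cdot> b \<in> comp A t"
  using mult_comp[of a 0 b t] mult_comp[of a t b 0] by simp_all

lemma hc_mult_left:
  assumes "a \<in> comp A r" "b \<in> CC"
  shows "hc (a \<cdot> b) s = (if r \<le> s then a \<cdot> hc b (s - r) else 0)"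
proof -
  have a: "a \<in> CC" using assms comp_CC by blast
  obtain N where N: "\<forall>s\<ge>N. hc b s = 0" "b = (\<Sum>s<N. hc b s)" using hc_sum_ex assms by blast
  have "a \<cdot> b = (\<Sum>s<N. a \<cdot> hc b s)" using N mult_sum_right[of a "{..<N}" "hc b"] assms a by simp
  then have "hc (a \<cdot> b) s = (\<Sum>k\<in>{k \<in> {..<N}. r + k = s}. a \<cdot> hc b k)"
    using component_sum_hom[OF grading, of "{..<N}" "\<lambda>s. a \<cdot> hc b s" "\<lambda>s. r + s" s]
      mult_comp[OF assms(1) hc_comp[OF assms(2)]] by simp
  also have "\<dots> = (if r \<le> s then a \<cdot> hc b (s - r) else 0)"
  proof (cases "r \<le> s \<and> s - r < N")
    case True
    then have "{k \<in> {..<N}. r + k = s} = {s - r}" by auto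
    then show ?thesis using True by simp
  next
    case False
    then have e: "{k \<in> {..<N}. r + k = s} = {}" by auto
    show ?thesis unfolding e using False N a by auto
  qed
  finally show ?thesis .
qed

lemma hc_mult_right:
  assumes "a \<in> comp A r" "b \<in> CC"
  shows "hc (b \<cdot> a) s = (if r \<le> s then hc b (s - r) \<cdot> a else 0)"
proof -
  have a: "a \<in> CC" using assms comp_CC by blast
  obtain N where N: "\<forall>s\<ge>N. hc b s = 0" "b = (\<Sum>s<N. hc b s)" using hc_sum_ex assms by blast
  have "b \<cdot> a = (\<Sum>s<N. hc b s \<cdot> a)" using N mult_sum_left[of a "{..<N}" "hc b"] assms a by simp
  then have "hc (b \<cdot> a) s = (\<Sum>k\<in>{k \<in> {..<N}. k + r = s}. hc b k \<cdot> a)"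
    using component_sum_hom[OF grading, of "{..<N}" "\<lambda>s. hc b s \<cdot> a" "\<lambda>s. s + r" s]
      mult_comp[OF hc_comp[OF assms(2)] assms(1)] by simp
  also have "\<dots> = (if r \<le> s then hc b (s - r) \<cdot> a else 0)"
  proof (cases "r \<le> s \<and> s - r < N")
    case True
    then have "{k \<in> {..<N}. k + r = s} = {s - r}" by auto
    then show ?thesis using True by simp
  next
    case False
    then have e: "{k \<in> {..<N}. k + r = s} = {}" by auto
    show ?thesis unfolding e using False N a by auto
  qed
  finally show ?thesis .
qed

lemma hc_scale: "a \<in> CC \<Longrightarrow> hc (r *s a) s = r *s hc a s"
proof -
  assume a: "a \<in> CC"
  obtain N where N: "\<forall>s\<ge>N. hc a s = 0" "a = (\<Sum>s<N. hc a s)" using hc_sum_ex a by blast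
  have "r *s a = (\<Sum>s<N. r *s hc a s)" using N scale_sum[of "{..<N}" "hc a" r] a by simp
  then have "hc (r *s a) s = (\<Sum>k\<in>{k \<in> {..<N}. k = s}. r *s hc a k)"
    using component_sum_hom[OF grading, of "{..<N}" "\<lambda>s. r *s hc a s" "\<lambda>s. s" s] hc_comp[OF a] by simp
  also have "\<dots> = r *s hc a s"
  proof (cases "s < N")
    case True
    then have "{k \<in> {..<N}. k = s} = {s}" by auto
    then show ?thesis by simp
  next
    case False
    then have e: "{k \<in> {..<N}. k = s} = {}" by auto
    show ?thesis unfolding e using False N by auto
  qed
  finally show ?thesis .
qed

lemma hc_ee: "i \<in> VV \<Longrightarrow> a \<in> CC \<Longrightarrow> hc (ee i \<cdot> a) s = ee i \<cdot> hc a s"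
  "i \<in> VV \<Longrightarrow> a \<in> CC \<Longrightarrow> hc (a \<cdot> ee i) s = hc a s \<cdot> ee i"
  using hc_mult_left[OF idem_comp] hc_mult_right[OF idem_comp] by simp_all

lemma hc_all_zero: "a \<in> CC \<Longrightarrow> (\<And>s. hc a s = 0) \<Longrightarrow> a = 0"
  by (rule component_all_zero[OF grading])

lemma comp_independent:
  assumes "\<And>s. c s \<in> comp A s" "(\<Sum>s<N. c s) = 0" "s < N"
  shows "c s = 0"
  using grading assms unfolding grading_def by metis

lemma pcI: "a \<in> comp A t \<Longrightarrow> ee j \<cdot> a = a \<Longrightarrow> a \<cdot> ee i = a \<Longrightarrow> a \<in> pc j t i"
  by (simp add: pc_def)

lemma pcD: assumes "a \<in> pc j t i"
  shows "a \<in> comp A t" "ee j \<cdot> a = a" "a \<cdot> ee i = a" "a \<in> CC"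
  using assms comp_CC by (auto simp: pc_def)

lemma pc_proj: "a \<in> comp A t \<Longrightarrow> i \<in> VV \<Longrightarrow> j \<in> VV \<Longrightarrow> ee j \<cdot> a \<cdot> ee i \<in> pc j t i"
proof -
  assume a: "a \<in> comp A t" "i \<in> VV" "j \<in> VV"
  then have "a \<in> CC" using comp_CC by blast
  with a show ?thesis
    using mult_assoc[of "ee j" "ee j \<cdot> a" "ee i"] mult_assoc[of "ee j" "ee j" a]
      mult_comp0_right[OF mult_comp0_left[OF idem_comp[of j] a(1)] idem_comp[of i]]
    by (intro pcI) auto
qed

lemma peirce_eq: assumes "i \<in> VV" "j \<in> VV" shows "peirce A j t i = pc j t i"
proof (intro equalityI subsetI)
  fix x assume "x \<in> peirce A j t i"
  then show "x \<in> pc j t i" using pc_proj assms by (auto simp: peirce_def)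
next
  fix x assume x: "x \<in> pc j t i"
  then have "x = ee j \<cdot> x \<cdot> ee i" by (simp add: pc_def)
  then show "x \<in> peirce A j t i" using x unfolding peirce_def by (auto dest: pcD)
qed

lemma pc_simps[simp]: "0 \<in> pc j t i \<longleftrightarrow> ee j \<cdot> 0 = 0 \<and> 0 \<cdot> ee i = 0"
  by (auto simp: pc_def)

lemma pc_group: "i \<in> VV \<Longrightarrow> j \<in> VV \<Longrightarrow> add_subgroup (pc j t i)"
  unfolding add_subgroup_def by (auto simp: pc_def mult_diff_left mult_diff_right comp_CC)

lemma pc_scale: "i \<in> VV \<Longrightarrow> j \<in> VV \<Longrightarrow> a \<in> pc j t i \<Longrightarrow> r *s a \<in> pc j t i"
  by (auto simp: pc_def comp_CC scale_mult_left scale_mult_right)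

lemma pc_mult:
  assumes "a \<in> pc k s j" "b \<in> pc j t i" "i \<in> VV" "j \<in> VV" "k \<in> VV"
  shows "a \<cdot> b \<in> pc k (s + t) i"
  using pcD[OF assms(1)] pcD[OF assms(2)] assms(3-)
    mult_assoc[of "ee k" a b] mult_assoc[of a b "ee i"] by (intro pcI mult_comp) auto

lemma pc_vertex:
  assumes "a \<in> pc j t i" "a \<noteq> 0" "i \<in> VV" "j \<in> VV" "k \<in> VV"
  shows "ee k \<cdot> a = (if k = j then a else 0)" "a \<cdot> ee k = (if k = i then a else 0)"
proof -
  note a = pcD[OF assms(1)]
  show "ee k \<cdot> a = (if k = j then a else 0)"
    using a assms mult_assoc[of "ee k" "ee j" a] by (auto simp: idem_mult)
  show "a \<cdot> ee k = (if k = i then a else 0)"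
    using a assms mult_assoc[of a "ee i" "ee k"] by (auto simp: idem_mult)
qed

lemma pc0: "a \<in> pc j 0 i \<Longrightarrow> i \<in> VV \<Longrightarrow> j \<in> VV \<Longrightarrow> (\<exists>r. a = r *s ee i) \<and> (a \<noteq> 0 \<longrightarrow> i = j)"
proof -
  assume a: "a \<in> pc j 0 i" and ij: "i \<in> VV" "j \<in> VV"
  obtain r where r: "a = r *s ee i" using comp0_right[of a i] pcD[OF a] ij by auto
  have "a \<noteq> 0 \<longrightarrow> i = j"
  proof (rule impI, rule ccontr)
    assume "a \<noteq> 0" "i \<noteq> j"
    have "ee j \<cdot> a = 0" unfolding r using ij \<open>i \<noteq> j\<close> by (simp add: scale_mult_right idem_mult)
    then show False using pcD[OF a] \<open>a \<noteq> 0\<close> by simp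
  qed
  with r show ?thesis by blast
qed

text \<open>A local unit on each side splits a homogeneous element into its Peirce pieces, so
  additive statements need checking on \<open>pc\<close> only.\<close>

lemma carrier_induct[consumes 1, case_names zero add pc]:
  assumes a: "a \<in> CC" and P0: "P 0" and Padd: "\<And>x y. x \<in> CC \<Longrightarrow> y \<in> CC \<Longrightarrow> P x \<Longrightarrow> P y \<Longrightarrow> P (x + y)"
    and Ppc: "\<And>x j t i. i \<in> VV \<Longrightarrow> j \<in> VV \<Longrightarrow> x \<in> pc j t i \<Longrightarrow> P x"
  shows "P a"
proof -
  have Psum: "finite I \<Longrightarrow> (\<And>i. i \<in> I \<Longrightarrow> f i \<in> CC \<and> P (f i)) \<Longrightarrow> P (sum f I)" for I and f :: "'v \<Rightarrow> 'a"
    by (induction I rule: finite_induct) (auto simp: P0 intro!: Padd CC_sum)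
  show ?thesis using a
  proof (rule add_component_induct[OF grading])
    fix x s assume x: "x \<in> comp A s"
    then have xC: "x \<in> CC" using comp_CC by blast
    obtain J where J: "finite J" "J \<subseteq> VV" "uu J \<cdot> x = x" "x \<cdot> uu J = x"
      using common_unit[of "{x}"] xC by auto
    have "x = (\<Sum>j\<in>J. ee j \<cdot> x)" using unit_sum(1)[of J x] J xC by simp
    moreover have "P (ee j \<cdot> x)" if "j \<in> J" for j
    proof -
      have jV: "j \<in> VV" using J that by auto
      have "ee j \<cdot> x \<cdot> uu J = ee j \<cdot> x" using J xC jV by (simp add: mult_assoc)
      then have "ee j \<cdot> x = (\<Sum>i\<in>J. ee j \<cdot> x \<cdot> ee i)" using unit_sum(2)[of J "ee j \<cdot> x"] J xC jV by simp
      moreover have "P (\<Sum>i\<in>J. ee j \<cdot> x \<cdot> ee i)"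
      proof (rule Psum[OF J(1)])
        fix i assume "i \<in> J"
        then have iV: "i \<in> VV" using J by auto
        have "ee j \<cdot> x \<cdot> ee i \<in> pc j s i" by (rule pc_proj[OF x iV jV])
        then show "ee j \<cdot> x \<cdot> ee i \<in> CC \<and> P (ee j \<cdot> x \<cdot> ee i)"
          using Ppc[OF iV jV] pcD(4) by simp
      qed
      ultimately show ?thesis by simp
    qed
    ultimately show "P x" using Psum[OF J(1), of "\<lambda>j. ee j \<cdot> x"] J xC by (auto simp: subset_iff)
  qed (simp_all add: P0 Padd)
qed

end

lemma opposite_simps[simp]:
  "vertices (opposite A) = vertices A" "idem (opposite A) = idem A" "carrier (opposite A) = carrier A"
  "comp (opposite A) = comp A" "mult (opposite A) a b = mult A b a" "scale (opposite A) = scale A"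
  "opposite (opposite A) = A"
  by (simp_all add: opposite_def)

text \<open>The axioms come in left-right pairs and so pass to the opposite algebra; right-hand
  versions of later results are obtained by interpreting them there.\<close>

lemma (in graded_algebra) opposite_graded_algebra: "graded_algebra (opposite A)"
proof
  fix a assume "a \<in> carrier (opposite A)"
  then show "\<exists>J. finite J \<and> J \<subseteq> vertices (opposite A) \<and>
      mult (opposite A) (\<Sum>j\<in>J. idem (opposite A) j) a = a \<and> mult (opposite A) a (\<Sum>j\<in>J. idem (opposite A) j) = a"
    using unit_ex[of a] by auto
next
  fix a b s t assume "a \<in> comp (opposite A) s" "b \<in> comp (opposite A) t"
  then show "mult (opposite A) a b \<in> comp (opposite A) (s + t)"
    using mult_comp[of b t a s] by (simp add: add.commute)
qed (use gen_left gen_right in \<open>simp_all add: grading mult_closed mult_add_left mult_add_right mult_assoc scale_add_left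
    scale_add_right scale_scale scale_one scale_mult_left scale_mult_right idem_comp idem_mult idem_nonzero
    comp0_left comp0_right\<close>)

text \<open>The set \<open>E\<close> is a set of arrows, realised as elements of degree one.\<close>

locale presented_algebra = graded_algebra A
  for A :: "('k::field, 'v, 'a::ab_group_add) galgebra" +
  fixes E :: "'a set"
  assumes arrows_comp: "E \<subseteq> comp A 1"
    and arrows_peirce: "\<And>x. x \<in> E \<Longrightarrow> \<exists>i\<in>vertices A. \<exists>j\<in>vertices A. mult A (idem A j) x = x \<and> mult A x (idem A i) = x"
    and arrows_indep: "\<And>F c. finite F \<Longrightarrow> F \<subseteq> E \<Longrightarrow> (\<Sum>x\<in>F. scale A (c x) x) = 0 \<Longrightarrow> \<forall>x\<in>F. c x = 0"
    and arrows_span: "\<And>a. a \<in> comp A 1 \<Longrightarrow> \<exists>F c. finite F \<and> F \<subseteq> E \<and> a = (\<Sum>x\<in>F. scale A (c x) x)"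
    and arrows_finite: "\<And>i. i \<in> vertices A \<Longrightarrow> finite {x \<in> E. mult A x (idem A i) = x}"
      "\<And>i. i \<in> vertices A \<Longrightarrow> finite {x \<in> E. mult A (idem A i) x = x}"
    and vertices_nonempty: "vertices A \<noteq> {}"
    and arrows_connected: "\<And>i j. i \<in> vertices A \<Longrightarrow> j \<in> vertices A \<Longrightarrow>
      (i, j) \<in> (let R = {(i, j) | i j x. i \<in> vertices A \<and> j \<in> vertices A \<and> x \<in> E \<and>
         mult A (idem A j) x = x \<and> mult A x (idem A i) = x} in (R \<union> R\<inverse>)\<^sup>*)"

lemma (in presented_algebra) opposite_presented_algebra: "presented_algebra (opposite A) E"
proof -
  interpret op: graded_algebra "opposite A" by (rule opposite_graded_algebra)
  show ?thesis
  proof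
    fix i j assume "i \<in> vertices (opposite A)" "j \<in> vertices (opposite A)"
    then have ij: "i \<in> vertices A" "j \<in> vertices A" by simp_all
    let ?R = "{(i, j) | i j x. i \<in> vertices A \<and> j \<in> vertices A \<and> x \<in> E \<and>
         mult A (idem A j) x = x \<and> mult A x (idem A i) = x}"
    have R: "{(i, j) | i j x. i \<in> vertices A \<and> j \<in> vertices A \<and> x \<in> E \<and>
         mult A x (idem A j) = x \<and> mult A (idem A i) x = x} = ?R\<inverse>" by blast
    have "?R\<inverse> \<union> (?R\<inverse>)\<inverse> = ?R \<union> ?R\<inverse>" by blast
    with arrows_connected[OF ij] show "(i, j) \<in> (let R = {(i, j) | i j x. i \<in> vertices (opposite A) \<and> j \<in> vertices (opposite A) \<and> x \<in> E \<and>
         mult (opposite A) (idem (opposite A) j) x = x \<and> mult (opposite A) x (idem (opposite A) i) = x} in (R \<union> R\<inverse>)\<^sup>*)"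
      unfolding opposite_simps R Let_def by simp
  qed (use arrows_comp arrows_peirce arrows_indep arrows_span arrows_finite vertices_nonempty in auto)
qed

section \<open>Quotients of path algebras\<close>

lemma pend_simps[simp]: "pend Q (i, []) = i" "pend Q (i, a # as) = tgt Q a"
  by (simp_all add: pend_def)

lemma pend_append: "pend Q (i, as @ bs) = pend Q (pend Q (i, bs), as)"
  by (cases as) simp_all

lemma lookup_smap[simp]: "Poly_Mapping.lookup (Poly_Mapping.map ((*) c) x) w = c * Poly_Mapping.lookup x w"
  for c :: "'k::field"
  by transfer (simp add: when_def)

lemma poly_mapping_sum_singles:
  "finite S \<Longrightarrow> Poly_Mapping.keys x \<subseteq> S \<Longrightarrow> x = (\<Sum>w\<in>S. Poly_Mapping.single w (Poly_Mapping.lookup x w))"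
  by (rule poly_mapping_eqI)
    (auto simp: lookup_sum lookup_single when_def sum.delta in_keys_iff cong: sum.cong)

locale wf_quiver =
  fixes Q :: "('v, 'e, 'k::field) bound_quiver"
  assumes src_verts: "\<And>a. a \<in> arrows Q \<Longrightarrow> src Q a \<in> verts Q"
    and tgt_verts: "\<And>a. a \<in> arrows Q \<Longrightarrow> tgt Q a \<in> verts Q"
begin

abbreviation PA where "PA \<equiv> path_algebra Q"
abbreviation pm where "pm \<equiv> path_mult Q"
abbreviation sg where "sg \<equiv> Poly_Mapping.single"
abbreviation lk where "lk \<equiv> Poly_Mapping.lookup"
abbreviation ks where "ks \<equiv> Poly_Mapping.keys"
abbreviation hom where "hom t x \<equiv> \<forall>w\<in>ks x. plen w = t"

lemma path_list_verts: "is_path_list Q i as \<Longrightarrow> i \<in> verts Q \<and> pend Q (i, as) \<in> verts Q"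
  by (induction as) (auto simp: tgt_verts)

lemma path_list_append:
  "is_path_list Q i (as @ bs) \<longleftrightarrow> is_path_list Q i bs \<and> is_path_list Q (pend Q (i, bs)) as"
  by (induction as) (auto simp: pend_append dest: path_list_verts)

lemma path_verts: "w \<in> paths Q \<Longrightarrow> fst w \<in> verts Q" "w \<in> paths Q \<Longrightarrow> pend Q w \<in> verts Q"
  using path_list_verts[of "fst w" "snd w"] by (auto simp: paths_def)

lemma path_concat:
  assumes "w \<in> paths Q" "v \<in> paths Q" "fst w = pend Q v"
  shows "(fst v, snd w @ snd v) \<in> paths Q" "pend Q (fst v, snd w @ snd v) = pend Q w"
  using assms by (cases w; cases v; auto simp: paths_def path_list_append pend_append)+

lemma trivial_path: "i \<in> verts Q \<Longrightarrow> (i, []) \<in> paths Q"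
  by (simp add: paths_def)

lemma arrow_path: "a \<in> arrows Q \<Longrightarrow> (src Q a, [a]) \<in> paths Q"
  by (simp add: paths_def src_verts)

lemma PA_iff: "x \<in> PA \<longleftrightarrow> (\<forall>w. lk x w \<noteq> 0 \<longrightarrow> w \<in> paths Q)"
  by (auto simp: path_algebra_def in_keys_iff)

lemma PA_simps[simp]: "0 \<in> PA" "x \<in> PA \<Longrightarrow> y \<in> PA \<Longrightarrow> x + y \<in> PA" "x \<in> PA \<Longrightarrow> y \<in> PA \<Longrightarrow> x - y \<in> PA"
  "w \<in> paths Q \<Longrightarrow> sg w c \<in> PA" "x \<in> PA \<Longrightarrow> Poly_Mapping.map ((*) c) x \<in> PA"
proof -
  have nz: "\<not> (lk x w = 0 \<and> lk y w = 0)" if "lk x w + lk y w \<noteq> 0 \<or> lk x w - lk y w \<noteq> 0" for w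
    using that by auto
  show "x \<in> PA \<Longrightarrow> y \<in> PA \<Longrightarrow> x + y \<in> PA" "x \<in> PA \<Longrightarrow> y \<in> PA \<Longrightarrow> x - y \<in> PA"
    unfolding PA_iff lookup_add lookup_minus using nz by blast+
qed (auto simp: PA_iff lookup_single when_def)

lemma PA_group: "add_subgroup PA"
  by (simp add: add_subgroup_def)

lemma PA_sum: "(\<And>i. i \<in> I \<Longrightarrow> f i \<in> PA) \<Longrightarrow> sum f I \<in> PA"
  by (rule add_subgroup_sum[OF PA_group])

text \<open>Sums over common finite supersets of the supports turn bilinearity of the product into
  distributivity of sums.\<close>

lemma pm_supset:
  assumes "finite S" "ks x \<subseteq> S" "finite T" "ks y \<subseteq> T"
  shows "pm x y = (\<Sum>w\<in>S. \<Sum>v\<in>T. if fst w = pend Q v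
      then sg (fst v, snd w @ snd v) (lk x w * lk y v) else 0)"
proof -
  have "pm x y = (\<Sum>w\<in>ks x. \<Sum>v\<in>T. if fst w = pend Q v
      then sg (fst v, snd w @ snd v) (lk x w * lk y v) else 0)"
    unfolding path_mult_def
    by (intro sum.cong refl sum.mono_neutral_left) (use assms in \<open>auto simp: in_keys_iff\<close>)
  also have "\<dots> = (\<Sum>w\<in>S. \<Sum>v\<in>T. if fst w = pend Q v
      then sg (fst v, snd w @ snd v) (lk x w * lk y v) else 0)"
    by (intro sum.mono_neutral_left) (use assms in \<open>auto simp: in_keys_iff cong: if_cong\<close>)
  finally show ?thesis .
qed

lemma pm_add_left: "pm (x + y) z = pm x z + pm y z"
proof -
  let ?S = "ks x \<union> ks y"
  have "ks (x + y) \<subseteq> ?S" by (rule keys_add)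
  then show ?thesis
    unfolding pm_supset[of ?S "x + y" "ks z" z, OF _ _ _ order_refl, simplified]
      pm_supset[of ?S x "ks z" z, simplified] pm_supset[of ?S y "ks z" z, simplified]
    by (auto simp: pm_supset[of ?S "x + y" "ks z" z] sum.distrib[symmetric] lookup_add distrib_right
      single_add intro!: sum.cong)
qed

lemma pm_add_right: "pm z (x + y) = pm z x + pm z y"
proof -
  let ?S = "ks x \<union> ks y"
  have "ks (x + y) \<subseteq> ?S" by (rule keys_add)
  then show ?thesis
    unfolding pm_supset[of "ks z" z ?S x, simplified] pm_supset[of "ks z" z ?S y, simplified]
    by (auto simp: pm_supset[of "ks z" z ?S "x + y"] sum.distrib[symmetric] lookup_add distrib_left
      single_add intro!: sum.cong)
qed

lemma pm_zero[simp]: "pm 0 x = 0" "pm x 0 = 0"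
  by (simp_all add: path_mult_def)

lemma pm_sum_left: "pm (sum f I) x = (\<Sum>i\<in>I. pm (f i) x)"
  by (induction I rule: infinite_finite_induct) (simp_all add: pm_add_left)

lemma pm_sum_right: "pm x (sum f I) = (\<Sum>i\<in>I. pm x (f i))"
  by (induction I rule: infinite_finite_induct) (simp_all add: pm_add_right)

lemma pm_single: "pm (sg w c) (sg v d) = (if fst w = pend Q v then sg (fst v, snd w @ snd v) (c * d) else 0)"
  by (subst pm_supset[of "{w}" _ "{v}"]) auto

lemma PA_induct[consumes 1, case_names zero single add]:
  assumes x: "x \<in> PA" and "P 0" "\<And>w c. w \<in> paths Q \<Longrightarrow> P (sg w c)"
    "\<And>x y. x \<in> PA \<Longrightarrow> y \<in> PA \<Longrightarrow> P x \<Longrightarrow> P y \<Longrightarrow> P (x + y)"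
  shows "P x"
proof -
  have "finite S \<Longrightarrow> S \<subseteq> paths Q \<Longrightarrow> P (\<Sum>w\<in>S. sg w (lk x w))" for S
  proof (induction S rule: finite_induct)
    case (insert w S)
    then have "(\<Sum>w\<in>S. sg w (lk x w)) \<in> PA" by (intro PA_sum) auto
    with insert show ?case using assms(3,4) by simp
  qed (simp add: assms(2))
  from this[of "ks x"] show ?thesis
    using x poly_mapping_sum_singles[of "ks x" x] by (simp add: path_algebra_def)
qed

lemma pm_closed[simp]: "x \<in> PA \<Longrightarrow> y \<in> PA \<Longrightarrow> pm x y \<in> PA"
proof (induction x rule: PA_induct)
  case (single w c)
  from single(2) show ?case
    by (induction y rule: PA_induct) (use single in \<open>auto simp: pm_single pm_add_right path_concat\<close>)
qed (simp_all add: pm_add_left)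

lemma pm_assoc: "x \<in> PA \<Longrightarrow> y \<in> PA \<Longrightarrow> z \<in> PA \<Longrightarrow> pm (pm x y) z = pm x (pm y z)"
proof (induction x rule: PA_induct)
  case (single w c)
  from single(2) show ?case
  proof (induction y rule: PA_induct)
    case (single v d)
    from \<open>z \<in> PA\<close> show ?case
    proof (induction z rule: PA_induct)
      case (single u e)
      then show ?case using \<open>w \<in> paths Q\<close> \<open>v \<in> paths Q\<close>
        by (auto simp: pm_single path_concat pend_append mult.assoc)
          (cases v; cases u; simp add: pend_append)+
    qed (simp_all add: pm_add_right)
  qed (simp_all add: pm_add_left pm_add_right)
qed (simp_all add: pm_add_left)

lemma smap_add: "Poly_Mapping.map ((*) c) (x + y) = Poly_Mapping.map ((*) c) x + Poly_Mapping.map ((*) (c::'k)) y"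
  by (rule poly_mapping_eqI) (simp add: lookup_add distrib_left)

lemma smap_add_left: "Poly_Mapping.map ((*) (c + d)) x = Poly_Mapping.map ((*) c) x + Poly_Mapping.map ((*) (d::'k)) x"
  by (rule poly_mapping_eqI) (simp add: lookup_add distrib_right)

lemma smap_single[simp]: "Poly_Mapping.map ((*) c) (sg w d) = sg w (c * d)" for c d :: 'k
  by (rule poly_mapping_eqI) (simp add: lookup_single when_def)

lemma smap_zero[simp]: "Poly_Mapping.map ((*) c) 0 = (0 :: _ \<Rightarrow>\<^sub>0 'k)"
  by (rule poly_mapping_eqI) simp

lemma pm_smap_left: "x \<in> PA \<Longrightarrow> y \<in> PA \<Longrightarrow> pm (Poly_Mapping.map ((*) c) x) y = Poly_Mapping.map ((*) c) (pm x y)"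
proof (induction x rule: PA_induct)
  case (single w d)
  from single(2) show ?case
    by (induction y rule: PA_induct) (simp_all add: pm_single pm_add_right smap_add mult.assoc)
qed (simp_all add: pm_add_left smap_add)

lemma pm_smap_right: "x \<in> PA \<Longrightarrow> y \<in> PA \<Longrightarrow> pm x (Poly_Mapping.map ((*) c) y) = Poly_Mapping.map ((*) c) (pm x y)"
proof (induction x rule: PA_induct)
  case (single w d)
  from single(2) show ?case
    by (induction y rule: PA_induct) (simp_all add: pm_single pm_add_right smap_add mult.left_commute)
qed (simp_all add: pm_add_left smap_add)

definition hpart :: "nat \<Rightarrow> (('v, 'e) qpath \<Rightarrow>\<^sub>0 'k) \<Rightarrow> (('v, 'e) qpath \<Rightarrow>\<^sub>0 'k)"
  where "hpart t x = (\<Sum>w\<in>{w \<in> ks x. plen w = t}. sg w (lk x w))"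

lemma lookup_hpart: "lk (hpart t x) w = (if plen w = t then lk x w else 0)"
  by (auto simp: hpart_def lookup_sum lookup_single when_def sum.delta in_keys_iff cong: sum.cong)

lemma hpart_PA[simp]: "x \<in> PA \<Longrightarrow> hpart t x \<in> PA"
  by (auto simp: PA_iff lookup_hpart)

lemma hpart_hom: "hom t (hpart t x)"
  by (auto simp: in_keys_iff lookup_hpart split: if_splits)

lemma hpart_add: "hpart t (x + y) = hpart t x + hpart t y"
  by (rule poly_mapping_eqI) (simp add: lookup_hpart lookup_add)

lemma hpart_zero[simp]: "hpart t 0 = 0"
  by (rule poly_mapping_eqI) (simp add: lookup_hpart)

lemma hpart_of_hom: "hom s x \<Longrightarrow> hpart t x = (if t = s then x else 0)"
  by (rule poly_mapping_eqI) (auto simp: lookup_hpart in_keys_iff)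

lemma hpart_sum: "hpart t (sum f I) = (\<Sum>i\<in>I. hpart t (f i))"
  by (induction I rule: infinite_finite_induct) (simp_all add: hpart_add)

lemma sum_hpart: "\<exists>N. x = (\<Sum>t<N. hpart t x)"
proof
  define N where "N = Suc (Max (insert 0 (plen ` ks x)))"
  show "x = (\<Sum>t<N. hpart t x)"
  proof (rule poly_mapping_eqI)
    fix w
    have "lk x w \<noteq> 0 \<Longrightarrow> plen w < N"
      unfolding N_def less_Suc_eq_le by (rule Max_ge) (auto simp: in_keys_iff)
    then show "lk x w = lk (\<Sum>t<N. hpart t x) w"
      by (auto simp: lookup_sum lookup_hpart sum.delta cong: sum.cong)
  qed
qed

lemma hpart_single: "hpart t (sg w c) = (if plen w = t then sg w c else 0)"
  by (rule poly_mapping_eqI) (auto simp: lookup_hpart lookup_single when_def)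

lemma hpart_pm_left: "x \<in> PA \<Longrightarrow> hpart t (pm (sg w c) x) = (if plen w \<le> t then pm (sg w c) (hpart (t - plen w) x) else 0)"
  by (induction x rule: PA_induct) (auto simp: hpart_add pm_add_right hpart_single pm_single)

lemma hpart_pm_right: "x \<in> PA \<Longrightarrow> hpart t (pm x (sg w c)) = (if plen w \<le> t then pm (hpart (t - plen w) x) (sg w c) else 0)"
  by (induction x rule: PA_induct) (auto simp: hpart_add pm_add_left hpart_single pm_single)

lemma hom_pm: "hom s x \<Longrightarrow> hom t y \<Longrightarrow> hom (s + t) (pm x y)"
proof -
  assume h: "hom s x" "hom t y"
  have "ks (pm x y) \<subseteq> (\<Union>w\<in>ks x. \<Union>v\<in>ks y. {(fst v, snd w @ snd v)})"
    unfolding path_mult_def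
    by (rule order_trans[OF keys_sum], rule UN_mono[OF order_refl], rule order_trans[OF keys_sum], rule UN_mono[OF order_refl]) auto
  then show ?thesis using h by fastforce
qed

lemma hom_diff: "hom t x \<Longrightarrow> hom t y \<Longrightarrow> hom t (x - y)"
  using keys_diff[of x y] by blast

lemma hom_smap: "hom t x \<Longrightarrow> hom t (Poly_Mapping.map ((*) (c::'k)) x)"
  by (auto simp: in_keys_iff)

lemma hom_sum: "(\<And>i. i \<in> I \<Longrightarrow> hom t (f i)) \<Longrightarrow> hom t (sum f I)"
  using keys_sum[of f I] by blast

lemma vertex_left: "x \<in> PA \<Longrightarrow> finite J \<Longrightarrow> pend Q ` ks x \<subseteq> J \<Longrightarrow> pm (\<Sum>j\<in>J. sg (j, []) 1) x = x"
proof -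
  assume x: "x \<in> PA" "finite J" "pend Q ` ks x \<subseteq> J"
  have 1: "pm (\<Sum>j\<in>J. sg (j, []) 1) (sg w c) = sg w c" if "pend Q w \<in> J" for w c
    using that x(2) by (simp add: pm_sum_left pm_single sum.delta cong: if_cong)
  have "pm (\<Sum>j\<in>J. sg (j, []) 1) (\<Sum>w\<in>ks x. sg w (lk x w)) = (\<Sum>w\<in>ks x. sg w (lk x w))"
    unfolding pm_sum_right by (intro sum.cong refl 1) (use x in auto)
  then show ?thesis using poly_mapping_sum_singles[of "ks x" x] by simp
qed

lemma vertex_right: "x \<in> PA \<Longrightarrow> finite J \<Longrightarrow> fst ` ks x \<subseteq> J \<Longrightarrow> pm x (\<Sum>j\<in>J. sg (j, []) 1) = x"
proof -
  assume x: "x \<in> PA" "finite J" "fst ` ks x \<subseteq> J"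
  have 1: "pm (sg w c) (\<Sum>j\<in>J. sg (j, []) 1) = sg w c" if "fst w \<in> J" for w c
    using that x(2) by (cases w) (simp add: pm_sum_right pm_single sum.delta eq_commute[of "fst w"] cong: if_cong)
  have "pm (\<Sum>w\<in>ks x. sg w (lk x w)) (\<Sum>j\<in>J. sg (j, []) 1) = (\<Sum>w\<in>ks x. sg w (lk x w))"
    unfolding pm_sum_left by (intro sum.cong refl 1) (use x in auto)
  then show ?thesis using poly_mapping_sum_singles[of "ks x" x] by simp
qed

lemma length_zero_right: "x \<in> PA \<Longrightarrow> hom 0 x \<Longrightarrow> pm x (sg (i, []) 1) = sg (i, []) (lk x (i, []))"
  and length_zero_left: "x \<in> PA \<Longrightarrow> hom 0 x \<Longrightarrow> pm (sg (i, []) 1) x = sg (i, []) (lk x (i, []))"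
proof -
  assume x: "x \<in> PA" "hom 0 x"
  have 1: "pm (sg w c) (sg (i, []) 1) = (if w = (i, []) then sg (i, []) c else 0)"
    and 2: "pm (sg (i, []) 1) (sg w c) = (if w = (i, []) then sg (i, []) c else 0)" if "plen w = 0" for w c
    using that by (cases w; auto simp: pm_single)+
  have "pm (\<Sum>w\<in>ks x. sg w (lk x w)) (sg (i, []) 1) = (\<Sum>w\<in>ks x. if w = (i, []) then sg (i, []) (lk x w) else 0)"
    unfolding pm_sum_left by (intro sum.cong refl 1) (use x in auto)
  then show "pm x (sg (i, []) 1) = sg (i, []) (lk x (i, []))"
    using poly_mapping_sum_singles[of "ks x" x] by (auto simp: sum.delta in_keys_iff)
  have "pm (sg (i, []) 1) (\<Sum>w\<in>ks x. sg w (lk x w)) = (\<Sum>w\<in>ks x. if w = (i, []) then sg (i, []) (lk x w) else 0)"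
    unfolding pm_sum_right by (intro sum.cong refl 2) (use x in auto)
  then show "pm (sg (i, []) 1) x = sg (i, []) (lk x (i, []))"
    using poly_mapping_sum_singles[of "ks x" x] by (auto simp: sum.delta in_keys_iff)
qed

end

locale quiver_presentation = 
  fixes Q :: "('v, 'e, 'k::field) bound_quiver" and A :: "('k, 'v, 'a::ab_group_add) galgebra" and \<pi>
  assumes bound: "bound_quiver Q"
    and verts_eq: "verts Q = vertices A"
    and pi_add: "\<And>x y. x \<in> path_algebra Q \<Longrightarrow> y \<in> path_algebra Q \<Longrightarrow> \<pi> (x + y) = \<pi> x + \<pi> y"
    and pi_mult: "\<And>x y. x \<in> path_algebra Q \<Longrightarrow> y \<in> path_algebra Q \<Longrightarrow> \<pi> (path_mult Q x y) = mult A (\<pi> x) (\<pi> y)"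
    and pi_scale: "\<And>c x. x \<in> path_algebra Q \<Longrightarrow> \<pi> (Poly_Mapping.map ((*) c) x) = scale A c (\<pi> x)"
    and pi_idem: "\<And>i. i \<in> verts Q \<Longrightarrow> \<pi> (path_elem (i, [])) = idem A i"
    and carrier_eq: "carrier A = \<pi> ` path_algebra Q"
    and comp_eq: "\<And>t. comp A t = \<pi> ` {x \<in> path_algebra Q. \<forall>w\<in>Poly_Mapping.keys x. plen w = t}"
    and kernel: "\<And>x. x \<in> path_algebra Q \<Longrightarrow> \<pi> x = 0 \<longleftrightarrow> x \<in> rel_ideal Q"

lemma quiver_algebraD:
  assumes "bound_quiver Q" "quiver_algebra Q A"
  obtains \<pi> where "quiver_presentation Q A \<pi>"
proof -
  obtain \<pi> where \<pi>: "(\<forall>x\<in>path_algebra Q. \<forall>y\<in>path_algebra Q.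
            \<pi> (x + y) = \<pi> x + \<pi> y \<and> \<pi> (path_mult Q x y) = mult A (\<pi> x) (\<pi> y)) \<and>
         (\<forall>c. \<forall>x\<in>path_algebra Q. \<pi> (Poly_Mapping.map ((*) c) x) = scale A c (\<pi> x)) \<and>
         (\<forall>i\<in>verts Q. \<pi> (path_elem (i, [])) = idem A i) \<and>
         carrier A = \<pi> ` path_algebra Q \<and>
         (\<forall>t. comp A t =
            \<pi> ` {x \<in> path_algebra Q. \<forall>w\<in>Poly_Mapping.keys x. plen w = t}) \<and>
         (\<forall>x\<in>path_algebra Q. \<pi> x = 0 \<longleftrightarrow> x \<in> rel_ideal Q)" and v: "verts Q = vertices A"
    using assms(2) unfolding quiver_algebra_def by (elim conjE exE) (rule that; (intro conjI)?; assumption)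
  have "quiver_presentation Q A \<pi>"
    by unfold_locales (use \<pi> v assms(1) in \<open>simp_all\<close>)
  then show ?thesis by (rule that)
qed

sublocale quiver_presentation \<subseteq> wf_quiver
  by unfold_locales (use bound in \<open>auto simp: bound_quiver_def\<close>)

context quiver_presentation
begin

lemma rel_ideal_PA: "x \<in> rel_ideal Q \<Longrightarrow> x \<in> PA"
  by (induction rule: rel_ideal.induct) (use bound in \<open>auto simp: bound_quiver_def\<close>)

text \<open>Products only lengthen paths, and the relations have length at least 2. Hence no nonzero
  combination of trivial paths and arrows dies in the quotient.\<close>

lemma rel_ideal_length: "x \<in> rel_ideal Q \<Longrightarrow> w \<in> ks x \<Longrightarrow> plen w \<ge> 2"
proof (induction arbitrary: w rule: rel_ideal.induct)
  case (rel r)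
  then obtain m where "m \<ge> 2" "hom m r" using bound unfolding bound_quiver_def by meson
  then show ?case using rel(2) by auto
next
  case (add x y)
  then show ?case using keys_add[of x y] by blast
next
  case (left x z)
  have "ks (pm z x) \<subseteq> (\<Union>w\<in>ks z. \<Union>v\<in>ks x. {(fst v, snd w @ snd v)})"
    unfolding path_mult_def
    by (rule order_trans[OF keys_sum], rule UN_mono[OF order_refl], rule order_trans[OF keys_sum], rule UN_mono[OF order_refl]) auto
  then show ?case using left by fastforce
next
  case (right x z)
  have "ks (pm x z) \<subseteq> (\<Union>w\<in>ks x. \<Union>v\<in>ks z. {(fst v, snd w @ snd v)})"
    unfolding path_mult_def
    by (rule order_trans[OF keys_sum], rule UN_mono[OF order_refl], rule order_trans[OF keys_sum], rule UN_mono[OF order_refl]) auto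
  then show ?case using right by fastforce
qed simp

lemma rel_ideal_sum: "(\<And>i. i \<in> I \<Longrightarrow> f i \<in> rel_ideal Q) \<Longrightarrow> sum f I \<in> rel_ideal Q"
  by (induction I rule: infinite_finite_induct) (auto intro: rel_ideal.intros)

text \<open>The relations are homogeneous, and multiplication by a single path shifts homogeneous
  parts. This is what lets path length descend to a grading of the quotient.\<close>

lemma rel_ideal_hpart: "x \<in> rel_ideal Q \<Longrightarrow> hpart t x \<in> rel_ideal Q"
proof (induction arbitrary: t rule: rel_ideal.induct)
  case zero then show ?case by (simp add: rel_ideal.zero)
next
  case (rel r)
  then obtain m where "hom m r" using bound unfolding bound_quiver_def by blast
  then show ?case using hpart_of_hom[of r m t] rel rel_ideal.intros by auto
next
  case (add x y) then show ?case by (simp add: hpart_add rel_ideal.add)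
next
  case (left x z)
  have "hpart t (pm (sg w c) x) \<in> rel_ideal Q" if "w \<in> paths Q" for w c
    using left that rel_ideal_PA[OF left(1)] by (auto simp: hpart_pm_left intro: rel_ideal.intros)
  then have "hpart t (pm (\<Sum>w\<in>ks z. sg w (lk z w)) x) \<in> rel_ideal Q"
    unfolding pm_sum_left hpart_sum using left(2) by (intro rel_ideal_sum) (auto simp: path_algebra_def)
  then show ?case using poly_mapping_sum_singles[of "ks z" z] by simp
next
  case (right x z)
  have "hpart t (pm x (sg w c)) \<in> rel_ideal Q" if "w \<in> paths Q" for w c
    using right that rel_ideal_PA[OF right(1)] by (auto simp: hpart_pm_right intro: rel_ideal.intros)
  then have "hpart t (pm x (\<Sum>w\<in>ks z. sg w (lk z w))) \<in> rel_ideal Q"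
    unfolding pm_sum_right hpart_sum using right(2) by (intro rel_ideal_sum) (auto simp: path_algebra_def)
  then show ?case using poly_mapping_sum_singles[of "ks z" z] by simp
qed

lemma pi_sum: "(\<And>i. i \<in> I \<Longrightarrow> f i \<in> PA) \<Longrightarrow> \<pi> (sum f I) = (\<Sum>i\<in>I. \<pi> (f i))"
  using additive_on_sum[OF PA_group, of \<pi> I f] pi_add by blast

lemma pi_zero[simp]: "\<pi> 0 = 0"
  using pi_add[of 0 0] by simp

lemma pi_diff: "x \<in> PA \<Longrightarrow> y \<in> PA \<Longrightarrow> \<pi> (x - y) = \<pi> x - \<pi> y"
  using additive_on_diff[OF PA_group, of \<pi> x y] pi_add by blast

lemma pi_single_scale: "w \<in> paths Q \<Longrightarrow> \<pi> (sg w c) = scale A c (\<pi> (sg w 1))"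
  using pi_scale[of "sg w 1" c] by simp

lemma comp_obtain: assumes "a \<in> comp A t" obtains x where "x \<in> PA" "hom t x" "a = \<pi> x"
  using assms comp_eq[of t] by blast

lemma comp_I: "x \<in> PA \<Longrightarrow> hom t x \<Longrightarrow> \<pi> x \<in> comp A t"
  using comp_eq[of t] by blast

lemma carrier_obtain: assumes "a \<in> carrier A" obtains x where "x \<in> PA" "a = \<pi> x"
  using assms carrier_eq by blast

lemma carrier_I: "x \<in> PA \<Longrightarrow> \<pi> x \<in> carrier A"
  using carrier_eq by blast

lemma pi_grading: "Submission.grading (carrier A) (comp A)"
  unfolding grading_def
proof (intro conjI allI ballI impI)
  show "add_subgroup (carrier A)"
    unfolding add_subgroup_def
  proof (intro conjI ballI)
    show "0 \<in> carrier A" using carrier_I[of 0] by simp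
    fix a b assume "a \<in> carrier A" "b \<in> carrier A"
    then obtain x y where "x \<in> PA" "a = \<pi> x" "y \<in> PA" "b = \<pi> y" using carrier_obtain by metis
    then show "a - b \<in> carrier A" using carrier_I[of "x - y"] by (simp add: pi_diff)
  qed
  fix s
  show "add_subgroup (comp A s)"
    unfolding add_subgroup_def
  proof (intro conjI ballI)
    show "0 \<in> comp A s" using comp_I[of 0] by simp
    fix a b assume "a \<in> comp A s" "b \<in> comp A s"
    then obtain x y where "x \<in> PA" "hom s x" "a = \<pi> x" "y \<in> PA" "hom s y" "b = \<pi> y"
      using comp_obtain by metis
    then show "a - b \<in> comp A s" using comp_I[of "x - y" s] hom_diff[of x s y] by (simp add: pi_diff)
  qed
  show "comp A s \<subseteq> carrier A" using comp_eq carrier_eq by auto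
next
  fix a assume "a \<in> carrier A"
  then obtain x where x: "x \<in> PA" "a = \<pi> x" using carrier_obtain by metis
  obtain N where N: "x = (\<Sum>t<N. hpart t x)" using sum_hpart by blast
  have "a = (\<Sum>s<N. \<pi> (hpart s x))"
    using x N pi_sum[of "{..<N}" "\<lambda>s. hpart s x"] by simp
  moreover have "\<forall>s. \<pi> (hpart s x) \<in> comp A s" using x hpart_hom comp_I by simp
  ultimately show "\<exists>c N. (\<forall>s. c s \<in> comp A s) \<and> a = (\<Sum>s<N. c s)"
    by (intro exI[of _ "\<lambda>s. \<pi> (hpart s x)"] exI[of _ N]) simp
next
  fix c N s assume c: "(\<forall>s. c s \<in> comp A s) \<and> (\<Sum>s<(N::nat). c s) = 0" and s: "s < N"
  then have "\<forall>s. \<exists>x. x \<in> PA \<and> hom s x \<and> c s = \<pi> x" using comp_obtain by metis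
  then obtain x where x: "\<And>s. x s \<in> PA" "\<And>s. hom s (x s)" "\<And>s. c s = \<pi> (x s)" by metis
  have "\<pi> (\<Sum>s<N. x s) = 0" using x c by (subst pi_sum) auto
  then have "(\<Sum>s<N. x s) \<in> rel_ideal Q" using kernel[OF PA_sum[of "{..<N}" x, OF x(1)]] by simp
  \<comment> \<open>The part of degree s of the lifted sum is the lift \<open>x s\<close>, and
    homogeneity of the ideal puts it into the kernel.\<close>
  then have "hpart s (\<Sum>s<N. x s) \<in> rel_ideal Q" by (rule rel_ideal_hpart)
  moreover have "hpart s (\<Sum>s<N. x s) = x s"
  proof -
    have "hpart s (\<Sum>s<N. x s) = (\<Sum>r<N. if s = r then x r else 0)"
      unfolding hpart_sum by (intro sum.cong refl hpart_of_hom x)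
    then show ?thesis using s by simp
  qed
  ultimately show "c s = 0" using kernel x by simp
qed

lemma pi_vertices: "finite J \<Longrightarrow> J \<subseteq> vertices A \<Longrightarrow> \<pi> (\<Sum>j\<in>J. sg (j, []) 1) = (\<Sum>j\<in>J. idem A j)"
  by (subst pi_sum) (auto simp: pi_idem verts_eq[symmetric] trivial_path subset_iff intro!: sum.cong)

sublocale graded_algebra A
proof
  show "Submission.grading (carrier A) (comp A)" by (rule pi_grading)
  fix a b c r s
  show "mult A a b \<in> carrier A" if "a \<in> carrier A" "b \<in> carrier A" for a b
    using that by (elim carrier_obtain) (simp flip: pi_mult add: carrier_I)
  show "mult A (a + b) c = mult A a c + mult A b c" if "a \<in> carrier A" "b \<in> carrier A" "c \<in> carrier A" for a b c
    using that by (elim carrier_obtain) (simp flip: pi_mult pi_add add: pm_add_left)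
  show "mult A a (b + c) = mult A a b + mult A a c" if "a \<in> carrier A" "b \<in> carrier A" "c \<in> carrier A" for a b c
    using that by (elim carrier_obtain) (simp flip: pi_mult pi_add add: pm_add_right)
  show "mult A (mult A a b) c = mult A a (mult A b c)" if "a \<in> carrier A" "b \<in> carrier A" "c \<in> carrier A" for a b c
    using that by (elim carrier_obtain) (simp flip: pi_mult add: pm_assoc)
  show "scale A r a \<in> carrier A" if "a \<in> carrier A" for a r
    using that by (elim carrier_obtain) (simp flip: pi_scale add: carrier_I)
  show "scale A r (a + b) = scale A r a + scale A r b" if "a \<in> carrier A" "b \<in> carrier A" for a b r
    using that by (elim carrier_obtain) (simp flip: pi_scale pi_add add: smap_add)
  show "scale A (r + s) a = scale A r a + scale A s a" if "a \<in> carrier A" for a r s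
    using that by (elim carrier_obtain) (simp flip: pi_scale pi_add add: smap_add_left)
  have ss: "Poly_Mapping.map ((*) r) (Poly_Mapping.map ((*) s) x) = Poly_Mapping.map ((*) (r * s)) x"
     "Poly_Mapping.map ((*) 1) x = x" for r s :: 'k and x :: "('v,'e) qpath \<Rightarrow>\<^sub>0 'k"
    by (rule poly_mapping_eqI; simp add: mult.assoc)+
  show "scale A r (scale A s a) = scale A (r * s) a" if "a \<in> carrier A" for a r s
    using that by (elim carrier_obtain) (simp flip: pi_scale add: ss)
  show "scale A 1 a = a" if "a \<in> carrier A" for a
    using that by (elim carrier_obtain) (simp flip: pi_scale add: ss)
  show "mult A (scale A r a) b = scale A r (mult A a b)" if "a \<in> carrier A" "b \<in> carrier A" for a b r
    using that by (elim carrier_obtain) (simp flip: pi_scale pi_mult add: pm_smap_left)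
  show "mult A a (scale A r b) = scale A r (mult A a b)" if "a \<in> carrier A" "b \<in> carrier A" for a b r
    using that by (elim carrier_obtain) (simp flip: pi_scale pi_mult add: pm_smap_right)
  show "scale A r a \<in> comp A t" if "a \<in> comp A t" for a r t
  proof -
    note a = that
    obtain x where x: "x \<in> PA" "hom t x" "a = \<pi> x" using a by (rule comp_obtain)
    show ?thesis using comp_I[OF PA_simps(5)[OF x(1), of r] hom_smap[OF x(2)]] x by (simp add: pi_scale)
  qed
  show "mult A a b \<in> comp A (s + t)" if "a \<in> comp A s" "b \<in> comp A t" for a b s t
  proof -
    note ab = that
    obtain x where x: "x \<in> PA" "hom s x" "a = \<pi> x" using ab(1) by (rule comp_obtain)
    obtain y where y: "y \<in> PA" "hom t y" "b = \<pi> y" using ab(2) by (rule comp_obtain)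
    show ?thesis using comp_I[OF pm_closed[OF x(1) y(1)] hom_pm[OF x(2) y(2)]] x y by (simp add: pi_mult)
  qed
  show "idem A i \<in> comp A 0" if "i \<in> vertices A" for i
    using that by (simp flip: pi_idem verts_eq add: comp_I trivial_path)
  show "mult A (idem A i) (idem A j) = (if i = j then idem A i else 0)" if "i \<in> vertices A" "j \<in> vertices A" for i j
    using that by (simp flip: pi_idem verts_eq pi_mult add: trivial_path pm_single)
  show "idem A i \<noteq> 0" if "i \<in> vertices A" for i
  proof
    assume "idem A i = 0"
    then have "sg (i, []) 1 \<in> rel_ideal Q" using that kernel[of "sg (i, []) 1"] pi_idem[of i] trivial_path verts_eq by simp
    then show False using rel_ideal_length[of "sg (i, []) 1" "(i, [])"] by simp
  qed
  show "\<exists>J. finite J \<and> J \<subseteq> vertices A \<and> mult A (\<Sum>j\<in>J. idem A j) a = a \<and> mult A a (\<Sum>j\<in>J. idem A j) = a"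
    if "a \<in> carrier A" for a
  proof -
    note a = that
    obtain x where x: "x \<in> PA" "a = \<pi> x" using a by (rule carrier_obtain)
    let ?J = "pend Q ` ks x \<union> fst ` ks x"
    have J: "finite ?J" "?J \<subseteq> vertices A" using x path_verts by (auto simp: path_algebra_def subset_iff verts_eq[symmetric])
    have "(\<Sum>j\<in>?J. sg (j, []) 1) \<in> PA" using J by (intro PA_sum) (auto simp: trivial_path verts_eq subset_iff)
    then have "mult A (\<Sum>j\<in>?J. idem A j) a = a" "mult A a (\<Sum>j\<in>?J. idem A j) = a"
      unfolding pi_vertices[OF J, symmetric] x(2)
      using vertex_left[OF x(1) J(1)] vertex_right[OF x(1) J(1)] x(1) by (simp_all flip: pi_mult)
    then show ?thesis using J by blast
  qed
  show "\<exists>r. mult A a (idem A i) = scale A r (idem A i)" if "a \<in> comp A 0" "i \<in> vertices A" for a i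
  proof -
    note a = that
    obtain x where x: "x \<in> PA" "hom 0 x" "a = \<pi> x" using a(1) by (rule comp_obtain)
    have "mult A a (idem A i) = \<pi> (pm x (sg (i, []) 1))" using x that by (simp add: pi_mult pi_idem verts_eq trivial_path)
    also have "\<dots> = scale A (lk x (i, [])) (idem A i)"
      using that x by (simp add: length_zero_right) (simp add: pi_single_scale[of _ "lk x (i, [])"] trivial_path verts_eq pi_idem)
    finally show ?thesis by blast
  qed
  show "\<exists>r. mult A (idem A i) a = scale A r (idem A i)" if "a \<in> comp A 0" "i \<in> vertices A" for a i
  proof -
    note a = that
    obtain x where x: "x \<in> PA" "hom 0 x" "a = \<pi> x" using a(1) by (rule comp_obtain)
    have "mult A (idem A i) a = \<pi> (pm (sg (i, []) 1) x)" using x that by (simp add: pi_mult pi_idem verts_eq trivial_path)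
    also have "\<dots> = scale A (lk x (i, [])) (idem A i)"
      using that x by (simp add: length_zero_left) (simp add: pi_single_scale[of _ "lk x (i, [])"] trivial_path verts_eq pi_idem)
    finally show ?thesis by blast
  qed
  fix t
  \<comment> \<open>A homogeneous element is a sum of images of scalar multiples of paths, so
    generation in degree 1 amounts to splitting one arrow off a path; the scalar goes with the
    arrow.\<close>
  have sp: "comp A (Suc t) \<subseteq> add_span X" if X: "\<And>w c. w \<in> paths Q \<Longrightarrow> plen w = Suc t \<Longrightarrow> \<pi> (sg w c) \<in> X" for X
  proof
    fix a assume "a \<in> comp A (Suc t)"
    then obtain x where x: "x \<in> PA" "hom (Suc t) x" "a = \<pi> x" by (rule comp_obtain)
    have "\<pi> (\<Sum>w\<in>ks x. sg w (lk x w)) = (\<Sum>w\<in>ks x. \<pi> (sg w (lk x w)))"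
      using x by (subst pi_sum) (auto simp: path_algebra_def)
    also have "\<dots> \<in> add_span X"
    proof (intro add_span_sum add_span_base X)
      fix w assume w: "w \<in> ks x"
      show "w \<in> paths Q" using w x(1) by (auto simp: path_algebra_def)
      show "plen w = Suc t" using w x(2) by blast
    qed
    finally show "a \<in> add_span X" using poly_mapping_sum_singles[of "ks x" x] x by simp
  qed
  show "comp A (Suc t) \<subseteq> add_span {mult A b c |b c. b \<in> comp A 1 \<and> c \<in> comp A t}"
  proof (rule sp)
    fix w c assume w: "w \<in> paths Q" "plen w = Suc t"
    then obtain i a as where e: "w = (i, a # as)" "length as = t" by (cases w) (auto simp: length_Suc_conv)
    with w have p: "a \<in> arrows Q" "(i, as) \<in> paths Q" "src Q a = pend Q (i, as)" by (auto simp: paths_def)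
    then have "sg w c = pm (sg (src Q a, [a]) c) (sg (i, as) 1)" by (simp add: pm_single e)
    then have "\<pi> (sg w c) = mult A (\<pi> (sg (src Q a, [a]) c)) (\<pi> (sg (i, as) 1))"
      using pi_mult[OF PA_simps(4)[OF arrow_path[OF p(1)]] PA_simps(4)[OF p(2)]] by simp
    moreover have "\<pi> (sg (src Q a, [a]) c) \<in> comp A 1" "\<pi> (sg (i, as) 1) \<in> comp A t"
      using comp_I[OF PA_simps(4)[OF arrow_path[OF p(1)], of c], of 1] comp_I[OF PA_simps(4)[OF p(2), of 1], of t] e
      by simp_all
    ultimately show "\<pi> (sg w c) \<in> {mult A b c |b c. b \<in> comp A 1 \<and> c \<in> comp A t}" by blast
  qed
  show "comp A (Suc t) \<subseteq> add_span {mult A c b |b c. b \<in> comp A 1 \<and> c \<in> comp A t}"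
  proof (rule sp)
    fix w c assume w: "w \<in> paths Q" "plen w = Suc t"
    then obtain i a as where e: "w = (i, as @ [a])" "length as = t"
      by (cases w) (auto simp: length_Suc_conv_rev)
    with w have p: "a \<in> arrows Q" "(tgt Q a, as) \<in> paths Q" "src Q a = i" by (auto simp: paths_def path_list_append)
    then have "sg w c = pm (sg (tgt Q a, as) 1) (sg (i, [a]) c)" by (simp add: pm_single e)
    then have "\<pi> (sg w c) = mult A (\<pi> (sg (tgt Q a, as) 1)) (\<pi> (sg (i, [a]) c))"
      using p arrow_path by (auto simp: pi_mult)
    moreover have "\<pi> (sg (i, [a]) c) \<in> comp A 1" "\<pi> (sg (tgt Q a, as) 1) \<in> comp A t"
      using comp_I[OF PA_simps(4)[OF arrow_path[OF p(1)], of c], of 1] comp_I[OF PA_simps(4)[OF p(2), of 1], of t] e p(3)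
      by simp_all
    ultimately show "\<pi> (sg w c) \<in> {mult A c b |b c. b \<in> comp A 1 \<and> c \<in> comp A t}" by blast
  qed
qed

definition arrow_elem where "arrow_elem a = \<pi> (sg (src Q a, [a]) 1)"

lemma arrow_elem_mult:
  assumes "a \<in> arrows Q" "i \<in> vertices A"
  shows "arrow_elem a \<cdot> ee i = (if i = src Q a then arrow_elem a else 0)"
    "ee i \<cdot> arrow_elem a = (if i = tgt Q a then arrow_elem a else 0)"
  using assms arrow_path[OF assms(1)] trivial_path[of i] unfolding arrow_elem_def
  by (auto simp flip: pi_idem verts_eq pi_mult simp: pm_single)

text \<open>The coefficient of an arrow can be read off modulo the ideal, since no path of length 1
  occurs in an element of the ideal.\<close>

lemma arrow_elem_independent:
  assumes "finite F" "F \<subseteq> arrows Q" "(\<Sum>a\<in>F. c a *s arrow_elem a) = 0" "a \<in> F"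
  shows "c a = 0"
proof -
  let ?x = "\<Sum>a\<in>F. sg (src Q a, [a]) (c a)"
  have x: "?x \<in> PA" using assms arrow_path by (intro PA_sum) auto
  have "\<pi> ?x = (\<Sum>a\<in>F. \<pi> (sg (src Q a, [a]) (c a)))" using assms arrow_path by (intro pi_sum) auto
  also have "\<dots> = (\<Sum>a\<in>F. c a *s arrow_elem a)"
    unfolding arrow_elem_def using assms arrow_path by (intro sum.cong refl pi_single_scale) auto
  finally have "?x \<in> rel_ideal Q" using kernel[OF x] assms by simp
  moreover have "lk ?x (src Q a, [a]) = c a"
  proof -
    have "lk ?x (src Q a, [a]) = (\<Sum>b\<in>F. if b = a then c b else 0)"
      unfolding lookup_sum by (intro sum.cong refl) (auto simp: lookup_single when_def)
    then show ?thesis using assms by simp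
  qed
  ultimately show ?thesis using rel_ideal_length[of ?x "(src Q a, [a])"] by (auto simp: in_keys_iff)
qed

lemma arrow_elem_nonzero: "a \<in> arrows Q \<Longrightarrow> arrow_elem a \<noteq> 0"
  using arrow_elem_independent[of "{a}" "\<lambda>_. 1" a] by auto

lemma arrow_elem_comp: "a \<in> arrows Q \<Longrightarrow> arrow_elem a \<in> comp A 1"
  unfolding arrow_elem_def by (intro comp_I) (auto simp: arrow_path)

lemma arrow_elem_inj: "inj_on arrow_elem (arrows Q)"
proof (rule inj_onI, rule ccontr)
  fix a b assume ab: "a \<in> arrows Q" "b \<in> arrows Q" "arrow_elem a = arrow_elem b" "a \<noteq> b"
  let ?c = "\<lambda>x. if x = a then 1 else - 1 :: 'k"
  have "(\<Sum>x\<in>{a, b}. ?c x *s arrow_elem x) = 0"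
    using ab arrow_elem_comp[OF ab(1)] comp_CC scale_minus[of "arrow_elem b" 1] by (auto simp: scale_one)
  then have "?c a = 0" using arrow_elem_independent[of "{a, b}" ?c a] ab by blast
  then show False by simp
qed

lemma presented: "presented_algebra A (arrow_elem ` arrows Q)"
proof
  show "arrow_elem ` arrows Q \<subseteq> comp A 1" using arrow_elem_comp by auto
  show "\<exists>i\<in>vertices A. \<exists>j\<in>vertices A. ee j \<cdot> x = x \<and> x \<cdot> ee i = x" if "x \<in> arrow_elem ` arrows Q" for x
  proof -
    obtain a where a: "a \<in> arrows Q" "x = arrow_elem a" using \<open>x \<in> _\<close> by blast
    then show ?thesis using src_verts[OF a(1)] tgt_verts[OF a(1)]
      by (intro bexI[of _ "src Q a"] bexI[of _ "tgt Q a"]) (simp_all add: arrow_elem_mult verts_eq)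
  qed
  show "\<forall>x\<in>F. c x = 0" if F: "finite F" "F \<subseteq> arrow_elem ` arrows Q" "(\<Sum>x\<in>F. c x *s x) = 0" for F c
  proof -
    obtain F' where F': "F' \<subseteq> arrows Q" "F = arrow_elem ` F'" using F(2) by (auto simp: subset_image_iff)
    have inj: "inj_on arrow_elem F'" using F' arrow_elem_inj inj_on_subset by blast
    have fin: "finite F'" using F(1) F' inj finite_image_iff by blast
    have "(\<Sum>a\<in>F'. c (arrow_elem a) *s arrow_elem a) = 0"
      using F(3) unfolding F'(2) sum.reindex[OF inj] by simp
    then show ?thesis using arrow_elem_independent[OF fin F'(1), of "\<lambda>a. c (arrow_elem a)"] F' by auto
  qed
  show "\<exists>F c. finite F \<and> F \<subseteq> arrow_elem ` arrows Q \<and> a = (\<Sum>x\<in>F. c x *s x)" if "a \<in> comp A 1" for a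
  proof -
    note a = that
    obtain x where x: "x \<in> PA" "hom 1 x" "a = \<pi> x" using a by (rule comp_obtain)
    have arr: "hd (snd w) \<in> arrows Q \<and> w = (src Q (hd (snd w)), [hd (snd w)])" if "w \<in> ks x" for w
    proof -
      have "w \<in> paths Q" "plen w = 1" using that x by (auto simp: path_algebra_def)
      then show ?thesis by (cases w) (auto simp: paths_def length_Suc_conv)
    qed
    let ?g = "\<lambda>w. arrow_elem (hd (snd w))"
    have inj: "inj_on ?g (ks x)"
    proof (rule inj_onI)
      fix w v assume wv: "w \<in> ks x" "v \<in> ks x" "?g w = ?g v"
      then have "hd (snd w) = hd (snd v)" using inj_onD[OF arrow_elem_inj wv(3)] arr by blast
      then show "w = v" using arr[OF wv(1)] arr[OF wv(2)] by metis
    qed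
    have "\<pi> (\<Sum>w\<in>ks x. sg w (lk x w)) = (\<Sum>w\<in>ks x. \<pi> (sg w (lk x w)))"
      using x by (intro pi_sum) (auto simp: path_algebra_def)
    then have "a = (\<Sum>w\<in>ks x. \<pi> (sg w (lk x w)))"
      using x(3) poly_mapping_sum_singles[of "ks x" x] by simp
    also have "\<dots> = (\<Sum>w\<in>ks x. lk x w *s ?g w)"
    proof (rule sum.cong[OF refl])
      fix w assume "w \<in> ks x"
      then have p: "w \<in> paths Q" using x by (auto simp: path_algebra_def)
      have "?g w = \<pi> (sg w 1)" unfolding arrow_elem_def using arr[OF \<open>w \<in> ks x\<close>] by metis
      then show "\<pi> (sg w (lk x w)) = lk x w *s ?g w" using pi_single_scale[OF p, of "lk x w"] by simp
    qed
    also have "\<dots> = (\<Sum>y\<in>?g ` ks x. lk x (the_inv_into (ks x) ?g y) *s y)"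
      unfolding sum.reindex[OF inj] by (intro sum.cong refl) (simp add: the_inv_into_f_f[OF inj])
    finally show ?thesis
      by (intro exI[of _ "?g ` ks x"] exI[of _ "\<lambda>y. lk x (the_inv_into (ks x) ?g y)"]) (use arr in auto)
  qed
  show "finite {x \<in> arrow_elem ` arrows Q. x \<cdot> ee i = x}" if "i \<in> vertices A" for i
  proof (rule finite_subset)
    show "{x \<in> arrow_elem ` arrows Q. x \<cdot> ee i = x} \<subseteq> arrow_elem ` {a \<in> arrows Q. src Q a = i}"
      using that arrow_elem_nonzero by (auto simp: arrow_elem_mult split: if_splits)
    show "finite (arrow_elem ` {a \<in> arrows Q. src Q a = i})"
      using that bound by (simp add: bound_quiver_def verts_eq)
  qed
  show "finite {x \<in> arrow_elem ` arrows Q. ee i \<cdot> x = x}" if "i \<in> vertices A" for i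
  proof (rule finite_subset)
    show "{x \<in> arrow_elem ` arrows Q. ee i \<cdot> x = x} \<subseteq> arrow_elem ` {a \<in> arrows Q. tgt Q a = i}"
      using that arrow_elem_nonzero by (auto simp: arrow_elem_mult split: if_splits)
    show "finite (arrow_elem ` {a \<in> arrows Q. tgt Q a = i})"
      using that bound by (simp add: bound_quiver_def verts_eq)
  qed
  have conn: "connected_quiver Q" using bound by (simp add: bound_quiver_def)
  then show "vertices A \<noteq> {}" by (simp add: connected_quiver_def verts_eq)
  fix i j assume ij: "i \<in> vertices A" "j \<in> vertices A"
  let ?S = "{(src Q a, tgt Q a) | a. a \<in> arrows Q}"
  let ?R = "{(i, j) | i j x. i \<in> vertices A \<and> j \<in> vertices A \<and> x \<in> arrow_elem ` arrows Q \<and> ee j \<cdot> x = x \<and> x \<cdot> ee i = x}"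
  have "?S \<subseteq> ?R"
  proof clarify
    fix a assume a: "a \<in> arrows Q"
    then show "\<exists>i j x. (src Q a, tgt Q a) = (i, j) \<and> i \<in> vertices A \<and> j \<in> vertices A \<and> x \<in> arrow_elem ` arrows Q \<and> ee j \<cdot> x = x \<and> x \<cdot> ee i = x"
      using src_verts[OF a] tgt_verts[OF a] by (auto simp: arrow_elem_mult verts_eq)
  qed
  then have "?S \<union> ?S\<inverse> \<subseteq> ?R \<union> ?R\<inverse>" by blast
  moreover have "(i, j) \<in> (?S \<union> ?S\<inverse>)\<^sup>*" using conn ij by (simp add: connected_quiver_def verts_eq Let_def)
  ultimately show "(i, j) \<in> (let R = ?R in (R \<union> R\<inverse>)\<^sup>*)"
    unfolding Let_def using rtrancl_mono by blast
qed

end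

section \<open>Presentations by quivers\<close>

context presented_algebra
begin

lemma arrow_nonzero: "x \<in> E \<Longrightarrow> x \<noteq> 0"
  using arrows_indep[of "{x}" "\<lambda>_. 1"] by auto

lemma arrow_CC: "x \<in> E \<Longrightarrow> x \<in> CC"
  using arrows_comp comp_CC by blast

definition psrc where "psrc x = (SOME i. i \<in> VV \<and> x \<cdot> ee i = x)"
definition ptgt where "ptgt x = (SOME j. j \<in> VV \<and> ee j \<cdot> x = x)"

lemma psrc: "x \<in> E \<Longrightarrow> psrc x \<in> VV" "x \<in> E \<Longrightarrow> x \<cdot> ee (psrc x) = x"
  using someI_ex[of "\<lambda>i. i \<in> VV \<and> x \<cdot> ee i = x"] arrows_peirce[of x] unfolding psrc_def by blast+

lemma ptgt: "x \<in> E \<Longrightarrow> ptgt x \<in> VV" "x \<in> E \<Longrightarrow> ee (ptgt x) \<cdot> x = x"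
  using someI_ex[of "\<lambda>j. j \<in> VV \<and> ee j \<cdot> x = x"] arrows_peirce[of x] unfolding ptgt_def by blast+

lemma arrow_pc: "x \<in> E \<Longrightarrow> x \<in> pc (ptgt x) 1 (psrc x)"
  using psrc[of x] ptgt[of x] arrows_comp by (auto intro!: pcI)

lemma psrc_iff: "x \<in> E \<Longrightarrow> i \<in> VV \<Longrightarrow> x \<cdot> ee i = x \<longleftrightarrow> psrc x = i"
  and ptgt_iff: "x \<in> E \<Longrightarrow> i \<in> VV \<Longrightarrow> ee i \<cdot> x = x \<longleftrightarrow> ptgt x = i"
  using pc_vertex[OF arrow_pc[of x] arrow_nonzero[of x] psrc(1) ptgt(1), of i] arrow_nonzero[of x] by auto

text \<open>The arrows are the elements of \<open>E\<close> themselves. The relations stay a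
  parameter: paths and the evaluation \<open>ev\<close> do not depend on them, and the actual
  relations \<open>prels\<close> are defined from \<open>ev\<close>.\<close>

definition pquiver :: "(('v, 'a) qpath \<Rightarrow>\<^sub>0 'k) set \<Rightarrow> ('v, 'a, 'k) bound_quiver"
  where "pquiver r = \<lparr>verts = VV, arrows = E, src = psrc, tgt = ptgt, rels = r\<rparr>"

lemma pquiver_simps[simp]: "verts (pquiver r) = VV" "arrows (pquiver r) = E" "src (pquiver r) = psrc"
  "tgt (pquiver r) = ptgt" "rels (pquiver r) = r"
  by (simp_all add: pquiver_def)

lemma pend_pquiver: "pend (pquiver r) = pend (pquiver {})"
  by (rule ext) (auto simp: pend_def split: list.split)

lemma paths_pquiver: "paths (pquiver r) = paths (pquiver {})"
proof -
  have "is_path_list (pquiver r) i as = is_path_list (pquiver {}) i as" for i as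
    by (induction as) (simp_all add: pend_pquiver[of r])
  then show ?thesis by (simp add: paths_def)
qed

lemma path_algebra_pquiver: "path_algebra (pquiver r) = path_algebra (pquiver {})"
  by (simp add: path_algebra_def paths_pquiver[of r])

sublocale pq: wf_quiver "pquiver r"
  by unfold_locales (auto simp: psrc ptgt)

fun pe :: "'v \<Rightarrow> 'a list \<Rightarrow> 'a" where
  "pe i [] = ee i"
| "pe i (a # as) = a \<cdot> pe i as"

text \<open>The canonical homomorphism from the path algebra to \<open>A\<close>, under which each
  arrow goes to itself.\<close>

definition ev :: "(('v, 'a) qpath \<Rightarrow>\<^sub>0 'k) \<Rightarrow> 'a"
  where "ev x = (\<Sum>w\<in>Poly_Mapping.keys x. Poly_Mapping.lookup x w *s pe (fst w) (snd w))"

lemma pe_list_pc: "is_path_list (pquiver r) i as \<Longrightarrow> pe i as \<in> pc (pend (pquiver r) (i, as)) (length as) i"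
proof (induction as)
  case Nil then show ?case by (auto intro!: pcI idem_comp)
next
  case (Cons a as)
  then have p: "pe i as \<in> pc (psrc a) (length as) i" "a \<in> E" "i \<in> VV"
    using pq.path_list_verts[of r i as] by auto
  have "a \<cdot> pe i as \<in> pc (ptgt a) (1 + length as) i"
    using p psrc(1) ptgt(1) by (intro pc_mult[OF arrow_pc p(1)]) auto
  then show ?case by simp
qed

lemma pe_pc: "w \<in> paths (pquiver r) \<Longrightarrow> pe (fst w) (snd w) \<in> pc (pend (pquiver r) w) (plen w) (fst w)"
  using pe_list_pc[of r "fst w" "snd w"] by (simp add: paths_def)

lemma pe_CC: "w \<in> paths (pquiver r) \<Longrightarrow> pe (fst w) (snd w) \<in> CC"
  using pe_pc pcD(4) by blast

lemma pe_append: "is_path_list (pquiver r) i bs \<Longrightarrow> is_path_list (pquiver r) (pend (pquiver r) (i, bs)) as \<Longrightarrow>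
  pe i (as @ bs) = pe (pend (pquiver r) (i, bs)) as \<cdot> pe i bs"
proof (induction as)
  case Nil
  then show ?case using pcD[OF pe_list_pc[of r i bs]] by simp
next
  case (Cons a as)
  then have "a \<in> E" "pe (pend (pquiver r) (i, bs)) as \<in> CC" "pe i bs \<in> CC"
    using pe_list_pc[of r i bs] pe_list_pc[of r "pend (pquiver r) (i, bs)" as] pcD(4) by auto
  with Cons show ?case by (simp add: mult_assoc arrow_CC)
qed

lemma ev_supset:
  assumes "finite S" "Poly_Mapping.keys x \<subseteq> S" "S \<subseteq> paths (pquiver r)"
  shows "ev x = (\<Sum>w\<in>S. Poly_Mapping.lookup x w *s pe (fst w) (snd w))"
  unfolding ev_def
  by (intro sum.mono_neutral_left) (use assms pe_CC[of _ r] in \<open>auto simp: in_keys_iff subset_iff\<close>)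

lemma ev_zero[simp]: "ev 0 = 0" by (simp add: ev_def)

lemma ev_single: "w \<in> paths (pquiver r) \<Longrightarrow> ev (Poly_Mapping.single w c) = c *s pe (fst w) (snd w)"
  by (subst ev_supset[of "{w}" _ r]) auto

lemma ev_add:
  assumes "x \<in> path_algebra (pquiver r)" "y \<in> path_algebra (pquiver r)"
  shows "ev (x + y) = ev x + ev y"
proof -
  let ?S = "Poly_Mapping.keys x \<union> Poly_Mapping.keys y"
  have S: "finite ?S" "?S \<subseteq> paths (pquiver r)" using assms by (auto simp: path_algebra_def)
  have "ev (x + y) = (\<Sum>w\<in>?S. Poly_Mapping.lookup (x + y) w *s pe (fst w) (snd w))"
    by (rule ev_supset[OF S(1) keys_add S(2)])
  also have "\<dots> = (\<Sum>w\<in>?S. Poly_Mapping.lookup x w *s pe (fst w) (snd w) + Poly_Mapping.lookup y w *s pe (fst w) (snd w))"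
    by (intro sum.cong refl) (use S(2) pe_CC[of _ r] in \<open>auto simp: lookup_add scale_add_left\<close>)
  also have "\<dots> = ev x + ev y"
    unfolding sum.distrib using ev_supset[OF S(1) _ S(2), of x] ev_supset[OF S(1) _ S(2), of y] by simp
  finally show ?thesis .
qed

lemma ev_CC: "x \<in> path_algebra (pquiver r) \<Longrightarrow> ev x \<in> CC"
  unfolding ev_def by (intro CC_sum) (use pe_CC[of _ r] in \<open>auto simp: path_algebra_def\<close>)

lemma ev_sum: "(\<And>i. i \<in> I \<Longrightarrow> f i \<in> path_algebra (pquiver r)) \<Longrightarrow> ev (sum f I) = (\<Sum>i\<in>I. ev (f i))"
  using additive_on_sum[OF pq.PA_group[of r], of ev I f] ev_add by blast

lemma ev_comp:
  assumes "x \<in> path_algebra (pquiver r)" "\<forall>w\<in>Poly_Mapping.keys x. plen w = t"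
  shows "ev x \<in> comp A t"
  unfolding ev_def
proof (intro comp_sum scale_comp)
  fix w assume w: "w \<in> Poly_Mapping.keys x"
  then have "w \<in> paths (pquiver r)" using assms by (auto simp: path_algebra_def)
  then show "pe (fst w) (snd w) \<in> comp A t" using pcD(1)[OF pe_pc] assms w by metis
qed

lemma ev_smap: "x \<in> path_algebra (pquiver r) \<Longrightarrow> ev (Poly_Mapping.map ((*) c) x) = c *s ev x"
proof (induction x rule: pq.PA_induct[of _ r])
  case zero then show ?case using pq.smap_zero[of c] by (simp add: fun_eq_iff)
next
  case (single w d)
  then show ?case using pq.smap_single[of c w d] by (simp add: ev_single[of _ r] scale_scale pe_CC[of _ r])
next
  case (add x y)
  then show ?case using pq.smap_add[of c x y] pq.PA_simps(5)[of x r c] pq.PA_simps(5)[of y r c]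
    by (simp add: ev_add[of _ r] ev_CC[of _ r] scale_add_right)
qed

lemma ev_mult:
  assumes "x \<in> path_algebra (pquiver r)" "y \<in> path_algebra (pquiver r)"
  shows "ev (path_mult (pquiver r) x y) = ev x \<cdot> ev y"
  using assms(1)
proof (induction x rule: pq.PA_induct[of _ r])
  case zero then show ?case using assms(2) ev_CC[of y r] by simp
next
  case (single w c)
  note w = \<open>w \<in> paths (pquiver r)\<close>
  from assms(2) show ?case
  proof (induction y rule: pq.PA_induct[of _ r])
    case zero then show ?case using w by (simp add: ev_single[of _ r] pe_CC[of _ r])
  next
    case (single v d)
    note v = \<open>v \<in> paths (pquiver r)\<close>
    show ?case
    proof (cases "fst w = pend (pquiver r) v")
      case True
      have "pe (fst v) (snd w @ snd v) = pe (fst w) (snd w) \<cdot> pe (fst v) (snd v)"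
        using w v True pe_append[of r "fst v" "snd v" "snd w"] by (simp add: paths_def)
      then show ?thesis
        using True w v pq.path_concat(1)[OF w v True] pe_CC[OF w] pe_CC[OF v]
        by (auto simp: pq.pm_single ev_single[of _ r] scale_mult_left scale_mult_right scale_scale mult.commute)
    next
      case False
      have "pe (fst w) (snd w) \<cdot> pe (fst v) (snd v) = pe (fst w) (snd w) \<cdot> ee (fst w) \<cdot> (ee (pend (pquiver r) v) \<cdot> pe (fst v) (snd v))"
        using pcD[OF pe_pc[OF w]] pcD[OF pe_pc[OF v]] by simp
      also have "\<dots> = pe (fst w) (snd w) \<cdot> (ee (fst w) \<cdot> ee (pend (pquiver r) v) \<cdot> pe (fst v) (snd v))"
        using pe_CC[OF w] pe_CC[OF v] pq.path_verts[OF w] pq.path_verts[OF v] by (simp add: mult_assoc)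
      also have "\<dots> = 0"
        using pe_CC[OF w] pe_CC[OF v] pq.path_verts[OF w] pq.path_verts[OF v] False by (simp add: idem_mult)
      finally show ?thesis using False w v
        by (simp add: pq.pm_single ev_single[of _ r] pe_CC[of _ r] scale_mult_left scale_mult_right)
    qed
  next
    case (add x y)
    then show ?case using w pq.pm_closed[of "Poly_Mapping.single w c" r]
      by (simp add: pq.pm_add_right ev_add[of _ r] mult_add_right ev_CC[of _ r])
  qed
next
  case (add x z)
  then show ?case using assms(2)
    by (simp add: pq.pm_add_left ev_add[of _ r] mult_add_left ev_CC[of _ r])
qed

text \<open>Induction on the degree: idempotents span degree 0, arrows span degree 1, and
  \<open>gen_left\<close> passes from t to t + 1.\<close>

lemma ev_surj_comp: "a \<in> comp A t \<Longrightarrow>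
  \<exists>x\<in>path_algebra (pquiver r). (\<forall>w\<in>Poly_Mapping.keys x. plen w = t) \<and> ev x = a"
proof (induction t arbitrary: a)
  case 0
  then have aC: "a \<in> CC" using comp_CC by blast
  then obtain J where J: "finite J" "J \<subseteq> VV" "uu J \<cdot> a = a" "a \<cdot> uu J = a"
    using common_unit[of "{a}"] by auto
  have "\<forall>j\<in>J. \<exists>c. a \<cdot> ee j = c *s ee j" using comp0_right[OF 0] J by blast
  then obtain c where c: "\<And>j. j \<in> J \<Longrightarrow> a \<cdot> ee j = c j *s ee j" by metis
  let ?x = "\<Sum>j\<in>J. Poly_Mapping.single (j, []) (c j)"
  have p: "(j, []) \<in> paths (pquiver r)" if "j \<in> J" for j using that J by (auto simp: paths_def)
  have "ev ?x = (\<Sum>j\<in>J. c j *s ee j)"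
    using p by (subst ev_sum[of _ _ r]) (simp_all add: ev_single[OF p])
  also have "\<dots> = (\<Sum>j\<in>J. a \<cdot> ee j)" by (intro sum.cong refl) (simp add: c)
  also have "\<dots> = a" using unit_sum(2)[of J a] J aC by simp
  finally have "ev ?x = a" .
  moreover have "\<forall>w\<in>Poly_Mapping.keys ?x. plen w = 0"
    by (rule pq.hom_sum) simp
  moreover have "?x \<in> path_algebra (pquiver r)" using p by (intro pq.PA_sum) auto
  ultimately show ?case by blast
next
  case (Suc t)
  let ?S = "\<lambda>t. {ev x | x. x \<in> path_algebra (pquiver r) \<and> (\<forall>w\<in>Poly_Mapping.keys x. plen w = t)}"
  have sub: "add_subgroup (?S t)" for t
    unfolding add_subgroup_def
  proof (intro conjI ballI)
    show "0 \<in> ?S t" by (intro CollectI exI[of _ 0]) auto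
    fix a b assume "a \<in> ?S t" "b \<in> ?S t"
    then obtain x y where xy: "a = ev x" "x \<in> path_algebra (pquiver r)" "\<forall>w\<in>Poly_Mapping.keys x. plen w = t"
      "b = ev y" "y \<in> path_algebra (pquiver r)" "\<forall>w\<in>Poly_Mapping.keys y. plen w = t" by blast
    have "ev (x - y) = a - b"
      using additive_on_diff[OF pq.PA_group[of r], of ev x y] ev_add xy by blast
    then show "a - b \<in> ?S t"
      using pq.PA_simps(3)[OF xy(2,5)] pq.hom_diff[OF xy(3,6)] by (intro CollectI exI[of _ "x - y"]) simp
  qed
  have one: "b \<in> ?S 1" if b: "b \<in> comp A 1" for b
  proof -
    obtain F c where F: "finite F" "F \<subseteq> E" "b = (\<Sum>x\<in>F. c x *s x)" using arrows_span[OF b] by blast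
    have p: "(psrc x, [x]) \<in> paths (pquiver r)" if "x \<in> F" for x
      using that F pq.arrow_path[of x r] by auto
    let ?x = "\<Sum>x\<in>F. Poly_Mapping.single (psrc x, [x]) (c x)"
    have "ev ?x = (\<Sum>x\<in>F. c x *s x)"
      using p F psrc(2) by (subst ev_sum[of _ _ r]) (auto simp: ev_single[OF p] subset_iff intro!: sum.cong)
    moreover have "\<forall>w\<in>Poly_Mapping.keys ?x. plen w = 1"
      by (rule pq.hom_sum) simp
    moreover have "?x \<in> path_algebra (pquiver r)" using p by (intro pq.PA_sum) auto
    ultimately show ?thesis unfolding F(3) by (intro CollectI exI[of _ ?x]) simp
  qed
  have "add_span {b \<cdot> c | b c. b \<in> comp A 1 \<and> c \<in> comp A t} \<subseteq> ?S (Suc t)"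
  proof (rule add_span_least[OF _ sub], clarify)
    fix b c assume bc: "b \<in> comp A 1" "c \<in> comp A t"
    obtain x where x: "x \<in> path_algebra (pquiver r)" "\<forall>w\<in>Poly_Mapping.keys x. plen w = 1" "ev x = b"
      using one[OF bc(1)] by blast
    obtain y where y: "y \<in> path_algebra (pquiver r)" "\<forall>w\<in>Poly_Mapping.keys y. plen w = t" "ev y = c"
      using Suc.IH[OF bc(2)] by blast
    show "\<exists>x. b \<cdot> c = ev x \<and> x \<in> path_algebra (pquiver r) \<and> (\<forall>w\<in>Poly_Mapping.keys x. plen w = Suc t)"
      using ev_mult[OF x(1) y(1)] x(3) y(3) pq.hom_pm[OF x(2) y(2), of r] pq.pm_closed[OF x(1) y(1)]
      by (intro exI[of _ "path_mult (pquiver r) x y"]) simp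
  qed
  then have "a \<in> ?S (Suc t)" using gen_left[of t] Suc.prems by blast
  then show ?case by blast
qed

lemma ev_surj:
  assumes "a \<in> CC"
  shows "\<exists>x\<in>path_algebra (pquiver r). ev x = a"
  using assms
proof (rule add_component_induct[OF grading])
  show "\<exists>x\<in>path_algebra (pquiver r). ev x = 0" by (intro bexI[of _ 0]) auto
  show "\<exists>z\<in>path_algebra (pquiver r). ev z = a + b"
    if ab: "\<exists>x\<in>path_algebra (pquiver r). ev x = a" "\<exists>x\<in>path_algebra (pquiver r). ev x = b" for a b
  proof -
    obtain x y where "x \<in> path_algebra (pquiver r)" "ev x = a" "y \<in> path_algebra (pquiver r)" "ev y = b"
      using ab by blast
    then show ?thesis by (intro bexI[of _ "x + y"]) (simp_all add: ev_add)
  qed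
  show "\<exists>x\<in>path_algebra (pquiver r). ev x = a" if "a \<in> comp A t" for a t
    using ev_surj_comp[OF that, of r] by blast
qed

text \<open>The largest admissible choice, so that the kernel of \<open>ev\<close> is generated as
  soon as it is homogeneous and starts in degree 2.\<close>

definition prels where "prels = {x \<in> path_algebra (pquiver {}).
  (\<exists>m\<ge>2. \<forall>w\<in>Poly_Mapping.keys x. plen w = m) \<and> ev x = 0}"

abbreviation "PQ \<equiv> pquiver prels"

lemma prels_iff: "x \<in> prels \<longleftrightarrow> x \<in> path_algebra PQ \<and>
  (\<exists>m\<ge>2. \<forall>w\<in>Poly_Mapping.keys x. plen w = m) \<and> ev x = 0"
  unfolding path_algebra_pquiver[of prels] by (subst prels_def) blast

text \<open>Idempotents and arrows are linearly independent in \<open>A\<close>, so the kernel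
  starts in degree 2 and the length condition in \<open>prels\<close> loses nothing.\<close>

lemma hom_le_1_kernel:
  assumes y: "y \<in> path_algebra PQ" "\<forall>w\<in>Poly_Mapping.keys y. plen w = t" "t < 2" "ev y = 0"
  shows "y = 0"
proof (cases "t = 0")
  case True
  have "Poly_Mapping.lookup y w = 0" if w: "w \<in> Poly_Mapping.keys y" for w
  proof -
    have wp: "w \<in> paths PQ" "w = (fst w, [])" using y w True by (auto simp: path_algebra_def prod_eq_iff)
    have i: "fst w \<in> VV" using pq.path_verts(1)[OF wp(1)] by simp
    then have p: "(fst w, []) \<in> paths PQ" by (simp add: paths_def)
    \<comment> \<open>Multiplying by the idempotent at \<open>fst w\<close> isolates the coefficient
      of \<open>w\<close>.\<close>
    have "ev (path_mult PQ y (Poly_Mapping.single (fst w, []) 1)) = 0"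
      using ev_mult[OF y(1) pq.PA_simps(4)[OF p, of 1]] y(4) i p by (simp add: ev_single scale_one)
    then have "Poly_Mapping.lookup y (fst w, []) *s ee (fst w) = 0"
      using pq.length_zero_right[OF y(1), of "fst w"] y(2) True ev_single[OF p] by simp
    then show ?thesis using i wp(2) scale_eq_0[of "ee (fst w)"] idem_nonzero by simp
  qed
  then show ?thesis by (intro poly_mapping_eqI) (metis in_keys_iff lookup_zero)
next
  case False
  then have t: "t = 1" using y(3) by simp
  let ?K = "Poly_Mapping.keys y" and ?g = "\<lambda>w. hd (snd w) :: 'a"
  have arr: "?g w \<in> E \<and> w = (psrc (?g w), [?g w]) \<and> w \<in> paths PQ" if "w \<in> ?K" for w
  proof -
    have "w \<in> paths PQ" "plen w = 1" using that y(1,2) t by (auto simp: path_algebra_def)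
    then show ?thesis by (cases w) (auto simp: paths_def length_Suc_conv)
  qed
  have inj: "inj_on ?g ?K"
    by (rule inj_onI) (metis arr)
  have "ev y = (\<Sum>w\<in>?K. Poly_Mapping.lookup y w *s ?g w)"
    unfolding ev_def
  proof (intro sum.cong refl arg_cong2[of _ _ _ _ "scale A"])
    fix w assume "w \<in> ?K"
    then show "pe (fst w) (snd w) = ?g w" using arr[of w] psrc(2)[of "?g w"]
      by (metis fst_conv snd_conv pe.simps)
  qed
  also have "\<dots> = (\<Sum>x\<in>?g ` ?K. Poly_Mapping.lookup y (the_inv_into ?K ?g x) *s x)"
    unfolding sum.reindex[OF inj] by (intro sum.cong refl) (simp add: the_inv_into_f_f[OF inj])
  finally have "(\<Sum>x\<in>?g ` ?K. Poly_Mapping.lookup y (the_inv_into ?K ?g x) *s x) = 0" using y(4) by simp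
  then have "\<forall>x\<in>?g ` ?K. Poly_Mapping.lookup y (the_inv_into ?K ?g x) = 0"
    using arr by (intro arrows_indep) auto
  then have "Poly_Mapping.lookup y w = 0" if "w \<in> ?K" for w using that the_inv_into_f_f[OF inj that] by force
  then show ?thesis by (intro poly_mapping_eqI) (metis in_keys_iff lookup_zero)
qed

text \<open>The homogeneous parts of a kernel element are mapped to different degrees, so each of
  them lies in the kernel; parts below degree 2 vanish and the others are relations.\<close>

lemma PQ_kernel: "x \<in> path_algebra PQ \<Longrightarrow> ev x = 0 \<longleftrightarrow> x \<in> rel_ideal PQ"
proof
  assume x: "x \<in> path_algebra PQ" "ev x = 0"
  obtain N where N: "x = (\<Sum>t<N. pq.hpart t x)" using pq.sum_hpart by blast
  have h: "pq.hpart t x \<in> path_algebra PQ" "\<forall>w\<in>Poly_Mapping.keys (pq.hpart t x). plen w = t" for t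
    using x pq.hpart_hom by auto
  have "(\<Sum>t<N. ev (pq.hpart t x)) = 0"
    using ev_sum[of "{..<N}" "\<lambda>t. pq.hpart t x" prels] h N x by simp
  then have z: "ev (pq.hpart t x) = 0" if "t < N" for t
    by (rule comp_independent[of "\<lambda>t. ev (pq.hpart t x)", OF ev_comp[OF h] _ that])
  have "pq.hpart t x \<in> rel_ideal PQ" if "t < N" for t
  proof (cases "t < 2")
    case True
    then have "pq.hpart t x = 0" using hom_le_1_kernel[OF h(1,2)[of t]] z[OF that] by blast
    then show ?thesis by (simp add: rel_ideal.zero)
  next
    case False
    have "\<exists>m\<ge>2. \<forall>w\<in>Poly_Mapping.keys (pq.hpart t x). plen w = m"
      using False h(2)[of t] by (intro exI[of _ t]) auto
    then have "pq.hpart t x \<in> prels" using z[OF that] h(1)[of t] by (subst prels_iff) blast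
    then show ?thesis by (intro rel_ideal.rel) simp
  qed
  then have "n \<le> N \<Longrightarrow> (\<Sum>t<n. pq.hpart t x) \<in> rel_ideal PQ" for n
    by (induction n) (auto intro: rel_ideal.intros)
  from this[of N] show "x \<in> rel_ideal PQ" using N by simp
next
  assume "x \<in> rel_ideal PQ"
  then have "x \<in> path_algebra PQ \<and> ev x = 0"
  proof (induction rule: rel_ideal.induct)
    case zero then show ?case by simp
  next
    case (rel r)
    then show ?case by (simp add: prels_iff)
  next
    case (add x y)
    then show ?case by (simp add: ev_add[of _ prels])
  next
    case (left x z)
    then show ?case by (simp add: ev_mult[of _ prels] ev_CC[of _ prels])
  next
    case (right x z)
    then show ?case by (simp add: ev_mult[of _ prels] ev_CC[of _ prels])
  qed
  then show "ev x = 0" by simp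
qed

lemma quiver_algebra_PQ: "quiver_algebra PQ A"
  unfolding quiver_algebra_def
proof (intro conjI exI[of _ ev] ballI allI)
  show "carrier A = ev ` path_algebra PQ" using ev_CC[of _ prels] ev_surj[of _ prels] by blast
  show "comp A t = ev ` {x \<in> path_algebra PQ. \<forall>w\<in>Poly_Mapping.keys x. plen w = t}" for t
    using ev_comp[of _ prels t] ev_surj_comp[of _ t prels] by blast
  show "ev (path_elem (i, [])) = ee i" if "i \<in> verts PQ" for i
    using that ev_single[of "(i, [])" prels 1] by (simp add: paths_def scale_one)
qed (auto simp: ev_add[of _ prels] ev_mult[of _ prels] ev_smap[of _ prels] PQ_kernel)

lemma bound_quiver_PQ: "bound_quiver PQ"
  unfolding bound_quiver_def
proof (intro conjI ballI)
  show "connected_quiver PQ"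
    unfolding connected_quiver_def Let_def
  proof (intro conjI ballI)
    show "verts PQ \<noteq> {}" using vertices_nonempty by simp
    fix i j assume ij: "i \<in> verts PQ" "j \<in> verts PQ"
    let ?S = "{(src PQ a, tgt PQ a) | a. a \<in> arrows PQ}"
    let ?R = "{(i, j) | i j x. i \<in> VV \<and> j \<in> VV \<and> x \<in> E \<and> ee j \<cdot> x = x \<and> x \<cdot> ee i = x}"
    have "?R \<subseteq> ?S"
    proof clarify
      fix i j x assume "i \<in> VV" "j \<in> VV" "x \<in> E" "ee j \<cdot> x = x" "x \<cdot> ee i = x"
      then show "\<exists>a. (i, j) = (src PQ a, tgt PQ a) \<and> a \<in> arrows PQ"
        using psrc_iff[of x i] ptgt_iff[of x j] by (intro exI[of _ x]) simp
    qed
    then have "?R \<union> ?R\<inverse> \<subseteq> ?S \<union> ?S\<inverse>" by blast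
    moreover have "(i, j) \<in> (?R \<union> ?R\<inverse>)\<^sup>*"
      using arrows_connected[of i j] ij unfolding Let_def by simp
    ultimately show "(i, j) \<in> (?S \<union> ?S\<inverse>)\<^sup>*"
      using rtrancl_mono by blast
  qed
  fix i assume i: "i \<in> verts PQ"
  have "{a \<in> arrows PQ. src PQ a = i} = {x \<in> E. x \<cdot> ee i = x}"
    using i by (intro Collect_cong) (auto simp: psrc_iff)
  then show "finite {a \<in> arrows PQ. src PQ a = i}" using arrows_finite(1)[of i] i by simp
  have "{a \<in> arrows PQ. tgt PQ a = i} = {x \<in> E. ee i \<cdot> x = x}"
    using i by (intro Collect_cong) (auto simp: ptgt_iff)
  then show "finite {a \<in> arrows PQ. tgt PQ a = i}" using arrows_finite(2)[of i] i by simp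
next
  fix r assume "r \<in> rels PQ"
  then show "r \<in> path_algebra PQ" "\<exists>m\<ge>2. \<forall>w\<in>Poly_Mapping.keys r. plen w = m"
    by (simp_all add: prels_iff)
qed (auto simp: psrc ptgt)

lemma presentation_ex: "\<exists>Q :: ('v, 'a, 'k) bound_quiver. bound_quiver Q \<and> quiver_algebra Q A"
  using bound_quiver_PQ quiver_algebra_PQ by blast

end

section \<open>Translation conditions in terms of Peirce components\<close>

context quiver_presentation
begin

lemma bound_path_iff: "bound_path Q w \<longleftrightarrow> w \<in> paths Q \<and> \<pi> (sg w 1) \<noteq> 0"
  unfolding bound_path_def using kernel[of "sg w 1"] by auto

lemma path_pc: "w \<in> paths Q \<Longrightarrow> \<pi> (sg w c) \<in> pc (pend Q w) (plen w) (fst w)"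
proof -
  assume w: "w \<in> paths Q"
  have p: "(fst w, []) \<in> paths Q" "(pend Q w, []) \<in> paths Q" using path_verts[OF w] trivial_path by auto
  show ?thesis
  proof (rule pcI)
    show "\<pi> (sg w c) \<in> comp A (plen w)" using w by (intro comp_I) auto
    show "ee (pend Q w) \<cdot> \<pi> (sg w c) = \<pi> (sg w c)"
      using w p path_verts[OF w] by (simp flip: pi_idem pi_mult add: pm_single)
    show "\<pi> (sg w c) \<cdot> ee (fst w) = \<pi> (sg w c)"
      using w p path_verts[OF w] by (cases w) (simp flip: pi_idem pi_mult add: pm_single)
  qed
qed

lemma comp_sum_paths:
  assumes "b \<in> comp A t"
  obtains S c where "finite S" "S \<subseteq> paths Q" "\<And>w. w \<in> S \<Longrightarrow> plen w = t" "b = (\<Sum>w\<in>S. c w *s \<pi> (sg w 1))"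
proof -
  obtain x where x: "x \<in> PA" "hom t x" "b = \<pi> x" using assms by (rule comp_obtain)
  have s: "ks x \<subseteq> paths Q" using x by (simp add: path_algebra_def)
  have "\<pi> (\<Sum>w\<in>ks x. sg w (lk x w)) = (\<Sum>w\<in>ks x. \<pi> (sg w (lk x w)))"
    using s by (intro pi_sum) auto
  also have "\<dots> = (\<Sum>w\<in>ks x. lk x w *s \<pi> (sg w 1))"
    using s pi_single_scale by (intro sum.cong refl) blast
  finally show ?thesis
    using that[of "ks x" "lk x"] s x poly_mapping_sum_singles[of "ks x" x] by auto
qed

text \<open>The translation conditions ask for paths, while pairings with a form produce elements of
  the algebra. Since an element is a combination of paths, some path already has nonzero image under
  the linear map \<open>f\<close>.\<close>

lemma path_factor:
  assumes b: "b \<in> pc j t i" and ij: "i \<in> VV" "j \<in> VV" and f: "\<And>x y. x \<in> CC \<Longrightarrow> y \<in> CC \<Longrightarrow> f (x + y) = f x + f y"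
    "\<And>c x. x \<in> CC \<Longrightarrow> f (c *s x) = c *s f x" and nz: "f b \<noteq> 0"
  shows "\<exists>w\<in>paths_between Q t i j. f (\<pi> (sg w 1)) \<noteq> 0"
proof -
  obtain S c where S: "finite S" "S \<subseteq> paths Q" "\<And>w. w \<in> S \<Longrightarrow> plen w = t" "b = (\<Sum>w\<in>S. c w *s \<pi> (sg w 1))"
    by (rule comp_sum_paths[OF pcD(1)[OF b]]) (rule that)
  have p: "\<pi> (sg w 1) \<in> pc (pend Q w) t (fst w)" if "w \<in> S" for w using path_pc[of w 1] S that by auto
  have C: "\<pi> (sg w 1) \<in> CC" if "w \<in> S" for w using pcD(4)[OF p[OF that]] .
  have f0: "f 0 = 0" using f(1)[of 0 0] by simp
  let ?S = "{w \<in> S. fst w = i \<and> pend Q w = j}"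
  \<comment> \<open>Multiplying by the two idempotents removes the paths with other end
    points.\<close>
  have "b = ee j \<cdot> b \<cdot> ee i" using pcD[OF b] by simp
  also have "\<dots> = (\<Sum>w\<in>S. c w *s (ee j \<cdot> \<pi> (sg w 1) \<cdot> ee i))"
    unfolding S(4) using ij C by (subst mult_sum_right mult_sum_left; auto simp: scale_mult_left scale_mult_right)+
  also have "\<dots> = (\<Sum>w\<in>?S. c w *s \<pi> (sg w 1))"
  proof (rule sum.mono_neutral_cong_right[OF S(1)])
    have v: "fst w \<in> VV" "pend Q w \<in> VV" if "w \<in> S" for w using path_verts[of w] S(2) that verts_eq by auto
    show "\<forall>w\<in>S - ?S. c w *s (ee j \<cdot> \<pi> (sg w 1) \<cdot> ee i) = 0"
    proof
      fix w assume w: "w \<in> S - ?S"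
      have "ee j \<cdot> \<pi> (sg w 1) \<cdot> ee i = 0"
      proof (cases "\<pi> (sg w 1) = 0")
        case False
        then show ?thesis using w ij pc_vertex[OF p[of w] False v(1)[of w] v(2)[of w]]
          by (auto split: if_splits)
      qed (use ij in auto)
      then show "c w *s (ee j \<cdot> \<pi> (sg w 1) \<cdot> ee i) = 0" by simp
    qed
    show "c w *s (ee j \<cdot> \<pi> (sg w 1) \<cdot> ee i) = c w *s \<pi> (sg w 1)" if "w \<in> ?S" for w
      using that pcD[OF p[of w]] by auto
  qed auto
  finally have "f b = (\<Sum>w\<in>?S. c w *s f (\<pi> (sg w 1)))"
    using additive_on_sum[OF CC_group, of f ?S "\<lambda>w. c w *s \<pi> (sg w 1)"] f C by (auto intro!: sum.cong)
  then have fb: "f b = (\<Sum>w\<in>?S. c w *s f (\<pi> (sg w 1)))" .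
  have "\<exists>w\<in>?S. c w *s f (\<pi> (sg w 1)) \<noteq> 0"
  proof (rule ccontr)
    assume "\<not> (\<exists>w\<in>?S. c w *s f (\<pi> (sg w 1)) \<noteq> 0)"
    then have "f b = 0" unfolding fb by (intro sum.neutral) blast
    with nz show False by simp
  qed
  then obtain w where "w \<in> ?S" "c w *s f (\<pi> (sg w 1)) \<noteq> 0" by blast
  then show ?thesis using S scale_zero(1)[of "c w"] by (intro bexI[of _ w]) (auto simp: paths_between_def)
qed

lemma path_factor_right:
  assumes "b \<in> pc j t i" "i \<in> VV" "j \<in> VV" "u \<in> CC" "u \<cdot> b \<noteq> 0"
  shows "\<exists>w\<in>paths_between Q t i j. u \<cdot> \<pi> (sg w 1) \<noteq> 0"
  by (rule path_factor[OF assms(1-3), of "\<lambda>x. u \<cdot> x"]) (use assms in \<open>auto simp: mult_add_right scale_mult_right\<close>)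

lemma path_factor_left:
  assumes "b \<in> pc j t i" "i \<in> VV" "j \<in> VV" "u \<in> CC" "b \<cdot> u \<noteq> 0"
  shows "\<exists>w\<in>paths_between Q t i j. \<pi> (sg w 1) \<cdot> u \<noteq> 0"
  by (rule path_factor[OF assms(1-3), of "\<lambda>x. x \<cdot> u"]) (use assms in \<open>auto simp: mult_add_left scale_mult_left\<close>)

lemma bound_elems_pc:
  assumes "u \<in> bound_elems Q t i j" "i \<in> VV" "j \<in> VV"
  shows "u \<in> PA" "\<pi> u \<in> pc j t i" "\<pi> u \<noteq> 0"
proof -
  have k: "ks u \<subseteq> paths_between Q t i j" "u \<notin> rel_ideal Q" using assms by (auto simp: bound_elems_def)
  then show u: "u \<in> PA" by (auto simp: path_algebra_def paths_between_def)
  then show "\<pi> u \<noteq> 0" using k kernel by blast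
  have "\<pi> (\<Sum>w\<in>ks u. sg w (lk u w)) = (\<Sum>w\<in>ks u. \<pi> (sg w (lk u w)))"
    using k by (intro pi_sum) (auto simp: paths_between_def)
  also have "\<dots> \<in> pc j t i"
    using k path_pc by (intro add_subgroup_sum[OF pc_group[OF assms(2,3)]]) (fastforce simp: paths_between_def)
  finally show "\<pi> u \<in> pc j t i" using poly_mapping_sum_singles[of "ks u" u] by simp
qed

text \<open>\<open>path_factor\<close> replaces elements by paths. So the translation conditions for
  the identity reduce to algebraic ones: bounded degree, top pieces of dimension at most one, and
  completion to degree n + 1 on either side.\<close>

lemma n_translation_identity:
  assumes top: "\<And>t. t > n + 1 \<Longrightarrow> comp A t = {0}"
    and one: "\<And>i. i \<in> VV \<Longrightarrow> \<exists>z\<in>CC. \<forall>b\<in>pc i (n + 1) i. \<exists>r. b = r *s z"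
    and right: "\<And>i j t u. i \<in> VV \<Longrightarrow> j \<in> VV \<Longrightarrow> t \<le> n + 1 \<Longrightarrow> u \<in> pc i t j \<Longrightarrow> u \<noteq> 0 \<Longrightarrow> \<exists>b\<in>pc j (n + 1 - t) i. u \<cdot> b \<noteq> 0"
    and left: "\<And>i j t u. i \<in> VV \<Longrightarrow> j \<in> VV \<Longrightarrow> t \<le> n + 1 \<Longrightarrow> u \<in> pc i t j \<Longrightarrow> u \<noteq> 0 \<Longrightarrow> \<exists>b\<in>pc j (n + 1 - t) i. b \<cdot> u \<noteq> 0"
  shows "n_translation n Q {} {} (\<lambda>i. i)"
proof -
  have ker: "x \<in> PA \<Longrightarrow> x \<notin> rel_ideal Q \<longleftrightarrow> \<pi> x \<noteq> 0" for x using kernel by blast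
  have 1: "\<exists>w\<in>paths_between Q (n + 1) i i. bound_path Q w" if i: "i \<in> VV" for i
  proof -
    have "ee i \<in> pc i 0 i" using i by (auto intro!: pcI idem_comp)
    then obtain b where b: "b \<in> pc i (n + 1 - 0) i" "ee i \<cdot> b \<noteq> 0" using right[OF i i, of 0 "ee i"] idem_nonzero[OF i] by auto
    then obtain w where "w \<in> paths_between Q (n + 1) i i" "ee i \<cdot> \<pi> (sg w 1) \<noteq> 0"
      using path_factor_right[OF b(1) i i _ b(2)] i by auto
    then show ?thesis using i by (intro bexI[of _ w]) (auto simp: bound_path_iff paths_between_def)
  qed
  \<comment> \<open>A bound path completes on the right to length n + 1. Maximality forces the
    completing path \<open>q\<close> to be trivial, so the path is itself a cycle of length n +
    1.\<close>
  have 2: "\<exists>i\<in>VV. w \<in> paths_between Q (n + 1) i i" if w: "maximal_bound_path Q w" for w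
  proof -
    have wp: "w \<in> paths Q" "\<pi> (sg w 1) \<noteq> 0" using w by (auto simp: maximal_bound_path_def bound_path_iff)
    have v: "fst w \<in> VV" "pend Q w \<in> VV" using path_verts[OF wp(1)] verts_eq by auto
    have pc: "\<pi> (sg w 1) \<in> pc (pend Q w) (plen w) (fst w)" by (rule path_pc[OF wp(1)])
    have le: "plen w \<le> n + 1" using top[of "plen w"] pcD(1)[OF pc] wp(2) by fastforce
    obtain b where b: "b \<in> pc (fst w) (n + 1 - plen w) (pend Q w)" "\<pi> (sg w 1) \<cdot> b \<noteq> 0"
      using right[OF v(2,1) le pc wp(2)] by blast
    obtain q where q: "q \<in> paths_between Q (n + 1 - plen w) (pend Q w) (fst w)" "\<pi> (sg w 1) \<cdot> \<pi> (sg q 1) \<noteq> 0"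
      using path_factor_right[OF b(1) v(2,1) pcD(4)[OF pc] b(2)] by blast
    have qp: "q \<in> paths Q" "plen q = n + 1 - plen w" "fst q = pend Q w" "pend Q q = fst w"
      using q by (auto simp: paths_between_def)
    have "bound_path Q (fst q, snd w @ snd q)"
      using q(2) qp wp path_concat[OF wp(1) qp(1)] by (simp flip: pi_mult add: bound_path_iff pm_single)
    moreover have "(pend Q w, []) \<in> paths Q" using v verts_eq trivial_path by simp
    ultimately have "plen q = 0"
      using w[unfolded maximal_bound_path_def, THEN conjunct2, rule_format, of "(pend Q w, [])" q] qp by auto
    then have "plen w = n + 1" "fst w = pend Q w" using le qp by (auto simp: pend_def)
    then show ?thesis using v wp(1) by (intro bexI[of _ "fst w"]) (auto simp: paths_between_def)
  qed
  \<comment> \<open>Both images are multiples of the same \<open>z\<close> and the second is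
    nonzero, so the first is a multiple of the second.\<close>
  have 3: "\<exists>a b. (a, b) \<noteq> (0, 0) \<and> sg w a + sg v b \<in> rel_ideal Q"
    if i: "i \<in> VV" and wv: "w \<in> paths_between Q (n + 1) i i" "v \<in> paths_between Q (n + 1) i i"
      "bound_path Q w \<and> bound_path Q v" for i w v
  proof -
    obtain z where z: "z \<in> CC" "\<forall>b\<in>pc i (n + 1) i. \<exists>r. b = r *s z" using one[OF i] by blast
    have p: "w \<in> paths Q" "v \<in> paths Q" "\<pi> (sg w 1) \<in> pc i (n + 1) i" "\<pi> (sg v 1) \<in> pc i (n + 1) i"
      using wv path_pc[of w 1] path_pc[of v 1] by (auto simp: paths_between_def)
    have "\<exists>r. \<pi> (sg w 1) = r *s \<pi> (sg v 1)"
    proof -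
      obtain r s where rs: "\<pi> (sg w 1) = r *s z" "\<pi> (sg v 1) = s *s z" using z p by metis
      have "s \<noteq> 0" using rs(2) wv z(1) by (auto simp: bound_path_iff)
      then have "r *s z = (r / s) *s (s *s z)" using z(1) by (simp add: scale_scale)
      then show ?thesis using rs by auto
    qed
    then obtain r where r: "\<pi> (sg w 1) = r *s \<pi> (sg v 1)" by blast
    have "\<pi> (sg w 1 + sg v (- r)) = 0"
      using p r pi_single_scale[of v "- r"] pcD(4)[OF p(4)] by (simp add: pi_add scale_minus)
    then show ?thesis using ker[of "sg w 1 + sg v (- r)"] p
      by (intro exI[of _ 1] exI[of _ "- r"]) auto
  qed
  have 4: "\<exists>w\<in>paths_between Q (n + 1 - t) i j. path_mult Q u (sg w 1) \<notin> rel_ideal Q"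
    if i: "i \<in> VV" "j \<in> VV" "t \<le> n + 1" and u: "u \<in> bound_elems Q t j i" for i j t u
  proof -
    note u' = bound_elems_pc[OF u i(2,1)]
    obtain b where b: "b \<in> pc j (n + 1 - t) i" "\<pi> u \<cdot> b \<noteq> 0" using right[OF i(1,2,3) u'(2,3)] by blast
    obtain w where w: "w \<in> paths_between Q (n + 1 - t) i j" "\<pi> u \<cdot> \<pi> (sg w 1) \<noteq> 0"
      using path_factor_right[OF b(1) i(1,2) pcD(4)[OF u'(2)] b(2)] by blast
    then show ?thesis using u'(1) ker[of "pm u (sg w 1)"]
      by (intro bexI[of _ w]) (auto simp: pi_mult paths_between_def)
  qed
  have 5: "\<exists>w\<in>paths_between Q (n + 1 - t) j i. path_mult Q (sg w 1) u \<notin> rel_ideal Q"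
    if i: "i \<in> VV" "j \<in> VV" "t \<le> n + 1" and u: "u \<in> bound_elems Q t i j" for i j t u
  proof -
    note u' = bound_elems_pc[OF u i(1,2)]
    obtain b where b: "b \<in> pc i (n + 1 - t) j" "b \<cdot> \<pi> u \<noteq> 0" using left[OF i(2,1,3) u'(2,3)] by blast
    obtain w where w: "w \<in> paths_between Q (n + 1 - t) j i" "\<pi> (sg w 1) \<cdot> \<pi> u \<noteq> 0"
      using path_factor_left[OF b(1) i(2,1) pcD(4)[OF u'(2)] b(2)] by blast
    then show ?thesis using u'(1) ker[of "pm (sg w 1) u"]
      by (intro bexI[of _ w]) (auto simp: pi_mult paths_between_def)
  qed
  have inv: "the_inv_into VV (\<lambda>i. i) i = i" if "i \<in> VV" for i
    by (rule the_inv_into_f_eq) (use that in auto)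
  show ?thesis
    unfolding n_translation_def verts_eq
    using 1 2 3 4 5 inv by (simp add: bij_betw_def)
qed

end

section \<open>Frobenius forms on self-injective algebras\<close>

text \<open>The Nakayama twist is required on idempotents; the whole automorphism is later
  constructed from nondegeneracy and local finiteness. \<open>form_twist\<close> is what makes the
  linear forms attached to elements locally finite.\<close>

locale frobenius_algebra = graded_algebra A
  for A :: "('k::field, 'v, 'a::ab_group_add) galgebra" +
  fixes m :: nat and \<theta> :: "'a \<Rightarrow> 'k" and \<nu> :: "'v \<Rightarrow> 'v"
  assumes form_add: "\<And>a b. a \<in> carrier A \<Longrightarrow> b \<in> carrier A \<Longrightarrow> \<theta> (a + b) = \<theta> a + \<theta> b"
    and form_scale: "\<And>r a. a \<in> carrier A \<Longrightarrow> \<theta> (scale A r a) = r * \<theta> a"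
    and form_degree: "\<And>a t. a \<in> comp A t \<Longrightarrow> t \<noteq> m \<Longrightarrow> \<theta> a = 0"
    and perm: "bij_betw \<nu> (vertices A) (vertices A)"
    and form_twist: "\<And>a i. a \<in> carrier A \<Longrightarrow> i \<in> vertices A \<Longrightarrow> \<theta> (mult A (idem A (\<nu> i)) a) = \<theta> (mult A a (idem A i))"
    and nondegenerate_left: "\<And>u. u \<in> carrier A \<Longrightarrow> u \<noteq> 0 \<Longrightarrow> \<exists>b\<in>carrier A. \<theta> (mult A b u) \<noteq> 0"
    and nondegenerate_right: "\<And>u. u \<in> carrier A \<Longrightarrow> u \<noteq> 0 \<Longrightarrow> \<exists>b\<in>carrier A. \<theta> (mult A u b) \<noteq> 0"

text \<open>The degree bound \<open>B\<close> makes multiplication by elements of degree 1 reach the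
  socle after finitely many steps.\<close>

locale self_injective_algebra = presented_algebra A E
  for A :: "('k::field, 'v, 'a::ab_group_add) galgebra" and E +
  fixes B :: nat
  assumes self_injective: "self_injective A"
    and bounded: "\<And>t. t > B \<Longrightarrow> comp A t = {0}"

lemma (in self_injective_algebra) opposite_self_injective_algebra: "self_injective_algebra (opposite A) E B"
proof -
  interpret op: presented_algebra "opposite A" E by (rule opposite_presented_algebra)
  show ?thesis
    by unfold_locales (use self_injective bounded in \<open>simp_all add: self_injective_def\<close>)
qed

lemma (in graded_algebra) opposite_pc: "graded_algebra.pc (opposite A) j t i = pc i t j"
proof -
  interpret op: graded_algebra "opposite A" by (rule opposite_graded_algebra)
  show ?thesis by (auto simp: op.pc_def pc_def)
qed

section \<open>Left and right socle elements\<close>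

context graded_algebra
begin

text \<open>Such an \<open>x\<close> spans a simple left ideal inside \<open>A e_i\<close>,
  isomorphic to the simple module at j: as degree 1 generates, only degree 0 acts on it
  nontrivially.\<close>

definition lsoc where "lsoc j t i x \<longleftrightarrow> x \<in> pc j t i \<and> x \<noteq> 0 \<and> (\<forall>b\<in>comp A 1. b \<cdot> x = 0)"
definition rsoc where "rsoc j t i x \<longleftrightarrow> x \<in> pc j t i \<and> x \<noteq> 0 \<and> (\<forall>b\<in>comp A 1. x \<cdot> b = 0)"

lemma opposite_lsoc: "graded_algebra.lsoc (opposite A) j t i x \<longleftrightarrow> rsoc i t j x"
proof -
  interpret op: graded_algebra "opposite A" by (rule opposite_graded_algebra)
  show ?thesis by (simp add: op.lsoc_def rsoc_def opposite_pc)
qed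

lemma annihilator_subgroup: "x \<in> CC \<Longrightarrow> add_subgroup {b \<in> CC. b \<cdot> x = 0}"
  by (auto simp: add_subgroup_def mult_diff_left)

text \<open>Generation from the right writes \<open>b\<close> as a sum of products whose last factor
  has degree 1 and already kills \<open>x\<close>.\<close>

lemma annihilated_degree:
  assumes x: "x \<in> CC" "\<forall>b\<in>comp A 1. b \<cdot> x = 0" and b: "b \<in> comp A (Suc t)"
  shows "b \<cdot> x = 0"
proof -
  have "add_span {c \<cdot> b | b c. b \<in> comp A 1 \<and> c \<in> comp A t} \<subseteq> {b \<in> CC. b \<cdot> x = 0}"
    by (rule add_span_least[OF _ annihilator_subgroup[OF x(1)]])
      (use x comp_CC in \<open>auto simp: mult_assoc\<close>)
  then show ?thesis using gen_right[of t] b by blast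
qed

text \<open>Only the degree 0 part of \<open>a\<close> acts, and only through its coefficient at
  \<open>ee j\<close>. The scalar depends on \<open>a\<close> and j alone, so sending one socle
  element at j to another is a module homomorphism.\<close>

lemma annihilated_scalar:
  assumes a: "a \<in> CC" and j: "j \<in> VV"
  obtains r where "\<And>x. x \<in> CC \<Longrightarrow> ee j \<cdot> x = x \<Longrightarrow> \<forall>b\<in>comp A 1. b \<cdot> x = 0 \<Longrightarrow> a \<cdot> x = r *s x"
proof -
  obtain r where r: "hc a 0 \<cdot> ee j = r *s ee j" using comp0_right[OF hc_comp[OF a] j] by blast
  show ?thesis
  proof (rule that)
    fix x assume x: "x \<in> CC" "ee j \<cdot> x = x" "\<forall>b\<in>comp A 1. b \<cdot> x = 0"
    obtain N where N: "\<forall>s\<ge>N. hc a s = 0" "a = (\<Sum>s<N. hc a s)" using hc_sum_ex[OF a] by blast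
    have "a \<cdot> x = (\<Sum>s<N. hc a s \<cdot> x)" using mult_sum_left[of x "{..<N}" "hc a"] x(1) a N(2) by simp
    also have "\<dots> = (\<Sum>s<N. if s = 0 then hc a 0 \<cdot> x else 0)"
    proof (intro sum.cong refl)
      fix s
      show "hc a s \<cdot> x = (if s = 0 then hc a 0 \<cdot> x else 0)"
        by (cases s) (use annihilated_degree[OF x(1,3)] hc_comp[OF a] in auto)
    qed
    also have "\<dots> = hc a 0 \<cdot> x" using N x by (cases "N = 0") auto
    also have "\<dots> = hc a 0 \<cdot> ee j \<cdot> x" using x a j mult_assoc[of "hc a 0" "ee j" x] by simp
    also have "\<dots> = r *s x" using r x j by (simp add: scale_mult_left)
    finally show "a \<cdot> x = r *s x" .
  qed
qed

end

context self_injective_algebra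
begin

text \<open>The homomorphism \<open>kx \<rightarrow> ky\<close> between simple left ideals extends to \<open>A\<close>, that is,
  it is the multiplication by an element on the right.\<close>

lemma lsoc_extend:
  assumes x: "lsoc j t i x" and y: "lsoc j s k y" and ijk: "i \<in> VV" "j \<in> VV" "k \<in> VV"
  shows "\<exists>c\<in>CC. y = x \<cdot> c"
proof -
  have x': "x \<in> CC" "ee j \<cdot> x = x" "x \<cdot> ee i = x" "x \<noteq> 0" "\<forall>b\<in>comp A 1. b \<cdot> x = 0"
    and y': "y \<in> CC" "ee j \<cdot> y = y" "\<forall>b\<in>comp A 1. b \<cdot> y = 0"
    using x y by (auto simp: lsoc_def dest: pcD)
  let ?M = "\<lparr>mcarrier = {r *s x | r. True}, act = mult A\<rparr> :: ('a, 'a) lmodule"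
  define f where "f u = (THE r. u = r *s x) *s y" for u
  have f: "f (r *s x) = r *s y" for r
    unfolding f_def using x' by (subst scale_cancel) auto
  have inj: "injective_module A (regular_module A)" using self_injective by (simp add: self_injective_def)
  then have N: "left_module A (regular_module A)" by (simp add: injective_module_def)
  have M: "left_module A ?M"
    unfolding left_module_def lmodule.simps
  proof (intro conjI ballI)
    show "add_subgroup {r *s x | r. True}"
      unfolding add_subgroup_def
    proof (intro conjI ballI)
      show "0 \<in> {r *s x | r. True}" using x' by (intro CollectI exI[of _ 0]) simp
      fix u v assume "u \<in> {r *s x | r. True}" "v \<in> {r *s x | r. True}"
      then show "u - v \<in> {r *s x | r. True}" using x' by (auto simp flip: scale_diff_left)
    qed
    fix a u assume a: "a \<in> CC" and u: "u \<in> {r *s x | r. True}"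
    obtain r where r: "a \<cdot> x = r *s x" using annihilated_scalar[OF a ijk(2)] x' by metis
    then show "a \<cdot> u \<in> {r *s x | r. True}" using a x' u by (auto simp: scale_mult_right scale_scale)
  next
    fix u assume "u \<in> {r *s x | r. True}"
    then show "\<exists>J. finite J \<and> J \<subseteq> VV \<and> u = (\<Sum>i\<in>J. ee i \<cdot> u)"
      using x' ijk by (intro exI[of _ "{j}"]) (auto simp: scale_mult_right)
  qed (use x' in \<open>auto simp: mult_add_left mult_add_right mult_assoc\<close>)
  have g: "module_hom A ?M (regular_module A) (\<lambda>u. u)" "inj_on (\<lambda>u. u) (mcarrier ?M)"
    using x' by (auto simp: module_hom_def regular_module_def)
  have fh: "module_hom A ?M (regular_module A) f"
    unfolding module_hom_def regular_module_def lmodule.simps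
  proof (intro conjI ballI)
    show "f ` {r *s x | r. True} \<subseteq> CC" using f y' by auto
    fix u assume u: "u \<in> {r *s x | r. True}"
    then obtain r where r: "u = r *s x" by blast
    show "f (u + v) = f u + f v" if "v \<in> {r *s x | r. True}" for v
      using that r x' y' by (auto simp: f simp flip: scale_add_left)
    fix a assume a: "a \<in> CC"
    obtain q where q: "a \<cdot> x = q *s x" "a \<cdot> y = q *s y" using annihilated_scalar[OF a ijk(2)] x' y' by metis
    show "f (a \<cdot> u) = a \<cdot> f u" using r a q x' y' by (simp add: f scale_mult_right scale_scale)
  qed
  obtain h where h: "module_hom A (regular_module A) (regular_module A) h" "\<forall>u\<in>mcarrier ?M. h u = f u"
    using inj[unfolded injective_module_def, THEN conjunct2, THEN spec, THEN spec, THEN spec, THEN spec, THEN mp,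
        of ?M "regular_module A" "\<lambda>u. u" f] M N g fh by blast
  have "x \<in> {r *s x | r. True}" using x' by (intro CollectI exI[of _ 1]) (simp add: scale_one)
  then have "h x = f x" using h(2) by simp
  also have "f x = y" using f[of 1] x' y' by (simp add: scale_one)
  finally have "y = h (x \<cdot> ee i)" using x' by simp
  also have "\<dots> = x \<cdot> h (ee i)"
  proof -
    have "\<forall>a\<in>CC. \<forall>b\<in>CC. h (a \<cdot> b) = a \<cdot> h b" using h(1) by (simp add: module_hom_def regular_module_def)
    then show ?thesis using x'(1) ijk by simp
  qed
  finally show ?thesis using h(1) ijk by (auto simp: module_hom_def regular_module_def image_subset_iff)
qed

text \<open>Both socle elements are homogeneous, so only the part of degree s - t of the factor from
  \<open>lsoc_extend\<close> contributes.\<close>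

lemma lsoc_degree_le:
  assumes x: "lsoc j t i x" and y: "lsoc j s k y" and ijk: "i \<in> VV" "j \<in> VV" "k \<in> VV"
  shows "t \<le> s \<and> (\<exists>c\<in>comp A (s - t). y = x \<cdot> c)"
proof -
  obtain c where c: "c \<in> CC" "y = x \<cdot> c" using lsoc_extend[OF assms] by blast
  have "x \<in> comp A t" "y \<in> comp A s" "y \<noteq> 0" using x y by (auto simp: lsoc_def dest: pcD)
  then have "y = (if t \<le> s then x \<cdot> hc c (s - t) else 0)"
    using hc_mult_left[of x t c s] hc_hom[of y s s] c by simp
  then show ?thesis using \<open>y \<noteq> 0\<close> hc_comp[OF c(1), of "s - t"] by (auto split: if_splits)
qed

text \<open>Comparing degrees both ways leaves a factor of degree 0, which is a scalar at the vertex
  i. So the simple module at j occurs in the socle of at most one \<open>A e_i\<close>, and there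
  only once.\<close>

lemma lsoc_unique:
  assumes x: "lsoc j t i x" and y: "lsoc j s k y" and ijk: "i \<in> VV" "j \<in> VV" "k \<in> VV"
  shows "s = t \<and> k = i \<and> (\<exists>r. y = r *s x)"
proof -
  have st: "s = t" using lsoc_degree_le[OF x y ijk] lsoc_degree_le[OF y x ijk(3,2,1)] by simp
  obtain c where c: "c \<in> comp A 0" "y = x \<cdot> c" using lsoc_degree_le[OF x y ijk] st by auto
  have x': "x \<in> CC" "x \<cdot> ee i = x" "x \<noteq> 0" "x \<in> pc j t i" using x by (auto simp: lsoc_def dest: pcD)
  obtain r where r: "ee i \<cdot> c = r *s ee i" using comp0_left[OF c(1) ijk(1)] by blast
  have "y = x \<cdot> ee i \<cdot> c" using c x' by simp
  also have "\<dots> = x \<cdot> (ee i \<cdot> c)" using x'(1) c comp_CC ijk by (simp add: mult_assoc)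
  finally have yr: "y = r *s x" using r x' ijk by (simp add: scale_mult_right)
  have "y \<cdot> ee k = y" "y \<noteq> 0" using y by (auto simp: lsoc_def dest: pcD)
  then have "x \<cdot> ee k \<noteq> 0" using yr x'(1) ijk by (auto simp: scale_mult_left)
  then have "k = i" using pc_vertex(2)[OF x'(4,3) ijk(1,2,3)] by (auto split: if_splits)
  with st yr show ?thesis by blast
qed

text \<open>Keep multiplying by elements of degree 1 as long as some product is nonzero; the degrees
  are bounded by \<open>B\<close>.\<close>

lemma lsoc_reach:
  assumes "u \<in> pc j t i" "u \<noteq> 0" "i \<in> VV" "j \<in> VV"
  shows "\<exists>k s b. k \<in> VV \<and> b \<in> pc k s j \<and> lsoc k (s + t) i (b \<cdot> u)"
  using assms
proof (induction "Suc B - t" arbitrary: u j t rule: less_induct)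
  case less
  note u = pcD[OF less.prems(1)]
  show ?case
  proof (cases "\<forall>b\<in>comp A 1. b \<cdot> u = 0")
    case True
    then have "lsoc j (0 + t) i (ee j \<cdot> u)" using less.prems u by (auto simp: lsoc_def)
    moreover have "ee j \<in> pc j 0 j" using less.prems by (auto intro!: pcI idem_comp)
    ultimately show ?thesis using less.prems by blast
  next
    case False
    then obtain b where b: "b \<in> comp A 1" "b \<cdot> u \<noteq> 0" by blast
    have bC: "b \<in> CC" using b comp_CC by blast
    obtain k where k: "k \<in> VV" "ee k \<cdot> (b \<cdot> u) \<noteq> 0" using nonzero_peirce_ex(1)[of "b \<cdot> u"] b bC u by auto
    let ?b = "ee k \<cdot> b \<cdot> ee j"
    have bp: "?b \<in> pc k 1 j" using pc_proj[OF b(1) less.prems(4) k(1)] .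
    have "?b \<cdot> u = ee k \<cdot> (b \<cdot> u)" using k bC u less.prems by (simp add: mult_assoc)
    then have nz: "?b \<cdot> u \<noteq> 0" using k by simp
    have p: "?b \<cdot> u \<in> pc k (1 + t) i" using pc_mult[OF bp less.prems(1)] less.prems k by blast
    have "t \<le> B" using bounded[of t] u(1) less.prems(2) by fastforce
    then have "Suc B - (1 + t) < Suc B - t" by linarith
    from less.hyps[OF this p nz less.prems(3) k(1)]
    obtain l s c where c: "l \<in> VV" "c \<in> pc l s k" "lsoc l (s + (1 + t)) i (c \<cdot> (?b \<cdot> u))" by blast
    have "c \<cdot> ?b \<in> pc l (s + 1) j" using pc_mult[OF c(2) bp] c k less.prems by blast
    moreover have "c \<cdot> (?b \<cdot> u) = c \<cdot> ?b \<cdot> u" using mult_assoc[of c ?b u] pcD(4)[OF c(2)] pcD(4)[OF bp] u by simp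
    ultimately have "l \<in> VV \<and> c \<cdot> ?b \<in> pc l (s + 1) j \<and> lsoc l (s + 1 + t) i (c \<cdot> ?b \<cdot> u)"
      using c by (simp add: add.assoc)
    then show ?thesis by blast
  qed
qed

text \<open>If \<open>x\<close> times some \<open>b\<close> of degree 1 were nonzero, a Peirce piece
  of the product would be another left socle element at j, in degree t + 1, against
  \<open>lsoc_unique\<close>.\<close>

lemma lsoc_rsoc:
  assumes x: "lsoc j t i x" and ij: "i \<in> VV" "j \<in> VV"
  shows "rsoc j t i x"
proof (rule ccontr)
  assume "\<not> rsoc j t i x"
  then obtain b where b: "b \<in> comp A 1" "x \<cdot> b \<noteq> 0" using x by (auto simp: lsoc_def rsoc_def)
  have xp: "x \<in> pc j t i" and ann: "\<forall>b\<in>comp A 1. b \<cdot> x = 0" using x by (auto simp: lsoc_def)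
  note x' = pcD[OF xp]
  have bC: "b \<in> CC" using b comp_CC by blast
  obtain k where k: "k \<in> VV" "x \<cdot> b \<cdot> ee k \<noteq> 0" using nonzero_peirce_ex(2)[of "x \<cdot> b"] b bC x' by auto
  let ?b = "ee i \<cdot> b \<cdot> ee k"
  have bp: "?b \<in> pc i 1 k" using pc_proj[OF b(1) k(1) ij(1)] .
  have "x \<cdot> ?b = x \<cdot> ee i \<cdot> b \<cdot> ee k" using k bC x'(4) ij by (simp add: mult_assoc)
  then have nz: "x \<cdot> ?b \<noteq> 0" using k x' by simp
  have "x \<cdot> ?b \<in> pc j (t + 1) k" using pc_mult[OF xp bp] ij k by blast
  moreover have "\<forall>c\<in>comp A 1. c \<cdot> (x \<cdot> ?b) = 0"
  proof
    fix c assume c: "c \<in> comp A 1"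
    have "c \<cdot> (x \<cdot> ?b) = c \<cdot> x \<cdot> ?b" using mult_assoc[of c x ?b] comp_CC[OF c] x'(4) pcD(4)[OF bp] by simp
    then show "c \<cdot> (x \<cdot> ?b) = 0" using ann c pcD(4)[OF bp] by simp
  qed
  ultimately have "lsoc j (t + 1) k (x \<cdot> ?b)" using nz by (simp add: lsoc_def)
  then have "t + 1 = t" using lsoc_unique[OF x _ ij k(1)] by blast
  then show False by simp
qed

end

context self_injective_algebra
begin

interpretation op: self_injective_algebra "opposite A" E B
  by (rule opposite_self_injective_algebra)

lemma rsoc_lsoc: "rsoc j t i x \<Longrightarrow> i \<in> VV \<Longrightarrow> j \<in> VV \<Longrightarrow> lsoc j t i x"
  using op.lsoc_rsoc[of i t j x] op.opposite_lsoc[of j t i x] opposite_lsoc[of i t j x]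
  by simp

lemma rsoc_unique: "rsoc j t i x \<Longrightarrow> rsoc k s i y \<Longrightarrow> i \<in> VV \<Longrightarrow> j \<in> VV \<Longrightarrow> k \<in> VV \<Longrightarrow>
  s = t \<and> k = j \<and> (\<exists>r. y = r *s x)"
  using op.lsoc_unique[of i t j x s k y] by (simp add: opposite_lsoc)

lemma rsoc_reach: "u \<in> pc j t i \<Longrightarrow> u \<noteq> 0 \<Longrightarrow> i \<in> VV \<Longrightarrow> j \<in> VV \<Longrightarrow>
  \<exists>k s b. k \<in> VV \<and> b \<in> pc i s k \<and> rsoc j (s + t) k (u \<cdot> b)"
  using op.lsoc_reach[of u i t j] by (simp add: opposite_lsoc opposite_pc)

text \<open>\<open>lsoc_reach\<close> from \<open>ee i\<close> gives a socle element ending at some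
  vertex, which becomes \<open>\<nu> i\<close>. Uniqueness of left socle elements makes
  \<open>\<nu>\<close> injective; right socle elements reached from \<open>ee j\<close> make it
  surjective.\<close>

lemma socle_data_ex:
  "\<exists>\<nu> mm z. bij_betw \<nu> VV VV \<and> (\<forall>i\<in>VV. lsoc (\<nu> i) (mm i) i (z i))"
proof -
  have "\<forall>i\<in>VV. \<exists>j t x. j \<in> VV \<and> lsoc j t i x"
  proof
    fix i assume i: "i \<in> VV"
    then have "ee i \<in> pc i 0 i" by (auto intro!: pcI idem_comp)
    then show "\<exists>j t x. j \<in> VV \<and> lsoc j t i x" using lsoc_reach[of "ee i" i 0 i] i idem_nonzero by blast
  qed
  then obtain \<nu> mm z where d: "\<And>i. i \<in> VV \<Longrightarrow> \<nu> i \<in> VV \<and> lsoc (\<nu> i) (mm i) i (z i)" by metis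
  have inj: "inj_on \<nu> VV"
  proof (rule inj_onI)
    fix i k assume ik: "i \<in> VV" "k \<in> VV" "\<nu> i = \<nu> k"
    have "lsoc (\<nu> i) (mm k) k (z k)" using d[OF ik(2)] ik by simp
    then show "i = k" using lsoc_unique[OF conjunct2[OF d[OF ik(1)]]] d ik by blast
  qed
  have surj: "j \<in> \<nu> ` VV" if j: "j \<in> VV" for j
  proof -
    have "ee j \<in> pc j 0 j" using j by (auto intro!: pcI idem_comp)
    then obtain i t x where i: "i \<in> VV" "rsoc j t i x"
      using rsoc_reach[of "ee j" j 0 j] j idem_nonzero by blast
    have "rsoc (\<nu> i) (mm i) i (z i)" using lsoc_rsoc d[OF i(1)] i(1) by blast
    then have "\<nu> i = j" using rsoc_unique[OF i(2) _ i(1) j] d[OF i(1)] by blast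
    then show ?thesis using i by blast
  qed
  have "bij_betw \<nu> VV VV" unfolding bij_betw_def using inj surj d by blast
  then show ?thesis using d by blast
qed

end

section \<open>Socle degrees and the Frobenius form\<close>

locale socle_data = self_injective_algebra A E B
  for A :: "('k::field, 'v, 'a::ab_group_add) galgebra" and E B +
  fixes \<nu> mm z
  assumes nu: "bij_betw \<nu> (vertices A) (vertices A)"
    and z: "\<And>i. i \<in> vertices A \<Longrightarrow> lsoc (\<nu> i) (mm i) i (z i)"
begin

lemma nu_VV[simp]: "i \<in> VV \<Longrightarrow> \<nu> i \<in> VV" using nu by (auto simp: bij_betw_def)
lemma nu_inj: "i \<in> VV \<Longrightarrow> j \<in> VV \<Longrightarrow> \<nu> i = \<nu> j \<longleftrightarrow> i = j"
  using nu by (auto simp: bij_betw_def inj_on_def)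
lemma nu_surj: "j \<in> VV \<Longrightarrow> \<exists>i\<in>VV. \<nu> i = j" using nu by (metis bij_betw_imp_surj_on imageE)

lemma z_pc: "i \<in> VV \<Longrightarrow> z i \<in> pc (\<nu> i) (mm i) i" "i \<in> VV \<Longrightarrow> z i \<noteq> 0"
  using z by (auto simp: lsoc_def)

text \<open>Any nonzero \<open>u\<close> can be driven into the socle of \<open>A e_i\<close>, which
  is the line spanned by \<open>z i\<close>; the scalar is absorbed in the cofactor.\<close>

lemma extend_left:
  assumes "u \<in> pc j t i" "u \<noteq> 0" "i \<in> VV" "j \<in> VV"
  shows "t \<le> mm i \<and> (\<exists>b\<in>pc (\<nu> i) (mm i - t) j. b \<cdot> u = z i)"
proof -
  obtain k s b where b: "k \<in> VV" "b \<in> pc k s j" "lsoc k (s + t) i (b \<cdot> u)" using lsoc_reach[OF assms] by blast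
  have "rsoc k (s + t) i (b \<cdot> u)" "rsoc (\<nu> i) (mm i) i (z i)" using lsoc_rsoc b z assms by auto
  then obtain r where r: "mm i = s + t" "\<nu> i = k" "z i = r *s (b \<cdot> u)"
    using rsoc_unique[of k "s + t" i "b \<cdot> u" "\<nu> i" "mm i" "z i"] b assms by auto
  have "r *s b \<in> pc (\<nu> i) (mm i - t) j" using pc_scale[OF assms(4) b(1) b(2)] r by simp
  moreover have "(r *s b) \<cdot> u = z i" using r pcD(4)[OF b(2)] pcD(4)[OF assms(1)] by (simp add: scale_mult_left)
  ultimately show ?thesis using r by auto
qed

lemma extend_right:
  assumes "u \<in> pc (\<nu> l) t i" "u \<noteq> 0" "i \<in> VV" "l \<in> VV"
  shows "t \<le> mm l \<and> (\<exists>c\<in>pc i (mm l - t) l. u \<cdot> c = z l)"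
proof -
  obtain k s b where b: "k \<in> VV" "b \<in> pc i s k" "rsoc (\<nu> l) (s + t) k (u \<cdot> b)"
    using rsoc_reach[OF assms(1-3)] assms(4) by auto
  have "lsoc (\<nu> l) (s + t) k (u \<cdot> b)" using rsoc_lsoc[OF b(3)] b assms by simp
  then obtain r where r: "mm l = s + t" "l = k" "z l = r *s (u \<cdot> b)"
    using lsoc_unique[of "\<nu> l" "s + t" k "u \<cdot> b" "mm l" l "z l"] b z assms by auto
  have "r *s b \<in> pc i (mm l - t) l" using pc_scale[OF b(1) assms(3) b(2)] r by simp
  moreover have "u \<cdot> (r *s b) = z l" using r pcD(4)[OF b(2)] pcD(4)[OF assms(1)] by (simp add: scale_mult_right)
  ultimately show ?thesis using r by auto
qed

text \<open>Complete \<open>b\<close> on the right to z j = b x, then \<open>x\<close> on the right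
  to z l = x c. The degrees of the two completions give the equation for s.\<close>

lemma shift_left:
  assumes "b \<in> pc (\<nu> j) t (\<nu> l)" "b \<noteq> 0" "j \<in> VV" "l \<in> VV"
  shows "\<exists>s. s + mm j = mm l + t \<and> (\<exists>c\<in>pc j s l. c \<noteq> 0)"
proof -
  obtain x where x: "t \<le> mm j" "x \<in> pc (\<nu> l) (mm j - t) j" "b \<cdot> x = z j" using extend_right[OF assms(1,2)] assms by auto
  have "x \<noteq> 0" using x z_pc[OF assms(3)] pcD(4)[OF assms(1)] by auto
  then obtain c where c: "mm j - t \<le> mm l" "c \<in> pc j (mm l - (mm j - t)) l" "x \<cdot> c = z l"
    using extend_right[OF x(2)] assms by auto
  have "c \<noteq> 0" using c z_pc[OF assms(4)] pcD(4)[OF x(2)] by auto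
  then show ?thesis using c x by (intro exI[of _ "mm l - (mm j - t)"]) auto
qed

lemma shift_right:
  assumes "c \<in> pc j s l" "c \<noteq> 0" "j \<in> VV" "l \<in> VV"
  shows "\<exists>t. t + mm l = mm j + s \<and> (\<exists>b\<in>pc (\<nu> j) t (\<nu> l). b \<noteq> 0)"
proof -
  obtain x where x: "s \<le> mm l" "x \<in> pc (\<nu> l) (mm l - s) j" "x \<cdot> c = z l" using extend_left[OF assms(1,2)] assms by auto
  have "x \<noteq> 0" using x z_pc[OF assms(4)] pcD(4)[OF assms(1)] by auto
  then obtain b where b: "mm l - s \<le> mm j" "b \<in> pc (\<nu> j) (mm j - (mm l - s)) (\<nu> l)" "b \<cdot> x = z j"
    using extend_left[OF x(2)] assms by auto
  have "b \<noteq> 0" using b z_pc[OF assms(3)] pcD(4)[OF x(2)] by auto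
  then show ?thesis using b x by (intro exI[of _ "mm j - (mm l - s)"]) auto
qed

text \<open>If all products of Peirce elements of degrees 1 and t vanished, then so would
  \<open>ee j \<cdot> (b \<cdot> c) \<cdot> ee i\<close> for all b and c of these degrees, as is
  seen by inserting a local unit between the factors.\<close>

lemma pc_factor:
  assumes b: "b \<in> pc j (Suc t) i" "b \<noteq> 0" and ij: "i \<in> VV" "j \<in> VV"
  shows "\<exists>k\<in>VV. \<exists>b1\<in>pc j 1 k. \<exists>c1\<in>pc k t i. b1 \<cdot> c1 \<noteq> 0"
proof (rule ccontr)
  assume no: "\<not> ?thesis"
  have sub: "add_subgroup {x \<in> CC. ee j \<cdot> x \<cdot> ee i = 0}"
    using ij by (auto simp: add_subgroup_def mult_diff_left mult_diff_right)
  have "add_span {b \<cdot> c | b c. b \<in> comp A 1 \<and> c \<in> comp A t} \<subseteq> {x \<in> CC. ee j \<cdot> x \<cdot> ee i = 0}"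
  proof (rule add_span_least[OF _ sub], clarify, intro conjI)
    fix b c assume bc: "b \<in> comp A 1" "c \<in> comp A t"
    then have C: "b \<in> CC" "c \<in> CC" using comp_CC by blast+
    then show "b \<cdot> c \<in> CC" by simp
    obtain J where J: "finite J" "J \<subseteq> VV" "uu J \<cdot> c = c" using C(2) by (rule unit_obtain)
    have "ee j \<cdot> (b \<cdot> c) \<cdot> ee i = ee j \<cdot> (b \<cdot> (\<Sum>k\<in>J. ee k \<cdot> c)) \<cdot> ee i"
      using unit_sum(1)[OF J(1,2) C(2)] J(3) by simp
    also have "\<dots> = (\<Sum>k\<in>J. ee j \<cdot> (b \<cdot> (ee k \<cdot> c)) \<cdot> ee i)"
    proof -
      have k: "k \<in> J \<Longrightarrow> k \<in> VV" for k using J by auto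
      have "b \<cdot> (\<Sum>k\<in>J. ee k \<cdot> c) = (\<Sum>k\<in>J. b \<cdot> (ee k \<cdot> c))"
        using C k by (intro mult_sum_right) auto
      moreover have "ee j \<cdot> (\<Sum>k\<in>J. b \<cdot> (ee k \<cdot> c)) = (\<Sum>k\<in>J. ee j \<cdot> (b \<cdot> (ee k \<cdot> c)))"
        using C k ij by (intro mult_sum_right) auto
      moreover have "(\<Sum>k\<in>J. ee j \<cdot> (b \<cdot> (ee k \<cdot> c))) \<cdot> ee i = (\<Sum>k\<in>J. ee j \<cdot> (b \<cdot> (ee k \<cdot> c)) \<cdot> ee i)"
        using C k ij by (intro mult_sum_left) auto
      ultimately show ?thesis by simp
    qed
    also have "\<dots> = 0"
    proof (intro sum.neutral ballI)
      fix k assume "k \<in> J"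
      then have k: "k \<in> VV" using J by auto
      let ?b = "ee j \<cdot> b \<cdot> ee k" and ?c = "ee k \<cdot> c \<cdot> ee i"
      have "?b \<in> pc j 1 k" "?c \<in> pc k t i" using pc_proj bc ij k by auto
      then have "?b \<cdot> ?c = 0" using no k by blast
      moreover have "?b \<cdot> ?c = ee j \<cdot> (b \<cdot> (ee k \<cdot> c)) \<cdot> ee i"
        using C ij k by (simp add: mult_assoc)
      ultimately show "ee j \<cdot> (b \<cdot> (ee k \<cdot> c)) \<cdot> ee i = 0" by simp
    qed
    finally show "ee j \<cdot> (b \<cdot> c) \<cdot> ee i = 0" .
  qed
  then have "ee j \<cdot> b \<cdot> ee i = 0" using gen_left[of t] pcD(1)[OF b(1)] by blast
  then show False using pcD[OF b(1)] b(2) by simp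
qed

text \<open>In degree 1, \<open>shift_left\<close> yields s with s + \<open>mm j\<close> =
  \<open>mm p\<close> + 1. Either s is positive and the inequality follows, or s = 0 and the two
  vertices agree. Higher degrees are factored by \<open>pc_factor\<close>.\<close>

lemma degree_along_nu_path:
  "b \<in> pc (\<nu> j) t (\<nu> l) \<Longrightarrow> b \<noteq> 0 \<Longrightarrow> j \<in> VV \<Longrightarrow> l \<in> VV \<Longrightarrow> mm j \<le> mm l"
proof (induction t arbitrary: b j)
  case 0
  then have "\<nu> l = \<nu> j" using pc0[of b "\<nu> j" "\<nu> l"] by simp
  then show ?case using nu_inj 0 by auto
next
  case (Suc t)
  obtain k b1 c1 where k: "k \<in> VV" "b1 \<in> pc (\<nu> j) 1 k" "c1 \<in> pc k t (\<nu> l)" "b1 \<cdot> c1 \<noteq> 0"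
    using pc_factor[OF Suc.prems(1,2)] Suc.prems(3,4) by auto
  obtain p where p: "p \<in> VV" "\<nu> p = k" using nu_surj[OF k(1)] by blast
  have nz: "b1 \<noteq> 0" "c1 \<noteq> 0" using k pcD(4)[OF k(2)] pcD(4)[OF k(3)] by auto
  have "mm p \<le> mm l" using Suc.IH[of c1 p] k p nz Suc.prems by auto
  moreover have "mm j \<le> mm p"
  proof -
    obtain s c where s: "s + mm j = mm p + 1" "c \<in> pc j s p" "c \<noteq> 0"
      using shift_left[of b1 j 1 p] k p nz Suc.prems by auto
    show ?thesis
    proof (cases "s = 0")
      case True
      then have "p = j" using pc0[of c j p] s p Suc.prems by auto
      then show ?thesis by simp
    qed (use s in auto)
  qed
  ultimately show ?case by simp
qed

text \<open>\<open>shift_right\<close> gives t + \<open>mm l\<close> = \<open>mm j\<close> + 1, so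
  \<open>mm l\<close> is at most \<open>mm j\<close> unless t = 0, in which case j = l. The nonzero
  element of degree t between the shifted vertices gives the converse inequality.\<close>

lemma degree_along_arrow:
  assumes "c \<in> pc j 1 l" "c \<noteq> 0" "j \<in> VV" "l \<in> VV"
  shows "mm j = mm l"
proof -
  obtain t b where b: "t + mm l = mm j + 1" "b \<in> pc (\<nu> j) t (\<nu> l)" "b \<noteq> 0" using shift_right[OF assms] by blast
  have le: "mm j \<le> mm l" using degree_along_nu_path[OF b(2,3) assms(3,4)] .
  show ?thesis
  proof (cases "t = 0")
    case True
    then have "\<nu> l = \<nu> j" using pc0[of b "\<nu> j" "\<nu> l"] b assms by auto
    then show ?thesis using nu_inj assms by auto
  qed (use b le in auto)
qed

lemma degree_constant: "i \<in> VV \<Longrightarrow> j \<in> VV \<Longrightarrow> mm i = mm j"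
proof -
  assume ij: "i \<in> VV" "j \<in> VV"
  let ?R = "{(i, j) | i j x. i \<in> VV \<and> j \<in> VV \<and> x \<in> E \<and> ee j \<cdot> x = x \<and> x \<cdot> ee i = x}"
  have "mm j = mm i" if "i \<in> VV" "j \<in> VV" "x \<in> E" "ee j \<cdot> x = x" "x \<cdot> ee i = x" for i j x
    using that arrows_comp by (intro degree_along_arrow[of x] pcI arrow_nonzero) auto
  then have R: "mm i = mm j" if "(i, j) \<in> ?R \<union> ?R\<inverse>" for i j
    using that by auto
  have "(i, j) \<in> (?R \<union> ?R\<inverse>)\<^sup>*" using arrows_connected[OF ij] unfolding Let_def .
  then show "mm i = mm j"
  proof induction
    case (step y z)
    then show ?case using R[OF step.hyps(2)] by simp
  qed simp
qed

definition top :: nat where "top = mm (SOME i. i \<in> VV)"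

lemma mm_top: "i \<in> VV \<Longrightarrow> mm i = top"
  unfolding top_def using degree_constant[of i "SOME i. i \<in> VV"] someI[of "\<lambda>i. i \<in> VV" i] by blast

lemma pc_top:
  assumes "a \<in> pc (\<nu> i) top i" "i \<in> VV"
  shows "\<exists>r. a = r *s z i"
proof (cases "a = 0")
  case True then show ?thesis using z_pc[OF assms(2)] pcD(4) by (intro exI[of _ 0]) auto
next
  case False
  obtain b where b: "b \<in> pc (\<nu> i) 0 (\<nu> i)" "b \<cdot> a = z i"
    using extend_left[OF assms(1) False] assms mm_top[OF assms(2)] by auto
  obtain r where r: "b = r *s ee (\<nu> i)" using pc0[OF b(1)] assms by auto
  have "z i = r *s a" using b r pcD[OF assms(1)] assms by (simp add: scale_mult_left)
  then have "r \<noteq> 0" "a = inverse r *s z i" using z_pc[OF assms(2)] pcD(4)[OF assms(1)]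
    by (auto simp: scale_scale) (metis scale_one right_inverse left_inverse scale_zero(2) scale_scale)
  then show ?thesis by blast
qed

text \<open>\<open>pc_top\<close> makes this coordinate on the socle line of \<open>A e_i\<close>
  well defined.\<close>

definition cf where "cf i a = (THE r. ee (\<nu> i) \<cdot> hc a top \<cdot> ee i = r *s z i)"

lemma cf_eq: "i \<in> VV \<Longrightarrow> ee (\<nu> i) \<cdot> hc a top \<cdot> ee i = r *s z i \<Longrightarrow> cf i a = r"
  unfolding cf_def using z_pc[of i] pcD(4)[of "z i"] by (auto simp: scale_cancel)

lemma cf: "a \<in> CC \<Longrightarrow> i \<in> VV \<Longrightarrow> ee (\<nu> i) \<cdot> hc a top \<cdot> ee i = cf i a *s z i"
  using pc_top[OF pc_proj[OF hc_comp]] cf_eq by (metis nu_VV)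

lemma cf_add: "a \<in> CC \<Longrightarrow> b \<in> CC \<Longrightarrow> i \<in> VV \<Longrightarrow> cf i (a + b) = cf i a + cf i b"
  using cf[of a i] cf[of b i] z_pc[of i] pcD(4)
  by (intro cf_eq) (auto simp: hc_add mult_add_left mult_add_right scale_add_left)

lemma cf_scale: "a \<in> CC \<Longrightarrow> i \<in> VV \<Longrightarrow> cf i (r *s a) = r * cf i a"
  using cf[of a i] z_pc[of i] pcD(4)
  by (intro cf_eq) (auto simp: hc_scale scale_mult_left scale_mult_right scale_scale)

text \<open>The sum of all socle coordinates. The restricted index set is finite by the local units,
  and the coordinates at other vertices are zero.\<close>

definition theta where "theta a = (\<Sum>i | i \<in> VV \<and> hc a top \<cdot> ee i \<noteq> 0. cf i a)"

lemma theta_sum: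
  assumes a: "a \<in> CC" and J: "finite J" "J \<subseteq> VV" "hc a top \<cdot> uu J = hc a top"
  shows "theta a = (\<Sum>i\<in>J. cf i a)"
  unfolding theta_def
proof (rule sum.mono_neutral_left[OF J(1)])
  show "{i. i \<in> VV \<and> hc a top \<cdot> ee i \<noteq> 0} \<subseteq> J"
    using unit_support(2)[of "hc a top" _ J] a J by auto
  show "\<forall>i\<in>J - {i. i \<in> VV \<and> hc a top \<cdot> ee i \<noteq> 0}. cf i a = 0"
  proof
    fix i assume i: "i \<in> J - {i. i \<in> VV \<and> hc a top \<cdot> ee i \<noteq> 0}"
    then have "i \<in> VV" "hc a top \<cdot> ee i = 0" using J by auto
    then show "cf i a = 0" using a z_pc[of i] pcD(4)
      by (intro cf_eq) (auto simp: mult_assoc)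
  qed
qed

lemma theta_add: "a \<in> CC \<Longrightarrow> b \<in> CC \<Longrightarrow> theta (a + b) = theta a + theta b"
proof -
  assume ab: "a \<in> CC" "b \<in> CC"
  have "{hc a top, hc b top, hc (a + b) top} \<subseteq> CC" using ab by simp
  from common_unit_ex[OF _ this] obtain J where J: "finite J" "J \<subseteq> VV"
    "\<forall>c\<in>{hc a top, hc b top, hc (a + b) top}. uu J \<cdot> c = c \<and> c \<cdot> uu J = c"
    by blast
  have "theta (a + b) = (\<Sum>i\<in>J. cf i (a + b))" using theta_sum[of "a + b" J] J ab by simp
  also have "\<dots> = (\<Sum>i\<in>J. cf i a + cf i b)" using J ab by (intro sum.cong refl cf_add) auto
  also have "\<dots> = theta a + theta b" using theta_sum[of a J] theta_sum[of b J] J ab by (simp add: sum.distrib)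
  finally show ?thesis .
qed

lemma theta_scale: "a \<in> CC \<Longrightarrow> theta (r *s a) = r * theta a"
proof -
  assume a: "a \<in> CC"
  have "{hc a top, hc (r *s a) top} \<subseteq> CC" using a by simp
  from common_unit_ex[OF _ this] obtain J where J: "finite J" "J \<subseteq> VV"
    "\<forall>c\<in>{hc a top, hc (r *s a) top}. uu J \<cdot> c = c \<and> c \<cdot> uu J = c"
    by blast
  have "theta (r *s a) = (\<Sum>i\<in>J. cf i (r *s a))" using theta_sum[of "r *s a" J] J a by simp
  also have "\<dots> = (\<Sum>i\<in>J. r * cf i a)" using J a by (intro sum.cong refl cf_scale) auto
  also have "\<dots> = r * theta a" using theta_sum[of a J] J a by (simp add: sum_distrib_left)
  finally show ?thesis .
qed

lemma theta_mult_ee: "a \<in> CC \<Longrightarrow> i \<in> VV \<Longrightarrow> theta (a \<cdot> ee i) = cf i a"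
proof -
  assume a: "a \<in> CC" "i \<in> VV"
  have "theta (a \<cdot> ee i) = (\<Sum>k\<in>{i}. cf k (a \<cdot> ee i))"
    using a by (intro theta_sum) (auto simp: hc_ee uu_def)
  also have "(\<Sum>k\<in>{i}. cf k (a \<cdot> ee i)) = cf i (a \<cdot> ee i)" by simp
  also have "\<dots> = cf i a"
  proof (rule cf_eq[OF a(2)])
    have "ee (\<nu> i) \<cdot> (hc a top \<cdot> ee i) \<cdot> ee i = ee (\<nu> i) \<cdot> hc a top \<cdot> ee i" using a by (simp add: mult_assoc)
    then show "ee (\<nu> i) \<cdot> hc (a \<cdot> ee i) top \<cdot> ee i = cf i a *s z i" using a cf[OF a] by (simp add: hc_ee)
  qed
  finally show ?thesis using a by simp
qed

text \<open>Multiplying by \<open>ee (\<nu> i)\<close> on the left keeps exactly the coordinate at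
  i, because \<open>\<nu>\<close> is injective. Together with \<open>theta_mult_ee\<close> this is
  the twist of the form on idempotents.\<close>

lemma theta_ee_mult: "a \<in> CC \<Longrightarrow> i \<in> VV \<Longrightarrow> theta (ee (\<nu> i) \<cdot> a) = cf i a"
proof -
  assume a: "a \<in> CC" "i \<in> VV"
  let ?b = "hc (ee (\<nu> i) \<cdot> a) top"
  obtain J where J: "finite J" "J \<subseteq> VV" "?b \<cdot> uu J = ?b"
    by (rule unit_obtain[of ?b]) (use a in auto)
  let ?J = "insert i J"
  have J': "finite ?J" "?J \<subseteq> VV" "?b \<cdot> uu ?J = ?b" using J a unit_mono(2)[of J ?J ?b] by auto
  have "theta (ee (\<nu> i) \<cdot> a) = (\<Sum>k\<in>?J. cf k (ee (\<nu> i) \<cdot> a))" using theta_sum[OF _ J'] a by simp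
  also have "\<dots> = (\<Sum>k\<in>?J. if k = i then cf i a else 0)"
  proof (intro sum.cong refl cf_eq)
    fix k assume "k \<in> ?J"
    then show k: "k \<in> VV" using J' by auto
    have "ee (\<nu> k) \<cdot> (ee (\<nu> i) \<cdot> hc a top) = (if k = i then ee (\<nu> i) \<cdot> hc a top else 0)"
      using a k mult_assoc[of "ee (\<nu> k)" "ee (\<nu> i)" "hc a top"] by (auto simp: idem_mult nu_inj)
    then show "ee (\<nu> k) \<cdot> hc (ee (\<nu> i) \<cdot> a) top \<cdot> ee k = (if k = i then cf i a else 0) *s z k"
      using a k cf[OF a] z_pc[OF k] pcD(4) by (auto simp: hc_ee)
  qed
  also have "\<dots> = cf i a" using J'(1) by simp
  finally show ?thesis .
qed

lemma frobenius: "frobenius_algebra A top theta \<nu>"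
proof
  show "theta (a + b) = theta a + theta b" if "a \<in> CC" "b \<in> CC" for a b using that by (rule theta_add)
  show "theta (r *s a) = r * theta a" if "a \<in> CC" for a r using that by (rule theta_scale)
  show "theta a = 0" if "a \<in> comp A t" "t \<noteq> top" for a t
    using that hc_hom[of a t top] by (auto simp: theta_def intro!: sum.neutral)
  show "bij_betw \<nu> VV VV" by (rule nu)
  show "theta (ee (\<nu> i) \<cdot> a) = theta (a \<cdot> ee i)" if "a \<in> CC" "i \<in> VV" for a i
    using that by (simp add: theta_ee_mult theta_mult_ee)
  \<comment> \<open>Nondegeneracy: some Peirce piece of a homogeneous part of \<open>u\<close> is
    nonzero. A cofactor that completes this piece to a socle generator carries the right
    idempotents, so it isolates the piece and the form takes the value 1.\<close>
  fix u assume u: "u \<in> CC" "u \<noteq> 0"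
  then obtain t where t: "hc u t \<noteq> 0" using hc_all_zero by blast
  obtain j where j: "j \<in> VV" "ee j \<cdot> hc u t \<noteq> 0" using nonzero_peirce_ex(1)[OF hc_CC[OF u(1)] t] by blast
  obtain i where i: "i \<in> VV" "ee j \<cdot> hc u t \<cdot> ee i \<noteq> 0"
    using nonzero_peirce_ex(2)[OF _ j(2)] j(1) u by auto
  let ?w = "ee j \<cdot> hc u t \<cdot> ee i"
  have w: "?w \<in> pc j t i" using pc_proj[OF hc_comp[OF u(1)] i(1) j(1)] .
  obtain b where b: "t \<le> top" "b \<in> pc (\<nu> i) (top - t) j" "b \<cdot> ?w = z i"
    using extend_left[OF w i(2) i(1) j(1)] mm_top[OF i(1)] by auto
  note b' = pcD[OF b(2)]
  have "hc (b \<cdot> u) top = b \<cdot> hc u t" using hc_mult_left[OF b'(1) u(1), of top] b(1) by simp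
  moreover have "ee (\<nu> i) \<cdot> (b \<cdot> hc u t) \<cdot> ee i = b \<cdot> ?w"
    using b' u i j mult_assoc[of "ee (\<nu> i)" b "hc u t"] mult_assoc[of b "ee j" "hc u t"]
      mult_assoc[of b "ee j \<cdot> hc u t" "ee i"] by simp
  ultimately have "cf i (b \<cdot> u) = 1"
    using b(3) z_pc[OF i(1)] pcD(4) by (intro cf_eq[OF i(1)]) (auto simp: scale_one)
  moreover have "theta (b \<cdot> u) = cf i (b \<cdot> u)"
    using theta_ee_mult[of "b \<cdot> u" i] b' u i mult_assoc[of "ee (\<nu> i)" b u] by simp
  ultimately show "\<exists>b\<in>CC. theta (b \<cdot> u) \<noteq> 0" using b' by (intro bexI[of _ b]) auto
  \<comment> \<open>On the right the completed element ends at j, so the index of the socle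
    generator is the preimage of j under \<open>\<nu>\<close>.\<close>
  obtain l where l: "l \<in> VV" "\<nu> l = j" using nu_surj[OF j(1)] by blast
  obtain c where c: "t \<le> top" "c \<in> pc i (top - t) l" "?w \<cdot> c = z l"
    using extend_right[of ?w l t i] w i l mm_top[OF l(1)] by auto
  note c' = pcD[OF c(2)]
  have "hc (u \<cdot> c) top = hc u t \<cdot> c" using hc_mult_right[OF c'(1) u(1), of top] c(1) by simp
  moreover have "ee j \<cdot> (hc u t \<cdot> c) \<cdot> ee l = ?w \<cdot> c"
    using c' u i j l by (simp add: mult_assoc)
  ultimately have "cf l (u \<cdot> c) = 1"
    using c(3) z_pc[OF l(1)] pcD(4) l by (intro cf_eq[OF l(1)]) (auto simp: scale_one)
  moreover have "theta (u \<cdot> c) = cf l (u \<cdot> c)"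
    using theta_mult_ee[of "u \<cdot> c" l] c' u l mult_assoc[of u c "ee l"] by simp
  ultimately show "\<exists>b\<in>CC. theta (u \<cdot> b) \<noteq> 0" using c' by (intro bexI[of _ c]) auto
qed

end

lemma (in self_injective_algebra) frobenius_ex: "\<exists>m \<theta> \<nu>. frobenius_algebra A m \<theta> \<nu>"
proof -
  obtain \<nu> mm z where d: "bij_betw \<nu> VV VV" "\<forall>i\<in>VV. lsoc (\<nu> i) (mm i) i (z i)" using socle_data_ex by blast
  interpret socle_data A E B \<nu> mm z by unfold_locales (use d in auto)
  show ?thesis using frobenius by blast
qed

section \<open>The trivial extension of a Frobenius algebra\<close>

context graded_algebra
begin

lemma comp_of_hc:
  assumes a: "a \<in> CC" and h: "\<And>s. s \<noteq> t \<Longrightarrow> hc a s = 0"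
  shows "a \<in> comp A t"
proof -
  have "hc (a - hc a t) s = 0" for s
  proof -
    have "hc (a - hc a t) s = hc a s - hc (hc a t) s" by (rule component_diff[OF grading a hc_CC[OF a]])
    also have "hc (hc a t) s = (if s = t then hc a t else 0)" by (rule hc_hom[OF hc_comp[OF a]])
    also have "hc a s - \<dots> = 0" by (cases "s = t") (simp_all add: h)
    finally show ?thesis .
  qed
  then have "a - hc a t = 0" by (rule hc_all_zero[rotated]) (use a in simp)
  then show ?thesis using hc_comp[OF a, of t] by simp
qed

definition kspan :: "'a set \<Rightarrow> 'a set" where "kspan X = add_span {r *s x | r x. x \<in> X}"

lemma kspan_base: "x \<in> X \<Longrightarrow> r *s x \<in> kspan X"
  unfolding kspan_def by (rule add_span_base) blast

lemma kspan_add: "u \<in> kspan X \<Longrightarrow> v \<in> kspan X \<Longrightarrow> u + v \<in> kspan X"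
  unfolding kspan_def by (rule add_span_add)

lemma kspan_zero: "0 \<in> kspan X"
  unfolding kspan_def by (rule add_span.zero)

lemma kspan_sum: "(\<And>i. i \<in> I \<Longrightarrow> f i \<in> kspan X) \<Longrightarrow> sum f I \<in> kspan X"
  unfolding kspan_def by (rule add_span_sum)

lemma kspan_induct[consumes 2, case_names zero add scale]:
  assumes "u \<in> kspan X" and X: "X \<subseteq> CC" and P0: "P 0"
    and Padd: "\<And>u v. u \<in> CC \<Longrightarrow> v \<in> CC \<Longrightarrow> P u \<Longrightarrow> P v \<Longrightarrow> P (u + v)" and Pscale: "\<And>r x. x \<in> X \<Longrightarrow> P (r *s x)"
  shows "u \<in> CC \<and> P u"
  using assms(1) unfolding kspan_def
proof induction
  case (step x y)
  then obtain r z where z: "x = r *s z" "z \<in> X" by blast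
  then have "x \<in> CC" "P x" using X Pscale by auto
  then show ?case using step Padd by auto
qed (simp add: P0)

lemma kspan_group: assumes "X \<subseteq> CC" shows "add_subgroup (kspan X)"
  unfolding kspan_def
proof (rule add_span_subgroup)
  fix u assume "u \<in> {r *s x | r x. x \<in> X}"
  then obtain r x where x: "u = r *s x" "x \<in> X" by blast
  then have "- u = (- r) *s x" using assms scale_minus[of x r] by auto
  then show "- u \<in> {r *s x | r x. x \<in> X}" using x by blast
qed

lemma kspan_scale: assumes "X \<subseteq> CC" "u \<in> kspan X" shows "r *s u \<in> kspan X"
proof -
  have "u \<in> CC \<and> (\<forall>r. r *s u \<in> kspan X)"
    using assms(2,1)
  proof (induction rule: kspan_induct)
    case (add u v) then show ?case by (auto simp: scale_add_right intro: kspan_add)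
  next
    case (scale r x) then show ?case using assms kspan_base[of x X] by (auto simp: scale_scale subset_iff)
  qed (simp add: kspan_zero)
  then show ?thesis by simp
qed

end

context presented_algebra
begin

text \<open>Induction on t: finitely many generators are extended by the finitely many arrows
  starting at their end vertices. Locally, linear forms are therefore forms on finite-dimensional
  spaces.\<close>

lemma comp_finite_span:
  "i \<in> VV \<Longrightarrow> \<exists>X. finite X \<and> (\<forall>x\<in>X. \<exists>k\<in>VV. x \<in> pc k t i) \<and> (\<forall>a\<in>comp A t. a \<cdot> ee i \<in> kspan X)"
proof (induction t)
  case 0
  have "a \<cdot> ee i \<in> kspan {ee i}" if "a \<in> comp A 0" for a
    using comp0_right[OF that 0] kspan_base[of "ee i" "{ee i}"] by auto
  moreover have "ee i \<in> pc i 0 i" using 0 by (auto intro!: pcI idem_comp)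
  ultimately show ?case using 0 by (intro exI[of _ "{ee i}"]) auto
next
  case (Suc t)
  then obtain X where X: "finite X" "\<forall>x\<in>X. \<exists>k\<in>VV. x \<in> pc k t i" "\<forall>a\<in>comp A t. a \<cdot> ee i \<in> kspan X" by blast
  then obtain v where v: "\<forall>x\<in>X. v x \<in> VV \<and> x \<in> pc (v x) t i" by metis
  then have XC: "X \<subseteq> CC" using pcD(4) by blast
  let ?Y = "\<Union>x\<in>X. (\<lambda>\<alpha>. \<alpha> \<cdot> x) ` {\<alpha> \<in> E. \<alpha> \<cdot> ee (v x) = \<alpha>}"
  have Y1: "\<exists>k\<in>VV. y \<in> pc k (Suc t) i" if "y \<in> ?Y" for y
  proof -
    from that obtain x \<alpha> where y: "x \<in> X" "\<alpha> \<in> E" "\<alpha> \<cdot> ee (v x) = \<alpha>" "y = \<alpha> \<cdot> x" by blast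
    then have "psrc \<alpha> = v x" using psrc_iff[of \<alpha> "v x"] v by blast
    then have "y \<in> pc (ptgt \<alpha>) (1 + t) i"
      using pc_mult[OF arrow_pc[OF y(2)]] v y ptgt(1)[OF y(2)] Suc.prems by metis
    then show ?thesis using ptgt(1)[OF y(2)] by auto
  qed
  then have YC: "?Y \<subseteq> CC" using pcD(4) by blast
  have S: "b \<cdot> x \<in> kspan ?Y" if "b \<in> comp A 1" "x \<in> X" for b x
  proof -
    obtain F c where F: "finite F" "F \<subseteq> E" "b = (\<Sum>x\<in>F. c x *s x)" using arrows_span[OF \<open>b \<in> comp A 1\<close>] by blast
    have xC: "x \<in> CC" using XC that by blast
    have "b \<cdot> x = (\<Sum>\<alpha>\<in>F. c \<alpha> *s (\<alpha> \<cdot> x))"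
      unfolding F(3) using F(2) xC arrow_CC by (subst mult_sum_left) (auto simp: scale_mult_left subset_iff intro!: sum.cong)
    also have "\<dots> \<in> kspan ?Y"
    proof (rule kspan_sum)
      fix \<alpha> assume "\<alpha> \<in> F"
      then have \<alpha>: "\<alpha> \<in> E" using F by blast
      show "c \<alpha> *s (\<alpha> \<cdot> x) \<in> kspan ?Y"
      proof (cases "\<alpha> \<cdot> ee (v x) = \<alpha>")
        case True
        then show ?thesis using \<alpha> that by (intro kspan_base) blast
      next
        case False
        then have "\<alpha> \<cdot> ee (v x) = 0"
          using pc_vertex(2)[OF arrow_pc[OF \<alpha>] arrow_nonzero[OF \<alpha>] psrc(1)[OF \<alpha>] ptgt(1)[OF \<alpha>], of "v x"] v that
          by (auto split: if_splits)
        moreover have "\<alpha> \<cdot> x = \<alpha> \<cdot> ee (v x) \<cdot> x"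
          using mult_assoc[of \<alpha> "ee (v x)" x] pcD[of x "v x" t i] v that arrow_CC[OF \<alpha>] by auto
        ultimately show ?thesis using xC by (simp add: kspan_zero)
      qed
    qed
    finally show ?thesis .
  qed
  have S2: "b \<cdot> u \<in> kspan ?Y" if b: "b \<in> comp A 1" and u: "u \<in> kspan X" for b u
  proof -
    have bC: "b \<in> CC" using b comp_CC by blast
    have "u \<in> CC \<and> b \<cdot> u \<in> kspan ?Y"
      using u XC
    proof (induction rule: kspan_induct)
      case zero then show ?case using bC by (simp add: kspan_zero)
    next
      case (add u v) then show ?case using bC by (simp add: mult_add_right kspan_add)
    next
      case (scale r x)
      then show ?case using bC XC S[OF b] kspan_scale[OF YC] by (simp add: scale_mult_right subset_iff)
    qed
    then show ?thesis by simp
  qed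
  have sub: "add_subgroup {a \<in> CC. a \<cdot> ee i \<in> kspan ?Y}"
    using Suc.prems add_subgroup_diff[OF kspan_group[OF YC]] by (auto simp: add_subgroup_def mult_diff_left kspan_zero)
  have "add_span {b \<cdot> c | b c. b \<in> comp A 1 \<and> c \<in> comp A t} \<subseteq> {a \<in> CC. a \<cdot> ee i \<in> kspan ?Y}"
  proof (rule add_span_least[OF _ sub], clarify, intro conjI)
    fix b c assume bc: "b \<in> comp A 1" "c \<in> comp A t"
    then have C: "b \<in> CC" "c \<in> CC" using comp_CC by blast+
    then show "b \<cdot> c \<in> CC" by simp
    have "b \<cdot> (c \<cdot> ee i) \<in> kspan ?Y" using S2[OF bc(1)] X(3) bc(2) by blast
    then show "b \<cdot> c \<cdot> ee i \<in> kspan ?Y" using C Suc.prems by (simp add: mult_assoc)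
  qed
  then have "\<forall>a\<in>comp A (Suc t). a \<cdot> ee i \<in> kspan ?Y" using gen_left[of t] by blast
  moreover have "finite ?Y" using X(1) v arrows_finite(1) by auto
  ultimately show ?case using Y1 by (intro exI[of _ ?Y]) blast
qed

end

lemma sum_Pair: "(\<Sum>i\<in>I. (f i, g i)) = (\<Sum>i\<in>I. f i, \<Sum>i\<in>I. g i)"
  by (induction I rule: infinite_finite_induct) (simp_all add: zero_prod_def)

lemma (in graded_algebra) local_dual_iff: "f \<in> local_dual A \<longleftrightarrow>
    (\<forall>x\<in>CC. \<forall>y\<in>CC. f (x + y) = f x + f y) \<and> (\<forall>c. \<forall>x\<in>CC. f (c *s x) = c * f x) \<and> (\<forall>x. x \<notin> CC \<longrightarrow> f x = 0) \<and>
    finite {(t, i, j). i \<in> VV \<and> j \<in> VV \<and> (\<exists>x\<in>pc j t i. f x \<noteq> 0)}"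
proof -
  have "{(t, i, j). i \<in> VV \<and> j \<in> VV \<and> (\<exists>x\<in>peirce A j t i. f x \<noteq> 0)} = {(t, i, j). i \<in> VV \<and> j \<in> VV \<and> (\<exists>x\<in>pc j t i. f x \<noteq> 0)}"
    using peirce_eq by auto
  then show ?thesis unfolding local_dual_def by simp
qed

lemma (in graded_algebra) local_dual_opposite: "local_dual (opposite A) = local_dual A"
proof -
  interpret op: graded_algebra "opposite A" by (rule opposite_graded_algebra)
  have "{(t, i, j). i \<in> VV \<and> j \<in> VV \<and> (\<exists>x\<in>pc i t j. f x \<noteq> 0)} = (\<lambda>(t, i, j). (t, j, i)) ` {(t, i, j). i \<in> VV \<and> j \<in> VV \<and> (\<exists>x\<in>pc j t i. f x \<noteq> 0)}" for f :: "'a \<Rightarrow> 'k"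
    by force
  moreover have "inj_on (\<lambda>(t, i, j). (t, j, i)) S" for S :: "(nat \<times> 'v \<times> 'v) set"
    by (auto simp: inj_on_def)
  ultimately have "finite {(t, i, j). i \<in> VV \<and> j \<in> VV \<and> (\<exists>x\<in>pc i t j. f x \<noteq> 0)} \<longleftrightarrow>
      finite {(t, i, j). i \<in> VV \<and> j \<in> VV \<and> (\<exists>x\<in>pc j t i. f x \<noteq> 0)}" for f :: "'a \<Rightarrow> 'k"
    by (simp add: finite_image_iff)
  then show ?thesis by (auto simp: op.local_dual_iff local_dual_iff opposite_pc)
qed

section \<open>The algebra and its local dual\<close>

locale frobenius_presented = frobenius_algebra A m \<theta> \<nu> + presented_algebra A E
  for A :: "('k::field, 'v, 'a::ab_group_add) galgebra" and m \<theta> \<nu> E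
begin

lemma nu_VV[simp]: "i \<in> VV \<Longrightarrow> \<nu> i \<in> VV" using perm by (auto simp: bij_betw_def)
lemma nu_surj: "j \<in> VV \<Longrightarrow> \<exists>i\<in>VV. \<nu> i = j" using perm by (metis bij_betw_imp_surj_on imageE)

text \<open>The same form serves the opposite algebra; the permutation is inverted because the twist
  trades left idempotents for right ones.\<close>

lemma opposite_frobenius_presented: "frobenius_presented (opposite A) m \<theta> (the_inv_into VV \<nu>) E"
proof -
  interpret op: presented_algebra "opposite A" E by (rule opposite_presented_algebra)
  have b: "bij_betw (the_inv_into VV \<nu>) VV VV" using perm by (rule bij_betw_the_inv_into)
  have n: "\<nu> (the_inv_into VV \<nu> i) = i" if "i \<in> VV" for i using that perm by (simp add: f_the_inv_into_f_bij_betw)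
  show ?thesis
  proof unfold_locales
    fix a i assume "a \<in> carrier (opposite A)" "i \<in> vertices (opposite A)"
    then show "\<theta> (mult (opposite A) (idem (opposite A) (the_inv_into VV \<nu> i)) a) = \<theta> (mult (opposite A) a (idem (opposite A) i))"
      using form_twist[of a "the_inv_into VV \<nu> i"] n[of i] bij_betwE[OF b] by simp
  qed (use form_add form_scale form_degree b nondegenerate_left nondegenerate_right in auto)
qed

lemma form_zero[simp]: "\<theta> 0 = 0" using form_scale[of 0 0] by simp

lemma form_sum: "(\<And>i. i \<in> I \<Longrightarrow> f i \<in> CC) \<Longrightarrow> \<theta> (sum f I) = (\<Sum>i\<in>I. \<theta> (f i))"
  using additive_on_sum[OF CC_group, of \<theta> I f] form_add by simp

lemma form_diff: "a \<in> CC \<Longrightarrow> b \<in> CC \<Longrightarrow> \<theta> (a - b) = \<theta> a - \<theta> b"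
  using additive_on_diff[OF CC_group, of \<theta> a b] form_add by simp

lemma form_hc: assumes a: "a \<in> CC" shows "\<theta> a = \<theta> (hc a m)"
proof -
  obtain N where N: "\<forall>s\<ge>N. hc a s = 0" "a = (\<Sum>s<N. hc a s)" using hc_sum_ex[OF a] by blast
  have "\<theta> a = (\<Sum>s<N. \<theta> (hc a s))" using form_sum[of "{..<N}" "hc a"] a N(2) by simp
  also have "\<dots> = (\<Sum>s<N. if s = m then \<theta> (hc a m) else 0)"
    by (intro sum.cong refl) (use form_degree[OF hc_comp[OF a]] in auto)
  also have "\<dots> = \<theta> (hc a m)" using N by auto
  finally show ?thesis .
qed

text \<open>A product with a factor of degree above m has no component of degree m, where the form
  lives; nondegeneracy then leaves only 0.\<close>

lemma comp_above: "t > m \<Longrightarrow> comp A t = {0}"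
proof -
  assume t: "t > m"
  have "u = 0" if u: "u \<in> comp A t" for u
  proof (rule ccontr)
    assume "u \<noteq> 0"
    have uC: "u \<in> CC" using u comp_CC by blast
    obtain b where b: "b \<in> CC" "\<theta> (b \<cdot> u) \<noteq> 0" using nondegenerate_left[OF uC \<open>u \<noteq> 0\<close>] by blast
    have "hc (b \<cdot> u) m = 0" using hc_mult_right[OF u b(1), of m] t by simp
    then show False using form_hc[of "b \<cdot> u"] b uC by simp
  qed
  then show ?thesis by auto
qed

lemma comp_top: "comp A m \<noteq> {0}"
proof -
  obtain i where i: "i \<in> VV" using vertices_nonempty by blast
  obtain b where b: "b \<in> CC" "\<theta> (b \<cdot> ee i) \<noteq> 0" using nondegenerate_left[of "ee i"] i idem_nonzero by auto
  then have "hc (b \<cdot> ee i) m \<noteq> 0" using form_hc[of "b \<cdot> ee i"] i by auto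
  then show ?thesis using hc_comp[of "b \<cdot> ee i" m] b i by auto
qed

text \<open>The isomorphism of left modules from \<open>A\<close> to its local dual;
  \<open>psi c\<close> plays the role of c x in the trivial extension. The cut outside the carrier
  matches the convention of \<open>local_dual\<close>.\<close>

definition psi :: "'a \<Rightarrow> 'a \<Rightarrow> 'k" where "psi c = (\<lambda>x. if x \<in> CC then \<theta> (x \<cdot> c) else 0)"

lemma psi_add: "c \<in> CC \<Longrightarrow> d \<in> CC \<Longrightarrow> psi (c + d) = psi c + psi d"
  by (rule ext) (auto simp: psi_def mult_add_right form_add)

lemma psi_zero[simp]: "psi 0 = 0" by (rule ext) (auto simp: psi_def)

lemma psi_diff: "c \<in> CC \<Longrightarrow> d \<in> CC \<Longrightarrow> psi (c - d) = psi c - psi d"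
  by (rule ext) (auto simp: psi_def mult_diff_right form_diff)

lemma psi_sum: "(\<And>i. i \<in> I \<Longrightarrow> f i \<in> CC) \<Longrightarrow> psi (sum f I) = (\<Sum>i\<in>I. psi (f i))"
  using additive_on_sum[OF CC_group, of psi I f] psi_add by simp

lemma psi_scale: "c \<in> CC \<Longrightarrow> psi (r *s c) = (\<lambda>x. r * psi c x)"
  by (rule ext) (auto simp: psi_def scale_mult_right form_scale)

lemma form_unique:
  assumes "c \<in> CC" "d \<in> CC" "\<And>x. x \<in> CC \<Longrightarrow> \<theta> (x \<cdot> c) = \<theta> (x \<cdot> d)"
  shows "c = d"
proof (rule ccontr)
  assume "c \<noteq> d"
  then obtain x where "x \<in> CC" "\<theta> (x \<cdot> (c - d)) \<noteq> 0" using nondegenerate_left[of "c - d"] assms by auto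
  then show False using assms by (simp add: mult_diff_right form_diff)
qed

lemma psi_inj: "c \<in> CC \<Longrightarrow> d \<in> CC \<Longrightarrow> psi c = psi d \<longleftrightarrow> c = d"
  using form_unique[of c d] by (auto simp: psi_def fun_eq_iff)

lemma psi_eq_0: "c \<in> CC \<Longrightarrow> psi c = 0 \<longleftrightarrow> c = 0"
  using psi_inj[of c 0] by simp

text \<open>A local unit \<open>J\<close> of \<open>c\<close> bounds the support: the right
  idempotent of \<open>x\<close> meets \<open>c\<close> directly, the left one after being moved
  around the form, which brings in \<open>\<nu>\<close>.\<close>

lemma psi_support:
  assumes c: "c \<in> CC" and J: "finite J" "J \<subseteq> VV" "uu J \<cdot> c = c" "c \<cdot> uu J = c"
    and ij: "i \<in> VV" "j \<in> VV" and x: "x \<in> pc j t i" "\<theta> (x \<cdot> c) \<noteq> 0"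
  shows "t \<le> m \<and> i \<in> J \<and> j \<in> \<nu> ` J"
proof -
  note x' = pcD[OF x(1)]
  have "t \<le> m" using comp_above[of t] x'(1) x(2) c by (rule_tac ccontr) auto
  moreover have "i \<in> J"
  proof (rule ccontr)
    assume "i \<notin> J"
    then have "ee i \<cdot> c = 0" using unit_support(1)[OF c ij(1) J(1,2)] J by blast
    then have "x \<cdot> c = 0" using mult_assoc[of x "ee i" c] x' c ij by simp
    then show False using x by simp
  qed
  moreover have "j \<in> \<nu> ` J"
  proof (rule ccontr)
    assume j: "j \<notin> \<nu> ` J"
    obtain l where l: "l \<in> VV" "\<nu> l = j" using nu_surj[OF ij(2)] by blast
    then have "c \<cdot> ee l = 0" using unit_support(2)[OF c l(1) J(1,2)] J j by blast
    have "\<theta> (x \<cdot> c) = \<theta> (ee (\<nu> l) \<cdot> (x \<cdot> c))" using mult_assoc[of "ee j" x c] x' c ij l by simp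
    also have "\<dots> = \<theta> (x \<cdot> c \<cdot> ee l)" using form_twist[of "x \<cdot> c" l] x' c l by simp
    also have "\<dots> = 0" using \<open>c \<cdot> ee l = 0\<close> x' c l by (simp add: mult_assoc)
    finally show False using x by simp
  qed
  ultimately show ?thesis by blast
qed

lemma psi_local_dual: assumes c: "c \<in> CC" shows "psi c \<in> local_dual A"
proof -
  obtain J where J: "finite J" "J \<subseteq> VV" "uu J \<cdot> c = c" "c \<cdot> uu J = c" using c by (rule unit_obtain)
  have "{(t, i, j). i \<in> VV \<and> j \<in> VV \<and> (\<exists>x\<in>pc j t i. psi c x \<noteq> 0)} \<subseteq> {..m} \<times> J \<times> \<nu> ` J"
    using psi_support[OF c J] by (auto simp: psi_def split: if_splits)
  then have "finite {(t, i, j). i \<in> VV \<and> j \<in> VV \<and> (\<exists>x\<in>pc j t i. psi c x \<noteq> 0)}"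
    by (rule finite_subset) (use J in auto)
  then show ?thesis unfolding local_dual_iff using c
    by (auto simp: psi_def mult_add_left form_add scale_mult_left form_scale)
qed

text \<open>Gram-Schmidt orthogonalisation with respect to the pairing \<open>(x, c) \<mapsto> \<theta> (x c)\<close>.\<close>

lemma dual_system:
  "finite X \<Longrightarrow> X \<subseteq> CC \<Longrightarrow> \<exists>S cc. finite S \<and> S \<subseteq> CC \<and> (\<forall>s\<in>S. cc s \<in> CC) \<and>
    (\<forall>s\<in>S. \<forall>s'\<in>S. \<theta> (s \<cdot> cc s') = (if s = s' then 1 else 0)) \<and>
    (\<forall>v\<in>kspan X. v = (\<Sum>s\<in>S. \<theta> (v \<cdot> cc s) *s s))"
proof (induction X rule: finite_induct)
  case empty
  have "v = 0" if "v \<in> kspan {}" for v using kspan_induct[OF that, of "\<lambda>v. v = 0"] by auto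
  then show ?case by (intro exI[of _ "{}"]) auto
next
  case (insert x X)
  then obtain S cc where S: "finite S" "S \<subseteq> CC" "\<forall>s\<in>S. cc s \<in> CC"
    "\<forall>s\<in>S. \<forall>s'\<in>S. \<theta> (s \<cdot> cc s') = (if s = s' then 1 else 0)"
    "\<forall>v\<in>kspan X. v = (\<Sum>s\<in>S. \<theta> (v \<cdot> cc s) *s s)" by auto
  have x: "x \<in> CC" "X \<subseteq> CC" using insert.prems by auto
  have SC: "s \<in> CC" "cc s \<in> CC" if "s \<in> S" for s using S that by auto
  \<comment> \<open>Subtracting what the old dual system sees makes \<open>x'\<close> pair to 0 with
    every \<open>cc s\<close>. If \<open>x'\<close> is zero, the old system also serves
    \<open>x\<close>.\<close>
  define x' where "x' = x - (\<Sum>s\<in>S. \<theta> (x \<cdot> cc s) *s s)"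
  have sumC: "(\<Sum>s\<in>S. f s *s s) \<in> CC" for f using SC by (intro CC_sum) auto
  have x'C: "x' \<in> CC" unfolding x'_def using x sumC by simp
  have pair_sum: "\<theta> ((\<Sum>s\<in>S. f s *s s) \<cdot> d) = (\<Sum>s\<in>S. f s * \<theta> (s \<cdot> d))" if "d \<in> CC" for f d
    using that SC by (simp add: mult_sum_left form_sum scale_mult_left form_scale)
  have orth: "\<theta> (x' \<cdot> cc s) = 0" if s: "s \<in> S" for s
  proof -
    have "\<theta> (x' \<cdot> cc s) = \<theta> (x \<cdot> cc s) - (\<Sum>s'\<in>S. \<theta> (x \<cdot> cc s') * \<theta> (s' \<cdot> cc s))"
      unfolding x'_def using x sumC SC[OF s] pair_sum by (simp add: mult_diff_left form_diff)
    also have "(\<Sum>s'\<in>S. \<theta> (x \<cdot> cc s') * \<theta> (s' \<cdot> cc s)) = (\<Sum>s'\<in>S. if s' = s then \<theta> (x \<cdot> cc s') else 0)"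
      using S(4) s by (intro sum.cong refl) auto
    also have "\<dots> = \<theta> (x \<cdot> cc s)" using s S(1) by simp
    finally show ?thesis by simp
  qed
  have rep: "v = (\<Sum>s\<in>T. \<theta> (v \<cdot> dd s) *s s)"
    if T: "finite T" "T \<subseteq> CC" "\<forall>s\<in>T. dd s \<in> CC" and gen: "\<forall>y\<in>insert x X. y = (\<Sum>s\<in>T. \<theta> (y \<cdot> dd s) *s s)"
      and v: "v \<in> kspan (insert x X)" for T dd v
  proof -
    have "insert x X \<subseteq> CC" using x by simp
    have "v \<in> CC \<and> v = (\<Sum>s\<in>T. \<theta> (v \<cdot> dd s) *s s)" using v \<open>insert x X \<subseteq> CC\<close>
    proof (induction rule: kspan_induct)
      case zero
      have "(\<Sum>s\<in>T. \<theta> (0 \<cdot> dd s) *s s) = 0" using T by (intro sum.neutral) (auto simp: subset_iff)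
      then show ?case by simp
    next
      case (add u v)
      have "(\<Sum>s\<in>T. \<theta> ((u + v) \<cdot> dd s) *s s) = (\<Sum>s\<in>T. \<theta> (u \<cdot> dd s) *s s + \<theta> (v \<cdot> dd s) *s s)"
        using add T by (intro sum.cong refl) (auto simp: mult_add_left form_add scale_add_left subset_iff)
      also have "\<dots> = u + v" using add by (simp add: sum.distrib)
      finally show ?case by simp
    next
      case (scale r y)
      have yC: "y \<in> CC" using scale \<open>insert x X \<subseteq> CC\<close> by blast
      have "(\<Sum>s\<in>T. \<theta> ((r *s y) \<cdot> dd s) *s s) = (\<Sum>s\<in>T. r *s (\<theta> (y \<cdot> dd s) *s s))"
        using yC T by (intro sum.cong refl) (auto simp: scale_mult_left form_scale scale_scale subset_iff)
      also have "\<dots> = r *s y" using gen scale T scale_sum[of T "\<lambda>s. \<theta> (y \<cdot> dd s) *s s" r] by (auto simp: subset_iff)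
      finally show ?case by simp
    qed
    then show ?thesis by simp
  qed
  have genX: "y = (\<Sum>s\<in>S. \<theta> (y \<cdot> cc s) *s s)" if "y \<in> X" for y
    using S(5) kspan_base[OF that, of 1] x that scale_one by (metis subsetD)
  show ?case
  proof (cases "x' = 0")
    case True
    then have "x = (\<Sum>s\<in>S. \<theta> (x \<cdot> cc s) *s s)" by (simp add: x'_def)
    then have "\<forall>y\<in>insert x X. y = (\<Sum>s\<in>S. \<theta> (y \<cdot> cc s) *s s)" using genX by blast
    then have "\<forall>v\<in>kspan (insert x X). v = (\<Sum>s\<in>S. \<theta> (v \<cdot> cc s) *s s)"
      using rep[OF S(1-3)] by blast
    then show ?thesis using S by blast
  next
    case False
    then obtain d0 where d0: "d0 \<in> CC" "\<theta> (x' \<cdot> d0) \<noteq> 0" using nondegenerate_right[OF x'C] by blast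
    define d1 where "d1 = inverse (\<theta> (x' \<cdot> d0)) *s d0"
    have d1: "d1 \<in> CC" "\<theta> (x' \<cdot> d1) = 1" using d0 x'C by (auto simp: d1_def scale_mult_right form_scale)
    \<comment> \<open>\<open>d1\<close> pairs to 1 with \<open>x'\<close>. The correction makes
      every old \<open>s\<close> pair to 0 with \<open>d\<close>, and by \<open>orth\<close> it does
      not change the value on \<open>x'\<close>.\<close>
    define d where "d = d1 - (\<Sum>s\<in>S. \<theta> (s \<cdot> d1) *s cc s)"
    have dC: "d \<in> CC" unfolding d_def using d1 SC by (auto intro!: CC_simps CC_sum)
    have pair_d: "\<theta> (y \<cdot> d) = \<theta> (y \<cdot> d1) - (\<Sum>s\<in>S. \<theta> (s \<cdot> d1) * \<theta> (y \<cdot> cc s))" if "y \<in> CC" for y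
    proof -
      have "(\<Sum>s\<in>S. \<theta> (s \<cdot> d1) *s cc s) \<in> CC" using SC by (intro CC_sum) auto
      then have "\<theta> (y \<cdot> d) = \<theta> (y \<cdot> d1) - \<theta> (y \<cdot> (\<Sum>s\<in>S. \<theta> (s \<cdot> d1) *s cc s))"
        unfolding d_def using that d1 by (simp add: mult_diff_right form_diff)
      also have "\<theta> (y \<cdot> (\<Sum>s\<in>S. \<theta> (s \<cdot> d1) *s cc s)) = (\<Sum>s\<in>S. \<theta> (s \<cdot> d1) * \<theta> (y \<cdot> cc s))"
        using that SC by (simp add: mult_sum_right form_sum scale_mult_right form_scale)
      finally show ?thesis .
    qed
    have x'd: "\<theta> (x' \<cdot> d) = 1" using pair_d[OF x'C] orth d1 by simp
    have sd: "\<theta> (s \<cdot> d) = 0" if s: "s \<in> S" for s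
    proof -
      have "(\<Sum>s'\<in>S. \<theta> (s' \<cdot> d1) * \<theta> (s \<cdot> cc s')) = (\<Sum>s'\<in>S. if s' = s then \<theta> (s \<cdot> d1) else 0)"
        using S(4) s by (intro sum.cong refl) auto
      then show ?thesis using pair_d SC[OF s] s S(1) by simp
    qed
    have notin: "x' \<notin> S" using orth S(4) by force
    let ?T = "insert x' S" and ?dd = "cc(x' := d)"
    have T: "finite ?T" "?T \<subseteq> CC" "\<forall>s\<in>?T. ?dd s \<in> CC" using S x'C dC by auto
    have ddS: "(\<Sum>s\<in>?T. \<theta> (y \<cdot> ?dd s) *s s) = \<theta> (y \<cdot> d) *s x' + (\<Sum>s\<in>S. \<theta> (y \<cdot> cc s) *s s)" for y
    proof -
      have "(\<Sum>s\<in>S. \<theta> (y \<cdot> ?dd s) *s s) = (\<Sum>s\<in>S. \<theta> (y \<cdot> cc s) *s s)"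
        using notin by (intro sum.cong refl) auto
      then show ?thesis using S(1) notin by simp
    qed
    have sum_d: "\<theta> ((\<Sum>s\<in>S. f s *s s) \<cdot> d) = 0" for f using pair_sum[OF dC, of f] sd by simp
    have gen: "y = (\<Sum>s\<in>?T. \<theta> (y \<cdot> ?dd s) *s s)" if "y \<in> insert x X" for y
    proof (cases "y = x")
      case True
      have "x = x' + (\<Sum>s\<in>S. \<theta> (x \<cdot> cc s) *s s)" by (simp add: x'_def)
      then have "\<theta> (x \<cdot> d) = \<theta> ((x' + (\<Sum>s\<in>S. \<theta> (x \<cdot> cc s) *s s)) \<cdot> d)" by (rule arg_cong)
      also have "\<dots> = \<theta> (x' \<cdot> d) + \<theta> ((\<Sum>s\<in>S. \<theta> (x \<cdot> cc s) *s s) \<cdot> d)"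
        using x'C sumC dC by (subst mult_add_left) (simp_all add: form_add)
      finally have "\<theta> (x \<cdot> d) = \<theta> (x' \<cdot> d) + \<theta> ((\<Sum>s\<in>S. \<theta> (x \<cdot> cc s) *s s) \<cdot> d)" .
      then have "\<theta> (x \<cdot> d) = 1" using x'd sum_d by simp
      then show ?thesis unfolding True ddS using x'C by (simp add: scale_one x'_def)
    next
      case False
      then have y: "y \<in> X" using that by blast
      have "\<theta> (y \<cdot> d) = \<theta> ((\<Sum>s\<in>S. \<theta> (y \<cdot> cc s) *s s) \<cdot> d)" using genX[OF y] by (rule arg_cong)
      then have z: "\<theta> (y \<cdot> d) *s x' = 0" using sum_d x'C by simp
      have "y = (\<Sum>s\<in>S. \<theta> (y \<cdot> cc s) *s s)" by (rule genX[OF y])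
      also have "\<dots> = \<theta> (y \<cdot> d) *s x' + (\<Sum>s\<in>S. \<theta> (y \<cdot> cc s) *s s)" unfolding z by simp
      finally show ?thesis unfolding ddS .
    qed
    have "\<forall>v\<in>kspan (insert x X). v = (\<Sum>s\<in>?T. \<theta> (v \<cdot> ?dd s) *s s)"
      by (rule ballI, rule rep[OF T]) (rule ballI, rule gen)
    moreover have "\<forall>s\<in>?T. \<forall>s'\<in>?T. \<theta> (s \<cdot> ?dd s') = (if s = s' then 1 else 0)"
      using S(4) sd x'd orth notin by auto
    ultimately show ?thesis using T by (intro exI[of _ ?T] exI[of _ ?dd]) blast
  qed
qed

text \<open>On the finite-dimensional piece a dual system represents \<open>f\<close>. The
  representing element is then cut down to one Peirce piece of degree m - t; this keeps its pairing
  with \<open>pc j t i\<close> and kills the pairing with all other pieces.\<close>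

lemma represent_on_pc:
  assumes f: "f \<in> local_dual A" and ij: "i \<in> VV" "j \<in> VV"
  shows "\<exists>c\<in>CC. (\<forall>x\<in>pc j t i. \<theta> (x \<cdot> c) = f x) \<and>
    (\<forall>i'\<in>VV. \<forall>j'\<in>VV. \<forall>t'. (t', i', j') \<noteq> (t, i, j) \<longrightarrow> (\<forall>x\<in>pc j' t' i'. \<theta> (x \<cdot> c) = 0))"
proof (cases "t \<le> m")
  case False
  then have "pc j t i \<subseteq> {0}" using comp_above[of t] by (auto dest: pcD)
  moreover have "f 0 = 0" using f[unfolded local_dual_iff] by (metis CC_simps(1) add.right_neutral add_cancel_right_right)
  ultimately show ?thesis by (intro bexI[of _ 0]) (auto dest: pcD(4))
next
  case tm: True
  have fadd: "f (x + y) = f x + f y" if "x \<in> CC" "y \<in> CC" for x y using f that by (simp add: local_dual_iff)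
  have fscale: "f (r *s x) = r * f x" if "x \<in> CC" for r x using f that by (simp add: local_dual_iff)
  obtain X where X: "finite X" "\<forall>x\<in>X. \<exists>k\<in>VV. x \<in> pc k t i" "\<forall>a\<in>comp A t. a \<cdot> ee i \<in> kspan X"
    using comp_finite_span[OF ij(1), of t] by blast
  then have XC: "X \<subseteq> CC" using pcD(4) by blast
  obtain S cc where S: "finite S" "S \<subseteq> CC" "\<forall>s\<in>S. cc s \<in> CC"
    "\<forall>v\<in>kspan X. v = (\<Sum>s\<in>S. \<theta> (v \<cdot> cc s) *s s)" using dual_system[OF X(1) XC] by blast
  define c0 where "c0 = (\<Sum>s\<in>S. f s *s cc s)"
  have c0: "c0 \<in> CC" unfolding c0_def using S by (intro CC_sum) auto
  have eq0: "\<theta> (x \<cdot> c0) = f x" if x: "x \<in> pc j t i" for x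
  proof -
    have "x \<in> kspan X" using X(3) pcD[OF x] by metis
    then have "x = (\<Sum>s\<in>S. \<theta> (x \<cdot> cc s) *s s)" using S by blast
    then have "f x = (\<Sum>s\<in>S. f (\<theta> (x \<cdot> cc s) *s s))"
      using additive_on_sum[OF CC_group, of f S "\<lambda>s. \<theta> (x \<cdot> cc s) *s s"] fadd S by (metis CC_simps(6) subsetD)
    also have "\<dots> = (\<Sum>s\<in>S. f s * \<theta> (x \<cdot> cc s))" using S fscale by (intro sum.cong refl) (auto simp: subset_iff)
    also have "\<dots> = \<theta> (x \<cdot> c0)"
      unfolding c0_def using pcD(4)[OF x] S by (simp add: mult_sum_right form_sum scale_mult_right form_scale)
    finally show ?thesis by simp
  qed
  obtain l where l: "l \<in> VV" "\<nu> l = j" using nu_surj[OF ij(2)] by blast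
  \<comment> \<open>The left idempotent must be that of i to meet \<open>x\<close>. The right one
    belongs to the preimage of j, since the form carries \<open>ee l\<close> on the right to
    \<open>ee j\<close> on the left.\<close>
  define c where "c = ee i \<cdot> hc c0 (m - t) \<cdot> ee l"
  have c: "c \<in> pc i (m - t) l" unfolding c_def by (rule pc_proj[OF hc_comp[OF c0] l(1) ij(1)])
  note c' = pcD[OF c]
  have eq: "\<theta> (x \<cdot> c) = \<theta> (x \<cdot> c0)" if x: "x \<in> pc j t i" for x
  proof -
    note x' = pcD[OF x]
    have "hc (x \<cdot> c0) m = x \<cdot> hc c0 (m - t)" using hc_mult_left[OF x'(1) c0, of m] tm by simp
    then have "\<theta> (x \<cdot> c0) = \<theta> (x \<cdot> hc c0 (m - t))" using form_hc[of "x \<cdot> c0"] x' c0 by simp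
    also have "\<dots> = \<theta> (ee (\<nu> l) \<cdot> (x \<cdot> hc c0 (m - t)))" using mult_assoc[of "ee j" x "hc c0 (m - t)"] x' c0 l ij by simp
    also have "\<dots> = \<theta> (x \<cdot> hc c0 (m - t) \<cdot> ee l)" using form_twist[of "x \<cdot> hc c0 (m - t)" l] l x' c0 by simp
    also have "x \<cdot> hc c0 (m - t) \<cdot> ee l = x \<cdot> ee i \<cdot> hc c0 (m - t) \<cdot> ee l" using x' by simp
    also have "\<dots> = x \<cdot> c" unfolding c_def using x'(4) c0 l ij by (simp add: mult_assoc)
    finally show ?thesis by simp
  qed
  have zero: "\<theta> (x \<cdot> c) = 0" if x: "x \<in> pc j' t' i'" and v: "i' \<in> VV" "j' \<in> VV" and ne: "(t', i', j') \<noteq> (t, i, j)" for x i' j' t'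
  proof (rule ccontr)
    assume nz: "\<theta> (x \<cdot> c) \<noteq> 0"
    note x' = pcD[OF x]
    have xcC: "x \<cdot> c \<in> CC" "x \<cdot> c \<noteq> 0" using x' c' nz by auto
    have "x \<cdot> c \<in> comp A (t' + (m - t))" using mult_comp x' c' by blast
    then have "t' + (m - t) = m" using form_degree nz by blast
    then have t: "t' = t" using tm by simp
    have i: "i' = i"
    proof (rule ccontr)
      assume "i' \<noteq> i"
      have "x \<cdot> c = x \<cdot> ee i' \<cdot> (ee i \<cdot> c)" using x' c' by simp
      also have "\<dots> = x \<cdot> (ee i' \<cdot> ee i \<cdot> c)" using x'(4) c'(4) v ij by (simp add: mult_assoc)
      also have "\<dots> = 0" using \<open>i' \<noteq> i\<close> v ij x'(4) c'(4) by (simp add: idem_mult)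
      finally show False using xcC by simp
    qed
    have "\<theta> (x \<cdot> c) = \<theta> (x \<cdot> c \<cdot> ee l)" using mult_assoc[of x c "ee l"] x' c' l by simp
    also have "\<dots> = \<theta> (ee j \<cdot> (x \<cdot> c))" using form_twist[OF xcC(1) l(1)] l by simp
    also have "ee j \<cdot> (x \<cdot> c) = ee j \<cdot> (ee j' \<cdot> x) \<cdot> c" using x' c' ij mult_assoc[of "ee j" x c] by simp
    also have "\<dots> = (ee j \<cdot> ee j') \<cdot> x \<cdot> c" using x'(4) c' ij v mult_assoc[of "ee j" "ee j'" x] by simp
    finally have "j' = j" using nz ij v x'(4) c' by (auto simp: idem_mult split: if_splits)
    with t i ne show False by simp
  qed
  show ?thesis using c'(4) eq eq0 zero by (intro bexI[of _ c]) auto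
qed

text \<open>A form in the local dual is nonzero on finitely many Peirce pieces only. The
  representing elements of these pieces can simply be added, because each of them pairs to zero with
  all other pieces.\<close>

lemma psi_surj: assumes f: "f \<in> local_dual A" shows "\<exists>c\<in>CC. f = psi c"
proof -
  let ?D = "{(t, i, j). i \<in> VV \<and> j \<in> VV \<and> (\<exists>x\<in>pc j t i. f x \<noteq> 0)}"
  have D: "finite ?D" using f by (simp add: local_dual_iff)
  define R where "R d c \<longleftrightarrow> c \<in> CC \<and> (\<forall>x\<in>pc (snd (snd d)) (fst d) (fst (snd d)). \<theta> (x \<cdot> c) = f x) \<and>
    (\<forall>i'\<in>VV. \<forall>j'\<in>VV. \<forall>t'. (t', i', j') \<noteq> d \<longrightarrow> (\<forall>x\<in>pc j' t' i'. \<theta> (x \<cdot> c) = 0))" for d c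
  have ex: "\<forall>d\<in>?D. \<exists>c. R d c"
  proof
    fix d assume "d \<in> ?D"
    then obtain t i j where d: "d = (t, i, j)" "i \<in> VV" "j \<in> VV" by blast
    show "\<exists>c. R d c"
      using represent_on_pc[OF f d(2,3), of t] unfolding R_def d(1) fst_conv snd_conv by (elim bexE) (rule exI, rule conjI)
  qed
  obtain cd where cd: "\<forall>d\<in>?D. R d (cd d)" using bchoice[OF ex] by (elim exE)
  define c where "c = (\<Sum>d\<in>?D. cd d)"
  have cdC: "cd d \<in> CC" if "d \<in> ?D" for d using bspec[OF cd that] unfolding R_def by (rule conjunct1)
  have c: "c \<in> CC" unfolding c_def by (rule CC_sum) (rule cdC)
  have f0: "f 0 = 0" using f[unfolded local_dual_iff] by (metis CC_simps(1) add.right_neutral add_cancel_right_right)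
  have "f x = \<theta> (x \<cdot> c)" if "x \<in> CC" for x
    using that
  proof (induction rule: carrier_induct)
    case zero then show ?case using c f0 by simp
  next
    case (add x y)
    then show ?case using f c by (simp add: local_dual_iff mult_add_left form_add)
  next
    case (pc x j t i)
    have xC: "x \<in> CC" using pcD(4)[OF pc(3)] .
    have "\<theta> (x \<cdot> c) = (\<Sum>d\<in>?D. \<theta> (x \<cdot> cd d))"
    proof -
      have "x \<cdot> c = (\<Sum>d\<in>?D. x \<cdot> cd d)" unfolding c_def by (rule mult_sum_right[OF xC cdC])
      then show ?thesis using form_sum[of ?D "\<lambda>d. x \<cdot> cd d", OF CC_simps(5)[OF xC cdC]] by (rule trans[OF arg_cong])
    qed
    also have "\<dots> = (\<Sum>d\<in>?D. if d = (t, i, j) then f x else 0)"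
    proof (intro sum.cong refl)
      fix d assume d: "d \<in> ?D"
      show "\<theta> (x \<cdot> cd d) = (if d = (t, i, j) then f x else 0)"
      proof (cases "d = (t, i, j)")
        case True then show ?thesis using bspec[OF cd d] pc unfolding R_def by auto
      next
        case False
        from bspec[OF cd d] have "\<forall>i'\<in>VV. \<forall>j'\<in>VV. \<forall>t'. (t', i', j') \<noteq> d \<longrightarrow> (\<forall>x\<in>pc j' t' i'. \<theta> (x \<cdot> cd d) = 0)"
          unfolding R_def by (elim conjE)
        from this[THEN bspec, OF pc(1), THEN bspec, OF pc(2), THEN spec, THEN mp, OF False[symmetric], THEN bspec, OF pc(3)]
        show ?thesis using False by simp
      qed
    qed
    also have "\<dots> = (if (t, i, j) \<in> ?D then f x else 0)" using D by (simp add: sum.delta)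
    also have "\<dots> = f x" using pc by auto
    finally show ?case by simp
  qed
  moreover have "f x = 0" if "x \<notin> CC" for x using f that by (simp add: local_dual_iff)
  ultimately have "f = psi c" by (intro ext) (simp add: psi_def)
  then show ?thesis using c by blast
qed

lemma local_dual_eq: "local_dual A = psi ` CC"
  using psi_surj psi_local_dual by blast

text \<open>The form lives in degree m, so degree s pairs with degree m - s. For the converse, a
  component of \<open>c\<close> in another degree q would pair nontrivially with something of degree
  m - q, where \<open>psi c\<close> vanishes.\<close>

lemma psi_dual_comp: assumes c: "c \<in> CC" and s: "s \<le> m" shows "psi c \<in> dual_comp A s \<longleftrightarrow> c \<in> comp A (m - s)"
proof
  assume c': "c \<in> comp A (m - s)"
  have "\<theta> (x \<cdot> c) = 0" if "x \<in> comp A r" "r \<noteq> s" for x r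
    using form_degree[OF mult_comp[OF that(1) c']] that s by auto
  then show "psi c \<in> dual_comp A s" using psi_local_dual[OF c] by (auto simp: dual_comp_def psi_def)
next
  assume d: "psi c \<in> dual_comp A s"
  have "hc c q = 0" if q: "q \<noteq> m - s" for q
  proof (rule ccontr)
    assume nz: "hc c q \<noteq> 0"
    then have qm: "q \<le> m" using comp_above[of q] hc_comp[OF c, of q] by (rule_tac ccontr) auto
    obtain x where x: "x \<in> CC" "\<theta> (x \<cdot> hc c q) \<noteq> 0" using nondegenerate_left[of "hc c q"] nz c by auto
    have "\<theta> (x \<cdot> hc c q) = \<theta> (hc x (m - q) \<cdot> hc c q)"
      using form_hc[of "x \<cdot> hc c q"] hc_mult_right[OF hc_comp[OF c] x(1), of q m] qm x c by simp
    also have "\<dots> = \<theta> (hc x (m - q) \<cdot> c)"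
      using form_hc[of "hc x (m - q) \<cdot> c"] hc_mult_left[OF hc_comp[OF x(1)] c, of "m - q" m] qm x c by simp
    also have "\<dots> = 0" using d hc_comp[OF x(1), of "m - q"] q qm s x by (auto simp: dual_comp_def psi_def dest!: spec[of _ "m - q"])
    finally show False using x by simp
  qed
  then show "c \<in> comp A (m - s)" by (rule comp_of_hc[OF c])
qed

lemma psi_left: "a \<in> CC \<Longrightarrow> c \<in> CC \<Longrightarrow> dual_left A a (psi c) = psi (a \<cdot> c)"
  by (rule ext) (auto simp: dual_left_def psi_def mult_assoc)

end

section \<open>The Nakayama automorphism\<close>

context frobenius_presented
begin

interpretation op: frobenius_presented "opposite A" m \<theta> "the_inv_into VV \<nu>" E
  by (rule opposite_frobenius_presented)

lemma op_psi: "op.psi b = (\<lambda>x. if x \<in> CC then \<theta> (b \<cdot> x) else 0)"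
  by (rule ext) (simp add: op.psi_def)

text \<open>Pairing with \<open>b\<close> on the left is a form in the local dual, by the opposite
  algebra; surjectivity of \<open>psi\<close> rewrites it as a pairing on the right.\<close>

lemma sigma_ex: "b \<in> CC \<Longrightarrow> \<exists>c\<in>CC. \<forall>x\<in>CC. \<theta> (b \<cdot> x) = \<theta> (x \<cdot> c)"
proof -
  assume b: "b \<in> CC"
  have "op.psi b \<in> local_dual A" using op.psi_local_dual[of b] b local_dual_opposite by simp
  then obtain c where c: "c \<in> CC" "op.psi b = psi c" using psi_surj by blast
  have "\<theta> (b \<cdot> x) = \<theta> (x \<cdot> c)" if "x \<in> CC" for x using fun_cong[OF c(2), of x] that by (simp add: op_psi psi_def)
  then show ?thesis using c by blast
qed

lemma kappa_ex: "c \<in> CC \<Longrightarrow> \<exists>b\<in>CC. \<forall>x\<in>CC. \<theta> (b \<cdot> x) = \<theta> (x \<cdot> c)"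
proof -
  assume c: "c \<in> CC"
  have "psi c \<in> local_dual (opposite A)" using psi_local_dual c local_dual_opposite by simp
  then obtain b where b: "b \<in> CC" "psi c = op.psi b" using op.psi_surj by auto
  have "\<theta> (b \<cdot> x) = \<theta> (x \<cdot> c)" if "x \<in> CC" for x using fun_cong[OF b(2), of x] that by (simp add: op_psi psi_def)
  then show ?thesis using b by blast
qed

lemma form_unique_left:
  assumes "c \<in> CC" "d \<in> CC" "\<And>x. x \<in> CC \<Longrightarrow> \<theta> (c \<cdot> x) = \<theta> (d \<cdot> x)"
  shows "c = d"
  using op.form_unique[of c d] assms by simp

end

text \<open>The Nakayama automorphism \<open>\<sigma>\<close> and its inverse \<open>\<kappa>\<close>.\<close>

definition (in frobenius_presented) sigma :: "'a \<Rightarrow> 'a"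
  where "sigma b = (SOME c. c \<in> CC \<and> (\<forall>x\<in>CC. \<theta> (b \<cdot> x) = \<theta> (x \<cdot> c)))"

definition (in frobenius_presented) kappa :: "'a \<Rightarrow> 'a"
  where "kappa c = (SOME b. b \<in> CC \<and> (\<forall>x\<in>CC. \<theta> (b \<cdot> x) = \<theta> (x \<cdot> c)))"

context frobenius_presented
begin

lemma sigma: "b \<in> CC \<Longrightarrow> sigma b \<in> CC" "b \<in> CC \<Longrightarrow> x \<in> CC \<Longrightarrow> \<theta> (b \<cdot> x) = \<theta> (x \<cdot> sigma b)"
  using someI_ex[of "\<lambda>c. c \<in> CC \<and> (\<forall>x\<in>CC. \<theta> (b \<cdot> x) = \<theta> (x \<cdot> c))"] sigma_ex[of b]
  unfolding sigma_def[symmetric] by blast+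

lemma kappa: "c \<in> CC \<Longrightarrow> kappa c \<in> CC" "c \<in> CC \<Longrightarrow> x \<in> CC \<Longrightarrow> \<theta> (kappa c \<cdot> x) = \<theta> (x \<cdot> c)"
  using someI_ex[of "\<lambda>b. b \<in> CC \<and> (\<forall>x\<in>CC. \<theta> (b \<cdot> x) = \<theta> (x \<cdot> c))"] kappa_ex[of c]
  unfolding kappa_def[symmetric] by blast+

lemma sigma_kappa[simp]: "c \<in> CC \<Longrightarrow> sigma (kappa c) = c"
  by (rule form_unique) (simp_all add: sigma(1) kappa sigma(2)[symmetric])

lemma kappa_sigma[simp]: "b \<in> CC \<Longrightarrow> kappa (sigma b) = b"
  by (rule form_unique_left) (simp_all add: kappa(1) sigma(1) kappa(2) sigma(2))

lemma sigma_CC[simp]: "b \<in> CC \<Longrightarrow> sigma b \<in> CC" and kappa_CC[simp]: "b \<in> CC \<Longrightarrow> kappa b \<in> CC"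
  using sigma kappa by auto

lemma sigma_eqI: "b \<in> CC \<Longrightarrow> c \<in> CC \<Longrightarrow> (\<And>x. x \<in> CC \<Longrightarrow> \<theta> (b \<cdot> x) = \<theta> (x \<cdot> c)) \<Longrightarrow> sigma b = c"
  by (rule form_unique) (simp_all add: sigma(1) sigma(2)[symmetric])

lemma sigma_add: "a \<in> CC \<Longrightarrow> b \<in> CC \<Longrightarrow> sigma (a + b) = sigma a + sigma b"
  by (rule sigma_eqI) (auto simp: mult_add_left mult_add_right form_add sigma(2))

lemma sigma_scale: "a \<in> CC \<Longrightarrow> sigma (r *s a) = r *s sigma a"
  by (rule sigma_eqI) (auto simp: scale_mult_left scale_mult_right form_scale sigma(2))

text \<open>The factors are moved around the form one after the other, first \<open>a\<close> and
  then \<open>b\<close>, which keeps their order.\<close>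

lemma sigma_mult: "a \<in> CC \<Longrightarrow> b \<in> CC \<Longrightarrow> sigma (a \<cdot> b) = sigma a \<cdot> sigma b"
proof (rule sigma_eqI)
  fix x assume a: "a \<in> CC" "b \<in> CC" "x \<in> CC"
  have "\<theta> (a \<cdot> b \<cdot> x) = \<theta> (b \<cdot> x \<cdot> sigma a)" using a sigma(2)[of a "b \<cdot> x"] by (simp add: mult_assoc)
  also have "\<dots> = \<theta> (x \<cdot> sigma a \<cdot> sigma b)" using a sigma(2)[of b "x \<cdot> sigma a"] by (simp add: mult_assoc)
  finally show "\<theta> (a \<cdot> b \<cdot> x) = \<theta> (x \<cdot> (sigma a \<cdot> sigma b))" using a by (simp add: mult_assoc)
qed auto

lemma sigma_ee: "i \<in> VV \<Longrightarrow> sigma (ee (\<nu> i)) = ee i"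
  by (rule sigma_eqI) (auto simp: form_twist)

text \<open>This is the relation x b = \<open>sigma b\<close> x: the right action on a form places
  \<open>b\<close> in front of the argument, and \<open>sigma\<close> moves it around.\<close>

lemma psi_right: "b \<in> CC \<Longrightarrow> c \<in> CC \<Longrightarrow> dual_right A (psi c) b = psi (c \<cdot> sigma b)"
proof (rule ext)
  fix x assume bc: "b \<in> CC" "c \<in> CC"
  have "\<theta> (b \<cdot> x \<cdot> c) = \<theta> (x \<cdot> (c \<cdot> sigma b))" if "x \<in> CC"
    using sigma(2)[of b "x \<cdot> c"] bc that by (simp add: mult_assoc)
  then show "dual_right A (psi c) b x = psi (c \<cdot> sigma b) x" using bc by (simp add: dual_right_def psi_def)
qed

text \<open>\<open>sigma b\<close> pairs nontrivially only with the degree with which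
  \<open>b\<close> does, namely m - t; \<open>psi_dual_comp\<close> turns this into
  homogeneity.\<close>

lemma sigma_comp: "b \<in> comp A t \<Longrightarrow> sigma b \<in> comp A t"
proof (cases "t \<le> m")
  case False
  assume "b \<in> comp A t"
  then have "b = 0" using comp_above[of t] False by auto
  moreover have "sigma 0 = 0" by (rule sigma_eqI) auto
  ultimately show ?thesis by simp
next
  case True
  assume b: "b \<in> comp A t"
  then have bC: "b \<in> CC" using comp_CC by blast
  have "\<theta> (x \<cdot> sigma b) = 0" if "x \<in> comp A s" "s \<noteq> m - t" for x s
    using form_degree[OF mult_comp[OF b that(1)]] that sigma(2)[OF bC comp_CC[OF that(1)]] by auto
  then have "psi (sigma b) \<in> dual_comp A (m - t)"
    using psi_local_dual[of "sigma b"] bC by (auto simp: dual_comp_def psi_def)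
  then show ?thesis using psi_dual_comp[of "sigma b" "m - t"] bC True by simp
qed

lemma kappa_add: "a \<in> CC \<Longrightarrow> b \<in> CC \<Longrightarrow> kappa (a + b) = kappa a + kappa b"
  using kappa_sigma[of "kappa a + kappa b"] by (simp add: sigma_add)

lemma kappa_mult: "a \<in> CC \<Longrightarrow> b \<in> CC \<Longrightarrow> kappa (a \<cdot> b) = kappa a \<cdot> kappa b"
  using kappa_sigma[of "kappa a \<cdot> kappa b"] by (simp add: sigma_mult)

text \<open>Apply \<open>sigma\<close> to the homogeneous parts of \<open>kappa c\<close> and
  compare with \<open>c\<close>: parts in degrees other than t are mapped to 0 and hence are
  0.\<close>

lemma kappa_comp: "c \<in> comp A t \<Longrightarrow> kappa c \<in> comp A t"
proof -
  assume c: "c \<in> comp A t"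
  then have cC: "c \<in> CC" using comp_CC by blast
  have "hc (kappa c) s = 0" if "s \<noteq> t" for s
  proof -
    obtain N where N: "\<forall>s\<ge>N. hc (kappa c) s = 0" "kappa c = (\<Sum>s<N. hc (kappa c) s)"
      using hc_sum_ex[of "kappa c"] cC by auto
    have "c = (\<Sum>s<N. sigma (hc (kappa c) s))"
      using additive_on_sum[OF CC_group, of sigma "{..<N}" "hc (kappa c)"] sigma_add N(2) cC sigma_kappa[OF cC] by simp
    then have "hc c s = (\<Sum>k\<in>{k \<in> {..<N}. k = s}. sigma (hc (kappa c) k))"
      using component_sum_hom[OF grading, of "{..<N}" "\<lambda>s. sigma (hc (kappa c) s)" "\<lambda>s. s" s]
        sigma_comp[OF hc_comp[of "kappa c"]] cC by simp
    moreover have "hc c s = 0" using hc_hom[OF c, of s] that by simp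
    moreover have "{k \<in> {..<N}. k = s} = (if s < N then {s} else {})" by auto
    ultimately have "s < N \<Longrightarrow> sigma (hc (kappa c) s) = 0" by simp
    moreover have "kappa 0 = 0" using kappa_add[of 0 0] by simp
    ultimately have "s < N \<Longrightarrow> hc (kappa c) s = 0" using kappa_sigma[of "hc (kappa c) s"] cC by simp
    then show ?thesis using N(1) by (cases "s < N") auto
  qed
  then show ?thesis by (rule comp_of_hc[OF kappa_CC[OF cC]])
qed

end

section \<open>Coordinates and quiver of the trivial extension\<close>

locale frobenius_extension = frobenius_presented A m \<theta> \<nu> E
  for A :: "('k::field, 'v, 'a::ab_group_add) galgebra" and m \<theta> \<nu> E +
  fixes n :: nat
  assumes top_le: "m \<le> n + 1"
begin

abbreviation "TE \<equiv> trivial_extension n A"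

text \<open>Both branches of \<open>dual_shift\<close> agree here: if degree n + 1 is nonzero then m
  = n + 1, and otherwise m is the last nonzero degree.\<close>

lemma shift: "dual_shift n A = m + 1"
proof (cases "comp A (n + 1) = {0}")
  case False
  then have "n + 1 = m" using comp_above[of "n + 1"] top_le by force
  then show ?thesis using False by (simp add: dual_shift_def)
next
  case True
  have sub: "{t. comp A t \<noteq> {0}} \<subseteq> {..m}" using comp_above by (auto simp: not_le[symmetric])
  then have "Max {t. comp A t \<noteq> {0}} = m"
    using comp_top by (intro Max_eqI) (auto intro: finite_subset[OF sub])
  then show ?thesis using True by (simp add: dual_shift_def)
qed

text \<open>The element a + c x. The whole carrier has this form because \<open>psi\<close> is onto
  the local dual, so computations reduce to pairs of elements of \<open>A\<close>.\<close>

definition em :: "'a \<Rightarrow> 'a \<Rightarrow> 'a \<times> ('a \<Rightarrow> 'k)" where "em a c = (a, psi c)"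

lemma em_eq: "c \<in> CC \<Longrightarrow> e \<in> CC \<Longrightarrow> em a c = em b e \<longleftrightarrow> a = b \<and> c = e"
  by (auto simp: em_def psi_inj)

lemma em_zero: "em 0 0 = 0" by (simp add: em_def zero_prod_def)

lemma em_eq_0: "c \<in> CC \<Longrightarrow> em a c = 0 \<longleftrightarrow> a = 0 \<and> c = 0"
  using em_eq[of c 0 a 0] em_zero by simp

lemma em_add: "c \<in> CC \<Longrightarrow> e \<in> CC \<Longrightarrow> em a c + em b e = em (a + b) (c + e)"
  by (simp add: em_def psi_add)

lemma em_diff: "c \<in> CC \<Longrightarrow> e \<in> CC \<Longrightarrow> em a c - em b e = em (a - b) (c - e)"
  by (simp add: em_def psi_diff)

lemma em_sum: "(\<And>i. i \<in> I \<Longrightarrow> g i \<in> CC) \<Longrightarrow> (\<Sum>i\<in>I. em (f i) (g i)) = em (\<Sum>i\<in>I. f i) (\<Sum>i\<in>I. g i)"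
  unfolding em_def sum_Pair by (simp add: psi_sum)

lemma TE_simps[simp]: "vertices TE = VV" "idem TE i = em (ee i) 0"
  by (simp_all add: trivial_extension_def em_def zero_fun_def)

lemma TE_carrier: "carrier TE = {em a c | a c. a \<in> CC \<and> c \<in> CC}"
  by (auto simp: trivial_extension_def local_dual_eq em_def)

lemma TE_carrierI[simp]: "a \<in> CC \<Longrightarrow> c \<in> CC \<Longrightarrow> em a c \<in> carrier TE"
  by (auto simp: TE_carrier)

lemma TE_carrierE: assumes "x \<in> carrier TE" obtains a c where "x = em a c" "a \<in> CC" "c \<in> CC"
  using assms by (auto simp: TE_carrier)

lemma TE_mult: "a \<in> CC \<Longrightarrow> c \<in> CC \<Longrightarrow> b \<in> CC \<Longrightarrow> e \<in> CC \<Longrightarrow>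
  mult TE (em a c) (em b e) = em (a \<cdot> b) (a \<cdot> e + c \<cdot> sigma b)"
  by (simp add: trivial_extension_def em_def psi_left psi_right psi_add)

lemma TE_scale: "c \<in> CC \<Longrightarrow> scale TE r (em a c) = em (r *s a) (r *s c)"
  by (simp add: trivial_extension_def em_def psi_scale)

text \<open>The coefficients c for which c x has degree s. As x has degree 1, they form degree s - 1
  of \<open>A\<close>, and there are none but 0 for s = 0.\<close>

definition dg :: "nat \<Rightarrow> 'a set" where "dg s = (case s of 0 \<Rightarrow> {0} | Suc r \<Rightarrow> comp A r)"

lemma dg_simps: "dg 0 = {0}" "dg (Suc r) = comp A r" by (simp_all add: dg_def)

lemma dg_CC: "c \<in> dg s \<Longrightarrow> c \<in> CC"
  using comp_CC by (auto simp: dg_def split: nat.splits)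

lemma dg_group: "add_subgroup (dg s)"
  using comp_group by (cases s) (auto simp: dg_simps add_subgroup_def)

lemma dg_scale: "c \<in> dg s \<Longrightarrow> r *s c \<in> dg s"
  by (cases s) (auto simp: dg_simps)

text \<open>A form concentrated above the top degree m vanishes; this empties the dual part of
  degree 0.\<close>

lemma dual_comp_0: "dual_comp A (m + 1) = {0}"
proof -
  have "c = 0" if c: "c \<in> CC" "psi c \<in> dual_comp A (m + 1)" for c
  proof -
    have "\<theta> (x \<cdot> c) = 0" if "x \<in> CC" for x
      using that
    proof (induction rule: carrier_induct)
      case (pc x j t i)
      note x = pcD[OF pc(3)]
      show ?case
      proof (cases "t = m + 1")
        case True
        then have "x = 0" using comp_above[of t] x by auto
        then show ?thesis using c by simp
      next
        case False
        then have "\<forall>x\<in>comp A t. psi c x = 0" using c(2) unfolding dual_comp_def by blast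
        then have "psi c x = 0" using x(1) by blast
        then show ?thesis using x(4) by (simp add: psi_def)
      qed
    qed (use c in \<open>simp_all add: mult_add_left form_add\<close>)
    then show ?thesis using form_unique[of c 0] c by simp
  qed
  moreover have "0 \<in> dual_comp A (m + 1)" using psi_local_dual[of 0] by (simp add: dual_comp_def)
  moreover have "dual_comp A (m + 1) \<subseteq> psi ` CC" by (auto simp: dual_comp_def local_dual_eq[symmetric])
  ultimately show ?thesis using psi_zero by fastforce
qed

lemma TE_comp: "comp TE s = {em a c | a c. a \<in> comp A s \<and> c \<in> dg s}"
proof -
  have *: "(if s \<le> m + 1 then dual_comp A (m + 1 - s) else {0}) = psi ` dg s"
  proof (cases s)
    case 0 then show ?thesis using dual_comp_0 by (simp add: dg_simps)
  next
    case (Suc r)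
    show ?thesis
    proof (cases "r \<le> m")
      case True
      have "dual_comp A (m - r) = psi ` comp A r"
      proof (intro equalityI subsetI)
        fix f assume f: "f \<in> dual_comp A (m - r)"
        then obtain c where c: "c \<in> CC" "f = psi c" using local_dual_eq by (auto simp: dual_comp_def)
        then show "f \<in> psi ` comp A r" using psi_dual_comp[OF c(1), of "m - r"] f True by simp
      next
        fix f assume "f \<in> psi ` comp A r"
        then obtain c where c: "c \<in> comp A r" "f = psi c" by blast
        then show "f \<in> dual_comp A (m - r)" using psi_dual_comp[OF comp_CC[OF c(1)], of "m - r"] True by simp
      qed
      then show ?thesis using True Suc by (simp add: dg_simps)
    next
      case False
      then show ?thesis using Suc comp_above[of r] by (simp add: dg_simps)
    qed
  qed
  have "comp TE s = comp A s \<times> (if s \<le> m + 1 then dual_comp A (m + 1 - s) else {0})"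
    by (simp only: trivial_extension_def galgebra.simps shift)
  then show ?thesis unfolding * em_def by auto
qed

lemma TE_compI: "a \<in> comp A s \<Longrightarrow> c \<in> dg s \<Longrightarrow> em a c \<in> comp TE s"
  by (auto simp: TE_comp)

lemma TE_compE: assumes "x \<in> comp TE s" obtains a c where "x = em a c" "a \<in> comp A s" "c \<in> dg s"
  using assms by (auto simp: TE_comp)

lemma sigma_zero[simp]: "sigma 0 = 0" and kappa_zero[simp]: "kappa 0 = 0"
  using sigma_scale[of 0 0] kappa_sigma[of 0] by simp_all

lemma TE_grading: "Submission.grading (carrier TE) (comp TE)"
  unfolding grading_def
proof (intro conjI allI ballI impI)
  show "add_subgroup (carrier TE)"
    unfolding add_subgroup_def
  proof (intro conjI ballI)
    show "0 \<in> carrier TE" using TE_carrierI[of 0 0] em_zero by simp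
    fix x y assume "x \<in> carrier TE" "y \<in> carrier TE"
    then show "x - y \<in> carrier TE" by (elim TE_carrierE) (simp add: em_diff)
  qed
  fix s
  show "add_subgroup (comp TE s)"
    unfolding add_subgroup_def
  proof (intro conjI ballI)
    show "0 \<in> comp TE s" using TE_compI[of 0 s 0] em_zero add_subgroup_zero[OF dg_group] by simp
    fix x y assume "x \<in> comp TE s" "y \<in> comp TE s"
    then show "x - y \<in> comp TE s"
      by (elim TE_compE) (simp add: em_diff dg_CC TE_compI add_subgroup_diff[OF dg_group])
  qed
  show "comp TE s \<subseteq> carrier TE" using comp_CC dg_CC by (auto elim!: TE_compE)
next
  fix x assume "x \<in> carrier TE"
  then obtain a c where x: "x = em a c" "a \<in> CC" "c \<in> CC" by (rule TE_carrierE)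
  obtain N where N: "\<forall>s\<ge>N. hc a s = 0" "a = (\<Sum>s<N. hc a s)" using hc_sum_ex[OF x(2)] by blast
  obtain N' where N': "\<forall>s\<ge>N'. hc c s = 0" "c = (\<Sum>s<N'. hc c s)" using hc_sum_ex[OF x(3)] by blast
  let ?M = "max N N'"
  define g where "g s = (case s of 0 \<Rightarrow> 0 | Suc r \<Rightarrow> hc c r)" for s
  have g: "g s \<in> dg s" for s using hc_comp[OF x(3)] by (simp add: g_def dg_def split: nat.split)
  \<comment> \<open>The dual coordinates are shifted by one degree, hence one more term.\<close>
  define M where "M = Suc ?M"
  have "(\<Sum>s<M. hc a s) = a" unfolding M_def using N sum_lessThan_stable[of N "hc a" "Suc ?M"] by simp
  moreover have "(\<Sum>s<M. g s) = c"
    unfolding M_def sum.lessThan_Suc_shift using N' sum_lessThan_stable[of N' "hc c" ?M] by (simp add: g_def)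
  ultimately have "x = (\<Sum>s<M. em (hc a s) (g s))" using em_sum[of "{..<M}" g "hc a"] dg_CC[OF g] x by simp
  moreover have "\<forall>s. em (hc a s) (g s) \<in> comp TE s" using TE_compI[OF hc_comp[OF x(2)] g] by blast
  ultimately show "\<exists>c N. (\<forall>s. c s \<in> comp TE s) \<and> x = (\<Sum>s<N. c s)"
    by (intro exI[of _ "\<lambda>s. em (hc a s) (g s)"] exI[of _ M] conjI)
next
  fix k N s assume k: "(\<forall>s. k s \<in> comp TE s) \<and> (\<Sum>s<(N::nat). k s) = 0" and s: "s < N"
  then have "\<forall>s. \<exists>a c. k s = em a c \<and> a \<in> comp A s \<and> c \<in> dg s" by (auto simp: TE_comp)
  then obtain a c where ac: "\<And>s. k s = em (a s) (c s)" "\<And>s. a s \<in> comp A s" "\<And>s. c s \<in> dg s" by metis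
  have cC: "c s \<in> CC" for s using ac(3) dg_CC by blast
  have "em (\<Sum>s<N. a s) (\<Sum>s<N. c s) = 0" using k em_sum[of "{..<N}" c a] cC ac(1) by simp
  then have z: "(\<Sum>s<N. a s) = 0" "(\<Sum>s<N. c s) = 0" using em_eq_0 CC_sum[of "{..<N}" c] cC by auto
  have "a s = 0" using comp_independent[of a N s] ac z s by blast
  moreover have "c s = 0"
  proof (cases s)
    case 0 then show ?thesis using ac(3)[of 0] by (simp add: dg_simps)
  next
    case (Suc r)
    obtain M where M: "N = Suc M" using s by (cases N) auto
    have "(\<Sum>s<M. c (Suc s)) = 0" using z(2) ac(3)[of 0] unfolding M sum.lessThan_Suc_shift by (simp add: dg_simps)
    then show ?thesis using comp_independent[of "\<lambda>s. c (Suc s)" M r] ac(3)[of "Suc _"] Suc M s by (simp add: dg_simps)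
  qed
  ultimately show "k s = 0" using ac(1) em_zero by simp
qed

lemma sigma_uu: "finite K \<Longrightarrow> K \<subseteq> VV \<Longrightarrow> sigma (uu (\<nu> ` K)) = uu K"
proof -
  assume K: "finite K" "K \<subseteq> VV"
  have inj: "inj_on \<nu> K" using perm K inj_on_subset by (auto simp: bij_betw_def)
  have "sigma (uu (\<nu> ` K)) = (\<Sum>i\<in>K. sigma (ee (\<nu> i)))"
    unfolding uu_def sum.reindex[OF inj] comp_def
    using K additive_on_sum[OF CC_group, of sigma K "\<lambda>i. ee (\<nu> i)"] sigma_add by (auto simp: subset_iff)
  then show ?thesis unfolding uu_def using K by (simp add: sigma_ee subset_iff)
qed

lemma em_uu: "(\<Sum>j\<in>J. em (ee j) 0) = em (uu J) 0"
  by (subst em_sum) (auto simp: uu_def)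

text \<open>On the right, a sum of idempotents acts on c x through \<open>sigma\<close>. Adding to a
  common unit \<open>J\<close> its image under \<open>\<nu>\<close> makes \<open>sigma\<close> of
  the enlarged sum an idempotent sum over a set that still contains \<open>J\<close>.\<close>

lemma TE_unit:
  assumes "a \<in> CC" "c \<in> CC"
  obtains J where "finite J" "J \<subseteq> VV" "uu J \<cdot> a = a" "a \<cdot> uu J = a" "uu J \<cdot> c = c" "c \<cdot> sigma (uu J) = c"
proof -
  have "\<exists>J. finite J \<and> J \<subseteq> VV \<and> (\<forall>x\<in>{a, c}. uu J \<cdot> x = x \<and> x \<cdot> uu J = x)"
    by (rule common_unit_ex) (use assms in simp_all)
  then obtain J where J: "finite J" "J \<subseteq> VV" "\<forall>x\<in>{a, c}. uu J \<cdot> x = x \<and> x \<cdot> uu J = x"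
    by (elim exE conjE)
  obtain L where L: "L \<subseteq> VV" "\<nu> ` L = J \<union> \<nu> ` J" "finite L"
  proof -
    let ?L = "J \<union> the_inv_into VV \<nu> ` J"
    have inv: "bij_betw (the_inv_into VV \<nu>) VV VV" using perm by (rule bij_betw_the_inv_into)
    have "\<nu> (the_inv_into VV \<nu> i) = i" if "i \<in> J" for i using that J perm by (simp add: f_the_inv_into_f_bij_betw subset_iff)
    then have "\<nu> ` ?L = J \<union> \<nu> ` J" by (force simp: image_Un image_image)
    moreover have "?L \<subseteq> VV" using J bij_betwE[OF inv] by auto
    ultimately show ?thesis by (intro that[of ?L]) (simp_all add: J(1))
  qed
  let ?K = "J \<union> \<nu> ` J"
  have K: "finite ?K" "?K \<subseteq> VV" using J by auto
  have "J \<subseteq> L"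
  proof
    fix i assume i: "i \<in> J"
    then have "\<nu> i \<in> \<nu> ` L" using L by blast
    then obtain l where "l \<in> L" "\<nu> i = \<nu> l" by blast
    moreover have "i \<in> VV" using i J by blast
    ultimately have "i = l" using inj_onD[OF bij_betw_imp_inj_on[OF perm]] L(1) by blast
    then show "i \<in> L" using \<open>l \<in> L\<close> by simp
  qed
  then have "c \<cdot> uu L = c" using unit_mono(2)[OF J(1,2) L(3,1)] J assms by simp
  then have "c \<cdot> sigma (uu ?K) = c" using sigma_uu[OF L(3,1)] L(2) by simp
  moreover have "uu ?K \<cdot> a = a" "a \<cdot> uu ?K = a" "uu ?K \<cdot> c = c"
    using unit_mono[OF J(1,2) K] J(3) assms by auto
  ultimately show ?thesis by (intro that[OF K])
qed

lemma add_span_image: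
  assumes "u \<in> add_span X" "\<And>u v. f (u + v) = f u + f v" "\<And>x. x \<in> X \<Longrightarrow> f x \<in> Y"
  shows "(f :: 'a \<Rightarrow> 'a \<times> ('a \<Rightarrow> 'k)) u \<in> add_span Y"
  using assms(1)
proof induction
  case zero
  have "f 0 = 0" using assms(2)[of 0 0] by simp
  then show ?case by (simp add: add_span.zero)
next
  case (step x y)
  then show ?case using assms by (auto intro: add_span.step)
qed

lemma em_left_add: "em (u + v) 0 = em u 0 + em v 0"
  by (subst em_add) auto

lemma TE_graded_algebra: "graded_algebra TE"
proof
  show "Submission.grading (carrier TE) (comp TE)" by (rule TE_grading)
  show "mult TE x y \<in> carrier TE" if "x \<in> carrier TE" "y \<in> carrier TE" for x y
    using that by (elim TE_carrierE) (simp add: TE_mult)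
  show "mult TE (x + y) z = mult TE x z + mult TE y z" if "x \<in> carrier TE" "y \<in> carrier TE" "z \<in> carrier TE" for x y z
    using that by (elim TE_carrierE) (simp add: TE_mult em_add mult_add_left add_ac)
  show "mult TE x (y + z) = mult TE x y + mult TE x z" if "x \<in> carrier TE" "y \<in> carrier TE" "z \<in> carrier TE" for x y z
    using that by (elim TE_carrierE) (simp add: TE_mult em_add mult_add_right sigma_add add_ac)
  show "mult TE (mult TE x y) z = mult TE x (mult TE y z)" if "x \<in> carrier TE" "y \<in> carrier TE" "z \<in> carrier TE" for x y z
    using that by (elim TE_carrierE) (simp add: TE_mult mult_add_left mult_add_right sigma_mult mult_assoc add_ac)
  show "scale TE r x \<in> carrier TE" if "x \<in> carrier TE" for r x
    using that by (elim TE_carrierE) (simp add: TE_scale)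
  show "scale TE r (x + y) = scale TE r x + scale TE r y" if "x \<in> carrier TE" "y \<in> carrier TE" for r x y
    using that by (elim TE_carrierE) (simp add: TE_scale em_add scale_add_right)
  show "scale TE (r + s) x = scale TE r x + scale TE s x" if "x \<in> carrier TE" for r s x
    using that by (elim TE_carrierE) (simp add: TE_scale em_add scale_add_left)
  show "scale TE r (scale TE s x) = scale TE (r * s) x" if "x \<in> carrier TE" for r s x
    using that by (elim TE_carrierE) (simp add: TE_scale scale_scale)
  show "scale TE 1 x = x" if "x \<in> carrier TE" for x
    using that by (elim TE_carrierE) (simp add: TE_scale scale_one)
  show "mult TE (scale TE r x) y = scale TE r (mult TE x y)" if "x \<in> carrier TE" "y \<in> carrier TE" for r x y
    using that by (elim TE_carrierE) (simp add: TE_mult TE_scale scale_mult_left scale_add_right)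
  show "mult TE x (scale TE r y) = scale TE r (mult TE x y)" if "x \<in> carrier TE" "y \<in> carrier TE" for r x y
    using that by (elim TE_carrierE) (simp add: TE_mult TE_scale scale_mult_right scale_add_right sigma_scale)
  show "scale TE r x \<in> comp TE t" if "x \<in> comp TE t" for r x t
    using that by (elim TE_compE) (simp add: TE_scale dg_CC TE_compI dg_scale)
  show "mult TE x y \<in> comp TE (s + t)" if "x \<in> comp TE s" "y \<in> comp TE t" for x y s t
  proof -
    note xy = that
    obtain a c where x: "x = em a c" "a \<in> comp A s" "c \<in> dg s" by (rule TE_compE[OF xy(1)])
    obtain b e where y: "y = em b e" "b \<in> comp A t" "e \<in> dg t" by (rule TE_compE[OF xy(2)])
    have "a \<cdot> e \<in> dg (s + t)" using mult_comp[OF x(2), of e "t - 1"] y(3) x(2) comp_CC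
      by (cases t) (auto simp: dg_simps add_subgroup_zero[OF dg_group])
    moreover have "c \<cdot> sigma b \<in> dg (s + t)"
      using mult_comp[of c "s - 1" "sigma b" t] sigma_comp[OF y(2)] x(3) y(2) comp_CC
      by (cases s) (auto simp: dg_simps add_subgroup_zero[OF dg_group])
    ultimately show ?thesis
      using x y mult_comp[OF x(2) y(2)] by (simp add: TE_mult comp_CC[OF x(2)] comp_CC[OF y(2)] dg_CC TE_compI add_subgroup_add[OF dg_group])
  qed
  show "idem TE i \<in> comp TE 0" if "i \<in> vertices TE" for i
    using that by (auto intro!: TE_compI idem_comp simp: dg_simps)
  show "mult TE (idem TE i) (idem TE j) = (if i = j then idem TE i else 0)" if "i \<in> vertices TE" "j \<in> vertices TE" for i j
    using that by (simp add: TE_mult idem_mult em_zero)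
  show "idem TE i \<noteq> 0" if "i \<in> vertices TE" for i
    using that idem_nonzero by (simp add: em_eq_0)
  show "\<exists>J. finite J \<and> J \<subseteq> vertices TE \<and> mult TE (\<Sum>j\<in>J. idem TE j) x = x \<and> mult TE x (\<Sum>j\<in>J. idem TE j) = x"
    if "x \<in> carrier TE" for x
  proof -
    note xc = that
    obtain a c where x: "x = em a c" "a \<in> CC" "c \<in> CC" by (rule TE_carrierE[OF xc])
    obtain J where J: "finite J" "J \<subseteq> VV" "uu J \<cdot> a = a" "a \<cdot> uu J = a" "uu J \<cdot> c = c" "c \<cdot> sigma (uu J) = c"
      by (rule TE_unit[OF x(2,3)])
    then show ?thesis using x by (intro exI[of _ J]) (simp add: em_uu TE_mult)
  qed
  show "\<exists>r. mult TE x (idem TE i) = scale TE r (idem TE i)" if "x \<in> comp TE 0" "i \<in> vertices TE" for x i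
  proof -
    note xi = that
    obtain a c where x: "x = em a c" "a \<in> comp A 0" "c \<in> dg 0" by (rule TE_compE[OF xi(1)])
    obtain r where "a \<cdot> ee i = r *s ee i" using comp0_right[OF x(2)] xi by auto
    then show ?thesis using x xi comp_CC[OF x(2)] by (intro exI[of _ r]) (simp add: TE_mult TE_scale dg_simps)
  qed
  show "\<exists>r. mult TE (idem TE i) x = scale TE r (idem TE i)" if "x \<in> comp TE 0" "i \<in> vertices TE" for x i
  proof -
    note xi = that
    obtain a c where x: "x = em a c" "a \<in> comp A 0" "c \<in> dg 0" by (rule TE_compE[OF xi(1)])
    obtain r where "ee i \<cdot> a = r *s ee i" using comp0_left[OF x(2)] xi by auto
    then show ?thesis using x xi comp_CC[OF x(2)] by (intro exI[of _ r]) (simp add: TE_mult TE_scale dg_simps)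
  qed
  fix t
  show "comp TE (Suc t) \<subseteq> add_span {mult TE b c |b c. b \<in> comp TE 1 \<and> c \<in> comp TE t}"
  proof
    let ?Y = "{mult TE b c |b c. b \<in> comp TE 1 \<and> c \<in> comp TE t}"
    fix x assume "x \<in> comp TE (Suc t)"
    then obtain a c where x: "x = em a c" "a \<in> comp A (Suc t)" "c \<in> comp A t" by (rule TE_compE) (simp add: dg_simps)
    have zt: "0 \<in> dg t" using add_subgroup_zero[OF dg_group] .
    have C: "a \<in> CC" "c \<in> CC" using x comp_CC by blast+
    have "em a 0 \<in> add_span ?Y"
    proof (rule add_span_image[OF subsetD[OF gen_left x(2)], of "\<lambda>u. em u 0"])
      fix u assume "u \<in> {b \<cdot> c |b c. b \<in> comp A 1 \<and> c \<in> comp A t}"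
      then obtain b c where u: "u = b \<cdot> c" "b \<in> comp A 1" "c \<in> comp A t" by blast
      have "em u 0 = mult TE (em b 0) (em c 0)" using u comp_CC[OF u(2)] comp_CC[OF u(3)] by (simp add: TE_mult)
      moreover have "em b 0 \<in> comp TE 1" "em c 0 \<in> comp TE t" using u zt by (auto intro!: TE_compI simp: dg_simps)
      ultimately show "em u 0 \<in> ?Y" by blast
    qed (rule em_left_add)
    \<comment> \<open>c x is the sum of the products (e_j x) \<open>kappa c\<close>: the new arrows
      stand on the left here, so the coefficient passes x by \<open>kappa\<close>, the inverse of
      \<open>sigma\<close>.\<close>
    moreover have "em 0 c \<in> add_span ?Y"
    proof -
      obtain J where J: "finite J" "J \<subseteq> VV" "uu J \<cdot> c = c" "c \<cdot> uu J = c" by (rule unit_obtain[OF C(2)])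
      have JV: "j \<in> J \<Longrightarrow> j \<in> VV" for j using J by blast
      have "em 0 c = em (\<Sum>j\<in>J. 0) (\<Sum>j\<in>J. ee j \<cdot> c)" using unit_sum(1)[OF J(1,2) C(2)] J(3) by simp
      also have "\<dots> = (\<Sum>j\<in>J. em 0 (ee j \<cdot> c))" using JV C by (subst em_sum[symmetric]) auto
      also have "\<dots> \<in> add_span ?Y"
      proof (intro add_span_sum add_span_base)
        fix j assume "j \<in> J"
        then have j: "j \<in> VV" by (rule JV)
        have "em 0 (ee j \<cdot> c) = mult TE (em 0 (ee j)) (em (kappa c) 0)" using j C by (simp add: TE_mult)
        moreover have "em 0 (ee j) \<in> comp TE 1" "em (kappa c) 0 \<in> comp TE t"
          using idem_comp[OF j] kappa_comp[OF x(3)] zt by (auto intro!: TE_compI simp: dg_simps)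
        ultimately show "em 0 (ee j \<cdot> c) \<in> ?Y" by blast
      qed
      finally show ?thesis .
    qed
    ultimately have "em a 0 + em 0 c \<in> add_span ?Y" by (rule add_span_add)
    then show "x \<in> add_span ?Y" using x C by (simp add: em_add)
  qed
  show "comp TE (Suc t) \<subseteq> add_span {mult TE c b |b c. b \<in> comp TE 1 \<and> c \<in> comp TE t}"
  proof
    let ?Y = "{mult TE c b |b c. b \<in> comp TE 1 \<and> c \<in> comp TE t}"
    fix x assume "x \<in> comp TE (Suc t)"
    then obtain a c where x: "x = em a c" "a \<in> comp A (Suc t)" "c \<in> comp A t" by (rule TE_compE) (simp add: dg_simps)
    have zt: "0 \<in> dg t" using add_subgroup_zero[OF dg_group] .
    have C: "a \<in> CC" "c \<in> CC" using x comp_CC by blast+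
    have "em a 0 \<in> add_span ?Y"
    proof (rule add_span_image[OF subsetD[OF gen_right x(2)], of "\<lambda>u. em u 0"])
      fix u assume "u \<in> {c \<cdot> b |b c. b \<in> comp A 1 \<and> c \<in> comp A t}"
      then obtain b c where u: "u = c \<cdot> b" "b \<in> comp A 1" "c \<in> comp A t" by blast
      have "em u 0 = mult TE (em c 0) (em b 0)" using u comp_CC[OF u(2)] comp_CC[OF u(3)] by (simp add: TE_mult)
      moreover have "em b 0 \<in> comp TE 1" "em c 0 \<in> comp TE t" using u zt by (auto intro!: TE_compI simp: dg_simps)
      ultimately show "em u 0 \<in> ?Y" by blast
    qed (rule em_left_add)
    moreover have "em 0 c \<in> add_span ?Y"
    proof -
      obtain J where J: "finite J" "J \<subseteq> VV" "uu J \<cdot> c = c" "c \<cdot> uu J = c" by (rule unit_obtain[OF C(2)])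
      have JV: "j \<in> J \<Longrightarrow> j \<in> VV" for j using J by blast
      have "em 0 c = em (\<Sum>j\<in>J. 0) (\<Sum>j\<in>J. c \<cdot> ee j)" using unit_sum(2)[OF J(1,2) C(2)] J(4) by simp
      also have "\<dots> = (\<Sum>j\<in>J. em 0 (c \<cdot> ee j))" using JV C by (subst em_sum[symmetric]) auto
      also have "\<dots> \<in> add_span ?Y"
      proof (intro add_span_sum add_span_base)
        fix j assume "j \<in> J"
        then have j: "j \<in> VV" by (rule JV)
        have "em 0 (c \<cdot> ee j) = mult TE (em c 0) (em 0 (ee j))" using j C by (simp add: TE_mult)
        moreover have "em 0 (ee j) \<in> comp TE 1" "em c 0 \<in> comp TE t"
          using idem_comp[OF j] x(3) zt by (auto intro!: TE_compI simp: dg_simps)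
        ultimately show "em 0 (c \<cdot> ee j) \<in> ?Y" by blast
      qed
      finally show ?thesis .
    qed
    ultimately have "em a 0 + em 0 c \<in> add_span ?Y" by (rule add_span_add)
    then show "x \<in> add_span ?Y" using x C by (simp add: em_add)
  qed
qed

text \<open>The new arrows are the e_j x. By x b = \<open>sigma b\<close> x, such an arrow runs from
  \<open>\<nu> j\<close> to j.\<close>

definition TE_arrows :: "('a \<times> ('a \<Rightarrow> 'k)) set"
  where "TE_arrows = (\<lambda>\<alpha>. em \<alpha> 0) ` E \<union> (\<lambda>j. em 0 (ee j)) ` VV"

lemma ee_independent:
  assumes "finite F" "F \<subseteq> VV" "(\<Sum>j\<in>F. c j *s ee j) = 0" "i \<in> F"
  shows "c i = 0"
proof -
  have F: "j \<in> F \<Longrightarrow> j \<in> VV" for j using assms by blast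
  have "(\<Sum>j\<in>F. c j *s ee j) \<cdot> ee i = (\<Sum>j\<in>F. if j = i then c i *s ee i else 0)"
    using F assms(4) by (subst mult_sum_left) (auto simp: scale_mult_left idem_mult intro!: sum.cong)
  also have "\<dots> = c i *s ee i" using assms by simp
  finally have "c i *s ee i = 0" using assms F by simp
  then show ?thesis using scale_eq_0[of "ee i" "c i"] F assms idem_nonzero[of i] by auto
qed

lemma ee_inj: "i \<in> VV \<Longrightarrow> j \<in> VV \<Longrightarrow> ee i = ee j \<longleftrightarrow> i = j"
  using idem_mult[of i j] idem_nonzero[of i] ee_idem[of i] by (metis)

lemma TE_presented: "presented_algebra TE TE_arrows"
proof -
  interpret T: graded_algebra TE by (rule TE_graded_algebra)
  have arr: "\<exists>i\<in>VV. \<exists>j\<in>VV. ee j \<cdot> \<alpha> = \<alpha> \<and> \<alpha> \<cdot> ee i = \<alpha>" if "\<alpha> \<in> E" for \<alpha> using arrows_peirce[OF that] by blast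
  have m1: "mult TE (em \<alpha> 0) (idem TE i) = em (\<alpha> \<cdot> ee i) 0" "mult TE (idem TE i) (em \<alpha> 0) = em (ee i \<cdot> \<alpha>) 0"
    if "\<alpha> \<in> CC" "i \<in> VV" for \<alpha> i using that by (simp_all add: TE_mult)
  have m2: "mult TE (em 0 (ee j)) (idem TE i) = em 0 (ee j \<cdot> sigma (ee i))" "mult TE (idem TE i) (em 0 (ee j)) = em 0 (ee i \<cdot> ee j)"
    if "j \<in> VV" "i \<in> VV" for i j using that by (simp_all add: TE_mult)
  show ?thesis
  proof
    show "TE_arrows \<subseteq> comp TE 1"
      using arrows_comp idem_comp by (auto simp: TE_arrows_def dg_simps intro!: TE_compI)
    show "\<exists>i\<in>vertices TE. \<exists>j\<in>vertices TE. mult TE (idem TE j) x = x \<and> mult TE x (idem TE i) = x" if x: "x \<in> TE_arrows" for x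
    proof -
      consider \<alpha> where "\<alpha> \<in> E" "x = em \<alpha> 0" | j where "j \<in> VV" "x = em 0 (ee j)" using x by (auto simp: TE_arrows_def)
      then show ?thesis
      proof cases
        case 1
        then obtain i j where "i \<in> VV" "j \<in> VV" "ee j \<cdot> \<alpha> = \<alpha>" "\<alpha> \<cdot> ee i = \<alpha>" using arr by blast
        then show ?thesis using 1 m1[OF arrow_CC[OF 1(1)]] by (intro bexI[of _ i] bexI[of _ j]) auto
      next
        case 2
        then show ?thesis using m2[OF 2(1)] sigma_ee[OF 2(1)]
          by (intro bexI[of _ "\<nu> j"] bexI[of _ j]) auto
      qed
    qed
    show "\<forall>x\<in>F. c x = 0" if F: "finite F" "F \<subseteq> TE_arrows" "(\<Sum>x\<in>F. scale TE (c x) x) = 0" for F c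
    proof -
      let ?G = "{\<alpha> \<in> E. em \<alpha> 0 \<in> F}" and ?J = "{j \<in> VV. em 0 (ee j) \<in> F}"
      have inj1: "inj_on (\<lambda>\<alpha>. em \<alpha> 0) ?G" by (auto simp: inj_on_def em_eq)
      have inj2: "inj_on (\<lambda>j. em 0 (ee j)) ?J" by (auto simp: inj_on_def em_eq ee_inj)
      have FU: "F = (\<lambda>\<alpha>. em \<alpha> 0) ` ?G \<union> (\<lambda>j. em 0 (ee j)) ` ?J" using F(2) by (auto simp: TE_arrows_def)
      have disj: "(\<lambda>\<alpha>. em \<alpha> 0) ` ?G \<inter> (\<lambda>j. em 0 (ee j)) ` ?J = {}" using idem_nonzero by (auto simp: em_eq)
      have fin: "finite ?G" "finite ?J"
        using finite_subset[OF _ F(1), of "(\<lambda>\<alpha>. em \<alpha> 0) ` ?G"] finite_subset[OF _ F(1), of "(\<lambda>j. em 0 (ee j)) ` ?J"]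
          finite_image_iff[OF inj1] finite_image_iff[OF inj2] by auto
      have "(\<Sum>x\<in>F. scale TE (c x) x) = (\<Sum>x\<in>(\<lambda>\<alpha>. em \<alpha> 0) ` ?G. scale TE (c x) x) + (\<Sum>x\<in>(\<lambda>j. em 0 (ee j)) ` ?J. scale TE (c x) x)"
        by (subst FU, rule sum.union_disjoint[OF _ _ disj]) (use fin in auto)
      also have "\<dots> = (\<Sum>\<alpha>\<in>?G. em (c (em \<alpha> 0) *s \<alpha>) 0) + (\<Sum>j\<in>?J. em 0 (c (em 0 (ee j)) *s ee j))"
        unfolding sum.reindex[OF inj1] sum.reindex[OF inj2] comp_def by (simp add: TE_scale)
      also have "\<dots> = em (\<Sum>\<alpha>\<in>?G. c (em \<alpha> 0) *s \<alpha>) 0 + em 0 (\<Sum>j\<in>?J. c (em 0 (ee j)) *s ee j)"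
        by (subst (1 2) em_sum) auto
      also have "\<dots> = em (\<Sum>\<alpha>\<in>?G. c (em \<alpha> 0) *s \<alpha>) (\<Sum>j\<in>?J. c (em 0 (ee j)) *s ee j)"
        by (subst em_add) (auto intro!: CC_sum)
      finally have "em (\<Sum>\<alpha>\<in>?G. c (em \<alpha> 0) *s \<alpha>) (\<Sum>j\<in>?J. c (em 0 (ee j)) *s ee j) = 0" using F(3) by simp
      then have z: "(\<Sum>\<alpha>\<in>?G. c (em \<alpha> 0) *s \<alpha>) = 0" "(\<Sum>j\<in>?J. c (em 0 (ee j)) *s ee j) = 0"
        using em_eq_0[OF CC_sum[of ?J "\<lambda>j. c (em 0 (ee j)) *s ee j"]] by simp_all
      have "\<forall>\<alpha>\<in>?G. c (em \<alpha> 0) = 0" using arrows_indep[OF fin(1) _ z(1)] by blast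
      moreover have "\<forall>j\<in>?J. c (em 0 (ee j)) = 0" using ee_independent[OF fin(2) _ z(2)] by blast
      ultimately show ?thesis by (subst FU) auto
    qed
    show "\<exists>F c. finite F \<and> F \<subseteq> TE_arrows \<and> x = (\<Sum>x\<in>F. scale TE (c x) x)" if x: "x \<in> comp TE 1" for x
    proof -
      obtain a d where ad: "x = em a d" "a \<in> comp A 1" "d \<in> comp A 0" using x by (rule TE_compE) (simp add: dg_simps)
      have dC: "d \<in> CC" using ad comp_CC by blast
      obtain G c where G: "finite G" "G \<subseteq> E" "a = (\<Sum>x\<in>G. c x *s x)" using arrows_span[OF ad(2)] by blast
      obtain J where J: "finite J" "J \<subseteq> VV" "uu J \<cdot> d = d" "d \<cdot> uu J = d" by (rule unit_obtain[OF dC])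
      have "\<forall>j\<in>J. \<exists>r. d \<cdot> ee j = r *s ee j" using comp0_right[OF ad(3)] J by blast
      then obtain r where r: "\<And>j. j \<in> J \<Longrightarrow> d \<cdot> ee j = r j *s ee j" by metis
      have "d = (\<Sum>j\<in>J. d \<cdot> ee j)" using unit_sum(2)[OF J(1,2) dC] J(4) by simp
      then have d: "d = (\<Sum>j\<in>J. r j *s ee j)" using r by simp
      let ?F1 = "(\<lambda>\<alpha>. em \<alpha> 0) ` G" and ?F2 = "(\<lambda>j. em 0 (ee j)) ` J"
      \<comment> \<open>On these sets an arrow is new exactly when its form component is nonzero;
        its coefficient then belongs to the vertex that it determines.\<close>
      define q where "q x = (if snd x = 0 then c (fst x) else r (SOME j. j \<in> J \<and> x = em 0 (ee j)))" for x
      have JV: "j \<in> J \<Longrightarrow> j \<in> VV" for j using J by blast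
      have q1: "q (em \<alpha> 0) = c \<alpha>" for \<alpha> by (simp add: q_def em_def)
      have q2: "q (em 0 (ee j)) = r j" if "j \<in> J" for j
      proof -
        have "snd (em 0 (ee j)) \<noteq> 0" using that JV idem_nonzero[of j] psi_eq_0[of "ee j"] by (simp add: em_def)
        moreover have "(SOME i. i \<in> J \<and> em 0 (ee j) = em 0 (ee i)) = j"
          using that JV by (intro some_equality) (auto simp: em_eq ee_inj)
        ultimately show ?thesis by (simp add: q_def)
      qed
      have inj1: "inj_on (\<lambda>\<alpha>. em \<alpha> 0) G" by (auto simp: inj_on_def em_eq)
      have inj2: "inj_on (\<lambda>j. em 0 (ee j)) J" using JV by (auto simp: inj_on_def em_eq ee_inj)
      have disj: "?F1 \<inter> ?F2 = {}" using idem_nonzero JV by (auto simp: em_eq)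
      have "(\<Sum>x\<in>?F1 \<union> ?F2. scale TE (q x) x) = (\<Sum>x\<in>?F1. scale TE (q x) x) + (\<Sum>x\<in>?F2. scale TE (q x) x)"
        using G(1) J(1) disj by (intro sum.union_disjoint) auto
      also have "\<dots> = (\<Sum>\<alpha>\<in>G. em (c \<alpha> *s \<alpha>) 0) + (\<Sum>j\<in>J. em 0 (r j *s ee j))"
        unfolding sum.reindex[OF inj1] sum.reindex[OF inj2] comp_def using JV by (simp add: TE_scale q1 q2)
      also have "\<dots> = em a 0 + em 0 d" unfolding G(3) d using JV by (subst (1 2) em_sum) auto
      also have "\<dots> = x" using ad dC by (simp add: em_add)
      finally have "x = (\<Sum>x\<in>?F1 \<union> ?F2. scale TE (q x) x)" by simp
      moreover have "?F1 \<union> ?F2 \<subseteq> TE_arrows" using G J by (auto simp: TE_arrows_def)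
      ultimately show ?thesis using G(1) J(1) by (intro exI[of _ "?F1 \<union> ?F2"] exI[of _ q]) blast
    qed
    show "finite {x \<in> TE_arrows. mult TE x (idem TE i) = x}" if "i \<in> vertices TE" for i
    proof -
      have i: "i \<in> VV" using that by simp
      \<comment> \<open>The only new arrow starting at i is e_l x with \<open>\<nu> l = i\<close>,
        so the quiver stays locally finite.\<close>
      obtain l where l: "l \<in> VV" "\<nu> l = i" using nu_surj[OF i] by blast
      have "sigma (ee i) = ee l" using sigma_ee[OF l(1)] l by simp
      have "{x \<in> TE_arrows. mult TE x (idem TE i) = x} \<subseteq> (\<lambda>\<alpha>. em \<alpha> 0) ` {\<alpha> \<in> E. \<alpha> \<cdot> ee i = \<alpha>} \<union> {em 0 (ee l)}"
      proof clarify
        fix x assume x: "x \<in> TE_arrows" "mult TE x (idem TE i) = x"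
          and nin: "x \<notin> (\<lambda>\<alpha>. em \<alpha> 0) ` {\<alpha> \<in> E. \<alpha> \<cdot> ee i = \<alpha>}" 
        consider \<alpha> where "\<alpha> \<in> E" "x = em \<alpha> 0" | j where "j \<in> VV" "x = em 0 (ee j)" using x by (auto simp: TE_arrows_def)
        then show "x = em 0 (ee l)"
        proof cases
          case 1
          then show ?thesis using x m1[OF arrow_CC[OF 1(1)] i] nin i by (auto simp: em_eq)
        next
          case 2
          then have "em 0 (ee j \<cdot> ee l) = em 0 (ee j)" using x m2[OF 2(1) i] \<open>sigma (ee i) = ee l\<close> by simp
          then have "j = l" using idem_mult[OF 2(1) l(1)] idem_nonzero[OF 2(1)] 2(1) l by (auto simp: em_eq split: if_splits)
          then show ?thesis using 2 by simp
        qed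
      qed
      then show ?thesis by (rule finite_subset) (use arrows_finite(1)[OF i] in simp)
    qed
    show "finite {x \<in> TE_arrows. mult TE (idem TE i) x = x}" if "i \<in> vertices TE" for i
    proof -
      have i: "i \<in> VV" using that by simp
      have "{x \<in> TE_arrows. mult TE (idem TE i) x = x} \<subseteq> (\<lambda>\<alpha>. em \<alpha> 0) ` {\<alpha> \<in> E. ee i \<cdot> \<alpha> = \<alpha>} \<union> {em 0 (ee i)}"
      proof clarify
        fix x assume x: "x \<in> TE_arrows" "mult TE (idem TE i) x = x"
          and nin: "x \<notin> (\<lambda>\<alpha>. em \<alpha> 0) ` {\<alpha> \<in> E. ee i \<cdot> \<alpha> = \<alpha>}" 
        consider \<alpha> where "\<alpha> \<in> E" "x = em \<alpha> 0" | j where "j \<in> VV" "x = em 0 (ee j)" using x by (auto simp: TE_arrows_def)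
        then show "x = em 0 (ee i)"
        proof cases
          case 1
          then show ?thesis using x m1[OF arrow_CC[OF 1(1)] i] nin i by (auto simp: em_eq)
        next
          case 2
          then have "em 0 (ee i \<cdot> ee j) = em 0 (ee j)" using x m2[OF 2(1) i] by simp
          then have "j = i" using idem_mult[OF i 2(1)] idem_nonzero[OF 2(1)] 2(1) i by (auto simp: em_eq split: if_splits)
          then show ?thesis using 2 by simp
        qed
      qed
      then show ?thesis by (rule finite_subset) (use arrows_finite(2)[OF i] in simp)
    qed
    show "vertices TE \<noteq> {}" using vertices_nonempty by simp
    fix i j assume "i \<in> vertices TE" "j \<in> vertices TE"
    then have ij: "i \<in> VV" "j \<in> VV" by simp_all
    let ?R = "{(i, j) | i j x. i \<in> VV \<and> j \<in> VV \<and> x \<in> E \<and> ee j \<cdot> x = x \<and> x \<cdot> ee i = x}"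
    let ?S = "{(i, j) | i j x. i \<in> vertices TE \<and> j \<in> vertices TE \<and> x \<in> TE_arrows \<and> mult TE (idem TE j) x = x \<and> mult TE x (idem TE i) = x}"
    \<comment> \<open>Old arrows survive with the same end points, so connectedness is
      inherited.\<close>
    have "?R \<subseteq> ?S"
    proof clarify
      fix i j x assume h: "i \<in> VV" "j \<in> VV" "x \<in> E" "ee j \<cdot> x = x" "x \<cdot> ee i = x"
      then show "\<exists>i' j' y. (i, j) = (i', j') \<and> i' \<in> vertices TE \<and> j' \<in> vertices TE \<and> y \<in> TE_arrows \<and> mult TE (idem TE j') y = y \<and> mult TE y (idem TE i') = y"
        using m1[OF arrow_CC[OF h(3)] h(1)] m1[OF arrow_CC[OF h(3)] h(2)]
        by (intro exI[of _ i] exI[of _ j] exI[of _ "em x 0"]) (auto simp: TE_arrows_def)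
    qed
    then have "?R \<union> ?R\<inverse> \<subseteq> ?S \<union> ?S\<inverse>" by blast
    moreover have "(i, j) \<in> (?R \<union> ?R\<inverse>)\<^sup>*" using arrows_connected[OF ij] unfolding Let_def .
    ultimately show "(i, j) \<in> (let R = ?S in (R \<union> R\<inverse>)\<^sup>*)"
      unfolding Let_def using rtrancl_mono by blast
  qed
qed

section \<open>The symmetric form and the translation quiver\<close>

definition tr :: "'a \<times> ('a \<Rightarrow> 'k) \<Rightarrow> 'k" where "tr x = \<theta> (THE c. c \<in> CC \<and> snd x = psi c)"

lemma tr_em: "c \<in> CC \<Longrightarrow> tr (em a c) = \<theta> c"
proof -
  assume c: "c \<in> CC"
  have "(THE c'. c' \<in> CC \<and> snd (em a c) = psi c') = c" using c by (intro the_equality) (auto simp: em_def psi_inj)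
  then show ?thesis by (simp add: tr_def)
qed

text \<open>\<open>tr\<close> sends a + c x to \<open>\<theta> c\<close>. On the product with b + e
  x it gives \<open>\<theta> (a \<cdot> e) + \<theta> (b \<cdot> c)\<close>, because
  \<open>sigma\<close> makes up for the asymmetry of \<open>\<theta>\<close>; this is invariant
  under the exchange of the factors.\<close>

lemma tr_commute: "x \<in> carrier TE \<Longrightarrow> y \<in> carrier TE \<Longrightarrow> tr (mult TE x y) = tr (mult TE y x)"
  by (elim TE_carrierE) (simp add: TE_mult tr_em form_add sigma(2)[symmetric])

text \<open>If \<open>a\<close> is nonzero, it is paired with some e x. Otherwise the element is c
  x, and it is paired with some \<open>kappa b\<close>, which cancels the twist. Only one
  homogeneous part of the cofactor matters, and it has degree m + 1 - t.\<close>

lemma tr_nondegenerate: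
  assumes x: "x \<in> comp TE t" "x \<noteq> 0"
  shows "t \<le> m + 1 \<and> (\<exists>y\<in>comp TE (m + 1 - t). tr (mult TE x y) \<noteq> 0)"
proof -
  obtain a c where ac: "x = em a c" "a \<in> comp A t" "c \<in> dg t" using x(1) by (rule TE_compE)
  have C: "a \<in> CC" "c \<in> CC" using ac comp_CC dg_CC by blast+
  show ?thesis
  proof (cases "a = 0")
    case False
    then have tm: "t \<le> m" using comp_above[of t] ac(2) by (rule_tac ccontr) auto
    obtain e where e: "e \<in> CC" "\<theta> (a \<cdot> e) \<noteq> 0" using nondegenerate_right[OF C(1) False] by blast
    have "\<theta> (a \<cdot> e) = \<theta> (a \<cdot> hc e (m - t))"
      using form_hc[of "a \<cdot> e"] hc_mult_left[OF ac(2) e(1), of m] tm C e by simp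
    then have "tr (mult TE x (em 0 (hc e (m - t)))) \<noteq> 0" using ac C e by (simp add: TE_mult tr_em)
    moreover have "em 0 (hc e (m - t)) \<in> comp TE (m + 1 - t)"
      using tm hc_comp[OF e(1), of "m - t"] by (intro TE_compI) (auto simp: Suc_diff_le dg_simps)
    ultimately show ?thesis using tm by auto
  next
    case True
    then have cn: "c \<noteq> 0" using x ac em_zero by auto
    then obtain r where r: "t = Suc r" "c \<in> comp A r" using ac(3) by (cases t) (auto simp: dg_simps)
    then have rm: "r \<le> m" using comp_above[of r] cn by (rule_tac ccontr) auto
    obtain b where b: "b \<in> CC" "\<theta> (c \<cdot> b) \<noteq> 0" using nondegenerate_right[OF C(2) cn] by blast
    have "\<theta> (c \<cdot> b) = \<theta> (c \<cdot> hc b (m - r))"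
      using form_hc[of "c \<cdot> b"] hc_mult_left[OF r(2) b(1), of m] rm C b by simp
    then have "tr (mult TE x (em (kappa (hc b (m - r))) 0)) \<noteq> 0" using ac C b True by (simp add: TE_mult tr_em)
    moreover have "em (kappa (hc b (m - r))) 0 \<in> comp TE (m + 1 - t)"
      using rm r kappa_comp[OF hc_comp[OF b(1)], of "m - r"] add_subgroup_zero[OF dg_group] by (intro TE_compI) auto
    ultimately show ?thesis using rm r by auto
  qed
qed

lemma TE_above: "t > m + 1 \<Longrightarrow> comp TE t = {0}"
  using tr_nondegenerate[of _ t] add_subgroup_zero[OF grading_comp[OF TE_grading, of t]] by fastforce

text \<open>Symmetry of \<open>tr\<close> carries idempotents around a product. So a nonzero
  \<open>u\<close> from j to i is completed, on either side, by an element from i back to j, in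
  total degree m + 1 = n + 2; this is why the translation is the identity.\<close>

lemma TE_n_translation:
  fixes Q :: "('v, 'e, 'k) bound_quiver"
  assumes Q: "bound_quiver Q" "quiver_algebra Q TE" and mn: "m = n + 1"
  shows "n_translation (n + 1) Q {} {} (\<lambda>i. i)"
proof -
  obtain \<pi> where "quiver_presentation Q TE \<pi>" using Q by (rule quiver_algebraD)
  then interpret qp: quiver_presentation Q TE \<pi> .
  have right: "\<exists>b\<in>qp.pc j (n + 1 + 1 - t) i. tr (mult TE u b) \<noteq> 0"
    if ij: "i \<in> VV" "j \<in> VV" and u: "u \<in> qp.pc i t j" "u \<noteq> 0" for i j t u
  proof -
    note u' = qp.pcD[OF u(1)]
    obtain y where y: "y \<in> comp TE (n + 1 + 1 - t)" "tr (mult TE u y) \<noteq> 0"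
      using tr_nondegenerate[OF u'(1) u(2)] mn by auto
    have yC: "y \<in> carrier TE" using y(1) qp.comp_CC by blast
    let ?ei = "idem TE i" and ?ej = "idem TE j"
    have eC: "?ei \<in> carrier TE" "?ej \<in> carrier TE" using ij qp.CC_simps(7) TE_simps(1) by blast+
    let ?b = "mult TE (mult TE ?ej y) ?ei"
    have b: "?b \<in> qp.pc j (n + 1 + 1 - t) i" using qp.pc_proj[OF y(1), of i j] ij by simp
    \<comment> \<open>Cutting the cofactor down to a Peirce piece does not change the trace: the
      idempotent at j is absorbed by \<open>u\<close> at once, the one at i after moving to the
      other side by symmetry.\<close>
    have "mult TE u ?b = mult TE (mult TE u y) ?ei"
    proof -
      have "mult TE u ?b = mult TE (mult TE u (mult TE ?ej y)) ?ei"
        using qp.mult_assoc[OF u'(4) qp.mult_closed[OF eC(2) yC] eC(1)] by simp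
      also have "mult TE u (mult TE ?ej y) = mult TE (mult TE u ?ej) y" using qp.mult_assoc[OF u'(4) eC(2) yC] by simp
      finally show ?thesis using u'(3) by simp
    qed
    then have "tr (mult TE u ?b) = tr (mult TE ?ei (mult TE u y))"
      using tr_commute[OF qp.mult_closed[OF u'(4) yC] eC(1)] by simp
    also have "mult TE ?ei (mult TE u y) = mult TE u y" using qp.mult_assoc[OF eC(1) u'(4) yC] u'(2) by simp
    finally have "tr (mult TE u ?b) \<noteq> 0" using y(2) by simp
    then show ?thesis using b by blast
  qed
  have tr0: "tr 0 = 0" using tr_em[of 0 0] em_zero by simp
  show ?thesis
  proof (rule qp.n_translation_identity)
    show "comp TE t = {0}" if "t > n + 1 + 1" for t using TE_above[of t] that mn by simp
    show "\<exists>b\<in>qp.pc j (n + 1 + 1 - t) i. mult TE u b \<noteq> 0"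
      if "i \<in> vertices TE" "j \<in> vertices TE" "t \<le> n + 1 + 1" "u \<in> qp.pc i t j" "u \<noteq> 0" for i j t u
      using right[of i j u t] that tr0 by force
    show "\<exists>b\<in>qp.pc j (n + 1 + 1 - t) i. mult TE b u \<noteq> 0"
      if h: "i \<in> vertices TE" "j \<in> vertices TE" "t \<le> n + 1 + 1" "u \<in> qp.pc i t j" "u \<noteq> 0" for i j t u
    proof -
      obtain b where b: "b \<in> qp.pc j (n + 1 + 1 - t) i" "tr (mult TE u b) \<noteq> 0" using right[of i j u t] h by auto
      then have "tr (mult TE b u) \<noteq> 0" using tr_commute[OF qp.pcD(4)[OF b(1)] qp.pcD(4)[OF h(4)]] by simp
      then show ?thesis using b(1) tr0 by force
    qed
    show "\<exists>z\<in>carrier TE. \<forall>b\<in>qp.pc i (n + 1 + 1) i. \<exists>r. b = scale TE r z" if "i \<in> vertices TE" for i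
    proof -
      have i: "i \<in> VV" using that by simp
      \<comment> \<open>Degree n + 2 = m + 1 consists of the c x with \<open>c\<close> of degree m,
        as \<open>A\<close> itself vanishes there.\<close>
      have form: "\<exists>c\<in>comp A m. b = em 0 c \<and> ee i \<cdot> c = c" if b: "b \<in> qp.pc i (n + 1 + 1) i" for b
      proof -
        note b' = qp.pcD[OF b]
        obtain a c where ac: "b = em a c" "a \<in> comp A (Suc m)" "c \<in> comp A m"
          using b'(1) mn by (elim TE_compE) (auto simp: dg_simps)
        have "a = 0" using ac comp_above[of "Suc m"] by simp
        moreover have "ee i \<cdot> c = c" using b'(2) ac \<open>a = 0\<close> comp_CC[OF ac(3)] i by (simp add: TE_mult em_eq)
        ultimately show ?thesis using ac by blast
      qed
      \<comment> \<open>For \<open>c\<close> of degree m starting with \<open>ee i\<close>, only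
        degree 0 pairs with it, so every pairing is a multiple of \<open>\<theta> c\<close>. Hence
        \<open>\<theta>\<close> is injective there, and the piece has dimension at most one.\<close>
      have theta0: "c = 0" if c: "c \<in> comp A m" "ee i \<cdot> c = c" "\<theta> c = 0" for c
      proof (rule ccontr)
        assume "c \<noteq> 0"
        have cC: "c \<in> CC" using c comp_CC by blast
        obtain x where x: "x \<in> CC" "\<theta> (x \<cdot> c) \<noteq> 0" using nondegenerate_left[OF cC \<open>c \<noteq> 0\<close>] by blast
        obtain r where r: "hc x 0 \<cdot> ee i = r *s ee i" using comp0_right[OF hc_comp[OF x(1)] i] by blast
        have "\<theta> (x \<cdot> c) = \<theta> (hc x 0 \<cdot> c)"
          using form_hc[of "x \<cdot> c"] hc_mult_right[OF c(1) x(1), of m] x cC by simp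
        also have "hc x 0 \<cdot> c = hc x 0 \<cdot> ee i \<cdot> c" using mult_assoc[of "hc x 0" "ee i" c] x cC i c by simp
        also have "\<dots> = r *s c" using r cC i c by (simp add: scale_mult_left)
        finally show False using x(2) c cC by (simp add: form_scale)
      qed
      show ?thesis
      proof (cases "\<exists>c\<in>comp A m. ee i \<cdot> c = c \<and> c \<noteq> 0")
        case True
        then obtain c0 where c0: "c0 \<in> comp A m" "ee i \<cdot> c0 = c0" "c0 \<noteq> 0" by blast
        have C0: "c0 \<in> CC" using c0 comp_CC by blast
        have t0: "\<theta> c0 \<noteq> 0" using theta0 c0 by blast
        have "\<exists>r. b = scale TE r (em 0 c0)" if b: "b \<in> qp.pc i (n + 1 + 1) i" for b
        proof -
          obtain c where c: "c \<in> comp A m" "b = em 0 c" "ee i \<cdot> c = c" using form[OF b] by blast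
          have cC: "c \<in> CC" using c comp_CC by blast
          define r where "r = \<theta> c / \<theta> c0"
          have "c - r *s c0 = 0"
          proof (rule theta0)
            show "c - r *s c0 \<in> comp A m" using c c0 by simp
            show "ee i \<cdot> (c - r *s c0) = c - r *s c0" using c c0 cC C0 i by (simp add: mult_diff_right scale_mult_right)
            show "\<theta> (c - r *s c0) = 0" using cC C0 t0 by (simp add: form_diff form_scale r_def)
          qed
          then show ?thesis using c C0 by (intro exI[of _ r]) (simp add: TE_scale)
        qed
        then show ?thesis using C0 by (intro bexI[of _ "em 0 c0"]) auto
      next
        case False
        then have "b = 0" if "b \<in> qp.pc i (n + 1 + 1) i" for b using form[OF that] em_zero by auto
        then show ?thesis by (intro bexI[of _ 0]) (auto simp: qp.scale_zero)
      qed
    qed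
  qed
qed

text \<open>If m = n + 1, the translation is the identity. If m is smaller, all degrees of the
  extension are at most m + 1 \<le> n + 1, which is the null case.\<close>

lemma TE_n_pretranslation: "n_pretranslation_algebra (n + 1) TE"
proof -
  interpret T: presented_algebra TE TE_arrows by (rule TE_presented)
  obtain Q :: "('v, 'a \<times> ('a \<Rightarrow> 'k), 'k) bound_quiver" where Q: "bound_quiver Q" "quiver_algebra Q TE"
    using T.presentation_ex by blast
  have "n_translation_quiver (n + 1) Q"
  proof (cases "m = n + 1")
    case True
    show ?thesis unfolding n_translation_quiver_def using TE_n_translation[OF Q True] by blast
  next
    case False
    obtain \<pi> where "quiver_presentation Q TE \<pi>" using Q by (rule quiver_algebraD)
    then interpret qp: quiver_presentation Q TE \<pi> .
    have "plen w \<le> n + 1" if "bound_path Q w" for w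
    proof (rule ccontr)
      assume "\<not> plen w \<le> n + 1"
      then have "comp TE (plen w) = {0}" using False top_le by (intro TE_above) simp
      moreover have "w \<in> paths Q" "\<pi> (qp.sg w 1) \<noteq> 0" using that qp.bound_path_iff by auto
      ultimately show False using T.pcD(1)[OF qp.path_pc[of w 1]] by auto
    qed
    then show ?thesis unfolding n_translation_quiver_def by blast
  qed
  then show ?thesis unfolding n_pretranslation_algebra_def using Q by blast
qed

end

section \<open>Linear resolutions\<close>

text \<open>\<open>projective_module\<close> tests against modules on the type of the module itself.
  Freeing the type of the test modules lets projectivity over \<open>A\<close> be used for modules
  over the trivial extension, which live on another type.\<close>

definition lifting_property ::
    "('k, 'v, 'a::ab_group_add) galgebra \<Rightarrow> ('a, 'm::ab_group_add) lmodule \<Rightarrow> 'l::ab_group_add itself \<Rightarrow> bool"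
  where "lifting_property A P L \<longleftrightarrow>
    (\<forall>(M :: ('a, 'l) lmodule) (N :: ('a, 'l) lmodule) g f.
       left_module A M \<and> left_module A N \<and> module_hom A M N g \<and> g ` mcarrier M = mcarrier N \<and>
       module_hom A P N f \<longrightarrow>
       (\<exists>h. module_hom A P M h \<and> (\<forall>x\<in>mcarrier P. g (h x) = f x)))"

lemma projective_iff:
  fixes P :: "('a::ab_group_add, 'm::ab_group_add) lmodule"
  shows "projective_module A P \<longleftrightarrow> left_module A P \<and> lifting_property A P TYPE('m)"
  unfolding projective_module_def lifting_property_def by simp

text \<open>The data of \<open>pq_koszul\<close> for infinite q, apart from projectivity, which is
  kept separate because it depends on the type. At P 0 every element is a cycle, so the head is
  expressed by the degree 0 part alone.\<close>

definition linear_resolution :: "('k, 'v, 'a::ab_group_add) galgebra \<Rightarrow> 'v \<Rightarrow>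
    (nat \<Rightarrow> ('a, 'm::ab_group_add) lmodule) \<Rightarrow> (nat \<Rightarrow> nat \<Rightarrow> 'm set) \<Rightarrow> (nat \<Rightarrow> 'm \<Rightarrow> 'm) \<Rightarrow> bool"
  where "linear_resolution A i P G d \<longleftrightarrow>
    (\<forall>t. graded_module A (P t) (G t) \<and> generated_by A (P t) (G t t)) \<and>
    (\<forall>t. module_hom A (P (Suc t)) (P t) (d t) \<and> (\<forall>s. d t ` G (Suc t) s \<subseteq> G t s)) \<and>
    (\<forall>t. \<forall>x\<in>mcarrier (P (Suc (Suc t))). d t (d (Suc t) x) = 0) \<and>
    (\<forall>t s. (t, s) \<noteq> (0, 0) \<longrightarrow> cycles P d t \<inter> G t s \<subseteq> boundaries P d t) \<and>
    (\<exists>\<phi>. \<phi> ` G 0 0 = {mult A a (idem A i) | a. a \<in> comp A 0} \<and>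
       (\<forall>x\<in>G 0 0. \<forall>y\<in>G 0 0. \<phi> (x + y) = \<phi> x + \<phi> y) \<and>
       (\<forall>a\<in>comp A 0. \<forall>x\<in>G 0 0. \<phi> (act (P 0) a x) = mult A a (\<phi> x)) \<and>
       (\<forall>x\<in>G 0 0. \<phi> x = 0 \<longleftrightarrow> x \<in> boundaries P d 0))"

lemma graded_module_cycles: "graded_module A (P 0) (G 0) \<Longrightarrow> cycles P d 0 \<inter> G 0 0 = G 0 0"
  by (auto simp: graded_module_def cycles_def)

text \<open>If p or q is infinite, no pair of natural numbers meets the exceptional position (q, p +
  q), so S(i) is the only homology.\<close>

lemma koszul_linear_resolution:
  fixes A :: "('k::field, 'v, 'a::ab_group_add) galgebra"
  assumes "koszul A" and i: "i \<in> vertices A"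
  obtains P :: "nat \<Rightarrow> ('a, nat \<Rightarrow> 'a) lmodule" and G d where
    "linear_resolution A i P G d" "\<And>t. projective_module A (P t)"
proof -
  obtain p q where pq: "p = \<infinity> \<or> q = \<infinity>" "pq_koszul p q A" using assms(1) unfolding koszul_def by blast
  obtain P :: "nat \<Rightarrow> ('a, nat \<Rightarrow> 'a) lmodule" and G d where
    lc: "linear_complex q A P G d"
    and ex: "\<forall>t s. (t, s) \<noteq> (0, 0) \<and> \<not> (enat t = q \<and> enat s = p + q) \<longrightarrow> cycles P d t \<inter> G t s \<subseteq> boundaries P d t"
    and phi: "\<exists>\<phi>. \<phi> ` (cycles P d 0 \<inter> G 0 0) = {mult A a (idem A i) | a. a \<in> comp A 0} \<and>
           (\<forall>x\<in>cycles P d 0 \<inter> G 0 0. \<forall>y\<in>cycles P d 0 \<inter> G 0 0. \<phi> (x + y) = \<phi> x + \<phi> y) \<and>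
           (\<forall>a\<in>comp A 0. \<forall>x\<in>cycles P d 0 \<inter> G 0 0. \<phi> (act (P 0) a x) = mult A a (\<phi> x)) \<and>
           (\<forall>x\<in>cycles P d 0 \<inter> G 0 0. \<phi> x = 0 \<longleftrightarrow> x \<in> boundaries P d 0)"
    using pq(2)[unfolded pq_koszul_def, THEN conjunct2, THEN bspec, OF i]
    by - ((erule exE)+, (erule conjE)+, rule that)
  have "\<not> (enat t = q \<and> enat s = p + q)" for t s using pq(1) by auto
  then have ex': "\<forall>t s. (t, s) \<noteq> (0, 0) \<longrightarrow> cycles P d t \<inter> G t s \<subseteq> boundaries P d t" using ex by simp
  have gm: "graded_module A (P 0) (G 0)" using lc unfolding linear_complex_def by simp
  note phi' = phi[unfolded graded_module_cycles[of A P G d, OF gm]]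
  show ?thesis
  proof (rule that)
    show "projective_module A (P t)" for t using lc unfolding linear_complex_def by simp
    show "linear_resolution A i P G d"
      unfolding linear_resolution_def
    proof (intro conjI phi' ex')
    qed (use lc in \<open>simp_all add: linear_complex_def\<close>)
  qed
qed

lemma pq_koszulI:
  fixes A :: "('k::field, 'v, 'a::ab_group_add) galgebra"
  assumes "\<And>t. enat t > p \<Longrightarrow> comp A t = {0}"
    and res: "\<And>i. i \<in> vertices A \<Longrightarrow> \<exists>(P :: nat \<Rightarrow> ('a, nat \<Rightarrow> 'a) lmodule) G d.
      linear_resolution A i P G d \<and> (\<forall>t. projective_module A (P t))"
  shows "pq_koszul p \<infinity> A"
  unfolding pq_koszul_def
proof (intro conjI allI impI ballI)
  fix i assume "i \<in> vertices A"
  then obtain P :: "nat \<Rightarrow> ('a, nat \<Rightarrow> 'a) lmodule" and G d where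
    lr: "linear_resolution A i P G d" and pr: "\<And>t. projective_module A (P t)" using res by blast
  have gm: "graded_module A (P 0) (G 0)" using lr by (simp add: linear_resolution_def)
  have lc: "linear_complex \<infinity> A P G d"
    using lr pr unfolding linear_complex_def linear_resolution_def by simp
  have ex: "\<forall>t s. (t, s) \<noteq> (0, 0) \<and> \<not> (enat t = \<infinity> \<and> enat s = p + \<infinity>) \<longrightarrow> cycles P d t \<inter> G t s \<subseteq> boundaries P d t"
    using lr unfolding linear_resolution_def by simp
  have phi: "\<exists>\<phi>. \<phi> ` (cycles P d 0 \<inter> G 0 0) = {mult A a (idem A i) | a. a \<in> comp A 0} \<and>
           (\<forall>x\<in>cycles P d 0 \<inter> G 0 0. \<forall>y\<in>cycles P d 0 \<inter> G 0 0. \<phi> (x + y) = \<phi> x + \<phi> y) \<and>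
           (\<forall>a\<in>comp A 0. \<forall>x\<in>cycles P d 0 \<inter> G 0 0. \<phi> (act (P 0) a x) = mult A a (\<phi> x)) \<and>
           (\<forall>x\<in>cycles P d 0 \<inter> G 0 0. \<phi> x = 0 \<longleftrightarrow> x \<in> boundaries P d 0)"
    unfolding graded_module_cycles[of A P G d, OF gm] using lr unfolding linear_resolution_def by (elim conjE)
  show "\<exists>(P :: nat \<Rightarrow> ('a, nat \<Rightarrow> 'a) lmodule) G d. linear_complex \<infinity> A P G d \<and>
        (\<forall>t s. (t, s) \<noteq> (0, 0) \<and> \<not> (enat t = \<infinity> \<and> enat s = p + \<infinity>) \<longrightarrow>
           cycles P d t \<inter> G t s \<subseteq> boundaries P d t) \<and>
        (\<exists>\<phi>. \<phi> ` (cycles P d 0 \<inter> G 0 0) = {mult A a (idem A i) | a. a \<in> comp A 0} \<and>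
           (\<forall>x\<in>cycles P d 0 \<inter> G 0 0. \<forall>y\<in>cycles P d 0 \<inter> G 0 0. \<phi> (x + y) = \<phi> x + \<phi> y) \<and>
           (\<forall>a\<in>comp A 0. \<forall>x\<in>cycles P d 0 \<inter> G 0 0. \<phi> (act (P 0) a x) = mult A a (\<phi> x)) \<and>
           (\<forall>x\<in>cycles P d 0 \<inter> G 0 0. \<phi> x = 0 \<longleftrightarrow> x \<in> boundaries P d 0)) \<and>
        (\<forall>r t. p = enat r \<and> \<infinity> = enat t \<longrightarrow>
           cycles P d t \<inter> G t (r + t) \<subseteq> boundaries P d t \<or>
           (\<forall>a\<in>comp A r. \<forall>x\<in>G t t. act (P t) a x \<in> cycles P d t))"
    by (rule exI[of _ P], rule exI[of _ G], rule exI[of _ d], intro conjI lc ex phi) simp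
qed (use assms(1) in simp)

lemma sum_fun_apply: "(\<Sum>i\<in>I. f i) x = (\<Sum>i\<in>I. f i x)"
  for f :: "'i \<Rightarrow> 'x \<Rightarrow> 'm::ab_group_add"
  by (induction I rule: infinite_finite_induct) simp_all

section \<open>Modules over algebras with local units, and finite spans\<close>

context graded_algebra
begin

context
  fixes M :: "('a, 'm::ab_group_add) lmodule"
  assumes M: "left_module A M"
begin

lemma lm_group: "add_subgroup (mcarrier M)" using M by (simp add: left_module_def)
lemma lm_closed: "a \<in> CC \<Longrightarrow> x \<in> mcarrier M \<Longrightarrow> act M a x \<in> mcarrier M" using M by (simp add: left_module_def)
lemma lm_add_left: "a \<in> CC \<Longrightarrow> b \<in> CC \<Longrightarrow> x \<in> mcarrier M \<Longrightarrow> act M (a + b) x = act M a x + act M b x"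
  using M by (simp add: left_module_def)
lemma lm_mult: "a \<in> CC \<Longrightarrow> b \<in> CC \<Longrightarrow> x \<in> mcarrier M \<Longrightarrow> act M (a \<cdot> b) x = act M a (act M b x)"
  using M by (simp add: left_module_def)
lemma lm_add_right: "a \<in> CC \<Longrightarrow> x \<in> mcarrier M \<Longrightarrow> y \<in> mcarrier M \<Longrightarrow> act M a (x + y) = act M a x + act M a y"
  using M by (simp add: left_module_def)

lemma lm_zero[simp]: "a \<in> CC \<Longrightarrow> act M a 0 = 0" "x \<in> mcarrier M \<Longrightarrow> act M 0 x = 0"
  using lm_add_right[of a 0 0] lm_add_left[of 0 0 x] add_subgroup_zero[OF lm_group] by simp_all

lemma lm_sum_left: "x \<in> mcarrier M \<Longrightarrow> (\<And>i. i \<in> I \<Longrightarrow> f i \<in> CC) \<Longrightarrow> act M (sum f I) x = (\<Sum>i\<in>I. act M (f i) x)"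
  using additive_on_sum[OF CC_group, of "\<lambda>a. act M a x" I f] lm_add_left by simp

lemma lm_sum_right: "a \<in> CC \<Longrightarrow> (\<And>i. i \<in> I \<Longrightarrow> f i \<in> mcarrier M) \<Longrightarrow> act M a (sum f I) = (\<Sum>i\<in>I. act M a (f i))"
  using additive_on_sum[OF lm_group, of "\<lambda>x. act M a x" I f] lm_add_right by simp

lemma lm_minus: "a \<in> CC \<Longrightarrow> x \<in> mcarrier M \<Longrightarrow> act M (- a) x = - act M a x"
  "a \<in> CC \<Longrightarrow> x \<in> mcarrier M \<Longrightarrow> act M a (- x) = - act M a x"
  using additive_on_minus[OF CC_group, of "\<lambda>a. act M a x" a] lm_add_left
    additive_on_minus[OF lm_group, of "\<lambda>x. act M a x" x] lm_add_right by simp_all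

lemma lm_diff: "a \<in> CC \<Longrightarrow> x \<in> mcarrier M \<Longrightarrow> y \<in> mcarrier M \<Longrightarrow> act M a (x - y) = act M a x - act M a y"
  using additive_on_diff[OF lm_group, of "\<lambda>x. act M a x" x y] lm_add_right by simp

lemma lm_unit_ex: "x \<in> mcarrier M \<Longrightarrow> \<exists>J. finite J \<and> J \<subseteq> VV \<and> (\<forall>K. J \<subseteq> K \<and> finite K \<and> K \<subseteq> VV \<longrightarrow> act M (uu K) x = x)"
proof -
  assume x: "x \<in> mcarrier M"
  have "\<forall>x\<in>mcarrier M. \<exists>J. finite J \<and> J \<subseteq> VV \<and> x = (\<Sum>i\<in>J. act M (ee i) x)"
    using M unfolding left_module_def by (elim conjE)
  then obtain J where J: "finite J \<and> J \<subseteq> VV \<and> x = (\<Sum>i\<in>J. act M (ee i) x)" using x by (elim ballE exE) auto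
  have uJ: "act M (uu J) x = x" unfolding uu_def using J x by (subst lm_sum_left) auto
  have "act M (uu K) x = x" if K: "J \<subseteq> K" "finite K" "K \<subseteq> VV" for K
  proof -
    have "act M (uu K) x = act M (uu K \<cdot> uu J) x" using uJ lm_mult[of "uu K" "uu J" x] J K x by simp
    also have "uu K \<cdot> uu J = uu J" using J K by (simp add: uu_uu Int_absorb1)
    finally show ?thesis using uJ by simp
  qed
  then show ?thesis using J by blast
qed

lemma submodule:
  assumes N: "add_subgroup N" "N \<subseteq> mcarrier M" and closed: "\<And>a x. a \<in> CC \<Longrightarrow> x \<in> N \<Longrightarrow> act M a x \<in> N"
  shows "left_module A (M\<lparr>mcarrier := N\<rparr>)"
proof -
  have *: "\<forall>x\<in>mcarrier M. \<exists>J. finite J \<and> J \<subseteq> VV \<and> x = (\<Sum>i\<in>J. act M (ee i) x)"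
    using M unfolding left_module_def by (elim conjE)
  have sub: "x \<in> N \<Longrightarrow> x \<in> mcarrier M" for x using N by blast
  show ?thesis
    unfolding left_module_def lmodule.simps
    by (intro conjI ballI) (use N closed sub lm_add_left lm_mult lm_add_right * in \<open>simp_all\<close>)
qed

text \<open>Spans over degree 0 stand in for linear spans, as modules carry no scalars of their own;
  the scalars enter through multiples of idempotents.\<close>

definition span0 :: "'m set \<Rightarrow> 'm set" where "span0 X = add_span {act M a x | a x. a \<in> comp A 0 \<and> x \<in> X}"

lemma span0_group: assumes X: "X \<subseteq> mcarrier M" shows "add_subgroup (span0 X)"
  unfolding span0_def
proof (rule add_span_subgroup)
  fix u assume "u \<in> {act M a x | a x. a \<in> comp A 0 \<and> x \<in> X}"
  then obtain a x where u: "u = act M a x" "a \<in> comp A 0" "x \<in> X" by blast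
  then have "- u = act M (- a) x" using lm_minus(1)[of a x] comp_CC[OF u(2)] X by auto
  then show "- u \<in> {act M a x | a x. a \<in> comp A 0 \<and> x \<in> X}" using u by (auto intro!: comp_simps)
qed

lemma span0_base: "a \<in> comp A 0 \<Longrightarrow> x \<in> X \<Longrightarrow> act M a x \<in> span0 X"
  unfolding span0_def by (rule add_span_base) blast

lemma span0_mono: "X \<subseteq> Y \<Longrightarrow> Y \<subseteq> mcarrier M \<Longrightarrow> span0 X \<subseteq> span0 Y"
  unfolding span0_def[of X] by (rule add_span_least[OF _ span0_group]) (auto intro!: span0_base)

lemma span0_subset: "X \<subseteq> V \<Longrightarrow> V \<subseteq> mcarrier M \<Longrightarrow> add_subgroup V \<Longrightarrow> (\<And>a v. a \<in> comp A 0 \<Longrightarrow> v \<in> V \<Longrightarrow> act M a v \<in> V) \<Longrightarrow> span0 X \<subseteq> V"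
  unfolding span0_def by (rule add_span_least) auto

lemma span0_carrier: "X \<subseteq> mcarrier M \<Longrightarrow> span0 X \<subseteq> mcarrier M"
  by (rule span0_subset) (auto simp: lm_group intro: lm_closed comp_CC)

lemma span0_act: assumes X: "X \<subseteq> mcarrier M" and a: "a \<in> comp A 0" and u: "u \<in> span0 X"
  shows "act M a u \<in> span0 X"
proof -
  have aC: "a \<in> CC" using a comp_CC by blast
  have sub: "add_subgroup {u \<in> mcarrier M. act M a u \<in> span0 X}"
    using add_subgroup_zero[OF span0_group[OF X]] add_subgroup_diff[OF span0_group[OF X]] aC
      add_subgroup_zero[OF lm_group] add_subgroup_diff[OF lm_group]
    by (auto simp: add_subgroup_def lm_diff)
  have "span0 X \<subseteq> {u \<in> mcarrier M. act M a u \<in> span0 X}"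
    unfolding span0_def[of X]
  proof (rule add_span_least[OF _ sub[unfolded span0_def]], clarify, intro conjI)
    fix b x assume b: "b \<in> comp A 0" "x \<in> X"
    then have bC: "b \<in> CC" "x \<in> mcarrier M" using X comp_CC by blast+
    then show "act M b x \<in> mcarrier M" by (rule lm_closed)
    have "act M a (act M b x) = act M (a \<cdot> b) x" using aC bC by (simp add: lm_mult)
    also have "\<dots> \<in> span0 X" by (rule span0_base[OF mult_comp0_left[OF a b(1)] b(2)])
    finally show "act M a (act M b x) \<in> add_span {act M a x | a x. a \<in> comp A 0 \<and> x \<in> X}" unfolding span0_def .
  qed
  then show ?thesis using u by blast
qed

text \<open>Gaussian elimination over degree 0. With one generator \<open>x\<close> set apart,
  either \<open>V\<close> lies in the span of the others, or it contains some x + w', which spans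
  \<open>V\<close> together with generators of the intersection with that span.\<close>

lemma subspace_finitely_spanned:
  "finite X \<Longrightarrow> X \<subseteq> mcarrier M \<Longrightarrow> \<forall>x\<in>X. \<exists>j\<in>VV. act M (ee j) x = x \<Longrightarrow>
    add_subgroup V \<Longrightarrow> V \<subseteq> mcarrier M \<Longrightarrow> (\<And>a v. a \<in> comp A 0 \<Longrightarrow> v \<in> V \<Longrightarrow> act M a v \<in> V) \<Longrightarrow> V \<subseteq> span0 X \<Longrightarrow>
    \<exists>Y. finite Y \<and> Y \<subseteq> V \<and> (\<forall>y\<in>Y. \<exists>j\<in>VV. act M (ee j) y = y) \<and> V \<subseteq> span0 Y"
proof (induction X arbitrary: V rule: finite_induct)
  case empty
  then show ?case by (intro exI[of _ "{}"]) simp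
next
  case (insert x X)
  have X: "X \<subseteq> mcarrier M" "x \<in> mcarrier M" using insert.prems by auto
  obtain j where j: "j \<in> VV" "act M (ee j) x = x" using insert.prems by blast
  note SG = span0_group[OF X(1)]
  have eC: "r *s ee j \<in> comp A 0" for r using idem_comp[OF j(1)] by simp
  have eCC: "r *s ee j \<in> CC" for r using eC comp_CC by blast
  \<comment> \<open>\<open>x\<close> sits at the vertex j, so degree 0 acts on it by scalars: every
    element has a coefficient at \<open>x\<close> and a remainder in the span of
    \<open>X\<close>.\<close>
  have dec: "\<exists>r. \<exists>w\<in>span0 X. u = act M (r *s ee j) x + w" if "u \<in> span0 (insert x X)" for u
    using that unfolding span0_def[of "insert x X"]
  proof induction
    case zero
    then show ?case using X add_subgroup_zero[OF SG] j by (intro exI[of _ 0] bexI[of _ 0]) auto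
  next
    case (step u v)
    then obtain r w where rw: "w \<in> span0 X" "v = act M (r *s ee j) x + w" by blast
    obtain a y where ay: "u = act M a y" "a \<in> comp A 0" "y \<in> insert x X" using step by blast
    show ?case
    proof (cases "y = x")
      case True
      obtain q where q: "a \<cdot> ee j = q *s ee j" using comp0_right[OF ay(2) j(1)] by blast
      have "u = act M (q *s ee j) x" using ay True lm_mult[of a "ee j" x] comp_CC[OF ay(2)] j X q by simp
      then have "u + v = act M ((q + r) *s ee j) x + w"
        using rw X j eCC by (simp add: scale_add_left lm_add_left add.assoc)
      then show ?thesis using rw by blast
    next
      case False
      then have "u \<in> span0 X" using ay span0_base by blast
      then have "u + w \<in> span0 X" "u + v = act M (r *s ee j) x + (u + w)"
        using rw add_subgroup_add[OF SG] by (auto simp: add_ac)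
      then show ?thesis by blast
    qed
  qed
  have V': "\<exists>Y. finite Y \<and> Y \<subseteq> V \<inter> span0 X \<and> (\<forall>y\<in>Y. \<exists>j\<in>VV. act M (ee j) y = y) \<and> V \<inter> span0 X \<subseteq> span0 Y"
  proof (rule insert.IH)
    show "add_subgroup (V \<inter> span0 X)" using insert.prems(3) SG by (simp add: add_subgroup_def)
    show "act M a v \<in> V \<inter> span0 X" if "a \<in> comp A 0" "v \<in> V \<inter> span0 X" for a v
      using that insert.prems(5) span0_act[OF X(1)] by blast
  qed (use insert.prems X in auto)
  then obtain Y where Y: "finite Y" "Y \<subseteq> V \<inter> span0 X" "\<forall>y\<in>Y. \<exists>j\<in>VV. act M (ee j) y = y" "V \<inter> span0 X \<subseteq> span0 Y" by blast
  show ?case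
  proof (cases "V \<subseteq> span0 X")
    case True
    then have "V \<subseteq> span0 Y" using Y(4) by (simp add: Int_absorb2)
    moreover have "Y \<subseteq> V" using Y(2) by simp
    ultimately show ?thesis using Y(1,3) by (intro exI[of _ Y] conjI)
  next
    case False
    then obtain v where v: "v \<in> V" "v \<notin> span0 X" by blast
    obtain r w where rw: "w \<in> span0 X" "v = act M (r *s ee j) x + w" using dec v insert.prems by blast
    have wM: "w \<in> mcarrier M" using rw span0_carrier[OF X(1)] by blast
    have r: "r \<noteq> 0" using rw v X j by auto
    \<comment> \<open>Dividing by the coefficient of \<open>x\<close> and cutting with
      \<open>ee j\<close> normalises \<open>v\<close> to the form x + w'.\<close>
    define y where "y = act M (inverse r *s ee j) v"
    have yV: "y \<in> V" unfolding y_def using v eC insert.prems(5) by blast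
    have yM: "y \<in> mcarrier M" using yV insert.prems by blast
    define w' where "w' = act M (inverse r *s ee j) w"
    have w': "w' \<in> span0 X" unfolding w'_def using span0_act[OF X(1) eC rw(1)] .
    have w'M: "w' \<in> mcarrier M" using w' span0_carrier[OF X(1)] by blast
    have "act M (inverse r *s ee j) (act M (r *s ee j) x) = act M ((inverse r *s ee j) \<cdot> (r *s ee j)) x"
      using X eCC by (simp add: lm_mult)
    also have "(inverse r *s ee j) \<cdot> (r *s ee j) = ee j"
      using r j by (simp add: scale_mult_left scale_mult_right scale_scale scale_one)
    finally have yx: "y = x + w'"
      unfolding y_def w'_def rw(2) using eCC X wM j lm_closed[OF eCC X(2)] by (simp add: lm_add_right)
    have yj: "act M (ee j) y = y"
      unfolding y_def using lm_mult[of "ee j" "inverse r *s ee j" v] j eCC v insert.prems by (auto simp: scale_mult_right)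
    let ?Y = "insert y Y"
    have YM: "?Y \<subseteq> mcarrier M" using yM Y insert.prems by blast
    have "u \<in> span0 ?Y" if u: "u \<in> V" for u
    proof -
      obtain q w2 where q: "w2 \<in> span0 X" "u = act M (q *s ee j) x + w2" using dec u insert.prems by blast
      have w2M: "w2 \<in> mcarrier M" using q span0_carrier[OF X(1)] by blast
      have "act M (q *s ee j) y = act M (q *s ee j) x + act M (q *s ee j) w'"
        unfolding yx using eCC X w'M by (simp add: lm_add_right)
      then have e: "u - act M (q *s ee j) y = w2 - act M (q *s ee j) w'" using q by simp
      have "u - act M (q *s ee j) y \<in> V"
        using u insert.prems(5)[OF eC yV] add_subgroup_diff[OF insert.prems(3)] by blast
      moreover have "u - act M (q *s ee j) y \<in> span0 X"
        unfolding e using q(1) span0_act[OF X(1) eC w'] add_subgroup_diff[OF SG] by blast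
      ultimately have "u - act M (q *s ee j) y \<in> span0 ?Y" using Y(4) span0_mono[of Y ?Y] YM by blast
      moreover have "act M (q *s ee j) y \<in> span0 ?Y" by (rule span0_base[OF eC]) simp
      ultimately have "(u - act M (q *s ee j) y) + act M (q *s ee j) y \<in> span0 ?Y"
        by (rule add_subgroup_add[OF span0_group[OF YM]])
      then show ?thesis by simp
    qed
    then show ?thesis using Y(1-3) yV yj j by (intro exI[of _ ?Y]) auto
  qed
qed

end

text \<open>The sums of products of algebra elements with \<open>G q\<close> form a submodule
  containing \<open>G q\<close>, hence are everything. Taking components of degree s leaves only
  factors of degree s - q, and none if s is below q.\<close>

lemma generated_component:
  assumes gm: "graded_module A M G" and gen: "generated_by A M (G q)" and x: "x \<in> G s"
  shows "if q \<le> s then x \<in> add_span {act M a g | a g. a \<in> comp A (s - q) \<and> g \<in> G q} else x = 0"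
proof -
  have lm: "left_module A M" and gr: "Submission.grading (mcarrier M) G"
    and deg: "\<And>r s a x. a \<in> comp A r \<Longrightarrow> x \<in> G s \<Longrightarrow> act M a x \<in> G (r + s)"
    using gm by (auto simp: graded_module_iff)
  note lmx = lm_group[OF lm] lm_closed[OF lm]
  have GM: "g \<in> G r \<Longrightarrow> g \<in> mcarrier M" for g r using grading_subset[OF gr] .
  let ?S = "{act M a g | a g. a \<in> CC \<and> g \<in> G q}"
  have neg: "- u \<in> ?S" if "u \<in> ?S" for u
  proof -
    from that obtain a g where u: "u = act M a g" "a \<in> CC" "g \<in> G q" by blast
    then have "- u = act M (- a) g" "- a \<in> CC" using lm_minus(1)[OF lm u(2) GM[OF u(3)]] by simp_all
    then show ?thesis using u(3) by blast
  qed
  have SM: "add_span ?S \<subseteq> mcarrier M" by (rule add_span_least[OF _ lmx(1)]) (use lmx GM in auto)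
  have "add_span ?S = mcarrier M"
  proof (rule gen[unfolded generated_by_def, rule_format], intro conjI)
    show "G q \<subseteq> add_span ?S"
    proof
      fix g assume g: "g \<in> G q"
      obtain J where J: "finite J" "J \<subseteq> VV" "act M (uu J) g = g" using lm_unit_ex[OF lm GM[OF g]] by blast
      then have "g \<in> ?S" using g uu_CC[OF J(2)] by (intro CollectI exI[of _ "uu J"] exI[of _ g]) simp
      then show "g \<in> add_span ?S" by (rule add_span_base)
    qed
    show "add_span ?S \<subseteq> mcarrier M" by (rule SM)
    show "left_module A (M\<lparr>mcarrier := add_span ?S\<rparr>)"
    proof (rule submodule[OF lm add_span_subgroup SM])
      fix u assume "u \<in> ?S" then show "- u \<in> ?S" by (rule neg)
    next
      fix a u assume a: "a \<in> CC" and u: "u \<in> add_span ?S"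
      from u show "act M a u \<in> add_span ?S"
      proof induction
        case zero then show ?case using lm_zero(1)[OF lm a] by (simp add: add_span.zero)
      next
        case (step v w)
        then obtain b g where b: "v = act M b g" "b \<in> CC" "g \<in> G q" by blast
        have "act M a v = act M (a \<cdot> b) g" using lm_mult[OF lm a b(2) GM[OF b(3)]] b by simp
        then have "act M a v \<in> ?S" using b a CC_simps(5) by blast
        moreover have "v \<in> mcarrier M" "w \<in> mcarrier M" using b lmx(2) GM step SM by auto
        ultimately show ?case using lm_add_right[OF lm a] step add_span.step[of _ ?S] by simp
      qed
    qed
  qed
  then have xs: "x \<in> add_span ?S" using GM[OF x] by simp
  let ?T = "\<lambda>s. if q \<le> s then add_span {act M a g | a g. a \<in> comp A (s - q) \<and> g \<in> G q} else {0}"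
  have "u \<in> add_span ?S \<Longrightarrow> component G u s \<in> ?T s" for u
  proof (induction rule: add_span.induct)
    case zero then show ?case using component_zero[OF gr] by (simp add: add_span.zero)
  next
    case (step v w)
    then obtain b g where b: "v = act M b g" "b \<in> CC" "g \<in> G q" by blast
    have vM: "v \<in> mcarrier M" "w \<in> mcarrier M" using b lmx(2) GM step SM by auto
    obtain N where N: "\<forall>s\<ge>N. hc b s = 0" "b = (\<Sum>s<N. hc b s)" using hc_sum_ex[OF b(2)] by blast
    have "v = (\<Sum>r<N. act M (hc b r) g)"
      using lm_sum_left[OF lm GM[OF b(3)], of "{..<N}" "hc b"] N(2) b by simp
    then have "component G v s = (\<Sum>r\<in>{r \<in> {..<N}. r + q = s}. act M (hc b r) g)"
      using component_sum_hom[OF gr, of "{..<N}" "\<lambda>r. act M (hc b r) g" "\<lambda>r. r + q" s] deg[OF hc_comp[OF b(2)] b(3)] by simp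
    also have "\<dots> \<in> ?T s"
    proof (cases "q \<le> s")
      case True
      have "(\<Sum>r\<in>{r \<in> {..<N}. r + q = s}. act M (hc b r) g) \<in> add_span {act M a g | a g. a \<in> comp A (s - q) \<and> g \<in> G q}"
      proof (intro add_span_sum add_span_base)
        fix r assume "r \<in> {r \<in> {..<N}. r + q = s}"
        then have "s - q = r" by auto
        then show "act M (hc b r) g \<in> {act M a g | a g. a \<in> comp A (s - q) \<and> g \<in> G q}"
          using hc_comp[OF b(2), of r] b(3) by blast
      qed
      then show ?thesis using True by simp
    next
      case False
      then have "{r \<in> {..<N}. r + q = s} = {}" by auto
      then show ?thesis using False by (simp only: if_False sum.empty singletonI)
    qed
    finally have "component G v s \<in> ?T s" .
    then show ?case using step vM component_add[OF gr, of v w s] add_span_add by (auto split: if_splits)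
  qed
  then have "component G x s \<in> ?T s" using xs by blast
  then show ?thesis using component_hom[OF gr x, of s] by auto
qed

end

context presented_algebra
begin

text \<open>Only the arrows starting at the vertex of \<open>x\<close> act nontrivially on it, and
  there are finitely many of them.\<close>

lemma arrows_finitely_spanned:
  assumes lm: "left_module A M" and X: "finite X" "X \<subseteq> mcarrier M" "\<forall>x\<in>X. \<exists>j\<in>VV. act M (ee j) x = x"
  shows "\<exists>Y. finite Y \<and> Y \<subseteq> mcarrier M \<and> (\<forall>y\<in>Y. \<exists>j\<in>VV. act M (ee j) y = y) \<and>
    (\<forall>b\<in>comp A 1. \<forall>u\<in>span0 M X. act M b u \<in> span0 M Y)"
proof -
  obtain v where v: "\<forall>x\<in>X. v x \<in> VV \<and> act M (ee (v x)) x = x" using X(3) by metis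
  let ?Y = "\<Union>x\<in>X. (\<lambda>\<alpha>. act M \<alpha> x) ` {\<alpha> \<in> E. \<alpha> \<cdot> ee (v x) = \<alpha>}"
  have fin: "finite ?Y" using X(1) v arrows_finite(1) by auto
  have YM: "?Y \<subseteq> mcarrier M" using X(2) lm_closed[OF lm] arrow_CC by auto
  have Yj: "\<exists>j\<in>VV. act M (ee j) y = y" if "y \<in> ?Y" for y
  proof -
    from that obtain x \<alpha> where y: "x \<in> X" "\<alpha> \<in> E" "y = act M \<alpha> x" by blast
    have "x \<in> mcarrier M" using y X by blast
    then have "act M (ee (ptgt \<alpha>)) y = y"
      using y lm_mult[OF lm, of "ee (ptgt \<alpha>)" \<alpha> x] ptgt[OF y(2)] arrow_CC[OF y(2)] by simp
    then show ?thesis using ptgt(1)[OF y(2)] by blast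
  qed
  have S: "act M b x \<in> span0 M ?Y" if bx: "b \<in> comp A 1" "x \<in> X" for b x
  proof -
    obtain F c where F: "finite F" "F \<subseteq> E" "b = (\<Sum>x\<in>F. c x *s x)" using arrows_span[OF bx(1)] by blast
    have xM: "x \<in> mcarrier M" using bx X by blast
    have "act M b x = (\<Sum>\<alpha>\<in>F. act M (c \<alpha> *s \<alpha>) x)"
      unfolding F(3) using F(2) arrow_CC by (intro lm_sum_left[OF lm xM]) auto
    also have "\<dots> \<in> span0 M ?Y"
    proof (rule add_subgroup_sum[OF span0_group[OF lm YM]])
      fix \<alpha> assume "\<alpha> \<in> F"
      then have \<alpha>: "\<alpha> \<in> E" using F by blast
      have aC: "\<alpha> \<in> CC" by (rule arrow_CC[OF \<alpha>])
      show "act M (c \<alpha> *s \<alpha>) x \<in> span0 M ?Y"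
      proof (cases "\<alpha> \<cdot> ee (v x) = \<alpha>")
        case True
        have "c \<alpha> *s \<alpha> = (c \<alpha> *s ee (ptgt \<alpha>)) \<cdot> \<alpha>" using ptgt[OF \<alpha>] aC by (simp add: scale_mult_left)
        then have "act M (c \<alpha> *s \<alpha>) x = act M (c \<alpha> *s ee (ptgt \<alpha>)) (act M \<alpha> x)"
          using lm_mult[OF lm, of "c \<alpha> *s ee (ptgt \<alpha>)" \<alpha> x] ptgt(1)[OF \<alpha>] aC xM by simp
        also have "\<dots> \<in> span0 M ?Y"
          by (rule span0_base[OF lm]) (use idem_comp[OF ptgt(1)[OF \<alpha>]] \<alpha> True bx in auto)
        finally show ?thesis .
      next
        case False
        have vx: "v x \<in> VV" "act M (ee (v x)) x = x" using v bx by auto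
        have "\<alpha> \<cdot> ee (v x) = 0"
          using pc_vertex(2)[OF arrow_pc[OF \<alpha>] arrow_nonzero[OF \<alpha>] psrc(1)[OF \<alpha>] ptgt(1)[OF \<alpha>] vx(1)] False
          by (auto split: if_splits)
        then have "(c \<alpha> *s \<alpha>) \<cdot> ee (v x) = 0" using aC vx by (simp add: scale_mult_left)
        moreover have "act M (c \<alpha> *s \<alpha>) x = act M ((c \<alpha> *s \<alpha>) \<cdot> ee (v x)) x"
          using lm_mult[OF lm, of "c \<alpha> *s \<alpha>" "ee (v x)" x] aC vx xM by simp
        ultimately show ?thesis using lm_zero(2)[OF lm xM] add_subgroup_zero[OF span0_group[OF lm YM]] by simp
      qed
    qed
    finally show ?thesis .
  qed
  have "act M b u \<in> span0 M ?Y" if b: "b \<in> comp A 1" and u: "u \<in> span0 M X" for b u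
  proof -
    have bC: "b \<in> CC" using b comp_CC by blast
    have sub: "add_subgroup {u \<in> mcarrier M. act M b u \<in> span0 M ?Y}"
      using add_subgroup_zero[OF span0_group[OF lm YM]] add_subgroup_diff[OF span0_group[OF lm YM]] bC
        add_subgroup_zero[OF lm_group[OF lm]] add_subgroup_diff[OF lm_group[OF lm]] lm_zero(1)[OF lm bC] lm_diff[OF lm bC]
      by (auto simp: add_subgroup_def)
    have "span0 M X \<subseteq> {u \<in> mcarrier M. act M b u \<in> span0 M ?Y}"
      unfolding span0_def[OF lm, of X]
    proof (rule add_span_least[OF _ sub], clarify, intro conjI)
      fix a x assume a: "a \<in> comp A 0" "x \<in> X"
      then have aC: "a \<in> CC" "x \<in> mcarrier M" using X comp_CC by blast+
      then show "act M a x \<in> mcarrier M" by (rule lm_closed[OF lm])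
      have "act M b (act M a x) = act M (b \<cdot> a) x" using lm_mult[OF lm bC aC] by simp
      then show "act M b (act M a x) \<in> span0 M ?Y" using S[OF mult_comp0_right[OF b a(1)] a(2)] by simp
    qed
    then show ?thesis using u by blast
  qed
  then show ?thesis using fin YM Yj by (intro exI[of _ ?Y]) blast
qed

end

lemma linear_resolutionD:
  assumes "linear_resolution A i P G d"
  shows "graded_module A (P t) (G t)" "generated_by A (P t) (G t t)"
    "module_hom A (P (Suc t)) (P t) (d t)" "d t ` G (Suc t) s \<subseteq> G t s"
    "x \<in> mcarrier (P (Suc (Suc t))) \<Longrightarrow> d t (d (Suc t) x) = 0"
    "(t, s) \<noteq> (0, 0) \<Longrightarrow> cycles P d t \<inter> G t s \<subseteq> boundaries P d t"
proof -
  note L = assms[unfolded linear_resolution_def]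
  show "graded_module A (P t) (G t)" by (rule L[THEN conjunct1, THEN spec, THEN conjunct1])
  show "generated_by A (P t) (G t t)" by (rule L[THEN conjunct1, THEN spec, THEN conjunct2])
  show "module_hom A (P (Suc t)) (P t) (d t)" by (rule L[THEN conjunct2, THEN conjunct1, THEN spec, THEN conjunct1])
  show "d t ` G (Suc t) s \<subseteq> G t s" by (rule L[THEN conjunct2, THEN conjunct1, THEN spec, THEN conjunct2, THEN spec])
  show "d t (d (Suc t) x) = 0" if "x \<in> mcarrier (P (Suc (Suc t)))"
    by (rule L[THEN conjunct2, THEN conjunct2, THEN conjunct1, THEN spec, THEN bspec, OF that])
  show "cycles P d t \<inter> G t s \<subseteq> boundaries P d t" if "(t, s) \<noteq> (0, 0)"
    by (rule L[THEN conjunct2, THEN conjunct2, THEN conjunct2, THEN conjunct1, THEN spec, THEN spec, THEN mp, OF that])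
qed

lemma linear_resolution_head:
  assumes "linear_resolution A i P G d"
  obtains \<phi> where "\<phi> ` G 0 0 = {mult A a (idem A i) | a. a \<in> comp A 0}"
    "\<And>x y. x \<in> G 0 0 \<Longrightarrow> y \<in> G 0 0 \<Longrightarrow> \<phi> (x + y) = \<phi> x + \<phi> y"
    "\<And>a x. a \<in> comp A 0 \<Longrightarrow> x \<in> G 0 0 \<Longrightarrow> \<phi> (act (P 0) a x) = mult A a (\<phi> x)"
    "\<And>x. x \<in> G 0 0 \<Longrightarrow> \<phi> x = 0 \<longleftrightarrow> x \<in> boundaries P d 0"
proof -
  from assms[unfolded linear_resolution_def, THEN conjunct2, THEN conjunct2, THEN conjunct2, THEN conjunct2]
  show ?thesis
  proof (elim exE conjE)
    fix \<phi> assume p: "\<phi> ` G 0 0 = {mult A a (idem A i) | a. a \<in> comp A 0}"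
      "\<forall>x\<in>G 0 0. \<forall>y\<in>G 0 0. \<phi> (x + y) = \<phi> x + \<phi> y"
      "\<forall>a\<in>comp A 0. \<forall>x\<in>G 0 0. \<phi> (act (P 0) a x) = mult A a (\<phi> x)"
      "\<forall>x\<in>G 0 0. \<phi> x = 0 \<longleftrightarrow> x \<in> boundaries P d 0"
    show thesis
      by (rule that[of \<phi>, OF p(1) p(2)[THEN bspec, THEN bspec] p(3)[THEN bspec, THEN bspec] p(4)[THEN bspec]])
  qed
qed

section \<open>Morphisms and projectivity for all types of test modules\<close>

context graded_algebra
begin

lemma module_homD:
  assumes "module_hom A M N f"
  shows "x \<in> mcarrier M \<Longrightarrow> f x \<in> mcarrier N" "x \<in> mcarrier M \<Longrightarrow> y \<in> mcarrier M \<Longrightarrow> f (x + y) = f x + f y"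
    "a \<in> CC \<Longrightarrow> x \<in> mcarrier M \<Longrightarrow> f (act M a x) = act N a (f x)"
  using assms by (auto simp: module_hom_def)

lemma hom_diff:
  assumes "left_module A M" "module_hom A M N f" "x \<in> mcarrier M" "y \<in> mcarrier M"
  shows "f (x - y) = f x - f y"
  using additive_on_diff[OF lm_group[OF assms(1)], of f x y] module_homD(2)[OF assms(2)] assms(3,4) by blast

lemma hom_sum:
  assumes "left_module A M" "module_hom A M N f" "\<And>i. i \<in> I \<Longrightarrow> g i \<in> mcarrier M"
  shows "f (\<Sum>i\<in>I. g i) = (\<Sum>i\<in>I. f (g i))"
  using additive_on_sum[OF lm_group[OF assms(1)], of f I g] module_homD(2)[OF assms(2)] assms(3) by blast

lemma hom_zero: "left_module A M \<Longrightarrow> module_hom A M N f \<Longrightarrow> f 0 = 0"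
  using additive_on_zero[OF lm_group, of M f] module_homD(2)[of M N f] by blast

lemma hom_component:
  assumes M: "graded_module A M G" and N: "graded_module A N H" and f: "module_hom A M N f"
    and fG: "\<And>s. f ` G s \<subseteq> H s" and x: "x \<in> mcarrier M"
  shows "component H (f x) s = f (component G x s)"
proof -
  have gM: "Submission.grading (mcarrier M) G" and lM: "left_module A M" and gN: "Submission.grading (mcarrier N) H"
    using M N by (auto simp: graded_module_iff)
  obtain n where n: "\<forall>k\<ge>n. x = (\<Sum>s<k. component G x s)" using component_sum_ex[OF gM x] by blast
  have cG: "component G x s \<in> G s" for s by (rule component_in[OF gM x])
  have "component H (f x) = (\<lambda>s. f (component G x s))"
  proof (rule component_eqI[OF gN])
    show "f (component G x s) \<in> H s" for s using fG cG by blast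
    fix k assume "k \<ge> n"
    then have "x = (\<Sum>s<k. component G x s)" using n by blast
    then have "f x = f (\<Sum>s<k. component G x s)" by (rule arg_cong)
    also have "\<dots> = (\<Sum>s<k. f (component G x s))"
      by (rule hom_sum[OF lM f]) (use cG grading_subset[OF gM] in blast)
    finally show "f x = (\<Sum>s<k. f (component G x s))" .
  qed
  then show ?thesis by simp
qed

text \<open>A finitely generated module on \<open>nat \<Rightarrow> 'a\<close> that is projective with respect to test modules on
  this type is a direct summand of some \<open>A\<^sup>N\<close>, and thus projective with respect to all modules.\<close>

lemma lifting_property_finite:
  fixes P :: "('a, nat \<Rightarrow> 'a) lmodule"
  assumes pr: "projective_module A P" and X: "finite X" "X \<subseteq> mcarrier P"
    and gen: "generated_by A P S" and S: "S \<subseteq> span0 P X"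
  shows "lifting_property A P TYPE('l::ab_group_add)"
proof -
  have lP: "left_module A P" using pr by (simp add: projective_module_def)
  obtain N :: nat and xs where xs: "bij_betw xs {..<N} X"
    using ex_bij_betw_nat_finite[OF X(1)] by (auto simp: lessThan_atLeast0)
  have xsP: "xs s \<in> mcarrier P" if "s < N" for s using that xs X by (auto simp: bij_betw_def)
  \<comment> \<open>The module \<open>A^N\<close> fits into the type
    \<open>nat \<Rightarrow> 'a\<close> on which \<open>P\<close> itself lives, so projectivity can
    be tested against its map onto \<open>P\<close>.\<close>
  define F :: "('a, nat \<Rightarrow> 'a) lmodule" where
    "F = \<lparr>mcarrier = {f. (\<forall>s<N. f s \<in> CC) \<and> (\<forall>s\<ge>N. f s = 0)}, act = (\<lambda>a f s. a \<cdot> f s)\<rparr>"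
  have FC: "f \<in> mcarrier F \<longleftrightarrow> (\<forall>s<N. f s \<in> CC) \<and> (\<forall>s\<ge>N. f s = 0)" for f by (simp add: F_def)
  have actF: "act F a f = (\<lambda>s. a \<cdot> f s)" for a f by (simp add: F_def)
  have FCC: "f s \<in> CC" if "f \<in> mcarrier F" for f s using that by (cases "s < N") (auto simp: FC)
  have lF: "left_module A F"
    unfolding left_module_def
  proof (intro conjI ballI)
    show "add_subgroup (mcarrier F)" unfolding add_subgroup_def by (auto simp: FC)
    fix f assume f: "f \<in> mcarrier F"
    have "\<exists>J. finite J \<and> J \<subseteq> VV \<and> (\<forall>a\<in>f ` {..<N}. uu J \<cdot> a = a \<and> a \<cdot> uu J = a)"
      by (rule common_unit_ex) (use f in \<open>auto simp: FC\<close>)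
    then obtain J where J: "finite J" "J \<subseteq> VV" "\<forall>a\<in>f ` {..<N}. uu J \<cdot> a = a \<and> a \<cdot> uu J = a" by blast
    have "f s = (\<Sum>i\<in>J. ee i \<cdot> f s)" for s
    proof (cases "s < N")
      case True
      then show ?thesis using unit_sum(1)[OF J(1,2) FCC[OF f], of s] J(3) by simp
    next
      case False
      then show ?thesis using f J by (auto simp: FC subset_iff intro!: sum.neutral[symmetric])
    qed
    then have "f = (\<Sum>i\<in>J. act F (ee i) f)" by (intro ext) (simp add: actF sum_fun_apply)
    then show "\<exists>J. finite J \<and> J \<subseteq> VV \<and> f = (\<Sum>i\<in>J. act F (ee i) f)" using J by blast
  qed (auto simp: FC actF fun_eq_iff mult_add_left mult_add_right mult_assoc FCC[unfolded FC] dest: FCC)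
  define p where "p f = (\<Sum>s<N. act P (f s) (xs s))" for f
  have pP: "p f \<in> mcarrier P" if "f \<in> mcarrier F" for f
    unfolding p_def using FCC[OF that] xsP lm_closed[OF lP] by (intro add_subgroup_sum[OF lm_group[OF lP]]) auto
  have padd: "p (f + g) = p f + p g" if "f \<in> mcarrier F" "g \<in> mcarrier F" for f g
    unfolding p_def sum.distrib[symmetric] using FCC that xsP lm_add_left[OF lP] by (intro sum.cong refl) auto
  have pact: "p (act F a f) = act P a (p f)" if "a \<in> CC" "f \<in> mcarrier F" for a f
    unfolding p_def actF using FCC that xsP lm_mult[OF lP] lm_closed[OF lP]
    by (subst lm_sum_right[OF lP]) (auto intro!: sum.cong)
  have pF: "module_hom A F P p" unfolding module_hom_def using pP padd pact by blast
  have sub: "add_subgroup (p ` mcarrier F)"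
    unfolding add_subgroup_def
  proof (intro conjI ballI)
    show "0 \<in> p ` mcarrier F" using hom_zero[OF lF pF] add_subgroup_zero[OF lm_group[OF lF]] by force
    fix x y assume "x \<in> p ` mcarrier F" "y \<in> p ` mcarrier F"
    then obtain f g where fg: "f \<in> mcarrier F" "g \<in> mcarrier F" "x = p f" "y = p g" by blast
    then have "x - y = p (f - g)" using hom_diff[OF lF pF] by simp
    then show "x - y \<in> p ` mcarrier F" using add_subgroup_diff[OF lm_group[OF lF]] fg by blast
  qed
  have act_im: "act P a x \<in> p ` mcarrier F" if "a \<in> CC" "x \<in> p ` mcarrier F" for a x
  proof -
    from that(2) obtain f where f: "f \<in> mcarrier F" "x = p f" by blast
    then show ?thesis using pact[OF that(1) f(1)] lm_closed[OF lF that(1) f(1)] by (metis imageI)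
  qed
  have "p ` mcarrier F = mcarrier P"
  proof (rule gen[unfolded generated_by_def, rule_format], intro conjI)
    show im: "p ` mcarrier F \<subseteq> mcarrier P" using pP by blast
    show "left_module A (P\<lparr>mcarrier := p ` mcarrier F\<rparr>)" by (rule submodule[OF lP sub im act_im])
    have "span0 P X \<subseteq> p ` mcarrier F"
      unfolding span0_def[OF lP]
    proof (rule add_span_least[OF _ sub], clarify)
      fix a x assume a: "a \<in> comp A 0" and "x \<in> X"
      then obtain s where s: "s < N" "xs s = x" using xs by (auto simp: bij_betw_def)
      let ?f = "\<lambda>r. if r = s then a else 0"
      have f: "?f \<in> mcarrier F" using s comp_CC[OF a] by (auto simp: FC)
      have "p ?f = (\<Sum>r<N. if r = s then act P a x else 0)"
        unfolding p_def using s lm_zero(2)[OF lP] xsP by (intro sum.cong refl) auto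
      also have "\<dots> = act P a x" using s by simp
      finally show "act P a x \<in> p ` mcarrier F" using f by (metis imageI)
    qed
    then show "S \<subseteq> p ` mcarrier F" using S by blast
  qed
  moreover have "module_hom A P P (\<lambda>x. x)" by (simp add: module_hom_def)
  \<comment> \<open>A section of \<open>p\<close>: the values \<open>h x s\<close> are coordinates
    of \<open>x\<close> with respect to the generators \<open>xs s\<close>.\<close>
  ultimately obtain h where h: "module_hom A P F h" "\<And>x. x \<in> mcarrier P \<Longrightarrow> p (h x) = x"
    using pr lF lP pF unfolding projective_module_def by blast
  show ?thesis
    unfolding lifting_property_def
  proof (intro allI impI, elim conjE)
    fix M K :: "('a, 'l) lmodule" and g f
    assume lM: "left_module A M" and lK: "left_module A K" and g: "module_hom A M K g"
      and surj: "g ` mcarrier M = mcarrier K" and f: "module_hom A P K f"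
    have "\<forall>s. \<exists>y. s < N \<longrightarrow> y \<in> mcarrier M \<and> g y = f (xs s)"
    proof
      fix s
      have "s < N \<Longrightarrow> f (xs s) \<in> g ` mcarrier M" using surj module_homD(1)[OF f] xsP by simp
      then show "\<exists>y. s < N \<longrightarrow> y \<in> mcarrier M \<and> g y = f (xs s)" by (metis imageE)
    qed
    then obtain ys where ys: "\<And>s. s < N \<Longrightarrow> ys s \<in> mcarrier M" "\<And>s. s < N \<Longrightarrow> g (ys s) = f (xs s)" by metis
    \<comment> \<open>The coordinates from the section are recombined with the chosen preimages
      \<open>ys s\<close> of the images of the generators.\<close>
    define H where "H x = (\<Sum>s<N. act M (h x s) (ys s))" for x
    have hC: "h x s \<in> CC" if "x \<in> mcarrier P" for x s using FCC module_homD(1)[OF h(1)] that by blast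
    have HM: "act M (h x s) (ys s) \<in> mcarrier M" if "x \<in> mcarrier P" "s < N" for x s
      using hC that ys lm_closed[OF lM] by blast
    have "module_hom A P M H"
      unfolding module_hom_def
    proof (intro conjI ballI)
      show "H ` mcarrier P \<subseteq> mcarrier M"
        unfolding H_def using HM by (auto intro!: add_subgroup_sum[OF lm_group[OF lM]])
      fix x assume x: "x \<in> mcarrier P"
      show "H (x + y) = H x + H y" if "y \<in> mcarrier P" for y
        unfolding H_def sum.distrib[symmetric]
        using hC[OF x] hC[OF that] ys module_homD(2)[OF h(1) x that] lm_add_left[OF lM] by (intro sum.cong refl) auto
      show "H (act P a x) = act M a (H x)" if "a \<in> CC" for a
        unfolding H_def using hC[OF x] that ys module_homD(3)[OF h(1) that x] lm_mult[OF lM] HM[OF x]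
        by (subst lm_sum_right[OF lM]) (auto simp: actF intro!: sum.cong)
    qed
    moreover have "g (H x) = f x" if x: "x \<in> mcarrier P" for x
    proof -
      have "g (H x) = (\<Sum>s<N. g (act M (h x s) (ys s)))" unfolding H_def using HM[OF x] by (intro hom_sum[OF lM g]) auto
      also have "\<dots> = (\<Sum>s<N. f (act P (h x s) (xs s)))"
        using hC[OF x] ys xsP module_homD(3)[OF g] module_homD(3)[OF f] by (intro sum.cong refl) auto
      also have "\<dots> = f (p (h x))" unfolding p_def using hC[OF x] xsP lm_closed[OF lP] by (intro hom_sum[OF lP f, symmetric]) auto
      finally show ?thesis using h(2)[OF x] by simp
    qed
    ultimately show "\<exists>h. module_hom A P M h \<and> (\<forall>x\<in>mcarrier P. g (h x) = f x)" by blast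
  qed
qed

end

text \<open>By linearity the differential is injective on the degree t + 1 part of P (t + 1), and it
  sends it into degree 1 times the generators of P t. That space is finitely spanned by local
  finiteness, and so is every submodule of it over degree 0.\<close>

lemma (in presented_algebra) linear_resolution_finitely_generated:
  assumes lr: "linear_resolution A i P G d" and i: "i \<in> VV"
  shows "\<exists>X. finite X \<and> X \<subseteq> G t t \<and> (\<forall>x\<in>X. \<exists>j\<in>VV. act (P t) (ee j) x = x) \<and> G t t \<subseteq> span0 (P t) X"
proof -
  note gm = linear_resolutionD(1)[OF lr] and gen = linear_resolutionD(2)[OF lr]
    and hom = linear_resolutionD(3)[OF lr] and dG = linear_resolutionD(4)[OF lr]
    and dd = linear_resolutionD(5)[OF lr] and ex = linear_resolutionD(6)[OF lr]
  have lm: "left_module A (P t)" and gr: "Submission.grading (mcarrier (P t)) (G t)"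
    and deg: "a \<in> comp A r \<Longrightarrow> x \<in> G t s \<Longrightarrow> act (P t) a x \<in> G t (r + s)" for t r s a x
    using gm[of t] by (auto simp: graded_module_iff)
  have GM: "x \<in> G t s \<Longrightarrow> x \<in> mcarrier (P t)" for x t s using grading_subset[OF gr] .
  \<comment> \<open>P (t + 1) starts in degree t + 1, so no nonzero boundary has degree t in P
    t.\<close>
  have bd: "d t y = 0" if y: "y \<in> mcarrier (P (Suc t))" and dy: "d t y \<in> G t t" for t y
  proof -
    have "component (G (Suc t)) y t \<in> G (Suc t) t" by (rule component_in[OF gr y])
    then have "component (G (Suc t)) y t = 0"
      using generated_component[OF gm[of "Suc t"] gen[of "Suc t"], of "component (G (Suc t)) y t" t] by simp
    then have "component (G t) (d t y) t = 0"
      using hom_component[OF gm gm hom dG y, of t] hom_zero[OF lm hom] by simp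
    then show ?thesis using component_hom[OF gr dy, of t] by simp
  qed
  show ?thesis
  proof (induction t)
    case 0
    obtain \<phi> where phi: "\<phi> ` G 0 0 = {a \<cdot> ee i | a. a \<in> comp A 0}"
       "\<And>x y. x \<in> G 0 0 \<Longrightarrow> y \<in> G 0 0 \<Longrightarrow> \<phi> (x + y) = \<phi> x + \<phi> y"
       "\<And>a x. a \<in> comp A 0 \<Longrightarrow> x \<in> G 0 0 \<Longrightarrow> \<phi> (act (P 0) a x) = a \<cdot> \<phi> x"
       "\<And>x. x \<in> G 0 0 \<Longrightarrow> \<phi> x = 0 \<longleftrightarrow> x \<in> boundaries P d 0"
      by (rule linear_resolution_head[OF lr]) (rule that)
    \<comment> \<open>As boundaries of degree 0 vanish, the head map identifies the degree 0 part of
      P 0 with S(i).\<close>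
    have inj: "x = y" if "x \<in> G 0 0" "y \<in> G 0 0" "\<phi> x = \<phi> y" for x y
    proof -
      have xy: "x - y \<in> G 0 0" using add_subgroup_diff[OF grading_comp[OF gr]] that by blast
      have "\<phi> (x - y) = 0"
        using additive_on_diff[OF grading_comp[OF gr, of 0 0], of \<phi> x y] phi(2) that by simp
      then obtain z where "z \<in> mcarrier (P (Suc 0))" "x - y = d 0 z" using phi(4)[OF xy] by (auto simp: boundaries_def)
      then have "x - y = 0" using bd[of z 0] xy by simp
      then show ?thesis by simp
    qed
    have "ee i \<in> \<phi> ` G 0 0" unfolding phi(1) using i idem_comp[OF i] by (intro CollectI exI[of _ "ee i"]) simp
    then obtain x0 where x0: "x0 \<in> G 0 0" "\<phi> x0 = ee i" by auto
    have G0: "a \<in> comp A 0 \<Longrightarrow> act (P 0) a x0 \<in> G 0 0" for a using deg[of a 0 x0 0 0] x0 by simp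
    have "act (P 0) (ee i) x0 = x0"
      using inj[OF G0[OF idem_comp[OF i]] x0(1)] phi(3)[OF idem_comp[OF i] x0(1)] x0 i by simp
    moreover have "x \<in> span0 (P 0) {x0}" if x: "x \<in> G 0 0" for x
    proof -
      have "\<phi> x \<in> {a \<cdot> ee i | a. a \<in> comp A 0}" using phi(1) x by blast
      then obtain a where a: "a \<in> comp A 0" "\<phi> x = a \<cdot> ee i" by blast
      then have "x = act (P 0) a x0" using inj[OF x G0[OF a(1)]] phi(3)[OF a(1) x0(1)] x0 by simp
      then show ?thesis using span0_base[OF lm a(1), of x0 "{x0}"] by simp
    qed
    ultimately show ?case using x0 i by (intro exI[of _ "{x0}"]) auto
  next
    case (Suc t)
    then obtain X where X: "finite X" "X \<subseteq> G t t" "\<forall>x\<in>X. \<exists>j\<in>VV. act (P t) (ee j) x = x" "G t t \<subseteq> span0 (P t) X" by blast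
    have XM: "X \<subseteq> mcarrier (P t)" using X GM by blast
    obtain Y where Y: "finite Y" "Y \<subseteq> mcarrier (P t)" "\<forall>y\<in>Y. \<exists>j\<in>VV. act (P t) (ee j) y = y"
      "\<forall>b\<in>comp A 1. \<forall>u\<in>span0 (P t) X. act (P t) b u \<in> span0 (P t) Y"
      using arrows_finitely_spanned[OF lm X(1) XM X(3)] by blast
    let ?G = "G (Suc t) (Suc t)"
    let ?V = "d t ` ?G"
    note gG = grading_comp[OF gr[of "Suc t"], of "Suc t"]
    have dinj: "x = y" if xy: "x \<in> ?G" "y \<in> ?G" "d t x = d t y" for x y
    proof -
      have g: "x - y \<in> ?G" using add_subgroup_diff[OF gG] xy by blast
      have "d t (x - y) = 0" using hom_diff[OF lm hom GM[OF xy(1)] GM[OF xy(2)]] xy by simp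
      then have "x - y \<in> cycles P d (Suc t) \<inter> ?G" using g GM by (simp add: cycles_def)
      then have "x - y \<in> boundaries P d (Suc t)" using ex[of "Suc t" "Suc t"] by blast
      then obtain z where "z \<in> mcarrier (P (Suc (Suc t)))" "x - y = d (Suc t) z" by (auto simp: boundaries_def)
      then have "x - y = 0" using bd[of z "Suc t"] g by simp
      then show ?thesis by simp
    qed
    have VY: "?V \<subseteq> span0 (P t) Y"
    proof
      fix v assume "v \<in> ?V"
      then have "v \<in> G t (Suc t)" using dG by blast
      then have "v \<in> add_span {act (P t) a g | a g. a \<in> comp A (Suc t - t) \<and> g \<in> G t t}"
        using generated_component[OF gm[of t] gen[of t], of v "Suc t"] by simp
      moreover have "add_span {act (P t) a g | a g. a \<in> comp A (Suc t - t) \<and> g \<in> G t t} \<subseteq> span0 (P t) Y"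
        by (rule add_span_least[OF _ span0_group[OF lm Y(2)]]) (use Y(4) X(4) in auto)
      ultimately show "v \<in> span0 (P t) Y" by blast
    qed
    have Vg: "add_subgroup ?V"
      unfolding add_subgroup_def
    proof (intro conjI ballI)
      show "0 \<in> ?V" using hom_zero[OF lm hom] add_subgroup_zero[OF gG] by force
      fix x y assume "x \<in> ?V" "y \<in> ?V"
      then obtain u w where uw: "u \<in> ?G" "w \<in> ?G" "x = d t u" "y = d t w" by blast
      then have "x - y = d t (u - w)" using hom_diff[OF lm hom GM[OF uw(1)] GM[OF uw(2)]] by simp
      then show "x - y \<in> ?V" using add_subgroup_diff[OF gG uw(1,2)] by blast
    qed
    have VM: "?V \<subseteq> mcarrier (P t)" using module_homD(1)[OF hom] GM by blast
    have Ga: "act (P (Suc t)) a x \<in> ?G" if "a \<in> comp A 0" "x \<in> ?G" for a x using deg[OF that] by simp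
    have da: "d t (act (P (Suc t)) a x) = act (P t) a (d t x)" if "a \<in> comp A 0" "x \<in> ?G" for a x
      using module_homD(3)[OF hom comp_CC[OF that(1)] GM[OF that(2)]] .
    have Va: "act (P t) a v \<in> ?V" if "a \<in> comp A 0" "v \<in> ?V" for a v
    proof -
      from that(2) obtain x where x: "x \<in> ?G" "v = d t x" by (rule imageE)
      then show ?thesis using Ga[OF that(1) x(1)] da[OF that(1) x(1)] by (intro image_eqI[of _ _ "act (P (Suc t)) a x"]) simp_all
    qed
    obtain Z where Z: "finite Z" "Z \<subseteq> ?V" "\<forall>y\<in>Z. \<exists>j\<in>VV. act (P t) (ee j) y = y" "?V \<subseteq> span0 (P t) Z"
      using subspace_finitely_spanned[OF lm Y(1,2,3) Vg VM Va VY] by blast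
    \<comment> \<open>Generators of the image are lifted back along the differential, which is
      injective in this degree.\<close>
    let ?X = "inv_into ?G (d t) ` Z"
    have inv: "inv_into ?G (d t) z \<in> ?G" "d t (inv_into ?G (d t) z) = z" if "z \<in> Z" for z
      using that Z(2) by (auto intro: inv_into_into f_inv_into_f)
    have XG: "?X \<subseteq> ?G" using inv by blast
    have XM': "?X \<subseteq> mcarrier (P (Suc t))" using XG GM by blast
    have Xj: "\<exists>j\<in>VV. act (P (Suc t)) (ee j) x = x" if "x \<in> ?X" for x
    proof -
      obtain z where z: "z \<in> Z" "x = inv_into ?G (d t) z" using \<open>x \<in> ?X\<close> by blast
      obtain j where j: "j \<in> VV" "act (P t) (ee j) z = z" using Z(3) z by blast
      have xG: "x \<in> ?G" "d t x = z" using inv z by auto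
      have "act (P (Suc t)) (ee j) x = x"
        using dinj[OF Ga[OF idem_comp[OF j(1)] xG(1)] xG(1)] da[OF idem_comp[OF j(1)] xG(1)] xG j by simp
      then show ?thesis using j by blast
    qed
    have lift: "\<exists>u\<in>span0 (P (Suc t)) ?X. d t u = w" if "w \<in> span0 (P t) Z" for w
      using that unfolding span0_def[OF lm, of t]
    proof induction
      case zero
      show ?case using hom_zero[OF lm hom] add_subgroup_zero[OF span0_group[OF lm XM']] by blast
    next
      case (step v w)
      then obtain u where u: "u \<in> span0 (P (Suc t)) ?X" "d t u = w" by blast
      obtain a z where az: "v = act (P t) a z" "a \<in> comp A 0" "z \<in> Z" using step by blast
      let ?u = "act (P (Suc t)) a (inv_into ?G (d t) z)"
      have "?u \<in> span0 (P (Suc t)) ?X" by (rule span0_base[OF lm az(2)]) (use az in blast)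
      moreover have "d t ?u = v" using da[OF az(2) inv(1)[OF az(3)]] inv(2)[OF az(3)] az by simp
      moreover have "?u \<in> mcarrier (P (Suc t))" "u \<in> mcarrier (P (Suc t))"
        using calculation u span0_carrier[OF lm XM'] by blast+
      ultimately have "d t (?u + u) = v + w" "?u + u \<in> span0 (P (Suc t)) ?X"
        using u module_homD(2)[OF hom] add_subgroup_add[OF span0_group[OF lm XM']] by auto
      then show ?case by blast
    qed
    have "span0 (P (Suc t)) ?X \<subseteq> ?G"
      by (rule span0_subset[OF lm XG _ gG]) (use GM Ga in blast)+
    then have sub: "u \<in> ?G" if "u \<in> span0 (P (Suc t)) ?X" for u using that by (rule subsetD)
    have "?G \<subseteq> span0 (P (Suc t)) ?X"
    proof
      fix x assume x: "x \<in> ?G"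
      then have "d t x \<in> span0 (P t) Z" using Z(4) by (intro subsetD[OF Z(4)] imageI)
      then obtain u where u: "u \<in> span0 (P (Suc t)) ?X" "d t u = d t x" using lift by (elim bexE[OF lift])
      then show "x \<in> span0 (P (Suc t)) ?X" using dinj[OF sub[OF u(1)] x] by simp
    qed
    then show ?case using Z(1) XG Xj by (intro exI[of _ ?X]) blast
  qed
qed

lemma grading_image:
  fixes enc :: "'m::ab_group_add \<Rightarrow> 'l::ab_group_add"
  assumes add: "\<And>x y. enc (x + y) = enc x + enc y" and inj: "\<And>x. enc x = 0 \<Longrightarrow> x = 0" and gr: "grading C G"
  shows "grading (enc ` C) (\<lambda>s. enc ` G s)"
proof -
  have ug: "add_subgroup (UNIV :: 'm set)" by (simp add: add_subgroup_def)
  have diff: "enc (x - y) = enc x - enc y" for x y using additive_on_diff[OF ug, of enc x y] add by simp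
  have sum: "enc (sum f I) = (\<Sum>i\<in>I. enc (f i))" for f :: "nat \<Rightarrow> 'm" and I
    using additive_on_sum[OF ug, of enc I f] add by simp
  have e0: "enc 0 = 0" using diff[of 0 0] by simp
  have sub: "add_subgroup (enc ` S)" if "add_subgroup S" for S
    using that e0 unfolding add_subgroup_def by (auto simp flip: diff intro: image_eqI[of _ _ 0])
  show ?thesis
    unfolding grading_def
  proof (intro conjI allI ballI impI)
    show "add_subgroup (enc ` C)" using sub grading_carrier[OF gr] by blast
    fix s
    show "add_subgroup (enc ` G s)" using sub grading_comp[OF gr] by blast
    show "enc ` G s \<subseteq> enc ` C" using grading_subset[OF gr] by blast
  next
    fix y assume "y \<in> enc ` C"
    then obtain x where x: "x \<in> C" "y = enc x" by blast
    obtain n where n: "x = (\<Sum>s<n. component G x s)" using component_sum_ex[OF gr x(1)] by blast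
    have "y = enc (\<Sum>s<n. component G x s)" unfolding x(2) using n by (rule arg_cong)
    then show "\<exists>c N. (\<forall>s. c s \<in> enc ` G s) \<and> y = (\<Sum>s<N. c s)"
      unfolding sum using component_in[OF gr x(1)] by (intro exI[of _ "\<lambda>s. enc (component G x s)"] exI[of _ n]) simp
  next
    fix c N s assume c: "(\<forall>s. c s \<in> enc ` G s) \<and> (\<Sum>s<(N::nat). c s) = 0" and s: "s < N"
    then have "\<forall>s. \<exists>x. x \<in> G s \<and> c s = enc x" by blast
    then obtain x where x: "\<And>s. x s \<in> G s" "\<And>s. c s = enc (x s)" by metis
    have "(\<Sum>s<N. x s) = 0" using c x(2) inj[of "\<Sum>s<N. x s"] by (simp add: sum)
    then have "x s = 0" using gr x(1) s unfolding grading_def by metis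
    then show "c s = 0" using x e0 by simp
  qed
qed

text \<open>The definition of Koszulity prescribes the type on which a resolution lives. All
  structure is carried along the additive injection \<open>enc\<close>; lifting against test modules
  on the new type then is projectivity there.\<close>

lemma (in graded_algebra) transport_linear_resolution:
  fixes enc :: "'m::ab_group_add \<Rightarrow> 'l::ab_group_add" and P :: "nat \<Rightarrow> ('a, 'm) lmodule"
  assumes add: "\<And>x y. enc (x + y) = enc x + enc y" and dec: "\<And>x. dec (enc x) = x"
    and lr: "linear_resolution A i P G d" and lp: "\<And>t. lifting_property A (P t) TYPE('l)"
  shows "\<exists>(P' :: nat \<Rightarrow> ('a, 'l) lmodule) G' d'. linear_resolution A i P' G' d' \<and> (\<forall>t. projective_module A (P' t))"
proof -
  have ug: "add_subgroup (UNIV :: 'm set)" by (simp add: add_subgroup_def)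
  have diff: "enc (x - y) = enc x - enc y" for x y using additive_on_diff[OF ug, of enc x y] add by simp
  have sum: "enc (sum f I) = (\<Sum>i\<in>I. enc (f i))" for f :: "'v \<Rightarrow> 'm" and I
    using additive_on_sum[OF ug, of enc I f] add by simp
  have e0: "enc 0 = 0" using diff[of 0 0] by simp
  have inj: "enc x = enc y \<longleftrightarrow> x = y" for x y using dec by metis
  have inj0: "enc x = 0 \<longleftrightarrow> x = 0" for x using inj[of x 0] e0 by simp
  have sub: "add_subgroup (enc ` S)" if "add_subgroup S" for S
    using that e0 unfolding add_subgroup_def by (auto simp flip: diff intro: image_eqI[of _ _ 0])
  note gm = linear_resolutionD(1)[OF lr] and gen = linear_resolutionD(2)[OF lr]
    and hom = linear_resolutionD(3)[OF lr] and dG = linear_resolutionD(4)[OF lr]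
    and dd = linear_resolutionD(5)[OF lr] and ex = linear_resolutionD(6)[OF lr]
  have lm: "left_module A (P t)" and gr: "Submission.grading (mcarrier (P t)) (G t)"
    and deg: "a \<in> comp A r \<Longrightarrow> x \<in> G t s \<Longrightarrow> act (P t) a x \<in> G t (r + s)" for t r s a x
    using gm[of t] by (auto simp: graded_module_iff)
  define P' :: "nat \<Rightarrow> ('a, 'l) lmodule" where
    "P' t = \<lparr>mcarrier = enc ` mcarrier (P t), act = (\<lambda>a y. enc (act (P t) a (dec y)))\<rparr>" for t
  define G' where "G' t s = enc ` G t s" for t s
  define d' where "d' t y = enc (d t (dec y))" for t y
  have P'C: "mcarrier (P' t) = enc ` mcarrier (P t)" and P'a: "act (P' t) a y = enc (act (P t) a (dec y))" for t a y
    by (simp_all add: P'_def)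
  have lm': "left_module A (P' t)" for t
    unfolding left_module_def
  proof (intro conjI ballI)
    show "add_subgroup (mcarrier (P' t))" unfolding P'C by (rule sub[OF lm_group[OF lm]])
    fix y assume "y \<in> mcarrier (P' t)"
    then obtain x where x: "x \<in> mcarrier (P t)" "y = enc x" by (auto simp: P'C)
    have "\<forall>x\<in>mcarrier (P t). \<exists>J. finite J \<and> J \<subseteq> VV \<and> x = (\<Sum>i\<in>J. act (P t) (ee i) x)"
      using lm[of t] unfolding left_module_def by (elim conjE)
    from bspec[OF this x(1)] obtain J where J: "finite J" "J \<subseteq> VV" "x = (\<Sum>i\<in>J. act (P t) (ee i) x)" by (elim exE conjE)
    have "enc x = enc (\<Sum>i\<in>J. act (P t) (ee i) x)" using J(3) by (rule arg_cong)
    then have "y = (\<Sum>i\<in>J. act (P' t) (ee i) y)" unfolding P'a x(2) dec sum .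
    then show "\<exists>J. finite J \<and> J \<subseteq> VV \<and> y = (\<Sum>i\<in>J. act (P' t) (ee i) y)" using J by blast
  qed (auto simp: P'C P'a dec lm_closed[OF lm] lm_add_left[OF lm] lm_mult[OF lm] lm_add_right[OF lm] simp flip: add)
  have gm': "graded_module A (P' t) (G' t)" for t
    unfolding graded_module_iff
  proof (intro conjI allI ballI)
    show "left_module A (P' t)" by (rule lm')
    show "Submission.grading (mcarrier (P' t)) (G' t)"
      unfolding P'C G'_def by (rule grading_image[OF add _ gr]) (simp add: inj0)
    fix r s a y assume "a \<in> comp A r" "y \<in> G' t s"
    then show "act (P' t) a y \<in> G' t (r + s)" by (auto simp: G'_def P'a dec deg)
  qed
  have gen': "generated_by A (P' t) (G' t t)" for t
    unfolding generated_by_def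
  proof (intro allI impI, elim conjE)
    fix N assume N: "G' t t \<subseteq> N" "N \<subseteq> mcarrier (P' t)" "left_module A (P' t\<lparr>mcarrier := N\<rparr>)"
    have Ng: "add_subgroup N" and Na: "a \<in> CC \<Longrightarrow> y \<in> N \<Longrightarrow> act (P' t) a y \<in> N" for a y
      using lm_group[OF N(3)] lm_closed[OF N(3)] by simp_all
    let ?N = "{x \<in> mcarrier (P t). enc x \<in> N}"
    have "?N = mcarrier (P t)"
    proof (rule gen[unfolded generated_by_def, rule_format], intro conjI)
      show "G t t \<subseteq> ?N" using N(1) grading_subset[OF gr] by (auto simp: G'_def)
      show s: "?N \<subseteq> mcarrier (P t)" by blast
      have g: "add_subgroup ?N" using Ng lm_group[OF lm[of t]] by (auto simp: add_subgroup_def diff e0)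
      show "left_module A (P t\<lparr>mcarrier := ?N\<rparr>)"
      proof (rule submodule[OF lm g s])
        fix a x assume "a \<in> CC" "x \<in> ?N"
        then show "act (P t) a x \<in> ?N" using Na[of a "enc x"] lm_closed[OF lm] by (simp add: P'a dec)
      qed
    qed
    then show "N = mcarrier (P' t)" using N(2) by (auto simp: P'C)
  qed
  have hom': "module_hom A (P' (Suc t)) (P' t) (d' t)" for t
    unfolding module_hom_def P'C
    using module_homD[OF hom[of t]] by (auto simp: d'_def dec P'a simp flip: add)
  have pr': "projective_module A (P' t)" for t
    unfolding projective_iff lifting_property_def
  proof (intro conjI lm' allI impI, elim conjE)
    fix M N :: "('a, 'l) lmodule" and g f
    assume M: "left_module A M" and N: "left_module A N" and g: "module_hom A M N g" "g ` mcarrier M = mcarrier N"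
      and f: "module_hom A (P' t) N f"
    have "module_hom A (P t) N (\<lambda>x. f (enc x))"
      unfolding module_hom_def using f by (auto simp: module_hom_def P'C P'a dec add)
    then obtain h where h: "module_hom A (P t) M h" "\<forall>x\<in>mcarrier (P t). g (h x) = f (enc x)"
      using lp[of t] M N g unfolding lifting_property_def by blast
    have "module_hom A (P' t) M (\<lambda>y. h (dec y))"
      unfolding module_hom_def P'C using module_homD[OF h(1)] by (auto simp: P'a dec simp flip: add)
    then show "\<exists>h. module_hom A (P' t) M h \<and> (\<forall>x\<in>mcarrier (P' t). g (h x) = f x)"
      using h(2) by (intro exI[of _ "\<lambda>y. h (dec y)"]) (auto simp: P'C dec)
  qed
  have bd': "boundaries P' d' t = enc ` boundaries P d t" for t
    by (auto simp: boundaries_def P'C d'_def dec image_image)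
  have cy': "cycles P' d' t = enc ` cycles P d t" for t
    by (cases t) (auto simp: cycles_def P'C d'_def dec inj0)
  obtain \<phi> where phi: "\<phi> ` G 0 0 = {a \<cdot> ee i | a. a \<in> comp A 0}"
       "\<And>x y. x \<in> G 0 0 \<Longrightarrow> y \<in> G 0 0 \<Longrightarrow> \<phi> (x + y) = \<phi> x + \<phi> y"
       "\<And>a x. a \<in> comp A 0 \<Longrightarrow> x \<in> G 0 0 \<Longrightarrow> \<phi> (act (P 0) a x) = a \<cdot> \<phi> x"
       "\<And>x. x \<in> G 0 0 \<Longrightarrow> \<phi> x = 0 \<longleftrightarrow> x \<in> boundaries P d 0"
    by (rule linear_resolution_head[OF lr]) (rule that)
  have "linear_resolution A i P' G' d'"
    unfolding linear_resolution_def
  proof (intro conjI allI ballI impI gm' gen' hom')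
    fix t s show "d' t ` G' (Suc t) s \<subseteq> G' t s" using dG[of t s] by (auto simp: G'_def d'_def dec)
  next
    fix t y assume "y \<in> mcarrier (P' (Suc (Suc t)))"
    then show "d' t (d' (Suc t) y) = 0" by (auto simp: P'C d'_def dec dd e0)
  next
    fix t s :: nat assume ts: "(t, s) \<noteq> (0, 0)"
    show "cycles P' d' t \<inter> G' t s \<subseteq> boundaries P' d' t"
    proof
      fix y assume "y \<in> cycles P' d' t \<inter> G' t s"
      then obtain x where x: "y = enc x" "x \<in> cycles P d t" "x \<in> G t s" unfolding cy' G'_def by (auto simp: inj)
      then show "y \<in> boundaries P' d' t" unfolding bd' using ex[OF ts] by blast
    qed
  next
    show "\<exists>\<phi>. \<phi> ` G' 0 0 = {a \<cdot> ee i | a. a \<in> comp A 0} \<and>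
       (\<forall>x\<in>G' 0 0. \<forall>y\<in>G' 0 0. \<phi> (x + y) = \<phi> x + \<phi> y) \<and>
       (\<forall>a\<in>comp A 0. \<forall>x\<in>G' 0 0. \<phi> (act (P' 0) a x) = a \<cdot> \<phi> x) \<and>
       (\<forall>x\<in>G' 0 0. \<phi> x = 0 \<longleftrightarrow> x \<in> boundaries P' d' 0)"
    proof (intro exI[of _ "\<lambda>y. \<phi> (dec y)"] conjI)
      show "(\<lambda>y. \<phi> (dec y)) ` G' 0 0 = {a \<cdot> ee i | a. a \<in> comp A 0}"
        unfolding G'_def image_image dec by (rule phi(1))
      show "\<forall>x\<in>G' 0 0. \<forall>y\<in>G' 0 0. \<phi> (dec (x + y)) = \<phi> (dec x) + \<phi> (dec y)"
        using phi(2) by (auto simp: G'_def dec simp flip: add)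
      show "\<forall>a\<in>comp A 0. \<forall>x\<in>G' 0 0. \<phi> (dec (act (P' 0) a x)) = a \<cdot> \<phi> (dec x)"
        using phi(3) by (auto simp: G'_def dec P'a)
      show "\<forall>x\<in>G' 0 0. \<phi> (dec x) = 0 \<longleftrightarrow> x \<in> boundaries P' d' 0"
        unfolding bd' using phi(4) by (auto simp: G'_def dec inj image_iff)
    qed
  qed
  then show ?thesis using pr' by blast
qed

section \<open>The linear resolution over the trivial extension\<close>

lemma grading_shift:
  assumes gr: "grading C G"
  shows "grading C (\<lambda>r. if q \<le> r then G (r - q) else {0})"
  unfolding grading_def
proof (intro conjI allI ballI impI)
  show "add_subgroup C" by (rule grading_carrier[OF gr])
  fix s
  show "add_subgroup (if q \<le> s then G (s - q) else {0})"
    using grading_comp[OF gr] by (simp add: add_subgroup_def)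
  show "(if q \<le> s then G (s - q) else {0}) \<subseteq> C"
    using grading_subset[OF gr] add_subgroup_zero[OF grading_carrier[OF gr]] by auto
next
  fix x assume x: "x \<in> C"
  obtain N where N: "\<forall>M\<ge>N. x = (\<Sum>s<M. component G x s)" using component_sum_ex[OF gr x] by blast
  let ?c = "\<lambda>r. if q \<le> r then component G x (r - q) else 0"
  have "(\<Sum>r<q + N. ?c r) = (\<Sum>r<q. ?c r) + (\<Sum>r<N. ?c (q + r))"
    by (induction N) (simp_all add: add.assoc)
  also have "(\<Sum>r<q. ?c r) = 0" by (rule sum.neutral) auto
  also have "(\<Sum>r<N. ?c (q + r)) = x" using N by simp
  finally have "x = (\<Sum>r<q + N. ?c r)" by simp
  moreover have "\<forall>r. ?c r \<in> (if q \<le> r then G (r - q) else {0})" using component_in[OF gr x] by auto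
  ultimately show "\<exists>c N. (\<forall>s. c s \<in> (if q \<le> s then G (s - q) else {0})) \<and> x = (\<Sum>s<N. c s)"
    by (intro exI[of _ ?c] exI[of _ "q + N"] conjI)
next
  fix c N s assume c: "(\<forall>s. c s \<in> (if q \<le> s then G (s - q) else {0})) \<and> (\<Sum>s<(N::nat). c s) = 0" and s: "s < N"
  show "c s = 0"
  proof (cases "q \<le> s")
    case True
    then obtain M where M: "N = q + M" using s by (metis le_add_diff_inverse less_imp_le_nat order_trans)
    have "(\<Sum>r<q + M. c r) = (\<Sum>r<q. c r) + (\<Sum>r<M. c (q + r))"
      by (induction M) (simp_all add: add.assoc)
    moreover have "(\<Sum>r<q. c r) = 0"
    proof (rule sum.neutral, rule ballI)
      fix r assume "r \<in> {..<q}"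
      then show "c r = 0" using c[THEN conjunct1, THEN spec, of r] by simp
    qed
    ultimately have z: "(\<Sum>r<M. c (q + r)) = 0" using c M by simp
    have "\<forall>r. c (q + r) \<in> G r"
    proof
      fix r show "c (q + r) \<in> G r" using c[THEN conjunct1, THEN spec, of "q + r"] by simp
    qed
    with z have "\<forall>r<M. c (q + r) = 0"
      by (intro gr[unfolded grading_def, THEN conjunct2, THEN conjunct2, THEN conjunct2, THEN spec,
          THEN spec, of "\<lambda>r. c (q + r)" M, THEN mp] conjI)
    then show ?thesis using True s M by (metis add_less_cancel_left le_add_diff_inverse)
  next
    case False
    then show ?thesis using c[THEN conjunct1, THEN spec, of s] by simp
  qed
qed

lemma uniform_bound:
  assumes "\<forall>s\<le>(t::nat). \<exists>N::nat. \<forall>M\<ge>N. Q s M"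
  shows "\<exists>N. \<forall>s\<le>t. \<forall>M\<ge>N. Q s M"
proof -
  obtain N where N: "\<And>s. s \<le> t \<Longrightarrow> \<forall>M\<ge>N s. Q s M" using assms by metis
  have "N s \<le> (\<Sum>s\<le>t. N s)" if "s \<le> t" for s using that by (intro member_le_sum) auto
  then show ?thesis using N by (intro exI[of _ "\<Sum>s\<le>t. N s"]) (meson order_trans)
qed

section \<open>The total complex\<close>

locale extension_resolution = frobenius_extension A m \<theta> \<nu> E n
  for A :: "('k::field, 'v, 'a::ab_group_add) galgebra" and m \<theta> \<nu> E n +
  fixes P :: "nat \<Rightarrow> ('a, 'm::ab_group_add) lmodule" and G d i
  assumes lr: "linear_resolution A i P G d" and iV: "i \<in> vertices A"

sublocale extension_resolution \<subseteq> T: graded_algebra "trivial_extension n A"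
  by (rule TE_graded_algebra)

context extension_resolution
begin

lemmas gm = linear_resolutionD(1)[OF lr] and gen = linear_resolutionD(2)[OF lr]
    and hom = linear_resolutionD(3)[OF lr] and dG = linear_resolutionD(4)[OF lr]
    and dd = linear_resolutionD(5)[OF lr] and ex = linear_resolutionD(6)[OF lr]

lemma lmP: "left_module A (P t)" and grP: "Submission.grading (mcarrier (P t)) (G t)"
  and degP: "a \<in> comp A r \<Longrightarrow> x \<in> G t s \<Longrightarrow> act (P t) a x \<in> G t (r + s)"
  using gm[of t] by (auto simp: graded_module_iff)

lemmas ac_closed[simp] = lm_closed[OF lmP] and ac_add_left = lm_add_left[OF lmP]
  and ac_add_right = lm_add_right[OF lmP] and ac_mult = lm_mult[OF lmP] and ac_zero[simp] = lm_zero[OF lmP]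
  and ac_minus = lm_minus(2)[OF lmP]

lemma mc_simps[simp]: "0 \<in> mcarrier (P t)" "x \<in> mcarrier (P t) \<Longrightarrow> y \<in> mcarrier (P t) \<Longrightarrow> x + y \<in> mcarrier (P t)"
  "x \<in> mcarrier (P t) \<Longrightarrow> y \<in> mcarrier (P t) \<Longrightarrow> x - y \<in> mcarrier (P t)" "x \<in> mcarrier (P t) \<Longrightarrow> - x \<in> mcarrier (P t)"
  using lm_group[OF lmP] by (auto simp: add_subgroup_zero add_subgroup_add add_subgroup_diff add_subgroup_minus)

lemma d_simps: "x \<in> mcarrier (P (Suc t)) \<Longrightarrow> d t x \<in> mcarrier (P t)"
  "x \<in> mcarrier (P (Suc t)) \<Longrightarrow> y \<in> mcarrier (P (Suc t)) \<Longrightarrow> d t (x + y) = d t x + d t y"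
  "a \<in> CC \<Longrightarrow> x \<in> mcarrier (P (Suc t)) \<Longrightarrow> d t (act (P (Suc t)) a x) = act (P t) a (d t x)"
  "d t 0 = 0" "x \<in> mcarrier (P (Suc t)) \<Longrightarrow> d t (- x) = - d t x"
  "x \<in> mcarrier (P (Suc t)) \<Longrightarrow> y \<in> mcarrier (P (Suc t)) \<Longrightarrow> d t (x - y) = d t x - d t y"
  using additive_on_diff[OF lm_group[OF lmP[of "Suc t"]], where f = "d t" and x = x and y = y] module_homD[OF hom] hom_zero[OF lmP hom]
    additive_on_minus[OF lm_group[OF lmP[of "Suc t"]], where f = "d t" and x = x] by blast+

definition kappa_pow where "kappa_pow s = (kappa ^^ s)"
definition sigma_pow where "sigma_pow s = (sigma ^^ s)"

lemma kappa_pow_0[simp]: "kappa_pow 0 a = a" by (simp add: kappa_pow_def)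
lemma kappa_pow_CC[simp]: "a \<in> CC \<Longrightarrow> kappa_pow s a \<in> CC" by (induction s) (simp_all add: kappa_pow_def)
lemma sigma_pow_CC[simp]: "a \<in> CC \<Longrightarrow> sigma_pow s a \<in> CC" by (induction s) (simp_all add: sigma_pow_def)
lemma kappa_pow_add: "a \<in> CC \<Longrightarrow> b \<in> CC \<Longrightarrow> kappa_pow s (a + b) = kappa_pow s a + kappa_pow s b"
  using kappa_pow_CC by (induction s) (simp_all add: kappa_pow_def kappa_add)
lemma sigma_pow_add: "a \<in> CC \<Longrightarrow> b \<in> CC \<Longrightarrow> sigma_pow s (a + b) = sigma_pow s a + sigma_pow s b"
  using sigma_pow_CC by (induction s) (simp_all add: sigma_pow_def sigma_add)
lemma kappa_pow_mult: "a \<in> CC \<Longrightarrow> b \<in> CC \<Longrightarrow> kappa_pow s (a \<cdot> b) = kappa_pow s a \<cdot> kappa_pow s b"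
  using kappa_pow_CC by (induction s) (simp_all add: kappa_pow_def kappa_mult)
lemma sigma_pow_mult: "a \<in> CC \<Longrightarrow> b \<in> CC \<Longrightarrow> sigma_pow s (a \<cdot> b) = sigma_pow s a \<cdot> sigma_pow s b"
  using sigma_pow_CC by (induction s) (simp_all add: sigma_pow_def sigma_mult)
lemma kappa_pow_comp: "a \<in> comp A t \<Longrightarrow> kappa_pow s a \<in> comp A t"
  by (induction s) (simp_all add: kappa_pow_def kappa_comp)
lemma kappa_pow_zero[simp]: "kappa_pow s 0 = 0" by (induction s) (simp_all add: kappa_pow_def)
lemma kappa_pow_Suc: "kappa_pow (Suc s) a = kappa_pow s (kappa a)"
  by (simp add: kappa_pow_def funpow_Suc_right del: funpow.simps)

lemma kappa_pow_Suc_sigma: "a \<in> CC \<Longrightarrow> kappa_pow (Suc s) (sigma a) = kappa_pow s a"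
  by (simp add: kappa_pow_Suc)

lemma sigma_pow_kappa_pow[simp]: "a \<in> CC \<Longrightarrow> sigma_pow s (kappa_pow s a) = a"
proof (induction s arbitrary: a)
  case (Suc s)
  have "sigma_pow (Suc s) (kappa_pow (Suc s) a) = sigma (sigma_pow s (kappa_pow s (kappa a)))" by (simp add: kappa_pow_Suc) (simp add: sigma_pow_def)
  then show ?case using Suc by simp
qed (simp add: sigma_pow_def kappa_pow_def)

lemma kappa_pow_sigma_pow[simp]: "a \<in> CC \<Longrightarrow> kappa_pow s (sigma_pow s a) = a"
proof (induction s arbitrary: a)
  case (Suc s)
  have "kappa_pow (Suc s) (sigma_pow (Suc s) a) = kappa_pow s (kappa (sigma (sigma_pow s a)))" by (simp add: kappa_pow_Suc) (simp add: sigma_pow_def)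
  then show ?case using Suc by simp
qed (simp add: sigma_pow_def kappa_pow_def)

lemma nu_pow_VV: "K \<subseteq> VV \<Longrightarrow> (\<nu> ^^ s) ` K \<subseteq> VV"
  by (induction s) (auto simp: image_subset_iff subset_iff)

lemma kappa_pow_uu: "finite K \<Longrightarrow> K \<subseteq> VV \<Longrightarrow> kappa_pow s (uu K) = uu ((\<nu> ^^ s) ` K)"
proof (induction s)
  case (Suc s)
  have K: "finite ((\<nu> ^^ s) ` K)" "(\<nu> ^^ s) ` K \<subseteq> VV" using Suc nu_pow_VV by auto
  have "\<nu> ` (\<nu> ^^ s) ` K \<subseteq> VV" using K by auto
  then have "kappa (uu ((\<nu> ^^ s) ` K)) = uu (\<nu> ` (\<nu> ^^ s) ` K)"
    using sigma_uu[OF K] kappa_sigma[of "uu (\<nu> ` (\<nu> ^^ s) ` K)"] by simp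
  then show ?case using Suc by (simp add: kappa_pow_def image_image)
qed (simp add: kappa_pow_def)

lemma sigma_pow_uu: "finite K \<Longrightarrow> K \<subseteq> VV \<Longrightarrow> sigma_pow s (uu ((\<nu> ^^ s) ` K)) = uu K"
  using sigma_pow_kappa_pow[of "uu K" s] by (simp add: kappa_pow_uu)

lemma nu_pow_surj: "finite K \<Longrightarrow> K \<subseteq> VV \<Longrightarrow> \<exists>L\<subseteq>VV. finite L \<and> K = (\<nu> ^^ s) ` L"
proof -
  assume K: "finite K" "K \<subseteq> VV"
  have "(\<nu> ^^ s) ` VV = VV"
  proof (induction s)
    case (Suc s)
    have "(\<nu> ^^ Suc s) ` VV = \<nu> ` (\<nu> ^^ s) ` VV" by (simp add: image_image)
    then show ?case using Suc perm by (simp add: bij_betw_def)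
  qed simp
  then show ?thesis using finite_subset_image[of K "\<nu> ^^ s" VV] K by blast
qed

text \<open>\<open>kappa_pow s\<close> moves a sum of idempotents along the s-th power of
  \<open>\<nu>\<close>, so the vertex set of a local unit is first pulled back along that
  power.\<close>

lemma kappa_pow_unit:
  assumes x: "x \<in> mcarrier (P t)"
  shows "\<exists>J. finite J \<and> J \<subseteq> VV \<and> (\<forall>K. J \<subseteq> K \<and> finite K \<and> K \<subseteq> VV \<longrightarrow> act (P t) (kappa_pow s (uu K)) x = x)"
proof -
  obtain J where J: "finite J" "J \<subseteq> VV" "\<forall>K. J \<subseteq> K \<and> finite K \<and> K \<subseteq> VV \<longrightarrow> act (P t) (uu K) x = x"
    using lm_unit_ex[OF lmP x] by (elim exE conjE) (rule that)
  obtain L where L: "L \<subseteq> VV" "finite L" "J = (\<nu> ^^ s) ` L" 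
    using nu_pow_surj[OF J(1,2), of s] by (elim exE conjE) (rule that)
  have "act (P t) (kappa_pow s (uu K)) x = x" if K: "L \<subseteq> K \<and> finite K \<and> K \<subseteq> VV" for K
  proof -
    have "kappa_pow s (uu K) = uu ((\<nu> ^^ s) ` K)" using K by (intro kappa_pow_uu) auto
    moreover have "J \<subseteq> (\<nu> ^^ s) ` K \<and> finite ((\<nu> ^^ s) ` K) \<and> (\<nu> ^^ s) ` K \<subseteq> VV"
      using K L(3) nu_pow_VV[of K s] by auto
    ultimately show ?thesis using J(3) by simp
  qed
  then show ?thesis using L by blast
qed

definition dual_coeff :: "'a \<times> ('a \<Rightarrow> 'k) \<Rightarrow> 'a" where "dual_coeff x = (THE c. c \<in> CC \<and> snd x = psi c)"

lemma fst_em[simp]: "fst (em a c) = a" by (simp add: em_def)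
lemma dual_coeff_em[simp]: "c \<in> CC \<Longrightarrow> dual_coeff (em a c) = c"
  unfolding dual_coeff_def by (rule the_equality) (auto simp: em_def psi_inj)

text \<open>With \<open>\<Lambda> = A\<close>, \<open>D\<^sub>*\<Lambda> = \<Lambda> x\<close> and \<open>x b = \<sigma>(b) x\<close>, the component \<open>(u, v)\<close> at \<open>s\<close> stands for
  \<open>u + x v\<close> in \<open>\<Lambda>\<^sup>~ \<otimes> P\<^sub>t\<^sub>-\<^sub>s\<close>, where \<open>P\<^sub>t\<^sub>-\<^sub>s\<close> is twisted by \<open>\<kappa>\<^sup>s\<close>. The differential of the total
  complex is that of \<open>P\<close>, up to sign, plus the multiplication by \<open>x\<close> from the column \<open>s + 1\<close>
  to the column \<open>s\<close>.\<close>

definition tot :: "nat \<Rightarrow> ('a \<times> ('a \<Rightarrow> 'k), nat \<Rightarrow> 'm \<times> 'm) lmodule" where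
  "tot t = \<lparr>mcarrier = {h. (\<forall>s\<le>t. fst (h s) \<in> mcarrier (P (t - s)) \<and> snd (h s) \<in> mcarrier (P (t - s))) \<and> (\<forall>s>t. h s = 0)},
    act = (\<lambda>x h s. (act (P (t - s)) (kappa_pow s (fst x)) (fst (h s)),
      act (P (t - s)) (kappa_pow (Suc s) (fst x)) (snd (h s)) + act (P (t - s)) (kappa_pow (Suc s) (dual_coeff x)) (fst (h s))))\<rparr>"

text \<open>The first coordinate of column s + 1 enters the x-coordinate of column s. The sign
  alternates with the column, so that the two mixed terms in the square of the differential
  cancel.\<close>

definition tot_d :: "nat \<Rightarrow> (nat \<Rightarrow> 'm \<times> 'm) \<Rightarrow> (nat \<Rightarrow> 'm \<times> 'm)" where
  "tot_d t h = (\<lambda>s. if s \<le> t then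
     (if even s then (d (t - s) (fst (h s)), d (t - s) (snd (h s)) + fst (h (Suc s)))
      else (- d (t - s) (fst (h s)), - d (t - s) (snd (h s)) + fst (h (Suc s))))
     else 0)"

definition shifted :: "nat \<Rightarrow> (nat \<Rightarrow> 'm set) \<Rightarrow> nat \<Rightarrow> 'm set"
  where "shifted q F r = (if q \<le> r then F (r - q) else {0})"

text \<open>Column s uses P (t - s), whose generators have degree t - s; shifting by s brings them
  to degree t. The x-coordinate is shifted once more because x has degree 1.\<close>

definition tot_G :: "nat \<Rightarrow> nat \<Rightarrow> (nat \<Rightarrow> 'm \<times> 'm) set" where
  "tot_G t r = {h \<in> mcarrier (tot t). \<forall>s\<le>t. fst (h s) \<in> shifted s (G (t - s)) r \<and> snd (h s) \<in> shifted (Suc s) (G (t - s)) r}"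

definition emb :: "nat \<Rightarrow> 'm \<Rightarrow> 'm \<Rightarrow> (nat \<Rightarrow> 'm \<times> 'm)"
  where "emb s u v = (\<lambda>r. if r = s then (u, v) else 0)"

lemma shifted_grading: "Submission.grading (mcarrier (P t)) (shifted q (G t))"
  using grading_shift[OF grP[of t], of q] unfolding shifted_def .

lemma shifted_simps[simp]: "0 \<in> shifted q (G t) r" "x \<in> shifted q (G t) r \<Longrightarrow> y \<in> shifted q (G t) r \<Longrightarrow> x + y \<in> shifted q (G t) r"
  "x \<in> shifted q (G t) r \<Longrightarrow> y \<in> shifted q (G t) r \<Longrightarrow> x - y \<in> shifted q (G t) r" "x \<in> shifted q (G t) r \<Longrightarrow> - x \<in> shifted q (G t) r"
  using grading_comp[OF shifted_grading, of q t r] by (auto simp: add_subgroup_zero add_subgroup_add add_subgroup_diff add_subgroup_minus)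

lemma shifted_carrier: "x \<in> shifted q (G t) r \<Longrightarrow> x \<in> mcarrier (P t)"
  by (rule grading_subset[OF shifted_grading])

lemma tot_mem: "h \<in> mcarrier (tot t) \<longleftrightarrow>
    (\<forall>s\<le>t. fst (h s) \<in> mcarrier (P (t - s)) \<and> snd (h s) \<in> mcarrier (P (t - s))) \<and> (\<forall>s>t. h s = 0)"
  by (simp add: tot_def)

lemma tot_D: assumes "h \<in> mcarrier (tot t)"
  shows "fst (h s) \<in> mcarrier (P (t - s))" "snd (h s) \<in> mcarrier (P (t - s))" "s > t \<Longrightarrow> h s = 0"
  using assms unfolding tot_mem by (cases "s \<le> t"; simp)+

lemma tot_act: "act (tot t) x h = (\<lambda>s. (act (P (t - s)) (kappa_pow s (fst x)) (fst (h s)),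
      act (P (t - s)) (kappa_pow (Suc s) (fst x)) (snd (h s)) + act (P (t - s)) (kappa_pow (Suc s) (dual_coeff x)) (fst (h s))))"
  by (simp add: tot_def)

lemma zero_pair: "(0 :: 'm \<times> 'm) = (0, 0)" by (simp add: zero_prod_def)

lemma tot_group: "add_subgroup (mcarrier (tot t))"
  unfolding add_subgroup_def
proof (intro conjI ballI)
  fix h k assume hk: "h \<in> mcarrier (tot t)" "k \<in> mcarrier (tot t)"
  show "h - k \<in> mcarrier (tot t)" unfolding tot_mem[of "h - k"]
    using tot_D[OF hk(1)] tot_D[OF hk(2)] by simp
qed (simp add: tot_mem)

lemma tot_act_closed: "x \<in> carrier TE \<Longrightarrow> h \<in> mcarrier (tot t) \<Longrightarrow> act (tot t) x h \<in> mcarrier (tot t)"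
proof (elim TE_carrierE)
  fix a c assume h: "h \<in> mcarrier (tot t)" and x: "x = em a c" "a \<in> CC" "c \<in> CC"
  note hD = tot_D[OF h]
  show ?thesis unfolding tot_mem
    by (intro conjI allI impI) (simp_all add: x tot_act hD zero_pair)
qed

lemma tot_act_add_left: "x \<in> carrier TE \<Longrightarrow> y \<in> carrier TE \<Longrightarrow> h \<in> mcarrier (tot t) \<Longrightarrow>
    act (tot t) (x + y) h = act (tot t) x h + act (tot t) y h"
proof (elim TE_carrierE)
  fix a c b e assume h: "h \<in> mcarrier (tot t)" and x: "x = em a c" "a \<in> CC" "c \<in> CC" "y = em b e" "b \<in> CC" "e \<in> CC"
  note hD = tot_D[OF h]
  show ?thesis
    by (rule ext) (simp add: x tot_act hD em_add kappa_pow_add ac_add_left add_ac)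
qed

lemma tot_module: "left_module TE (tot t)"
  unfolding left_module_def
proof (intro conjI ballI)
  show "add_subgroup (mcarrier (tot t))" by (rule tot_group)
  fix h assume h: "h \<in> mcarrier (tot t)"
  note hD = tot_D[OF h]
  show "act (tot t) x h \<in> mcarrier (tot t)" if "x \<in> carrier TE" for x by (rule tot_act_closed[OF that h])
  show "act (tot t) (x + y) h = act (tot t) x h + act (tot t) y h" if "x \<in> carrier TE" "y \<in> carrier TE" for x y
    by (rule tot_act_add_left[OF that h])
  \<comment> \<open>Associativity rests on \<open>kappa_pow_Suc_sigma\<close>: the additional power
    of \<open>kappa\<close> on the x-coordinate cancels the \<open>sigma\<close> in the
    product.\<close>
  show "act (tot t) (mult TE x y) h = act (tot t) x (act (tot t) y h)" if "x \<in> carrier TE" "y \<in> carrier TE" for x y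
    using that
  proof (elim TE_carrierE)
    fix a c b e assume x: "x = em a c" "a \<in> CC" "c \<in> CC" "y = em b e" "b \<in> CC" "e \<in> CC"
    show ?thesis
      by (rule ext) (simp add: x tot_act hD TE_mult kappa_pow_add kappa_pow_mult kappa_pow_Suc_sigma ac_mult ac_add_left ac_add_right add_ac)
  qed
  show "act (tot t) x (h + k) = act (tot t) x h + act (tot t) x k" if "x \<in> carrier TE" "k \<in> mcarrier (tot t)" for x k
    using that(1)
  proof (elim TE_carrierE)
    fix a c assume x: "x = em a c" "a \<in> CC" "c \<in> CC"
    show ?thesis
      by (rule ext) (simp add: x tot_act hD tot_D[OF that(2)] ac_add_right add_ac)
  qed
  \<comment> \<open>A local unit for \<open>h\<close>: because of the twists each coordinate needs a
    set of its own, and the finitely many columns have a finite union.\<close>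
  have "\<forall>s. \<exists>J. finite J \<and> J \<subseteq> VV \<and> (\<forall>K. J \<subseteq> K \<and> finite K \<and> K \<subseteq> VV \<longrightarrow> act (P (t - s)) (kappa_pow s (uu K)) (fst (h s)) = fst (h s))"
    using kappa_pow_unit[OF hD(1)] by blast
  from choice[OF this] obtain J1 where J1: "\<forall>s. finite (J1 s) \<and> J1 s \<subseteq> VV \<and> (\<forall>K. J1 s \<subseteq> K \<and> finite K \<and> K \<subseteq> VV \<longrightarrow> act (P (t - s)) (kappa_pow s (uu K)) (fst (h s)) = fst (h s))" by blast
  have "\<forall>s. \<exists>J. finite J \<and> J \<subseteq> VV \<and> (\<forall>K. J \<subseteq> K \<and> finite K \<and> K \<subseteq> VV \<longrightarrow> act (P (t - s)) (kappa_pow (Suc s) (uu K)) (snd (h s)) = snd (h s))"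
    using kappa_pow_unit[OF hD(2)] by blast
  from choice[OF this] obtain J2 where J2: "\<forall>s. finite (J2 s) \<and> J2 s \<subseteq> VV \<and> (\<forall>K. J2 s \<subseteq> K \<and> finite K \<and> K \<subseteq> VV \<longrightarrow> act (P (t - s)) (kappa_pow (Suc s) (uu K)) (snd (h s)) = snd (h s))" by blast
  define J where "J = (\<Union>s\<le>t. J1 s \<union> J2 s)"
  have J: "finite J" "J \<subseteq> VV" using J1 J2 by (auto simp: J_def)
  have "act (tot t) (em (uu J) 0) h = h"
  proof
    fix s
    show "act (tot t) (em (uu J) 0) h s = h s"
    proof (cases "s \<le> t")
      case True
      then have "J1 s \<subseteq> J" "J2 s \<subseteq> J" by (auto simp: J_def)
      then have "act (P (t - s)) (kappa_pow s (uu J)) (fst (h s)) = fst (h s)" "act (P (t - s)) (kappa_pow (Suc s) (uu J)) (snd (h s)) = snd (h s)"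
        using J1 J2 J by blast+
      then show ?thesis using hD(1)[of s] by (simp add: tot_act)
    next
      case False
      then show ?thesis using hD(3)[of s] J by (simp add: tot_act zero_pair)
    qed
  qed
  moreover have "(\<Sum>j\<in>J. act (tot t) (idem TE j) h) = act (tot t) (em (uu J) 0) h"
    unfolding em_uu[symmetric] TE_simps
    using additive_on_sum[OF T.CC_group, of "\<lambda>x. act (tot t) x h" J "\<lambda>j. em (ee j) 0"] tot_act_add_left[OF _ _ h] J
    by (auto simp: subset_iff)
  ultimately show "\<exists>J. finite J \<and> J \<subseteq> vertices TE \<and> h = (\<Sum>j\<in>J. act (tot t) (idem TE j) h)"
    using J by (intro exI[of _ J]) simp
qed

lemma tot_G_grading: "Submission.grading (mcarrier (tot t)) (tot_G t)"
  unfolding grading_def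
proof (intro conjI allI ballI impI)
  show "add_subgroup (mcarrier (tot t))" by (rule tot_group)
  fix r
  show "add_subgroup (tot_G t r)" using tot_group[of t] unfolding add_subgroup_def by (auto simp: tot_G_def)
  show "tot_G t r \<subseteq> mcarrier (tot t)" by (auto simp: tot_G_def)
next
  fix h assume h: "h \<in> mcarrier (tot t)"
  note hD = tot_D[OF h]
  let ?a = "\<lambda>s r. component (shifted s (G (t - s))) (fst (h s)) r" and ?b = "\<lambda>s r. component (shifted (Suc s) (G (t - s))) (snd (h s)) r"
  have "\<forall>s\<le>t. \<exists>N. \<forall>M\<ge>N. fst (h s) = (\<Sum>r<M. ?a s r)" using component_sum_ex[OF shifted_grading hD(1)] by blast
  from uniform_bound[OF this] obtain N1 where N1: "\<forall>s\<le>t. \<forall>M\<ge>N1. fst (h s) = (\<Sum>r<M. ?a s r)" by blast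
  have "\<forall>s\<le>t. \<exists>N. \<forall>M\<ge>N. snd (h s) = (\<Sum>r<M. ?b s r)" using component_sum_ex[OF shifted_grading hD(2)] by blast
  from uniform_bound[OF this] obtain N2 where N2: "\<forall>s\<le>t. \<forall>M\<ge>N2. snd (h s) = (\<Sum>r<M. ?b s r)" by blast
  define k where "k r = (\<lambda>s. if s \<le> t then (?a s r, ?b s r) else 0)" for r
  define N where "N = max N1 N2"
  have "h s = (\<Sum>r<N. k r) s" for s
  proof (cases "s \<le> t")
    case True
    have "(\<Sum>r<N. k r) s = (\<Sum>r<N. (?a s r, ?b s r))" using True by (simp add: sum_fun_apply k_def)
    also have "\<dots> = (\<Sum>r<N. ?a s r, \<Sum>r<N. ?b s r)" by (rule sum_Pair)
    also have "(\<Sum>r<N. ?a s r) = fst (h s)" using N1 True by (simp add: N_def)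
    also have "(\<Sum>r<N. ?b s r) = snd (h s)" using N2 True by (simp add: N_def)
    finally show ?thesis by simp
  next
    case False
    then show ?thesis using hD(3)[of s] by (simp add: sum_fun_apply k_def)
  qed
  then have "h = (\<Sum>r<N. k r)" by (rule ext)
  moreover have "k r \<in> tot_G t r" for r
    using component_in[OF shifted_grading hD(1)] component_in[OF shifted_grading hD(2)] shifted_carrier
    by (simp add: tot_G_def tot_mem k_def zero_pair) blast
  ultimately show "\<exists>c N. (\<forall>s. c s \<in> tot_G t s) \<and> h = (\<Sum>s<N. c s)" by blast
next
  fix k N r assume k: "(\<forall>r. k r \<in> tot_G t r) \<and> (\<Sum>r<(N::nat). k r) = 0" and r: "r < N"
  have kR: "k r \<in> tot_G t r" for r using k by blast
  have sz: "(\<Sum>r<N. k r s) = 0" for s using k sum_fun_apply[of k "{..<N}" s] by simp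
  show "k r = 0"
  proof
    fix s
    show "k r s = 0 s"
    proof (cases "s \<le> t")
      case True
      have "(\<Sum>r<N. (fst (k r s), snd (k r s))) = (0, 0)" using sz[of s] by (simp add: zero_pair)
      then have z: "(\<Sum>r<N. fst (k r s)) = 0" "(\<Sum>r<N. snd (k r s)) = 0" unfolding sum_Pair by simp_all
      have m: "\<forall>r. fst (k r s) \<in> shifted s (G (t - s)) r" "\<forall>r. snd (k r s) \<in> shifted (Suc s) (G (t - s)) r"
        using kR True by (auto simp: tot_G_def)
      have "fst (k r s) = 0"
        by (rule shifted_grading[of "t - s" s, unfolded grading_def, THEN conjunct2, THEN conjunct2, THEN conjunct2, THEN spec,
          THEN spec, of "\<lambda>r. fst (k r s)" N, THEN mp, OF conjI[OF m(1) z(1)], THEN spec, THEN mp, OF r])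
      moreover have "snd (k r s) = 0"
        by (rule shifted_grading[of "t - s" "Suc s", unfolded grading_def, THEN conjunct2, THEN conjunct2, THEN conjunct2, THEN spec,
          THEN spec, of "\<lambda>r. snd (k r s)" N, THEN mp, OF conjI[OF m(2) z(2)], THEN spec, THEN mp, OF r])
      ultimately show ?thesis by (simp add: prod_eq_iff)
    next
      case False
      then show ?thesis using tot_D(3)[of "k r" t s] kR[of r] by (simp add: tot_G_def)
    qed
  qed
qed

lemma shifted_act: "a \<in> comp A r \<Longrightarrow> x \<in> shifted q (G t) p \<Longrightarrow> act (P t) a x \<in> shifted q (G t) (r + p)"
proof -
  assume a: "a \<in> comp A r" and x: "x \<in> shifted q (G t) p"
  show ?thesis
  proof (cases "q \<le> p")
    case True
    then have "x \<in> G t (p - q)" using x by (simp add: shifted_def)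
    then have "act (P t) a x \<in> G t (r + (p - q))" by (rule degP[OF a])
    then show ?thesis using True by (simp add: shifted_def)
  next
    case False
    then have "x = 0" using x by (simp add: shifted_def)
    then show ?thesis using comp_CC[OF a] by simp
  qed
qed

lemma shifted_Suc: "x \<in> shifted q (G t) p \<Longrightarrow> x \<in> shifted (Suc q) (G t) (Suc p)"
  by (simp add: shifted_def split: if_splits)

lemma tot_G_module: "graded_module TE (tot t) (tot_G t)"
  unfolding graded_module_iff
proof (intro conjI allI ballI)
  show "left_module TE (tot t)" by (rule tot_module)
  show "Submission.grading (mcarrier (tot t)) (tot_G t)" by (rule tot_G_grading)
  fix r p x h assume x: "x \<in> comp TE r" and h: "h \<in> tot_G t p"
  obtain a c where ac: "x = em a c" "a \<in> comp A r" "c \<in> dg r" using x by (rule TE_compE)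
  have hR: "h \<in> mcarrier (tot t)" using h by (simp add: tot_G_def)
  have xC: "x \<in> carrier TE" using x T.comp_CC by blast
  show "act (tot t) x h \<in> tot_G t (r + p)"
    unfolding tot_G_def mem_Collect_eq
  proof (intro conjI allI impI)
    show "act (tot t) x h \<in> mcarrier (tot t)" by (rule tot_act_closed[OF xC hR])
    fix s assume s: "s \<le> t"
    have u: "fst (h s) \<in> shifted s (G (t - s)) p" and v: "snd (h s) \<in> shifted (Suc s) (G (t - s)) p" using h s by (auto simp: tot_G_def)
    show "fst (act (tot t) x h s) \<in> shifted s (G (t - s)) (r + p)"
      using shifted_act[OF kappa_pow_comp[OF ac(2)] u] ac by (simp add: tot_act)
    have "act (P (t - s)) (kappa_pow (Suc s) c) (fst (h s)) \<in> shifted (Suc s) (G (t - s)) (r + p)"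
    proof (cases r)
      case 0
      then have "c = 0" using ac by (simp add: dg_simps)
      then show ?thesis using shifted_carrier[OF u] by simp
    next
      case (Suc q)
      then have "c \<in> comp A q" using ac by (simp add: dg_simps)
      then have "act (P (t - s)) (kappa_pow (Suc s) c) (fst (h s)) \<in> shifted s (G (t - s)) (q + p)"
        by (intro shifted_act[OF kappa_pow_comp u])
      then show ?thesis using shifted_Suc Suc by simp
    qed
    then show "snd (act (tot t) x h s) \<in> shifted (Suc s) (G (t - s)) (r + p)"
      using shifted_act[OF kappa_pow_comp[OF ac(2)] v, of "Suc s"] ac dg_CC by (simp add: tot_act)
  qed
qed

lemma emb_mem: "s \<le> t \<Longrightarrow> u \<in> mcarrier (P (t - s)) \<Longrightarrow> v \<in> mcarrier (P (t - s)) \<Longrightarrow> emb s u v \<in> mcarrier (tot t)"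
  by (auto simp: emb_def tot_mem)

lemma emb_add: "emb s (u + u') (v + v') = emb s u v + emb s u' v'"
  by (auto simp: emb_def fun_eq_iff)

lemma emb_act: "a \<in> CC \<Longrightarrow> c \<in> CC \<Longrightarrow> u \<in> mcarrier (P (t - s)) \<Longrightarrow> v \<in> mcarrier (P (t - s)) \<Longrightarrow>
    act (tot t) (em a c) (emb s u v) =
      emb s (act (P (t - s)) (kappa_pow s a) u) (act (P (t - s)) (kappa_pow (Suc s) a) v + act (P (t - s)) (kappa_pow (Suc s) c) u)"
  by (auto simp: emb_def tot_act fun_eq_iff zero_pair)

text \<open>\<open>sigma_pow s\<close> undoes the twist of column s; in this way submodules of the
  column and maps out of it are reduced to those of P (t - s) over \<open>A\<close>.\<close>

lemma emb_act_sp: "a \<in> CC \<Longrightarrow> u \<in> mcarrier (P (t - s)) \<Longrightarrow>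
    emb s (act (P (t - s)) a u) 0 = act (tot t) (em (sigma_pow s a) 0) (emb s u 0)"
  by (simp add: emb_act)

lemma emb_sum: assumes h: "h \<in> mcarrier (tot t)" shows "h = (\<Sum>s\<le>t. emb s (fst (h s)) 0 + emb s 0 (snd (h s)))"
proof
  fix r
  have "(\<Sum>s\<le>t. emb s (fst (h s)) 0 + emb s 0 (snd (h s))) r = (\<Sum>s\<le>t. if r = s then h s else 0)"
    unfolding sum_fun_apply by (intro sum.cong refl) (auto simp: emb_def prod_eq_iff)
  also have "\<dots> = h r" using tot_D(3)[OF h, of r] by auto
  finally show "h r = (\<Sum>s\<le>t. emb s (fst (h s)) 0 + emb s 0 (snd (h s))) r" by simp
qed

text \<open>The first coordinates of each column are generated because P (t - s) is. The
  x-coordinates are then reached through \<open>em 0 (uu J)\<close>, that is, by multiplication with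
  x.\<close>

lemma tot_generated: "generated_by TE (tot t) (tot_G t t)"
  unfolding generated_by_def
proof (intro allI impI, elim conjE)
  fix N assume N: "tot_G t t \<subseteq> N" "N \<subseteq> mcarrier (tot t)" "left_module TE (tot t\<lparr>mcarrier := N\<rparr>)"
  have Ng: "add_subgroup N" and Na: "\<And>x h. x \<in> carrier TE \<Longrightarrow> h \<in> N \<Longrightarrow> act (tot t) x h \<in> N"
    using T.lm_group[OF N(3)] T.lm_closed[OF N(3)] by simp_all
  have emb1: "emb s u 0 \<in> N" if s: "s \<le> t" and u: "u \<in> mcarrier (P (t - s))" for s u
  proof -
    let ?N = "{u \<in> mcarrier (P (t - s)). emb s u 0 \<in> N}"
    have "?N = mcarrier (P (t - s))"
    proof (rule gen[unfolded generated_by_def, rule_format], intro conjI)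
      show sub: "?N \<subseteq> mcarrier (P (t - s))" by blast
      have emb0: "emb s 0 0 = 0" by (auto simp: emb_def fun_eq_iff zero_pair)
      have embd: "emb s (u - v) 0 = emb s u 0 - emb s v 0" for u v by (auto simp: emb_def fun_eq_iff)
      have g: "add_subgroup ?N"
        using Ng by (auto simp: add_subgroup_def emb0 embd)
      show "left_module A (P (t - s)\<lparr>mcarrier := ?N\<rparr>)"
      proof (rule submodule[OF lmP g sub])
        fix a x assume "a \<in> CC" "x \<in> ?N"
        then show "act (P (t - s)) a x \<in> ?N" using Na[of "em (sigma_pow s a) 0" "emb s x 0"] by (simp add: emb_act_sp)
      qed
      show "G (t - s) (t - s) \<subseteq> ?N"
      proof
        fix g assume g: "g \<in> G (t - s) (t - s)"
        then have gP: "g \<in> mcarrier (P (t - s))" using grading_subset[OF grP] by blast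
        have "emb s g 0 \<in> tot_G t t" unfolding tot_G_def mem_Collect_eq
        proof (intro conjI allI impI)
          show "emb s g 0 \<in> mcarrier (tot t)" using emb_mem[OF s gP] by simp
          have "g \<in> shifted s (G (t - s)) t" using g s by (simp add: shifted_def)
          then show "fst (emb s g 0 r) \<in> shifted r (G (t - r)) t" "snd (emb s g 0 r) \<in> shifted (Suc r) (G (t - r)) t" for r
            by (simp_all add: emb_def)
        qed
        then show "g \<in> ?N" using N(1) gP by blast
      qed
    qed
    then show ?thesis using u by blast
  qed
  have emb2: "emb s 0 v \<in> N" if s: "s \<le> t" and v: "v \<in> mcarrier (P (t - s))" for s v
  proof -
    obtain J where J: "finite J" "J \<subseteq> VV" "\<forall>K. J \<subseteq> K \<and> finite K \<and> K \<subseteq> VV \<longrightarrow> act (P (t - s)) (kappa_pow (Suc s) (uu K)) v = v"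
      using kappa_pow_unit[OF v, of "Suc s"] by (elim exE conjE) (rule that)
    have "act (P (t - s)) (kappa_pow (Suc s) (uu J)) v = v" using J by blast
    then have "act (tot t) (em 0 (uu J)) (emb s v 0) = emb s 0 v" using v J by (simp add: emb_act)
    moreover have "act (tot t) (em 0 (uu J)) (emb s v 0) \<in> N" using Na emb1[OF s v] J by simp
    ultimately show ?thesis by simp
  qed
  have "h \<in> N" if h: "h \<in> mcarrier (tot t)" for h
  proof -
    have "(\<Sum>s\<le>t. emb s (fst (h s)) 0 + emb s 0 (snd (h s))) \<in> N"
      using emb1 emb2 tot_D[OF h] by (intro add_subgroup_sum[OF Ng] add_subgroup_add[OF Ng]) auto
    then show ?thesis using emb_sum[OF h] by simp
  qed
  then show "N = mcarrier (tot t)" using N(2) by blast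
qed

lemma tot_d_mem: "h \<in> mcarrier (tot (Suc t)) \<Longrightarrow> tot_d t h \<in> mcarrier (tot t)"
proof -
  assume h: "h \<in> mcarrier (tot (Suc t))"
  have "fst (h s) \<in> mcarrier (P (Suc (t - s)))" "snd (h s) \<in> mcarrier (P (Suc (t - s)))" "fst (h (Suc s)) \<in> mcarrier (P (t - s))"
    if "s \<le> t" for s
    using tot_D(1,2)[OF h, of s] tot_D(1)[OF h, of "Suc s"] that by (simp_all add: Suc_diff_le)
  then show ?thesis unfolding tot_mem by (simp add: tot_d_def d_simps)
qed

lemma tot_d_hom: "module_hom TE (tot (Suc t)) (tot t) (tot_d t)"
  unfolding module_hom_def
proof (intro conjI ballI)
  show "tot_d t ` mcarrier (tot (Suc t)) \<subseteq> mcarrier (tot t)" using tot_d_mem by blast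
  fix h assume h: "h \<in> mcarrier (tot (Suc t))"
  have hs: "fst (h s) \<in> mcarrier (P (Suc (t - s)))" "snd (h s) \<in> mcarrier (P (Suc (t - s)))" "fst (h (Suc s)) \<in> mcarrier (P (t - s))"
    if "s \<le> t" for s
    using tot_D(1,2)[OF h, of s] tot_D(1)[OF h, of "Suc s"] that by (simp_all add: Suc_diff_le)
  show "tot_d t (h + k) = tot_d t h + tot_d t k" if k: "k \<in> mcarrier (tot (Suc t))" for k
  proof
    fix s
    have "fst (k s) \<in> mcarrier (P (Suc (t - s)))" "snd (k s) \<in> mcarrier (P (Suc (t - s)))" if "s \<le> t"
      using tot_D(1,2)[OF k, of s] that by (simp_all add: Suc_diff_le)
    then show "tot_d t (h + k) s = (tot_d t h + tot_d t k) s"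
      using hs[of s] by (simp add: tot_d_def d_simps add_ac)
  qed
  fix x assume "x \<in> carrier TE"
  then obtain a c where x: "x = em a c" "a \<in> CC" "c \<in> CC" by (rule TE_carrierE)
  show "tot_d t (act (tot (Suc t)) x h) = act (tot t) x (tot_d t h)"
  proof
    fix s
    show "tot_d t (act (tot (Suc t)) x h) s = act (tot t) x (tot_d t h) s"
    proof (cases "s \<le> t")
      case True
      then have st: "Suc t - s = Suc (t - s)" by (simp add: Suc_diff_le)
      show ?thesis using True hs[OF True] x
        by (simp add: tot_d_def tot_act st d_simps ac_add_right ac_minus lm_diff[OF lmP] add_ac)
    next
      case False
      then show ?thesis using x by (simp add: tot_d_def tot_act zero_pair)
    qed
  qed
qed

lemma tot_d_degree: "tot_d t ` tot_G (Suc t) r \<subseteq> tot_G t r"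
proof
  fix y assume "y \<in> tot_d t ` tot_G (Suc t) r"
  then obtain h where h: "h \<in> tot_G (Suc t) r" "y = tot_d t h" by blast
  have hR: "h \<in> mcarrier (tot (Suc t))" using h by (simp add: tot_G_def)
  have dsh: "d p x \<in> shifted q (G p) r" if "x \<in> shifted q (G (Suc p)) r" for p q x
    using that dG[of p "r - q"] d_simps(4) by (auto simp: shifted_def split: if_splits)
  show "y \<in> tot_G t r"
    unfolding tot_G_def mem_Collect_eq h(2)
  proof (intro conjI allI impI)
    show "tot_d t h \<in> mcarrier (tot t)" by (rule tot_d_mem[OF hR])
    fix s assume s: "s \<le> t"
    then have st: "Suc t - s = Suc (t - s)" by (simp add: Suc_diff_le)
    have u: "fst (h s) \<in> shifted s (G (Suc (t - s))) r" and v: "snd (h s) \<in> shifted (Suc s) (G (Suc (t - s))) r"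
      and w: "fst (h (Suc s)) \<in> shifted (Suc s) (G (t - s)) r"
      using h(1) s unfolding tot_G_def st[symmetric] by auto
    show "fst (tot_d t h s) \<in> shifted s (G (t - s)) r" using dsh[OF u] s by (simp add: tot_d_def)
    show "snd (tot_d t h s) \<in> shifted (Suc s) (G (t - s)) r" using dsh[OF v] w s by (simp add: tot_d_def)
  qed
qed

lemma tot_d_tot_d: "h \<in> mcarrier (tot (Suc (Suc t))) \<Longrightarrow> tot_d t (tot_d (Suc t) h) = 0"
proof
  fix s assume h: "h \<in> mcarrier (tot (Suc (Suc t)))"
  show "tot_d t (tot_d (Suc t) h) s = 0 s"
  proof (cases "s \<le> t")
    case True
    then have st: "Suc t - s = Suc (t - s)" "Suc (Suc t) - s = Suc (Suc (t - s))" by (simp_all add: Suc_diff_le)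
    have hs: "fst (h s) \<in> mcarrier (P (Suc (Suc (t - s))))" "snd (h s) \<in> mcarrier (P (Suc (Suc (t - s))))"
      "fst (h (Suc s)) \<in> mcarrier (P (Suc (t - s)))"
      using tot_D(1,2)[OF h, of s] tot_D(1)[OF h, of "Suc s"] st by simp_all
    show ?thesis using True hs d_simps(1)[OF hs(1)] d_simps(1)[OF hs(2)]
      by (simp add: tot_d_def st d_simps dd zero_pair)
  next
    case False
    then show ?thesis by (simp add: tot_d_def)
  qed
qed

text \<open>The elements \<open>u\<^sub>s\<^sub>+\<^sub>1\<close> of a cycle are determined by the \<open>v\<^sub>s\<close>. If \<open>u\<^sub>0 = d w\<close>, then the cycle is the
  boundary of the element with \<open>w, v\<^sub>0, v\<^sub>1, \<dots>\<close> in place of the \<open>u\<^sub>s\<close> and zeros in place of the \<open>v\<^sub>s\<close>.\<close>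

lemma tot_d_preimage:
  assumes h: "h \<in> mcarrier (tot t)" and w: "w \<in> mcarrier (P (Suc t))" "d t w = fst (h 0)"
    and cyc: "\<And>s. s < t \<Longrightarrow> fst (h (Suc s)) = (if even s then - d (t - Suc s) (snd (h s)) else d (t - Suc s) (snd (h s)))"
  shows "h \<in> boundaries tot tot_d t"
proof -
  define k :: "nat \<Rightarrow> 'm \<times> 'm" where "k s = (case s of 0 \<Rightarrow> (w, 0) | Suc r \<Rightarrow> (snd (h r), 0))" for s
  have k: "k \<in> mcarrier (tot (Suc t))"
    unfolding tot_mem
  proof (intro conjI allI impI)
    fix s assume "s \<le> Suc t"
    then show "fst (k s) \<in> mcarrier (P (Suc t - s))" "snd (k s) \<in> mcarrier (P (Suc t - s))"
      using w tot_D(2)[OF h, of "s - 1"] by (cases s; simp add: k_def)+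
  next
    fix s assume "s > Suc t"
    then show "k s = 0" using tot_D(3)[OF h, of "s - 1"] by (cases s) (simp_all add: k_def zero_pair)
  qed
  have "h = tot_d t k"
  proof
    fix s
    show "h s = tot_d t k s"
    proof (cases "s \<le> t")
      case True
      show ?thesis
      proof (cases s)
        case 0
        then show ?thesis using w by (simp add: tot_d_def k_def d_simps prod_eq_iff)
      next
        case (Suc r)
        then show ?thesis using cyc[of r] True by (simp add: tot_d_def k_def d_simps prod_eq_iff)
      qed
    next
      case False
      then show ?thesis using tot_D(3)[OF h, of s] by (simp add: tot_d_def)
    qed
  qed
  then show ?thesis using k by (auto simp: boundaries_def)
qed

text \<open>The first coordinate of column 0 is a cycle of \<open>P\<close> in the same degree, so
  exactness of \<open>P\<close> provides \<open>w\<close>. The x-coordinates of the cycle equation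
  are the remaining hypotheses of \<open>tot_d_preimage\<close>.\<close>

lemma tot_exact:
  assumes "(t, r) \<noteq> (0, 0)"
  shows "cycles tot tot_d t \<inter> tot_G t r \<subseteq> boundaries tot tot_d t"
proof
  fix h assume h: "h \<in> cycles tot tot_d t \<inter> tot_G t r"
  then have hR: "h \<in> mcarrier (tot t)" and h0: "fst (h 0) \<in> G t r" by (auto simp: tot_G_def shifted_def)
  have dz: "t = Suc p \<Longrightarrow> tot_d p h = 0" for p using h by (simp add: cycles_def)
  have "fst (h 0) \<in> cycles P d t"
  proof (cases t)
    case 0 then show ?thesis using tot_D(1)[OF hR, of 0] by (simp add: cycles_def)
  next
    case (Suc p)
    have "fst (tot_d p h 0) = 0" using dz[OF Suc] by simp
    then show ?thesis using tot_D(1)[OF hR, of 0] Suc by (simp add: cycles_def tot_d_def)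
  qed
  then have "fst (h 0) \<in> boundaries P d t" using ex[OF assms] h0 by blast
  then obtain w where w: "w \<in> mcarrier (P (Suc t))" "d t w = fst (h 0)" by (auto simp: boundaries_def)
  show "h \<in> boundaries tot tot_d t"
  proof (rule tot_d_preimage[OF hR w])
    fix s assume s: "s < t"
    then obtain p where p: "t = Suc p" by (cases t) auto
    have "snd (tot_d p h s) = 0" using dz[OF p] by simp
    then show "fst (h (Suc s)) = (if even s then - d (t - Suc s) (snd (h s)) else d (t - Suc s) (snd (h s)))"
      using s p by (auto simp: tot_d_def eq_neg_iff_add_eq_0 add.commute split: if_splits)
  qed
qed

lemma tot_linear_resolution: "linear_resolution TE i tot tot_G tot_d"
  unfolding linear_resolution_def
proof (intro conjI allI ballI impI tot_G_module tot_generated tot_d_hom tot_d_degree tot_d_tot_d tot_exact)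
  obtain \<phi> where phi: "\<phi> ` G 0 0 = {a \<cdot> ee i | a. a \<in> comp A 0}"
       "\<And>x y. x \<in> G 0 0 \<Longrightarrow> y \<in> G 0 0 \<Longrightarrow> \<phi> (x + y) = \<phi> x + \<phi> y"
       "\<And>a x. a \<in> comp A 0 \<Longrightarrow> x \<in> G 0 0 \<Longrightarrow> \<phi> (act (P 0) a x) = a \<cdot> \<phi> x"
       "\<And>x. x \<in> G 0 0 \<Longrightarrow> \<phi> x = 0 \<longleftrightarrow> x \<in> boundaries P d 0"
    by (rule linear_resolution_head[OF lr]) (rule that)
  have phiC: "\<phi> x \<in> CC" if "x \<in> G 0 0" for x
  proof -
    have "\<phi> x \<in> {a \<cdot> ee i | a. a \<in> comp A 0}" using phi(1) that by blast
    then show ?thesis using comp_CC iV by auto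
  qed
  \<comment> \<open>In degree 0 the shift kills the x-coordinate, so the head of the total complex
    is that of \<open>P\<close>.\<close>
  have R0: "h \<in> tot_G 0 0 \<longleftrightarrow> (\<exists>u\<in>G 0 0. h = emb 0 u 0)" for h
  proof
    assume h: "h \<in> tot_G 0 0"
    then have "fst (h 0) \<in> G 0 0" "snd (h 0) = 0" "\<forall>s>0. h s = 0" by (auto simp: tot_G_def shifted_def tot_mem)
    then show "\<exists>u\<in>G 0 0. h = emb 0 u 0" by (intro bexI[of _ "fst (h 0)"]) (auto simp: emb_def fun_eq_iff prod_eq_iff)
  next
    assume "\<exists>u\<in>G 0 0. h = emb 0 u 0"
    then obtain u where u: "u \<in> G 0 0" "h = emb 0 u 0" by blast
    then show "h \<in> tot_G 0 0" using emb_mem[of 0 0 u 0] grading_subset[OF grP u(1)] by (auto simp: tot_G_def shifted_def emb_def)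
  qed
  have fio: "fst (emb 0 u v 0) = u" for u v by (simp add: emb_def)
  have C0: "comp TE 0 = (\<lambda>a. em a 0) ` comp A 0" by (auto simp: TE_comp dg_simps)
  show "\<exists>\<phi>. \<phi> ` tot_G 0 0 = {mult TE a (idem TE i) | a. a \<in> comp TE 0} \<and>
       (\<forall>x\<in>tot_G 0 0. \<forall>y\<in>tot_G 0 0. \<phi> (x + y) = \<phi> x + \<phi> y) \<and>
       (\<forall>a\<in>comp TE 0. \<forall>x\<in>tot_G 0 0. \<phi> (act (tot 0) a x) = mult TE a (\<phi> x)) \<and>
       (\<forall>x\<in>tot_G 0 0. \<phi> x = 0 \<longleftrightarrow> x \<in> boundaries tot tot_d 0)"
  proof (intro exI[of _ "\<lambda>h. em (\<phi> (fst (h 0))) 0"] conjI ballI)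
    have "(\<lambda>h. em (\<phi> (fst (h 0))) 0) ` tot_G 0 0 = (\<lambda>u. em (\<phi> u) 0) ` G 0 0"
    proof -
      have "tot_G 0 0 = (\<lambda>u. emb 0 u 0) ` G 0 0" using R0 by auto
      then show ?thesis by (simp add: image_image fio)
    qed
    also have "\<dots> = (\<lambda>b. em b 0) ` (\<phi> ` G 0 0)" by (simp add: image_image)
    also have "\<dots> = {em (a \<cdot> ee i) 0 | a. a \<in> comp A 0}" unfolding phi(1) by auto
    also have "\<dots> = {mult TE a (idem TE i) | a. a \<in> comp TE 0}"
    proof -
      have "mult TE (em a 0) (idem TE i) = em (a \<cdot> ee i) 0" if "a \<in> comp A 0" for a
        using that comp_CC[OF that] iV by (simp add: TE_mult)
      then show ?thesis unfolding C0 setcompr_eq_image Collect_mem_eq image_image by (intro image_cong) auto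
    qed
    finally show "(\<lambda>h. em (\<phi> (fst (h 0))) 0) ` tot_G 0 0 = {mult TE a (idem TE i) | a. a \<in> comp TE 0}" .
    fix h assume "h \<in> tot_G 0 0"
    then obtain u where u: "u \<in> G 0 0" "h = emb 0 u 0" using R0 by blast
    have uP: "u \<in> mcarrier (P 0)" using grading_subset[OF grP u(1)] .
    show "em (\<phi> (fst ((h + k) 0))) 0 = em (\<phi> (fst (h 0))) 0 + em (\<phi> (fst (k 0))) 0" if "k \<in> tot_G 0 0" for k
    proof -
      obtain v where v: "v \<in> G 0 0" "k = emb 0 v 0" using R0 \<open>k \<in> tot_G 0 0\<close> by blast
      then show ?thesis using u phi(2)[OF u(1) v(1)] by (simp add: fio em_left_add)
    qed
    show "em (\<phi> (fst (act (tot 0) x h 0))) 0 = mult TE x (em (\<phi> (fst (h 0))) 0)" if "x \<in> comp TE 0" for x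
    proof -
      obtain a where a: "a \<in> comp A 0" "x = em a 0" using \<open>x \<in> comp TE 0\<close> C0 by blast
      have aC: "a \<in> CC" using comp_CC[OF a(1)] .
      have "fst (act (tot 0) x h 0) = act (P 0) a u" using u by (simp add: tot_act a fio)
      then show ?thesis using phi(3)[OF a(1) u(1)] phiC[OF u(1)] aC u by (simp add: a TE_mult fio)
    qed
    have "em (\<phi> (fst (h 0))) 0 = 0 \<longleftrightarrow> u \<in> boundaries P d 0"
      using phi(4)[OF u(1)] u(2) by (simp add: fio em_eq_0)
    also have "\<dots> \<longleftrightarrow> h \<in> boundaries tot tot_d 0"
    proof
      assume "u \<in> boundaries P d 0"
      then obtain w where w: "w \<in> mcarrier (P (Suc 0))" "d 0 w = u" by (auto simp: boundaries_def)
      have hR: "h \<in> mcarrier (tot 0)" unfolding u(2) using emb_mem[of 0 0 u 0] uP by simp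
      show "h \<in> boundaries tot tot_d 0" by (rule tot_d_preimage[OF hR w(1)]) (use w u fio in auto)
    next
      assume "h \<in> boundaries tot tot_d 0"
      then obtain k where k: "k \<in> mcarrier (tot (Suc 0))" "h = tot_d 0 k" by (auto simp: boundaries_def)
      have "u = fst (h 0)" using u fio by simp
      also have "\<dots> = d 0 (fst (k 0))" by (simp add: k(2) tot_d_def)
      finally show "u \<in> boundaries P d 0" using tot_D(1)[OF k(1), of 0] by (auto simp: boundaries_def)
    qed
    finally show "em (\<phi> (fst (h 0))) 0 = 0 \<longleftrightarrow> h \<in> boundaries tot tot_d 0" .
  qed
qed simp_all

end

section \<open>Lifting for the total modules\<close>

context extension_resolution
begin

text \<open>Truth for all sufficiently large finite sets of vertices. Without a unit, x is not an
  element of the extension and is handled as the limit of \<open>em 0 (uu K)\<close>.\<close>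

definition large :: "('v set \<Rightarrow> bool) \<Rightarrow> bool"
  where "large Q \<longleftrightarrow> (\<exists>J. finite J \<and> J \<subseteq> VV \<and> (\<forall>K. J \<subseteq> K \<and> finite K \<and> K \<subseteq> VV \<longrightarrow> Q K))"

lemma large_conj: "large Q \<Longrightarrow> large R \<Longrightarrow> large (\<lambda>K. Q K \<and> R K)"
proof -
  assume "large Q" "large R"
  then obtain J L where J: "finite J" "J \<subseteq> VV" "\<forall>K. J \<subseteq> K \<and> finite K \<and> K \<subseteq> VV \<longrightarrow> Q K"
    and L: "finite L" "L \<subseteq> VV" "\<forall>K. L \<subseteq> K \<and> finite K \<and> K \<subseteq> VV \<longrightarrow> R K"
    unfolding large_def by (elim exE conjE) (rule that)
  show ?thesis unfolding large_def
  proof (intro exI[of _ "J \<union> L"] conjI allI impI)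
    fix K assume K: "J \<union> L \<subseteq> K \<and> finite K \<and> K \<subseteq> VV"
    show "Q K" using J(3)[THEN spec, of K] K by simp
    show "R K" using L(3)[THEN spec, of K] K by simp
  qed (use J L in simp_all)
qed

lemma large_ex: "large Q \<Longrightarrow> \<exists>K. finite K \<and> K \<subseteq> VV \<and> Q K"
  unfolding large_def by blast

lemma large_mono: "large Q \<Longrightarrow> (\<And>K. finite K \<Longrightarrow> K \<subseteq> VV \<Longrightarrow> Q K \<Longrightarrow> R K) \<Longrightarrow> large R"
proof -
  assume "large Q" and QR: "\<And>K. finite K \<Longrightarrow> K \<subseteq> VV \<Longrightarrow> Q K \<Longrightarrow> R K"
  then obtain J where J: "finite J" "J \<subseteq> VV" "\<forall>K. J \<subseteq> K \<and> finite K \<and> K \<subseteq> VV \<longrightarrow> Q K"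
    unfolding large_def by (elim exE conjE) (rule that)
  show ?thesis unfolding large_def
    by (intro exI[of _ J] conjI J(1,2) allI impI QR J(3)[THEN spec, THEN mp]) simp_all
qed

lemma large_unit: "a \<in> CC \<Longrightarrow> large (\<lambda>K. uu K \<cdot> a = a \<and> a \<cdot> uu K = a)"
proof -
  assume a: "a \<in> CC"
  obtain J where J: "finite J" "J \<subseteq> VV" "uu J \<cdot> a = a" "a \<cdot> uu J = a" by (rule unit_obtain[OF a])
  show ?thesis unfolding large_def
  proof (intro exI[of _ J] conjI J(1,2) allI impI)
    fix K assume K: "J \<subseteq> K \<and> finite K \<and> K \<subseteq> VV"
    show "uu K \<cdot> a = a" "a \<cdot> uu K = a" using unit_mono[OF J(1,2) _ _ _ a, of K] J(3,4) K by blast+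
  qed
qed

lemma TE_uu: "T.uu K = em (uu K) 0"
  unfolding T.uu_def TE_simps em_uu ..

text \<open>Multiplication by x on \<open>M\<close>: on a given element, \<open>em 0 (uu K)\<close>
  acts in the same way for all large \<open>K\<close>.\<close>

definition xact :: "('a \<times> ('a \<Rightarrow> 'k), 'l::ab_group_add) lmodule \<Rightarrow> 'l \<Rightarrow> 'l"
  where "xact M y = (SOME z. large (\<lambda>K. act M (em 0 (uu K)) y = z))"

context
  fixes M :: "('a \<times> ('a \<Rightarrow> 'k), 'l::ab_group_add) lmodule"
  assumes M: "left_module TE M"
begin

lemma em_act: "a \<in> CC \<Longrightarrow> c \<in> CC \<Longrightarrow> b \<in> CC \<Longrightarrow> e \<in> CC \<Longrightarrow> y \<in> mcarrier M \<Longrightarrow>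
    act M (em a c) (act M (em b e) y) = act M (em (a \<cdot> b) (a \<cdot> e + c \<cdot> sigma b)) y"
  using T.lm_mult[OF M, of "em a c" "em b e" y] by (simp add: TE_mult)

lemma large_em_unit: "y \<in> mcarrier M \<Longrightarrow> large (\<lambda>K. act M (em (uu K) 0) y = y)"
  using T.lm_unit_ex[OF M, of y] unfolding large_def TE_uu TE_simps .

text \<open>If \<open>uu J\<close> fixes \<open>y\<close>, then \<open>em 0 (uu K)\<close> acts on
  \<open>y\<close> with dual coefficient \<open>uu K \<cdot> sigma (uu J)\<close>, which is constant
  as soon as \<open>uu K\<close> is a unit for \<open>sigma (uu J)\<close>.\<close>

lemma large_xact: assumes y: "y \<in> mcarrier M" shows "large (\<lambda>K. act M (em 0 (uu K)) y = xact M y)"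
  unfolding xact_def
proof (rule someI_ex)
  obtain J where J: "finite J" "J \<subseteq> VV" "act M (em (uu J) 0) y = y" 
    using large_ex[OF large_em_unit[OF y]] by (elim exE conjE) (rule that)
  have "act M (em 0 (uu K)) y = act M (em 0 (sigma (uu J))) y"
    if "uu K \<cdot> sigma (uu J) = sigma (uu J)" "finite K" "K \<subseteq> VV" for K
    using em_act[of 0 "uu K" "uu J" 0 y] J y that by simp
  then have "large (\<lambda>K. act M (em 0 (uu K)) y = act M (em 0 (sigma (uu J))) y)"
    by (intro large_mono[OF large_unit[of "sigma (uu J)"]]) (use J in simp_all)
  then show "\<exists>z. large (\<lambda>K. act M (em 0 (uu K)) y = z)" by blast
qed

lemma xact_closed: assumes y: "y \<in> mcarrier M" shows "xact M y \<in> mcarrier M"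
proof -
  obtain K where K: "finite K" "K \<subseteq> VV" "act M (em 0 (uu K)) y = xact M y"
    using large_ex[OF large_xact[OF y]] by (elim exE conjE) (rule that)
  then show ?thesis using T.lm_closed[OF M, of "em 0 (uu K)" y] y by simp
qed

lemma xact_add: assumes "y \<in> mcarrier M" "z \<in> mcarrier M" shows "xact M (y + z) = xact M y + xact M z"
proof -
  have yz: "y + z \<in> mcarrier M" using assms add_subgroup_add[OF T.lm_group[OF M]] by blast
  obtain K where K: "finite K" "K \<subseteq> VV" "act M (em 0 (uu K)) y = xact M y" "act M (em 0 (uu K)) z = xact M z"
    "act M (em 0 (uu K)) (y + z) = xact M (y + z)"
    using large_ex[OF large_conj[OF large_conj[OF large_xact[OF assms(1)] large_xact[OF assms(2)]] large_xact[OF yz]]] by blast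
  then show ?thesis using T.lm_add_right[OF M, of "em 0 (uu K)" y z] assms by simp
qed

text \<open>The relation x b = \<open>sigma b\<close> x on modules, read off at a \<open>K\<close>
  that is large enough for \<open>y\<close>, for b y and for \<open>sigma b\<close>.\<close>

lemma xact_act: assumes "y \<in> mcarrier M" "b \<in> CC"
  shows "xact M (act M (em b 0) y) = act M (em (sigma b) 0) (xact M y)"
proof -
  have by_: "act M (em b 0) y \<in> mcarrier M" using T.lm_closed[OF M, of "em b 0" y] assms by simp
  obtain K where K: "finite K" "K \<subseteq> VV" "act M (em 0 (uu K)) y = xact M y"
    "act M (em 0 (uu K)) (act M (em b 0) y) = xact M (act M (em b 0) y)"
    "uu K \<cdot> sigma b = sigma b" "sigma b \<cdot> uu K = sigma b"
    using large_ex[OF large_conj[OF large_conj[OF large_xact[OF assms(1)] large_xact[OF by_]] large_unit[of "sigma b"]]] assms by auto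
  have "xact M (act M (em b 0) y) = act M (em 0 (sigma b)) y"
    using K em_act[of 0 "uu K" b 0 y] assms by simp
  also have "\<dots> = act M (em (sigma b) 0) (xact M y)"
    using K em_act[of "sigma b" 0 0 "uu K" y] assms by simp
  finally show ?thesis .
qed

text \<open>For large \<open>K\<close>, x acts on \<open>y\<close> as \<open>em 0 (uu K)\<close>.
  Multiplying that element by c gives c x, and multiplying it by c x gives 0.\<close>

lemma act_dual: assumes "y \<in> mcarrier M" "c \<in> CC"
  shows "act M (em 0 c) y = act M (em c 0) (xact M y)" "act M (em 0 c) (xact M y) = 0"
proof -
  obtain K where K: "finite K" "K \<subseteq> VV" "act M (em 0 (uu K)) y = xact M y" "uu K \<cdot> c = c" "c \<cdot> uu K = c"
    using large_ex[OF large_conj[OF large_xact[OF assms(1)] large_unit[OF assms(2)]]] by auto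
  show "act M (em 0 c) y = act M (em c 0) (xact M y)"
    using K em_act[of c 0 0 "uu K" y] assms by simp
  show "act M (em 0 c) (xact M y) = 0"
    using K em_act[of 0 c 0 "uu K" y] assms T.lm_zero(2)[OF M] by (simp add: em_zero)
qed

text \<open>Restriction of \<open>M\<close> to \<open>A\<close> along \<open>sigma_pow s\<close>,
  which matches the twist of column s and makes \<open>M\<close> a target for maps from P (t - s).
  The local unit is moved along the s-th power of \<open>\<nu>\<close>.\<close>

lemma twisted_module: "left_module A \<lparr>mcarrier = mcarrier M, act = (\<lambda>a. act M (em (sigma_pow s a) 0))\<rparr>"
  unfolding left_module_def lmodule.simps
proof (intro conjI ballI)
  show "add_subgroup (mcarrier M)" by (rule T.lm_group[OF M])
  fix y assume y: "y \<in> mcarrier M"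
  show "act M (em (sigma_pow s a) 0) y \<in> mcarrier M" if "a \<in> CC" for a
    using that y T.lm_closed[OF M] by simp
  show al: "act M (em (sigma_pow s (a + b)) 0) y = act M (em (sigma_pow s a) 0) y + act M (em (sigma_pow s b) 0) y" if "a \<in> CC" "b \<in> CC" for a b
    using that y T.lm_add_left[OF M, of "em (sigma_pow s a) 0" "em (sigma_pow s b) 0" y] by (simp add: sigma_pow_add em_left_add)
  show "act M (em (sigma_pow s (a \<cdot> b)) 0) y = act M (em (sigma_pow s a) 0) (act M (em (sigma_pow s b) 0) y)" if "a \<in> CC" "b \<in> CC" for a b
    using that y by (simp add: em_act sigma_pow_mult)
  show "act M (em (sigma_pow s a) 0) (y + z) = act M (em (sigma_pow s a) 0) y + act M (em (sigma_pow s a) 0) z" if "a \<in> CC" "z \<in> mcarrier M" for a z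
    using that y T.lm_add_right[OF M, of "em (sigma_pow s a) 0" y z] by simp
  obtain J where J: "finite J" "J \<subseteq> VV" "act M (em (uu J) 0) y = y" 
    using large_ex[OF large_em_unit[OF y]] by (elim exE conjE) (rule that)
  let ?J = "(\<nu> ^^ s) ` J"
  have JV: "finite ?J" "?J \<subseteq> VV" using J nu_pow_VV by auto
  have "(\<Sum>i\<in>?J. act M (em (sigma_pow s (ee i)) 0) y) = act M (em (sigma_pow s (uu ?J)) 0) y"
    unfolding uu_def[of ?J]
    using additive_on_sum[OF CC_group, of "\<lambda>a. act M (em (sigma_pow s a) 0) y" ?J ee] al JV by (simp add: subset_iff)
  also have "\<dots> = y" using sigma_pow_uu[OF J(1,2), of s] J(3) by simp
  finally show "\<exists>J. finite J \<and> J \<subseteq> VV \<and> y = (\<Sum>i\<in>J. act M (em (sigma_pow s (ee i)) 0) y)"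
    using JV by (intro exI[of _ ?J]) simp
qed

end

lemma xact_hom:
  assumes M: "left_module TE M" and N: "left_module TE N" and f: "module_hom TE M N f" and y: "y \<in> mcarrier M"
  shows "f (xact M y) = xact N (f y)"
proof -
  have fy: "f y \<in> mcarrier N" using T.module_homD(1)[OF f y] .
  obtain K where K: "finite K" "K \<subseteq> VV" "act M (em 0 (uu K)) y = xact M y" "act N (em 0 (uu K)) (f y) = xact N (f y)"
    using large_ex[OF large_conj[OF large_xact[OF M y] large_xact[OF N fy]]] by blast
  then show ?thesis using T.module_homD(3)[OF f, of "em 0 (uu K)" y] y by simp
qed

lemma xact_emb:
  assumes s: "s \<le> t" and v: "v \<in> mcarrier (P (t - s))"
  shows "xact (tot t) (emb s v 0) = emb s 0 v"
proof -
  have m: "emb s v 0 \<in> mcarrier (tot t)" using emb_mem[OF s v] by simp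
  have "large (\<lambda>K. act (P (t - s)) (kappa_pow (Suc s) (uu K)) v = v)" unfolding large_def by (rule kappa_pow_unit[OF v])
  then obtain K where K: "finite K" "K \<subseteq> VV" "act (P (t - s)) (kappa_pow (Suc s) (uu K)) v = v"
    "act (tot t) (em 0 (uu K)) (emb s v 0) = xact (tot t) (emb s v 0)"
    using large_ex[OF large_conj[OF _ large_xact[OF tot_module m]]] by blast
  then show ?thesis using v by (simp add: emb_act)
qed

text \<open>Column s is induced from a twist of P (t - s): a map out of it is determined by the
  first coordinate, where it is an \<open>A\<close>-homomorphism into a twisted module, since the
  x-coordinate must go to x times the corresponding value. Lifting therefore reduces to that of P (t
  - s).\<close>

lemma tot_lifting:
  assumes lp: "\<And>t. lifting_property A (P t) TYPE('l::ab_group_add)"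
  shows "lifting_property TE (tot t) TYPE('l)"
  unfolding lifting_property_def
proof (intro allI impI, elim conjE)
  fix M N :: "('a \<times> ('a \<Rightarrow> 'k), 'l) lmodule" and g f
  assume M: "left_module TE M" and N: "left_module TE N" and g: "module_hom TE M N g"
    and surj: "g ` mcarrier M = mcarrier N" and f: "module_hom TE (tot t) N f"
  let ?tw = "\<lambda>s L. \<lparr>mcarrier = mcarrier L, act = (\<lambda>a. act L (em (sigma_pow s a) 0))\<rparr> :: ('a, 'l) lmodule"
  have "\<exists>h. s \<le> t \<longrightarrow> module_hom A (P (t - s)) (?tw s M) h \<and> (\<forall>u\<in>mcarrier (P (t - s)). g (h u) = f (emb s u 0))" for s
  proof (cases "s \<le> t")
    case True
    have "module_hom A (P (t - s)) (?tw s N) (\<lambda>u. f (emb s u 0))"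
      unfolding module_hom_def lmodule.simps
    proof (intro conjI ballI)
      have mem: "u \<in> mcarrier (P (t - s)) \<Longrightarrow> emb s u 0 \<in> mcarrier (tot t)" for u using emb_mem[OF True, of u 0] by simp
      show "(\<lambda>u. f (emb s u 0)) ` mcarrier (P (t - s)) \<subseteq> mcarrier N" using T.module_homD(1)[OF f] mem by blast
      fix u assume u: "u \<in> mcarrier (P (t - s))"
      show "f (emb s (u + v) 0) = f (emb s u 0) + f (emb s v 0)" if "v \<in> mcarrier (P (t - s))" for v
        using T.module_homD(2)[OF f mem[OF u] mem[OF that]] emb_add[of s u v 0 0] by simp
      show "f (emb s (act (P (t - s)) a u) 0) = act N (em (sigma_pow s a) 0) (f (emb s u 0))" if "a \<in> CC" for a
        using T.module_homD(3)[OF f _ mem[OF u], of "em (sigma_pow s a) 0"] emb_act_sp[OF that u] that by simp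
    qed
    moreover have "module_hom A (?tw s M) (?tw s N) g"
      using T.module_homD[OF g] by (auto simp: module_hom_def)
    ultimately have "\<exists>h. module_hom A (P (t - s)) (?tw s M) h \<and> (\<forall>u\<in>mcarrier (P (t - s)). g (h u) = f (emb s u 0))"
      using lp[of "t - s", unfolded lifting_property_def, THEN spec, THEN spec, THEN spec, THEN spec, THEN mp,
        of "?tw s M" "?tw s N" g "\<lambda>u. f (emb s u 0)"] twisted_module[OF M] twisted_module[OF N] surj by simp
    then show ?thesis by blast
  qed simp
  then obtain hs where hs: "\<And>s. s \<le> t \<Longrightarrow> module_hom A (P (t - s)) (?tw s M) (hs s)"
    "\<And>s u. s \<le> t \<Longrightarrow> u \<in> mcarrier (P (t - s)) \<Longrightarrow> g (hs s u) = f (emb s u 0)" by metis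
  have hsM: "hs s u \<in> mcarrier M" if "s \<le> t" "u \<in> mcarrier (P (t - s))" for s u
    using module_homD(1)[OF hs(1)[OF that(1)] that(2)] by simp
  have hsadd: "hs s (u + v) = hs s u + hs s v" if "s \<le> t" "u \<in> mcarrier (P (t - s))" "v \<in> mcarrier (P (t - s))" for s u v
    using module_homD(2)[OF hs(1)[OF that(1)] that(2,3)] .
  have hsact: "hs s (act (P (t - s)) a u) = act M (em (sigma_pow s a) 0) (hs s u)" if "s \<le> t" "a \<in> CC" "u \<in> mcarrier (P (t - s))" for s a u
    using module_homD(3)[OF hs(1)[OF that(1)] that(2,3)] by simp
  \<comment> \<open>The x-coordinate v stands for x v, so it is sent to x times the lift of
    v.\<close>
  define H where "H h = (\<Sum>s\<le>t. hs s (fst (h s)) + xact M (hs s (snd (h s))))" for h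
  have term_M: "hs s (fst (h s)) + xact M (hs s (snd (h s))) \<in> mcarrier M" if "h \<in> mcarrier (tot t)" "s \<le> t" for h s
    using that hsM tot_D[OF that(1)] xact_closed[OF M] add_subgroup_add[OF T.lm_group[OF M]] by blast
  have "module_hom TE (tot t) M H"
    unfolding module_hom_def
  proof (intro conjI ballI)
    show "H ` mcarrier (tot t) \<subseteq> mcarrier M"
      unfolding H_def using term_M by (auto intro!: add_subgroup_sum[OF T.lm_group[OF M]])
    fix h assume h: "h \<in> mcarrier (tot t)"
    note hD = tot_D[OF h]
    show "H (h + k) = H h + H k" if k: "k \<in> mcarrier (tot t)" for k
      unfolding H_def sum.distrib[symmetric]
    proof (intro sum.cong refl)
      fix s assume "s \<in> {..t}"
      then have s: "s \<le> t" by simp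
      show "hs s (fst ((h + k) s)) + xact M (hs s (snd ((h + k) s))) =
        hs s (fst (h s)) + xact M (hs s (snd (h s))) + (hs s (fst (k s)) + xact M (hs s (snd (k s))))"
        using hsadd[OF s hD(1) tot_D(1)[OF k]] hsadd[OF s hD(2) tot_D(2)[OF k]]
          xact_add[OF M hsM[OF s hD(2)] hsM[OF s tot_D(2)[OF k]]] by (simp add: add_ac)
    qed
    fix x assume x: "x \<in> carrier TE"
    then obtain a c where ac: "x = em a c" "a \<in> CC" "c \<in> CC" by (rule TE_carrierE)
    have "act M x (H h) = (\<Sum>s\<le>t. act M x (hs s (fst (h s)) + xact M (hs s (snd (h s)))))"
      unfolding H_def using term_M[OF h] by (intro T.lm_sum_right[OF M x]) auto
    also have "\<dots> = H (act (tot t) x h)"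
      unfolding H_def
    proof (intro sum.cong refl)
      fix s assume "s \<in> {..t}"
      then have s: "s \<le> t" by simp
      let ?u = "fst (h s)" and ?v = "snd (h s)"
      let ?y = "hs s ?u" and ?z = "hs s ?v"
      have yz: "?y \<in> mcarrier M" "?z \<in> mcarrier M" "xact M ?y \<in> mcarrier M" "xact M ?z \<in> mcarrier M"
        using hsM[OF s] hD xact_closed[OF M] by auto
      \<comment> \<open>One power of \<open>kappa\<close> is left over; it is cancelled when x moves
        past it.\<close>
      have e: "sigma_pow s (kappa_pow (Suc s) b) = kappa b" if "b \<in> CC" for b using that by (simp add: kappa_pow_Suc)
      have u1: "hs s (act (P (t - s)) (kappa_pow s a) ?u) = act M (em a 0) ?y"
        using hsact[OF s kappa_pow_CC[OF ac(2)] hD(1)] ac by simp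
      have tw: "xact M (hs s (act (P (t - s)) (kappa_pow (Suc s) b) w)) = act M (em b 0) (xact M (hs s w))"
        if "b \<in> CC" "w \<in> mcarrier (P (t - s))" for b w
        using hsact[OF s kappa_pow_CC[OF that(1)] that(2), of "Suc s"] that xact_act[OF M hsM[OF s that(2)], of "kappa b"] by (simp add: e)
      have "xact M (hs s (act (P (t - s)) (kappa_pow (Suc s) a) ?v + act (P (t - s)) (kappa_pow (Suc s) c) ?u)) =
          act M (em a 0) (xact M ?z) + act M (em c 0) (xact M ?y)"
        using hsadd[OF s, of "act (P (t - s)) (kappa_pow (Suc s) a) ?v" "act (P (t - s)) (kappa_pow (Suc s) c) ?u"]
          xact_add[OF M hsM[OF s, of "act (P (t - s)) (kappa_pow (Suc s) a) ?v"] hsM[OF s, of "act (P (t - s)) (kappa_pow (Suc s) c) ?u"]]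
          tw[OF ac(2) hD(2)] tw[OF ac(3) hD(1)] ac hD by simp
      then have "hs s (fst (act (tot t) x h s)) + xact M (hs s (snd (act (tot t) x h s))) =
          act M (em a 0) ?y + (act M (em a 0) (xact M ?z) + act M (em c 0) (xact M ?y))"
        using u1 ac by (simp add: tot_act)
      moreover have "act M x (?y + xact M ?z) = act M (em a 0) (?y + xact M ?z) + act M (em 0 c) (?y + xact M ?z)"
        using T.lm_add_left[OF M, of "em a 0" "em 0 c" "?y + xact M ?z"] yz ac add_subgroup_add[OF T.lm_group[OF M]]
        by (simp add: em_add)
      moreover have "act M (em a 0) (?y + xact M ?z) = act M (em a 0) ?y + act M (em a 0) (xact M ?z)"
        using T.lm_add_right[OF M, of "em a 0"] yz ac by simp
      moreover have "act M (em 0 c) (?y + xact M ?z) = act M (em c 0) (xact M ?y)"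
        using T.lm_add_right[OF M _ yz(1,4), of "em 0 c"] ac act_dual(1)[OF M yz(1) ac(3)] act_dual(2)[OF M yz(2) ac(3)] by simp
      ultimately show "act M x (?y + xact M ?z) = hs s (fst (act (tot t) x h s)) + xact M (hs s (snd (act (tot t) x h s)))"
        by (simp add: add_ac)
    qed
    finally show "H (act (tot t) x h) = act M x (H h)" by simp
  qed
  moreover have "g (H h) = f h" if h: "h \<in> mcarrier (tot t)" for h
  proof -
    note hD = tot_D[OF h]
    have "g (H h) = (\<Sum>s\<le>t. g (hs s (fst (h s)) + xact M (hs s (snd (h s)))))"
      unfolding H_def using term_M[OF h] by (intro T.hom_sum[OF M g]) auto
    also have "\<dots> = (\<Sum>s\<le>t. f (emb s (fst (h s)) 0 + emb s 0 (snd (h s))))"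
    proof (intro sum.cong refl)
      fix s assume "s \<in> {..t}"
      then have s: "s \<le> t" by simp
      have m: "emb s (fst (h s)) 0 \<in> mcarrier (tot t)" "emb s 0 (snd (h s)) \<in> mcarrier (tot t)" "emb s (snd (h s)) 0 \<in> mcarrier (tot t)"
        using emb_mem[OF s] hD by auto
      have "g (xact M (hs s (snd (h s)))) = xact N (f (emb s (snd (h s)) 0))"
        using xact_hom[OF M N g hsM[OF s hD(2)]] hs(2)[OF s hD(2)] by simp
      also have "\<dots> = f (emb s 0 (snd (h s)))"
        using xact_hom[OF tot_module N f m(3)] xact_emb[OF s hD(2)] by simp
      finally show "g (hs s (fst (h s)) + xact M (hs s (snd (h s)))) = f (emb s (fst (h s)) 0 + emb s 0 (snd (h s)))"
        using T.module_homD(2)[OF g hsM[OF s hD(1)] xact_closed[OF M hsM[OF s hD(2)]]] hs(2)[OF s hD(1)]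
          T.module_homD(2)[OF f m(1,2)] by simp
    qed
    also have "\<dots> = f (\<Sum>s\<le>t. emb s (fst (h s)) 0 + emb s 0 (snd (h s)))"
      using emb_mem hD add_subgroup_add[OF tot_group] by (intro T.hom_sum[OF tot_module f, symmetric]) auto
    finally show ?thesis using emb_sum[OF h] by simp
  qed
  ultimately show "\<exists>h. module_hom TE (tot t) M h \<and> (\<forall>x\<in>mcarrier (tot t). g (h x) = f x)" by blast
qed

end

context frobenius_extension
begin

lemma TE_koszul:
  assumes "koszul A"
  shows "pq_koszul (enat (n + 1 + 1)) \<infinity> TE"
proof (rule pq_koszulI)
  show "comp TE t = {0}" if "enat t > enat (n + 1 + 1)" for t
    using that top_le by (intro TE_above) simp
  fix i assume "i \<in> vertices TE"
  then have i: "i \<in> VV" by simp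
  obtain P :: "nat \<Rightarrow> ('a, nat \<Rightarrow> 'a) lmodule" and G d where
    lr: "linear_resolution A i P G d" and pr: "\<And>t. projective_module A (P t)"
    by (rule koszul_linear_resolution[OF assms i]) (rule that)
  interpret R: extension_resolution A m \<theta> \<nu> E n P G d i
    by unfold_locales (rule lr, rule i)
  \<comment> \<open>Here finite generation pays off: lifting over \<open>A\<close> is needed against
    modules on the type used for the trivial extension.\<close>
  have lp: "lifting_property A (P t) TYPE(nat \<Rightarrow> 'a \<times> ('a \<Rightarrow> 'k))" for t
  proof -
    obtain X where X: "finite X" "X \<subseteq> G t t" "G t t \<subseteq> span0 (P t) X"
      using linear_resolution_finitely_generated[OF lr i, of t] by blast
    have "X \<subseteq> mcarrier (P t)" using X(2) grading_subset[OF R.grP] by blast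
    then show ?thesis by (rule lifting_property_finite[OF pr X(1) _ R.gen X(3)])
  qed
  \<comment> \<open>A sequence of pairs of sequences is stored as one sequence: the pairing function
    codes the column and the position, even positions hold first coordinates and odd ones second
    coordinates, and the form component stays 0.\<close>
  define enc :: "(nat \<Rightarrow> (nat \<Rightarrow> 'a) \<times> (nat \<Rightarrow> 'a)) \<Rightarrow> (nat \<Rightarrow> 'a \<times> ('a \<Rightarrow> 'k))" where
    "enc h = (\<lambda>k. case prod_decode k of (s, j) \<Rightarrow>
       (if even j then fst (h s) (j div 2) else snd (h s) (j div 2), 0))" for h
  define dec :: "(nat \<Rightarrow> 'a \<times> ('a \<Rightarrow> 'k)) \<Rightarrow> (nat \<Rightarrow> (nat \<Rightarrow> 'a) \<times> (nat \<Rightarrow> 'a))" where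
    "dec F = (\<lambda>s. (\<lambda>j. fst (F (prod_encode (s, 2 * j))), \<lambda>j. fst (F (prod_encode (s, 2 * j + 1)))))" for F
  have add: "enc (x + y) = enc x + enc y" for x y
    by (rule ext) (auto simp: enc_def split: prod.split)
  have de: "dec (enc x) = x" for x
    by (rule ext) (auto simp: enc_def dec_def prod_eq_iff)
  show "\<exists>(P :: nat \<Rightarrow> ('a \<times> ('a \<Rightarrow> 'k), nat \<Rightarrow> 'a \<times> ('a \<Rightarrow> 'k)) lmodule) G d.
      linear_resolution TE i P G d \<and> (\<forall>t. projective_module TE (P t))"
    by (rule R.T.transport_linear_resolution[OF add de R.tot_linear_resolution R.tot_lifting[OF lp]])
qed

end

theorem theorem4p3:
  fixes A :: "('k::field, 'v, 'a::ab_group_add) galgebra" and n :: nat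
  assumes "koszul A" and "self_injective A"
    and "n_translation_algebra n A"
  shows "n_translation_algebra (n + 1) (trivial_extension n A)"
proof -
  obtain Q :: "('v, 'a, 'k) bound_quiver" where Q: "bound_quiver Q" "quiver_algebra Q A"
    using assms(3) unfolding n_translation_algebra_def n_pretranslation_algebra_def by blast
  \<comment> \<open>The vanishing of \<open>A\<close> above degree n + 1 bounds the search for socle
    elements and later gives \<open>m \<le> n + 1\<close>.\<close>
  have top: "comp A t = {0}" if "t > n + 1" for t
    using assms(3) that unfolding n_translation_algebra_def pq_koszul_def by auto
  obtain \<pi> where "quiver_presentation Q A \<pi>" using Q by (rule quiver_algebraD)
  then interpret qp: quiver_presentation Q A \<pi> .
  interpret presented_algebra A "qp.arrow_elem ` arrows Q" by (rule qp.presented)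
  interpret si: self_injective_algebra A "qp.arrow_elem ` arrows Q" "n + 1"
    by unfold_locales (use assms(2) top in auto)
  obtain m \<theta> \<nu> where "frobenius_algebra A m \<theta> \<nu>" using si.frobenius_ex by blast
  then interpret fr: frobenius_algebra A m \<theta> \<nu> .
  interpret fp: frobenius_presented A m \<theta> \<nu> "qp.arrow_elem ` arrows Q" ..
  have "m \<le> n + 1" using fp.comp_top top[of m] by (rule_tac ccontr) auto
  then interpret fe: frobenius_extension A m \<theta> \<nu> "qp.arrow_elem ` arrows Q" n
    by unfold_locales
  show ?thesis
    unfolding n_translation_algebra_def using fe.TE_n_pretranslation fe.TE_koszul[OF assms(1)] by blast
qed

end
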